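(* Let $(X,Z)$ satisfy the linear system on $[0,T]$ $$X_t=X_0+\int_0^ta(s)X_s\,ds+\sigma_0W_t,\qquad Z_t=\int_0^th(s)X_s\,ds+N_t,$$ with $X_t\in\mathbb{R}^m$, $Z_t\in\mathbb{R}^n$, $W_t\in\mathbb{R}^l$, $a(s)\in\mathbb{R}^{m\times m}$, $\sigma_0\in\mathbb{R}^{m\times l}$, $h(s)\in\mathbb{R}^{n\times m}$, in the setting described in the context. Let $U,b,\sigma,c,k$ be as defined in the context, and let $\hat U_t=\mathbb{E}[U_t|\mathcal{F}^Z_t]$ and $P_t=\mathbb{E}\big((U_t-\hat U_t)(U_t-\hat U_t)^T|\mathcal{F}^Z_t\big)$ be the conditional mean and covariance of $U_t$ given $\mathcal{F}^Z_t$. Then: (i) $\hat U$ solves $$\hat U_t=\hat U_0+\int_0^tb(s)\hat U_s\,ds+\int_0^t\big(c+P_sk(s)^T\big)\,d\nu_s,$$ where the innovation process is $\nu_t=Z_t-\int_0^tk(s)\hat U_s\,ds$. (ii) The $\mathbb{R}^{(2m+n)\times(2m+n)}$-valued conditional covariance $P$ satisfies the Riccati equation $$P_t'=P_tb(t)^T+b(t)P_t+A-\big(c+P_tk(t)^T\big)\big(c+P_tk(t)^T\big)^T,\qquad A=cc^T+\sigma\sigma^T .$$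
   Context: $W$ and $N$ are standard Brownian motions in $\mathbb{R}^l$ and $\mathbb{R}^n$ on a complete probability space; $a,h$ are deterministic. The family $(X_0,W_t,N_t;\,0\le t\le T)$ is Gaussian, $X_0$ is centered with covariance $\Sigma\in\mathbb{R}^{m\times m}$, $W$ is independent of $(X_0,N)$, and $\rho(t):=\mathbb{E}(N_tX_0^T)$ belongs to $C^2([0,T],\mathbb{R}^{n\times m})$. ($X_0$ and $N$ may be correlated.) $\mathcal{F}^Z_t=\sigma(Z_s,\,s\in[0,t])$. $g\in C([0,T];\mathbb{R}^{n\times m})$ is a function satisfying $g'(t)\big(\Sigma-\int_0^t\rho'(u)^T\rho'(u)\,du\big)=\rho'(t)$, $g(0)=0$; $p(s)=\rho''(s)^T$ and $q(s)=-g(s)\rho''(s)^T-g'(s)\rho'(s)^T$ are continuous; $r(t)=g(t)p(t)+q(t)=-g'(t)\rho'(t)^T\in\mathbb{R}^{n\times n}$. Put $\bar X_t=X_0+\int_0^tp(s)N_s\,ds\in\mathbb{R}^m$ and $$U=\begin{bmatrix}X\\ \bar X\\ N\end{bmatrix},\quad b(t)=\begin{bmatrix}a(t)&0&0\\ 0&0&p(t)\\ 0&g'(t)&r(t)\end{bmatrix},\quad \sigma=\begin{bmatrix}\sigma_0\\ 0\\ 0\end{bmatrix},\quad c=\begin{bmatrix}0\\ 0\\ I_n\end{bmatrix},\quad k(t)=\big(h(t),\,g'(t),\,r(t)\big).$$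
   Formalization: The English gives no regularity for a and h and fails without some; here a is assumed integrable and h measurable and square-integrable on [0,T], and the Riccati equation holds in integral form, almost everywhere, and classically at every t where a and h are continuous. *)

theory Defs
  imports "HOL-Probability.Probability"
begin

section \<open>Processes, Brownian motion, Gaussian families\<close>

text \<open>The (uncompleted) \<open>\<sigma>\<close>-algebra generated by \<open>Y\<^sub>s\<close>, \<open>s \<in> I\<close>.\<close>

definition generated_sigma ::
    "'w measure \<Rightarrow> (real \<Rightarrow> 'w \<Rightarrow> 'a::topological_space) \<Rightarrow> real set \<Rightarrow> 'w measure" where
  "generated_sigma M Y I =
     sigma (space M) {Y s -` A \<inter> space M | s A. s \<in> I \<and> A \<in> sets borel}"

definition standard_brownian_motion ::
    "'w measure \<Rightarrow> real \<Rightarrow> (real \<Rightarrow> 'w \<Rightarrow> real ^ 'd) \<Rightarrow> bool" where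
  "standard_brownian_motion M T B \<longleftrightarrow>
     (\<forall>t\<in>{0..T}. B t \<in> borel_measurable M) \<and>
     (AE \<omega> in M. B 0 \<omega> = 0) \<and>
     (AE \<omega> in M. continuous_on {0..T} (\<lambda>t. B t \<omega>)) \<and>
     (\<forall>s t. 0 \<le> s \<and> s < t \<and> t \<le> T \<longrightarrow>
        prob_space.indep_set M (sets (generated_sigma M B {0..s}))
          {(\<lambda>\<omega>. B t \<omega> - B s \<omega>) -` A \<inter> space M | A. A \<in> sets borel} \<and>
        prob_space.indep_vars M (\<lambda>_. borel) (\<lambda>i \<omega>. (B t \<omega> - B s \<omega>) $ i) UNIV \<and>
        (\<forall>i. distributed M lborel (\<lambda>\<omega>. (B t \<omega> - B s \<omega>) $ i) (normal_density 0 (sqrt (t - s)))))"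

text \<open>Degenerate (almost surely constant) variables count as Gaussian: they are the case
  \<open>\<beta> = 0\<close>.\<close>

definition gaussian_rv :: "'w measure \<Rightarrow> ('w \<Rightarrow> real) \<Rightarrow> bool" where
  "gaussian_rv M Y \<longleftrightarrow> Y \<in> borel_measurable M \<and>
     (\<exists>\<alpha> \<beta>. distr M borel Y = distr std_normal_distribution borel (\<lambda>z. \<alpha> + \<beta> * z))"

definition jointly_gaussian ::
    "'w measure \<Rightarrow> real \<Rightarrow> ('w \<Rightarrow> real ^ 'm) \<Rightarrow> (real \<Rightarrow> 'w \<Rightarrow> real ^ 'l) \<Rightarrow>
     (real \<Rightarrow> 'w \<Rightarrow> real ^ 'n) \<Rightarrow> bool" where
  "jointly_gaussian M T X0 W N \<longleftrightarrow>
     (\<forall>S u v w. finite S \<and> S \<subseteq> {0..T} \<longrightarrow>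
        gaussian_rv M (\<lambda>\<omega>. u \<bullet> X0 \<omega> + (\<Sum>t\<in>S. v t \<bullet> W t \<omega> + w t \<bullet> N t \<omega>)))"

definition jointly_measurable ::
    "'w measure \<Rightarrow> real \<Rightarrow> (real \<Rightarrow> 'w \<Rightarrow> 'a::topological_space) \<Rightarrow> bool" where
  "jointly_measurable M T Y \<longleftrightarrow>
     (\<lambda>(t, \<omega>). Y t \<omega>) \<in> borel_measurable (restrict_space borel {0..T} \<Otimes>\<^sub>M M)"


section \<open>Conditional mean and covariance of a random vector\<close>

definition cond_mean :: "'w measure \<Rightarrow> 'w measure \<Rightarrow> ('w \<Rightarrow> real ^ 'd) \<Rightarrow> 'w \<Rightarrow> real ^ 'd" where
  "cond_mean M F V = (\<lambda>\<omega>. \<chi> i. real_cond_exp M F (\<lambda>\<omega>'. V \<omega>' $ i) \<omega>)"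

definition cond_cov :: "'w measure \<Rightarrow> 'w measure \<Rightarrow> ('w \<Rightarrow> real ^ 'd) \<Rightarrow> 'w \<Rightarrow> real ^ 'd ^ 'd" where
  "cond_cov M F V =
     (\<lambda>\<omega>. \<chi> i j. real_cond_exp M F
        (\<lambda>\<omega>'. (V \<omega>' $ i - cond_mean M F V \<omega>' $ i) * (V \<omega>' $ j - cond_mean M F V \<omega>' $ j)) \<omega>)"

text \<open>The conditional means \<open>E[U\<^sub>t | F\<^sub>t]\<close> are only defined up to a null set for each \<open>t\<close>; joint
  measurability makes time integrals along the paths meaningful.\<close>

definition cond_mean_version ::
    "'w measure \<Rightarrow> real \<Rightarrow> (real \<Rightarrow> 'w measure) \<Rightarrow> (real \<Rightarrow> 'w \<Rightarrow> real ^ 'd) \<Rightarrow>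
     (real \<Rightarrow> 'w \<Rightarrow> real ^ 'd) \<Rightarrow> bool" where
  "cond_mean_version M T F U Uh \<longleftrightarrow>
     jointly_measurable M T Uh \<and>
     (\<forall>t\<in>{0..T}. AE \<omega> in M. Uh t \<omega> = cond_mean M (F t) (U t) \<omega>)"


section \<open>The It\^o integral of a square-integrable matrix-valued integrand\<close>

definition simple_integrand ::
    "'w measure \<Rightarrow> real \<Rightarrow> (real \<Rightarrow> 'w measure) \<Rightarrow> nat \<Rightarrow> (nat \<Rightarrow> real) \<Rightarrow>
     (nat \<Rightarrow> 'w \<Rightarrow> real ^ 'n ^ 'd) \<Rightarrow> bool" where
  "simple_integrand M T F K \<tau> \<xi> \<longleftrightarrow>
     0 \<le> \<tau> 0 \<and> \<tau> K \<le> T \<and> (\<forall>i<K. \<tau> i \<le> \<tau> (Suc i)) \<and>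
     (\<forall>i<K. \<xi> i \<in> borel_measurable (F (\<tau> i))) \<and>
     (\<exists>C. \<forall>i<K. \<forall>\<omega>\<in>space M. norm (\<xi> i \<omega>) \<le> C)"

definition simple_process ::
    "nat \<Rightarrow> (nat \<Rightarrow> real) \<Rightarrow> (nat \<Rightarrow> 'w \<Rightarrow> real ^ 'n ^ 'd) \<Rightarrow> real \<Rightarrow> 'w \<Rightarrow> real ^ 'n ^ 'd" where
  "simple_process K \<tau> \<xi> s \<omega> = (\<Sum>i<K. indicator {\<tau> i<..\<tau> (Suc i)} s *\<^sub>R \<xi> i \<omega>)"

definition simple_integral ::
    "nat \<Rightarrow> (nat \<Rightarrow> real) \<Rightarrow> (nat \<Rightarrow> 'w \<Rightarrow> real ^ 'n ^ 'd) \<Rightarrow> (real \<Rightarrow> 'w \<Rightarrow> real ^ 'n) \<Rightarrow>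
     real \<Rightarrow> 'w \<Rightarrow> real ^ 'd" where
  "simple_integral K \<tau> \<xi> B t \<omega> =
     (\<Sum>i<K. \<xi> i \<omega> *v (B (min (\<tau> (Suc i)) t) \<omega> - B (min (\<tau> i) t) \<omega>))"

text \<open>\<open>J\<^sub>t = \<integral>\<^sub>0\<^sup>t H\<^sub>s dB\<^sub>s\<close> for \<open>t \<in> [0, T]\<close>: approximation of \<open>H\<close> by simple \<open>F\<close>-adapted
  processes in \<open>L\<^sup>2(ds \<otimes> P)\<close>. When \<open>B\<close> is an \<open>F\<close>-Brownian motion (as an innovation process
  is), the It\^o isometry makes \<open>J\<close> unique up to indistinguishability and independent of the
  approximating sequence.\<close>

definition has_ito_integral ::
    "'w measure \<Rightarrow> real \<Rightarrow> (real \<Rightarrow> 'w measure) \<Rightarrow> (real \<Rightarrow> 'w \<Rightarrow> real ^ 'n) \<Rightarrow>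
     (real \<Rightarrow> 'w \<Rightarrow> real ^ 'n ^ 'd) \<Rightarrow> (real \<Rightarrow> 'w \<Rightarrow> real ^ 'd) \<Rightarrow> bool" where
  "has_ito_integral M T F B H J \<longleftrightarrow>
     jointly_measurable M T H \<and>
     (\<forall>t\<in>{0..T}. J t \<in> borel_measurable M) \<and>
     (AE \<omega> in M. continuous_on {0..T} (\<lambda>t. J t \<omega>)) \<and>
     (\<exists>K \<tau> \<xi>.
        (\<forall>j::nat. simple_integrand M T F (K j) (\<tau> j) (\<xi> j)) \<and>
        (\<lambda>j. \<integral>\<^sup>+\<omega>. (\<integral>\<^sup>+s\<in>{0..T}.
            ennreal ((norm (simple_process (K j) (\<tau> j) (\<xi> j) s \<omega> - H s \<omega>))\<^sup>2) \<partial>lborel) \<partial>M)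
          \<longlonglongrightarrow> 0 \<and>
        (\<forall>t\<in>{0..T}.
           (\<lambda>j. \<integral>\<^sup>+\<omega>. ennreal ((norm (simple_integral (K j) (\<tau> j) (\<xi> j) B t \<omega> - J t \<omega>))\<^sup>2) \<partial>M)
             \<longlonglongrightarrow> 0))"


section \<open>Block vectors and block matrices\<close>

text \<open>A matrix is a vector of rows, so \<open>vstack3\<close> stacks column vectors as well as block rows.\<close>

definition vstack3 :: "'a ^ 'm \<Rightarrow> 'a ^ 'k \<Rightarrow> 'a ^ 'n \<Rightarrow> 'a ^ ('m + 'k + 'n)" where
  "vstack3 x y z =
     (\<chi> i. case i of Inl i1 \<Rightarrow> x $ i1 | Inr (Inl i2) \<Rightarrow> y $ i2 | Inr (Inr i3) \<Rightarrow> z $ i3)"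

definition hstack3 :: "'a ^ 'm ^ 'r \<Rightarrow> 'a ^ 'k ^ 'r \<Rightarrow> 'a ^ 'n ^ 'r \<Rightarrow> 'a ^ ('m + 'k + 'n) ^ 'r" where
  "hstack3 A B C = (\<chi> i. vstack3 (A $ i) (B $ i) (C $ i))"

end

theory Submission
 imports Defs "HOL-Probability.Probability"
begin

text \<open>The function \<open>g'\<close> turns the noise \<open>N\<close>, which is correlated with \<open>X\<^sub>0\<close>, into a Brownian motion
 \<open>B = N - \<integral>(g' Xbar + r N) ds\<close> uncorrelated with \<open>X\<^sub>0\<close>: indeed \<open>g' Xbar + r N = g' R\<close> with
 \<open>R = Xbar - \<rho>'\<^sup>T N\<close>, and \<open>R\<^sub>t\<close> is orthogonal to the past of \<open>N\<close>. So \<open>(U, Z)\<close> is a linear system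
 driven by Brownian motions independent of \<open>U\<^sub>0\<close>, and the Kalman-Bucy filter applies. The filter is constructed
 rather than characterised: solve the Riccati equation, put \<open>f = c + P k\<^sup>T\<close> and \<open>\<beta> = b - f k\<close>, and solve
 \<open>V = \<integral>\<beta> V ds + \<integral>f dZ\<close> pathwise. Linear differential equations for covariances show that \<open>U\<^sub>t - V\<^sub>t\<close> is
 orthogonal to the past of \<open>Z\<close> with covariance \<open>P\<^sub>t\<close>; in a Gaussian space orthogonality is independence,
 so \<open>V\<^sub>t\<close> and \<open>P\<^sub>t\<close> are the conditional mean and covariance. When \<open>\<Sigma>0\<close> is singular, \<open>g'\<close> need not be
 integrable; only \<open>g' (1 - E)\<close>, with \<open>E\<close> the projection onto the kernel of \<open>\<Sigma>0\<close>, is continuous, but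
 \<open>E X\<^sub>0 = 0\<close> almost surely, so the difference does not matter.\<close>

section \<open>Indefinite integrals and linear differential equations\<close>

text \<open>The coefficients are only integrable (\<open>a\<close>) or square integrable
  (\<open>h\<close>), so equations cannot be differentiated pointwise: they are kept in integrated
  form and handled by a product rule for absolutely continuous functions. The forcing terms of the
  path equations are merely continuous, hence variation of constants is written after an integration
  by parts, without stochastic differentials. The decisive covariance computation freezes the time
  \<open>t\<close> of the error: \<open>\<Psi> t\<close> times the covariance of the error at
  \<open>t\<close> with \<open>U v\<close> satisfies, for \<open>v \<le> t\<close>, a linear
  equation in \<open>v\<close> in which \<open>t\<close> no longer occurs, and
  \<open>\<Psi> v ** P v\<close> solves the same equation. The integrand
  \<open>c + P k\<^sup>T\<close> is deterministic, so nonrandom step functions suffice for the Ito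
  integral, and one approximating sequence serves the integrators \<open>B\<close>, \<open>Z\<close>
  and the innovation, which differ by absolutely continuous drifts. For singular
  \<open>\<Sigma>0\<close> the system with \<open>g' (1 - E)\<close> is filtered first. The almost
  surely vanishing direction \<open>E Xbar\<close> is inherited by the filter and annihilates
  \<open>P\<close>, which brings \<open>g'\<close> back into the final equations.\<close>

abbreviation (input) L1on :: "real => (real => 'a::euclidean_space) => bool" where
 "L1on T f \<equiv> set_integrable lborel {0..T} f"

abbreviation (input) prim :: "(real => 'a::euclidean_space) => real => 'a" where
 "prim f t \<equiv> (LINT s:{0..t}|lborel. f s)"

lemmas lint_cong = Bochner_Integration.integral_cong
lemmas lint_diff = Bochner_Integration.integral_diff

lemma L1on_subset: "L1on T f ==> t \<le> T ==> L1on t f"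
 by (rule set_integrable_subset) auto

lemma prim_0: "prim f 0 = 0"
 unfolding set_lebesgue_integral_def
 by (rule integral_eq_zero_AE, rule AE_I'[of "{0}"]) (auto simp: indicator_def split: if_splits)

text \<open>The simplifier turns \<open>{0..0}\<close> into \<open>{0}\<close>, so the initial value
  of a primitive is also needed in this form.\<close>

lemma prim_0' [simp]: "(LINT s:{0::real}|lborel. (f s :: 'a::euclidean_space)) = 0"
 using prim_0[of f] by simp

lemma prim_eq_integral: "L1on T f ==> t \<le> T ==> prim f t = integral {0..t} f"
 by (rule set_borel_integral_eq_integral(2)) (rule L1on_subset)

lemma L1on_continuous:
 fixes f :: "real => 'a::euclidean_space"
 assumes "continuous_on {0..T} f" shows "L1on T f"
 using borel_integrable_compact[OF compact_Icc assms] by (simp add: set_integrable_def)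

lemma prim_continuous:
 fixes f :: "real => 'a::euclidean_space"
 assumes "L1on T f" shows "continuous_on {0..T} (prim f)"
proof -
 have "continuous_on {0..T} (\<lambda>t. integral {0..t} f)"
  by (rule indefinite_integral_continuous_1) (rule set_borel_integral_eq_integral(1)[OF assms])
 then show ?thesis
  by (rule continuous_on_eq) (auto simp: prim_eq_integral[OF assms])
qed

lemma prim_cong: "(\<And>s. s \<in> {0..t} ==> f s = g s) ==> prim f t = prim g t"
 by (rule set_lebesgue_integral_cong) auto

lemma L1on_cong: "(\<And>s. s \<in> {0..T} ==> f s = g s) ==> L1on T f = L1on T g"
 unfolding set_integrable_def by (intro Bochner_Integration.integrable_cong) (auto simp: indicator_def)

lemma prim_add: "L1on T f ==> L1on T g ==> t \<le> T ==> prim (\<lambda>s. f s + g s) t = prim f t + prim g t"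
 by (rule set_integral_add(2)) (erule (1) L1on_subset)+

lemma prim_diff: "L1on T f ==> L1on T g ==> t \<le> T ==> prim (\<lambda>s. f s - g s) t = prim f t - prim g t"
 by (rule set_integral_diff(2)) (erule (1) L1on_subset)+

lemma prim_bounded_linear:
 assumes "bounded_linear h" "L1on T f" "t \<le> T"
 shows "h (prim f t) = prim (\<lambda>s. h (f s)) t" "L1on T (\<lambda>s. h (f s))"
proof -
 interpret bounded_linear h by fact
 have *: "integrable lborel (\<lambda>s. indicator {0..t} s *\<^sub>R f s)"
  using L1on_subset[OF assms(2,3)] by (simp add: set_integrable_def)
 show "h (prim f t) = prim (\<lambda>s. h (f s)) t"
  unfolding set_lebesgue_integral_def using integral_bounded_linear[OF assms(1) *] by (simp add: scaleR)
 have "integrable lborel (\<lambda>s. h (indicator {0..T} s *\<^sub>R f s))"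
  by (rule integrable_bounded_linear[OF assms(1)]) (use assms(2) in \<open>simp add: set_integrable_def\<close>)
 then show "L1on T (\<lambda>s. h (f s))" by (simp add: scaleR set_integrable_def)
qed

lemma set_borel_measurable_bilinear:
 fixes f :: "'d => 'a::euclidean_space" and g :: "'d => 'b::euclidean_space" and B :: "_ => _ => 'c::euclidean_space"
 assumes B: "bounded_bilinear B" and "set_borel_measurable M S f" "set_borel_measurable M S g"
 shows "set_borel_measurable M S (\<lambda>s. B (f s) (g s))"
proof -
 interpret bounded_bilinear B by fact
 have "(\<lambda>s. B (indicator S s *\<^sub>R f s) (indicator S s *\<^sub>R g s)) \<in> borel_measurable M"
 proof -
  have c: "continuous_on UNIV (\<lambda>x. B (fst x) (snd x))"
   by (rule bounded_bilinear.continuous_on[OF B]) (intro continuous_intros)+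
  show ?thesis
   by (rule borel_measurable_continuous_Pair[OF _ _ c]) (use assms(2,3) in \<open>simp_all add: set_borel_measurable_def\<close>)
 qed
 also have "(\<lambda>s. B (indicator S s *\<^sub>R f s) (indicator S s *\<^sub>R g s)) = (\<lambda>s. indicator S s *\<^sub>R B (f s) (g s))"
  by (auto simp: indicator_def zero_left)
 finally show ?thesis by (simp add: set_borel_measurable_def)
qed

lemma set_borel_measurable_continuous:
 fixes f :: "real => 'a::euclidean_space"
 shows "continuous_on {0..T} f ==> set_borel_measurable lborel {0..T} f"
 unfolding set_borel_measurable_def
 by (rule borel_measurable_integrable) (rule L1on_continuous[unfolded set_integrable_def])

lemma continuous_bounded_Icc:
 fixes f :: "real => 'a::euclidean_space"
 assumes "continuous_on {0..T} f"
 obtains C where "C > 0" "\<And>s. s \<in> {0..T} ==> norm (f s) \<le> C"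
proof -
 have "bounded (f ` {0..T})" by (intro compact_imp_bounded compact_continuous_image assms) auto
 then show ?thesis using that by (auto simp: bounded_pos)
qed

lemma L1on_bound:
 fixes f :: "real => 'a::euclidean_space" and g :: "real => real"
 assumes "L1on T g" "set_borel_measurable lborel {0..T} f" "\<And>s. s \<in> {0..T} ==> norm (f s) \<le> g s"
 shows "L1on T f"
proof (rule set_integrable_bound[OF assms(1,2)], rule AE_I2, rule impI)
 fix s assume "s \<in> {0..T}"
 from assms(3)[OF this] show "norm (f s) \<le> norm (g s)" by simp
qed

lemma L1on_meas: "L1on T f ==> set_borel_measurable lborel {0..T} f"
 by (auto simp: set_integrable_def set_borel_measurable_def)

lemma L1on_norm: "L1on T f ==> L1on T (\<lambda>s. norm (f s))"
 unfolding set_integrable_def using integrable_norm[of lborel "\<lambda>s. indicator {0..T} s *\<^sub>R f s"]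
 by simp

lemma L1on_bilinear:
 fixes f :: "real => 'a::euclidean_space" and g :: "real => 'b::euclidean_space" and B :: "_ => _ => 'c::euclidean_space"
 assumes B: "bounded_bilinear B" and f: "L1on T f" and g: "continuous_on {0..T} g"
 shows "L1on T (\<lambda>s. B (f s) (g s))"
proof -
 obtain C where C: "\<And>s. s \<in> {0..T} ==> norm (g s) \<le> C" "C > 0" by (rule continuous_bounded_Icc[OF g]) auto
 obtain K where K: "\<And>x y. norm (B x y) \<le> norm x * norm y * K" "K > 0" using bounded_bilinear.pos_bounded[OF B] by auto
 show ?thesis
 proof (rule L1on_bound[where g="\<lambda>s. norm (f s) * (C * K)"])
  show "L1on T (\<lambda>s. norm (f s) * (C * K))" using L1on_norm[OF f] by simp
  show "set_borel_measurable lborel {0..T} (\<lambda>s. B (f s) (g s))"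
   by (rule set_borel_measurable_bilinear[OF B L1on_meas[OF f] set_borel_measurable_continuous[OF g]])
  fix s assume s: "s \<in> {0..T}"
  have "norm (B (f s) (g s)) \<le> norm (f s) * norm (g s) * K" by (rule K)
  also have "\<dots> \<le> norm (f s) * C * K" using C(1)[OF s] K(2) by (intro mult_right_mono mult_left_mono) auto
  finally show "norm (B (f s) (g s)) \<le> norm (f s) * (C * K)" by (simp add: mult.assoc)
 qed
qed

lemma L1on_bilinear2:
 fixes f :: "real => 'a::euclidean_space" and g :: "real => 'b::euclidean_space" and B :: "_ => _ => 'c::euclidean_space"
 assumes B: "bounded_bilinear B" and f: "L1on T g" and g: "continuous_on {0..T} f"
 shows "L1on T (\<lambda>s. B (f s) (g s))"
 using L1on_bilinear[OF bounded_bilinear.flip[OF B] f g] by simp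

text \<open>Measurability is a separate conjunct because integrability of the squared norm says
  nothing about measurability of \<open>f\<close> itself.\<close>

definition L2on :: "real => (real => 'a::euclidean_space) => bool" where
 "L2on T f \<longleftrightarrow> set_borel_measurable lborel {0..T} f \<and> L1on T (\<lambda>s. (norm (f s))\<^sup>2)"

lemma L2on_bilinear:
 fixes f :: "real => 'a::euclidean_space" and g :: "real => 'b::euclidean_space" and B :: "_ => _ => 'c::euclidean_space"
 assumes B: "bounded_bilinear B" and f: "L2on T f" and g: "L2on T g"
 shows "L1on T (\<lambda>s. B (f s) (g s))"
proof -
 obtain K where K: "\<And>x y. norm (B x y) \<le> norm x * norm y * K" "K > 0" using bounded_bilinear.pos_bounded[OF B] by auto
 show ?thesis
 proof (rule L1on_bound[where g="\<lambda>s. K * ((norm (f s))\<^sup>2 + (norm (g s))\<^sup>2)"])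
  show "L1on T (\<lambda>s. K * ((norm (f s))\<^sup>2 + (norm (g s))\<^sup>2))" using f g by (auto simp: L2on_def)
  show "set_borel_measurable lborel {0..T} (\<lambda>s. B (f s) (g s))"
   by (rule set_borel_measurable_bilinear[OF B]) (use f g in \<open>auto simp: L2on_def\<close>)
  fix s
  have "norm (B (f s) (g s)) \<le> norm (f s) * norm (g s) * K" by (rule K)
  also have "\<dots> \<le> ((norm (f s))\<^sup>2 + (norm (g s))\<^sup>2) * K"
  proof (rule mult_right_mono)
   have "0 \<le> norm (f s) * norm (g s)" by simp
   then show "norm (f s) * norm (g s) \<le> (norm (f s))\<^sup>2 + (norm (g s))\<^sup>2"
    using sum_squares_bound[of "norm (f s)" "norm (g s)"] by linarith
  qed (use K(2) in simp)
  finally show "norm (B (f s) (g s)) \<le> K * ((norm (f s))\<^sup>2 + (norm (g s))\<^sup>2)" by (simp add: mult.commute)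
 qed
qed

lemma L2on_continuous:
 fixes f :: "real => 'a::euclidean_space"
 shows "continuous_on {0..T} f ==> L2on T f"
 unfolding L2on_def
 by (rule conjI[OF set_borel_measurable_continuous L1on_continuous]) (assumption, intro continuous_intros)

lemma L2on_mult_continuous:
 fixes f :: "real => 'a::euclidean_space" and g :: "real => 'b::euclidean_space" and B :: "_ => _ => 'c::euclidean_space"
 assumes B: "bounded_bilinear B" and f: "L2on T f" and g: "continuous_on {0..T} g"
 shows "L2on T (\<lambda>s. B (f s) (g s))"
proof -
 obtain C where C: "\<And>s. s \<in> {0..T} ==> norm (g s) \<le> C" "C > 0" by (rule continuous_bounded_Icc[OF g]) auto
 obtain K where K: "\<And>x y. norm (B x y) \<le> norm x * norm y * K" "K > 0" using bounded_bilinear.pos_bounded[OF B] by auto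
 have m: "set_borel_measurable lborel {0..T} (\<lambda>s. B (f s) (g s))"
  by (rule set_borel_measurable_bilinear[OF B _ set_borel_measurable_continuous[OF g]]) (use f in \<open>auto simp: L2on_def\<close>)
 have "set_borel_measurable lborel {0..T} (\<lambda>s. norm (B (f s) (g s)))"
  using measurable_compose[OF m[unfolded set_borel_measurable_def] borel_measurable_norm] by (simp add: set_borel_measurable_def)
 from set_borel_measurable_bilinear[OF bounded_bilinear_mult this this]
 have m2: "set_borel_measurable lborel {0..T} (\<lambda>s. (norm (B (f s) (g s)))\<^sup>2)"
  by (simp add: power2_eq_square)
 have "L1on T (\<lambda>s. (norm (B (f s) (g s)))\<^sup>2)"
 proof (rule L1on_bound[where g="\<lambda>s. (C * K)\<^sup>2 * (norm (f s))\<^sup>2"])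
  show "L1on T (\<lambda>s. (C*K)\<^sup>2 * (norm (f s))\<^sup>2)" using f by (auto simp: L2on_def)
  fix s assume s: "s \<in> {0..T}"
  have "norm (B (f s) (g s)) \<le> norm (f s) * norm (g s) * K" by (rule K)
  also have "\<dots> \<le> norm (f s) * C * K" using C(1)[OF s] K(2) by (intro mult_right_mono mult_left_mono) auto
  finally have "norm (B (f s) (g s)) \<le> (C * K) * norm (f s)" by (simp add: mult_ac)
  then have "(norm (B (f s) (g s)))\<^sup>2 \<le> ((C * K) * norm (f s))\<^sup>2" by (rule power_mono) simp
  then show "norm ((norm (B (f s) (g s)))\<^sup>2) \<le> (C * K)\<^sup>2 * (norm (f s))\<^sup>2" by (simp add: power_mult_distrib)
 qed (rule m2)
 with m show ?thesis by (simp add: L2on_def)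
qed

lemma L2on_add:
 fixes f g :: "real => 'a::euclidean_space"
 assumes "L2on T f" "L2on T g" shows "L2on T (\<lambda>s. f s + g s)"
proof -
 have m: "set_borel_measurable lborel {0..T} (\<lambda>s. f s + g s)"
  using assms unfolding L2on_def set_borel_measurable_def scaleR_add_right by (intro borel_measurable_add) auto
 have "L1on T (\<lambda>s. (norm (f s + g s))\<^sup>2)"
 proof -
  have "L1on T (\<lambda>s. (norm (f s))\<^sup>2 + (norm (g s))\<^sup>2 + 2 * (f s \<bullet> g s))"
   using assms L2on_bilinear[OF bounded_bilinear_inner assms] by (auto simp: L2on_def)
  then show ?thesis by (simp add: power2_norm_eq_inner inner_add inner_commute algebra_simps)
 qed
 with m show ?thesis by (simp add: L2on_def)
qed

text \<open>On a bounded interval the constant 1 is square integrable, and a product of two square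
  integrable functions is integrable.\<close>

lemma L2on_L1on: 
 fixes f :: "real => 'a::euclidean_space"
 shows "L2on T f ==> L1on T f"
 using L2on_bilinear[OF bounded_bilinear_scaleR L2on_continuous[of T "\<lambda>_. 1::real"], of f] by simp

lemma L2on_linear:
 assumes h: "bounded_linear h" and f: "L2on T f"
 shows "L2on T (\<lambda>s. h (f s) :: 'b::euclidean_space)"
proof -
 have "bounded_bilinear (\<lambda>x (c::real). c *\<^sub>R h x)"
  by (rule bounded_bilinear.comp[OF bounded_bilinear.flip[OF bounded_bilinear_scaleR] h bounded_linear_ident])
 from L2on_mult_continuous[OF this f, of "\<lambda>_. 1"] show ?thesis by simp
qed

section \<open>Matrix products as bounded bilinear maps\<close>

lemma bb_mm: "bounded_bilinear ((**) :: real^'n^'m => real^'k^'n => real^'k^'m)"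
 unfolding bilinear_conv_bounded_bilinear[symmetric] bilinear_def
 by (auto intro!: linearI simp: matrix_matrix_mult_def vec_eq_iff sum.distrib sum_distrib_left algebra_simps)

lemma bb_mv: "bounded_bilinear ((*v) :: real^'n^'m => real^'n => real^'m)"
 unfolding bilinear_conv_bounded_bilinear[symmetric] bilinear_def
 by (auto intro!: linearI simp: matrix_vector_mult_def vec_eq_iff sum.distrib sum_distrib_left algebra_simps)

lemma bl_transpose: "bounded_linear (transpose :: real^'n^'m => real^'m^'n)"
 unfolding linear_conv_bounded_linear[symmetric] by (rule linearI) (auto simp: transpose_def vec_eq_iff)

interpretation bb_mm: bounded_bilinear "(**) :: real^'n^'m => real^'k^'n => real^'k^'m" by (rule bb_mm)
interpretation bb_mv: bounded_bilinear "(*v) :: real^'n^'m => real^'n => real^'m" by (rule bb_mv)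

section \<open>Estimates and the product rule for primitives\<close>

lemma norm_prim_le:
 assumes f: "L1on T f" and g: "L1on T g" and le: "\<And>s. s \<in> {0..t} ==> norm (f s) \<le> g s" and t: "t \<le> T"
 shows "norm (prim f t) \<le> prim g t"
proof -
 have i: "integrable lborel (\<lambda>s. indicator {0..t} s *\<^sub>R f s)" "integrable lborel (\<lambda>s. indicator {0..t} s *\<^sub>R g s)"
  using L1on_subset[OF f t] L1on_subset[OF g t] by (simp_all add: set_integrable_def)
 then have "norm (prim f t) \<le> (\<integral>s. norm (indicator {0..t} s *\<^sub>R f s) \<partial>lborel)"
  unfolding set_lebesgue_integral_def by (intro integral_norm_bound)
 also have "\<dots> \<le> prim g t"
  unfolding set_lebesgue_integral_def
  by (rule integral_mono[OF integrable_norm[OF i(1)] i(2)]) (use le in \<open>auto simp: indicator_def\<close>)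
 finally show ?thesis .
qed

lemma prim_nonneg: "(\<And>s. s \<in> {0..t} ==> 0 \<le> (f s::real)) ==> 0 \<le> prim f t"
 unfolding set_lebesgue_integral_def by (rule integral_nonneg_AE) (auto simp: indicator_def)

lemma prim_mono:
 assumes f: "L1on T f" and g: "L1on T g" and le: "\<And>s. s \<in> {0..t} ==> f s \<le> (g s::real)" and t: "t \<le> T"
 shows "prim f t \<le> prim g t"
 by (rule set_integral_mono) (use L1on_subset[OF f t] L1on_subset[OF g t] le in auto)

lemma prim_mono2:
 assumes f: "L1on T f" and "\<And>s. s \<in> {0..T} ==> 0 \<le> (f s::real)" "0 \<le> s" "s \<le> t" "t \<le> T"
 shows "prim f s \<le> prim f t"
 unfolding set_lebesgue_integral_def
 by (rule integral_mono) (use L1on_subset[OF f, of s] L1on_subset[OF f, of t] assms in \<open>auto simp: set_integrable_def indicator_def\<close>)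

text \<open>By Fubini the product is the integral of \<open>B (f s) (g u)\<close> over the square
  \<open>[0,t] x [0,t]\<close>; splitting the square along the diagonal and integrating out the
  smaller variable on each half gives the two terms.\<close>

lemma prim_product:
 fixes f :: "real => 'a::euclidean_space" and g :: "real => 'b::euclidean_space" and B :: "_ => _ => 'c::euclidean_space"
 assumes B: "bounded_bilinear B" and f: "L1on T f" and g: "L1on T g" and t: "t \<in> {0..T}"
 shows "B (prim f t) (prim g t) = prim (\<lambda>s. B (f s) (prim g s)) t + prim (\<lambda>s. B (prim f s) (g s)) t"
proof -
 interpret bounded_bilinear B by fact
 define F where "F s = indicator {0..t} s *\<^sub>R f s" for s
 define G where "G s = indicator {0..t} s *\<^sub>R g s" for s
 have F: "integrable lborel F" and G: "integrable lborel G"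
  using L1on_subset[OF f, of t] L1on_subset[OF g, of t] t unfolding F_def[abs_def] G_def[abs_def] by (auto simp: set_integrable_def)
 have [measurable]: "F \<in> borel_measurable borel" "G \<in> borel_measurable borel" using F G by auto
 have cB: "continuous_on UNIV (\<lambda>x. B (fst x) (snd x))"
  by (rule continuous_on) (intro continuous_intros)+
 obtain K where K: "\<And>x y. norm (B x y) \<le> norm x * norm y * K" "K > 0" using pos_bounded by auto
 define H where "H = (\<lambda>(s,u). B (F s) (G u))"
 have Hm [measurable]: "H \<in> borel_measurable (lborel \<Otimes>\<^sub>M lborel)"
  unfolding H_def split_beta' by (rule borel_measurable_continuous_Pair[OF _ _ cB]) measurable
 have H: "integrable (lborel \<Otimes>\<^sub>M lborel) H"
 proof (rule lborel_pair.Fubini_integrable)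
  have iG: "integrable lborel (\<lambda>u. B x (G u))" for x
   by (rule integrable_bounded_linear[OF bounded_linear_right G])
  show "AE x in lborel. integrable lborel (\<lambda>y. H (x, y))" using iG by (simp add: H_def)
  show "integrable lborel (\<lambda>x. \<integral>y. norm (H (x, y)) \<partial>lborel)"
  proof (rule Bochner_Integration.integrable_bound[where f="\<lambda>x. norm (F x) * (K * (\<integral>u. norm (G u) \<partial>lborel))"])
   show "integrable lborel (\<lambda>x. norm (F x) * (K * (\<integral>u. norm (G u) \<partial>lborel)))"
    using F by (intro integrable_mult_left integrable_norm)
   show "(\<lambda>x. \<integral>y. norm (H (x, y)) \<partial>lborel) \<in> borel_measurable lborel"
    by (rule lborel.borel_measurable_lebesgue_integral) simp
   have "(\<integral>y. norm (H (x, y)) \<partial>lborel) \<le> norm (F x) * (K * (\<integral>u. norm (G u) \<partial>lborel))" for x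
   proof -
    have "(\<integral>y. norm (H (x, y)) \<partial>lborel) \<le> (\<integral>y. norm (F x) * K * norm (G y) \<partial>lborel)"
     using iG[of "F x"] G K(1)[of "F x"]
     by (intro integral_mono) (auto simp: H_def mult_ac intro!: integrable_norm order_trans[OF K(1)])
    then show ?thesis by (simp add: mult_ac)
   qed
   then show "AE x in lborel. norm (\<integral>y. norm (H (x, y)) \<partial>lborel) \<le> norm (norm (F x) * (K * (\<integral>u. norm (G u) \<partial>lborel)))"
    using K(2) by (intro AE_I2) (simp add: integral_nonneg_AE)
  qed
 qed measurable
 have GI: "(\<integral>u. indicator {..s} u *\<^sub>R G u \<partial>lborel) = prim g s" if "s \<in> {0..t}" for s
  unfolding set_lebesgue_integral_def G_def using that
  by (intro lint_cong) (auto simp: indicator_def)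
 \<comment> \<open>The strict half of the split omits the endpoint \<open>u\<close>, whereas
   \<open>prim f u\<close> includes it; the two integrands differ on a null set only.\<close>
 have FI: "(\<integral>s. indicator {..<u} s *\<^sub>R F s \<partial>lborel) = prim f u" if "u \<in> {0..t}" for u
  unfolding set_lebesgue_integral_def
 proof (rule integral_cong_AE)
  show "(\<lambda>s. indicator {..<u} s *\<^sub>R F s) \<in> borel_measurable lborel" by measurable
  show "(\<lambda>s. indicator {0..u} s *\<^sub>R f s) \<in> borel_measurable lborel"
   using L1on_meas[OF L1on_subset[OF f, of u]] that t by (simp add: set_borel_measurable_def)
  show "AE s in lborel. indicator {..<u} s *\<^sub>R F s = indicator {0..u} s *\<^sub>R f s"
   using AE_lborel_singleton[of u] by eventually_elim (use that in \<open>auto simp: indicator_def F_def\<close>)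
 qed
 have m1: "{x. snd x \<le> fst (x::real\<times>real)} \<in> sets (lborel \<Otimes>\<^sub>M lborel)" 
  and m2: "{x. fst x < snd (x::real\<times>real)} \<in> sets (lborel \<Otimes>\<^sub>M lborel)"
  unfolding lborel_prod sets_lborel
  by (intro borel_closed borel_open closed_Collect_le open_Collect_less continuous_intros)+
 have H1: "integrable (lborel \<Otimes>\<^sub>M lborel) (\<lambda>x. indicator {x. snd x \<le> fst x} x *\<^sub>R H x)"
  and H2: "integrable (lborel \<Otimes>\<^sub>M lborel) (\<lambda>x. indicator {x. fst x < snd x} x *\<^sub>R H x)"
  by (rule integrable_mult_indicator[OF m1 H], rule integrable_mult_indicator[OF m2 H])
 have "B (prim f t) (prim g t) = (\<integral>s. B (F s) (prim g t) \<partial>lborel)"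
  using integral_bounded_linear[OF bounded_linear_left F] by (simp add: set_lebesgue_integral_def F_def[abs_def])
 also have "\<dots> = (\<integral>s. (\<integral>u. H (s,u) \<partial>lborel) \<partial>lborel)"
  using integral_bounded_linear[OF bounded_linear_right G] by (simp add: set_lebesgue_integral_def G_def[abs_def] H_def)
 also have "\<dots> = integral\<^sup>L (lborel \<Otimes>\<^sub>M lborel) H" by (rule lborel_pair.integral_fst'[OF H])
 also have "\<dots> = integral\<^sup>L (lborel \<Otimes>\<^sub>M lborel) (\<lambda>x. indicator {x. snd x \<le> fst x} x *\<^sub>R H x + indicator {x. fst x < snd x} x *\<^sub>R H x)"
  by (rule lint_cong) (auto simp: indicator_def)
 also have "\<dots> = integral\<^sup>L (lborel \<Otimes>\<^sub>M lborel) (\<lambda>x. indicator {x. snd x \<le> fst x} x *\<^sub>R H x)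
   + integral\<^sup>L (lborel \<Otimes>\<^sub>M lborel) (\<lambda>x. indicator {x. fst x < snd x} x *\<^sub>R H x)"
  by (rule Bochner_Integration.integral_add[OF H1 H2])
 also have "integral\<^sup>L (lborel \<Otimes>\<^sub>M lborel) (\<lambda>x. indicator {x. snd x \<le> fst x} x *\<^sub>R H x)
   = (\<integral>s. (\<integral>u. indicator {x. snd x \<le> fst x} (s,u) *\<^sub>R H (s,u) \<partial>lborel) \<partial>lborel)"
  using lborel_pair.integral_fst'[OF H1] by simp
 also have "\<dots> = (\<integral>s. B (F s) (\<integral>u. indicator {..s} u *\<^sub>R G u \<partial>lborel) \<partial>lborel)"
 proof (rule lint_cong)
  fix s
  have "integrable lborel (\<lambda>u. indicator {..s} u *\<^sub>R G u)" by (rule integrable_mult_indicator[OF _ G]) simp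
  from integral_bounded_linear[OF bounded_linear_right this]
  show "(\<integral>u. indicator {x. snd x \<le> fst x} (s,u) *\<^sub>R H (s,u) \<partial>lborel) = B (F s) (\<integral>u. indicator {..s} u *\<^sub>R G u \<partial>lborel)"
   by (simp add: H_def scaleR_right indicator_def)
 qed simp
 also have "\<dots> = prim (\<lambda>s. B (f s) (prim g s)) t"
  unfolding set_lebesgue_integral_def[of _ _ "\<lambda>s. B (f s) (prim g s)"]
  using GI by (intro lint_cong) (auto simp: F_def indicator_def zero_left)
 also have "integral\<^sup>L (lborel \<Otimes>\<^sub>M lborel) (\<lambda>x. indicator {x. fst x < snd x} x *\<^sub>R H x)
   = (\<integral>u. (\<integral>s. indicator {x. fst x < snd x} (s,u) *\<^sub>R H (s,u) \<partial>lborel) \<partial>lborel)"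
  using lborel_pair.integral_snd[of "\<lambda>s u. indicator {x. fst x < snd x} (s,u) *\<^sub>R H (s,u)"] H2 by (simp add: split_beta')
 also have "\<dots> = (\<integral>u. B (\<integral>s. indicator {..<u} s *\<^sub>R F s \<partial>lborel) (G u) \<partial>lborel)"
 proof (rule lint_cong)
  fix u
  have "integrable lborel (\<lambda>s. indicator {..<u} s *\<^sub>R F s)" by (rule integrable_mult_indicator[OF _ F]) simp
  from integral_bounded_linear[OF bounded_linear_left this]
  show "(\<integral>s. indicator {x. fst x < snd x} (s,u) *\<^sub>R H (s,u) \<partial>lborel) = B (\<integral>s. indicator {..<u} s *\<^sub>R F s \<partial>lborel) (G u)"
   by (simp add: H_def scaleR_left indicator_def)
 qed simp
 also have "\<dots> = prim (\<lambda>s. B (prim f s) (g s)) t"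
  unfolding set_lebesgue_integral_def[of _ _ "\<lambda>s. B (prim f s) (g s)"]
  using FI by (intro lint_cong) (auto simp: G_def indicator_def zero_right)
 finally show ?thesis .
qed

text \<open>Leibniz rule in integrated form with initial values: the constants contribute linear
  terms, the primitives \<open>prim_product\<close>. It replaces differentiation throughout, since
  the integrands need not be continuous.\<close>

lemma ac_product:
 fixes f :: "real => 'a::euclidean_space" and g :: "real => 'b::euclidean_space" and B :: "_ => _ => 'c::euclidean_space"
 assumes B: "bounded_bilinear B" and f: "L1on T f" and g: "L1on T g"
  and F: "\<And>t. t \<in> {0..T} ==> F t = F0 + prim f t" and G: "\<And>t. t \<in> {0..T} ==> G t = G0 + prim g t"
 shows "L1on T (\<lambda>s. B (f s) (G s) + B (F s) (g s))"
  and "t \<in> {0..T} ==> B (F t) (G t) = B F0 G0 + prim (\<lambda>s. B (f s) (G s) + B (F s) (g s)) t"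
proof -
 interpret bounded_bilinear B by fact
 have cF: "continuous_on {0..T} F"
  by (rule continuous_on_eq[of _ "\<lambda>t. F0 + prim f t"]) (auto simp: F intro!: continuous_intros prim_continuous f)
 have cG: "continuous_on {0..T} G"
  by (rule continuous_on_eq[of _ "\<lambda>t. G0 + prim g t"]) (auto simp: G intro!: continuous_intros prim_continuous g)
 have 1: "L1on T (\<lambda>s. B (f s) (G s))" "L1on T (\<lambda>s. B (F s) (g s))"
  by (rule L1on_bilinear[OF B f cG], rule L1on_bilinear2[OF B g cF])
 then show "L1on T (\<lambda>s. B (f s) (G s) + B (F s) (g s))" by (rule set_integral_add)
 assume t: "t \<in> {0..T}"
 then have tT: "t \<le> T" by simp
 have 2: "L1on T (\<lambda>s. B (f s) (prim g s))" "L1on T (\<lambda>s. B (prim f s) (g s))"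
  by (rule L1on_bilinear[OF B f prim_continuous[OF g]], rule L1on_bilinear2[OF B g prim_continuous[OF f]])
 have 3: "L1on T (\<lambda>s. B (f s) G0)" "L1on T (\<lambda>s. B F0 (g s))"
  by (rule L1on_bilinear[OF B f continuous_on_const], rule L1on_bilinear2[OF B g continuous_on_const])
 have "prim (\<lambda>s. B (f s) (G s)) t = prim (\<lambda>s. B (f s) G0 + B (f s) (prim g s)) t"
  by (rule prim_cong) (use t in \<open>simp add: G add_right\<close>)
 also have "\<dots> = B (prim f t) G0 + prim (\<lambda>s. B (f s) (prim g s)) t"
  using prim_add[OF 3(1) 2(1) tT] prim_bounded_linear(1)[OF bounded_linear_left f tT] by simp
 finally have a: "prim (\<lambda>s. B (f s) (G s)) t = B (prim f t) G0 + prim (\<lambda>s. B (f s) (prim g s)) t" .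
 have "prim (\<lambda>s. B (F s) (g s)) t = prim (\<lambda>s. B F0 (g s) + B (prim f s) (g s)) t"
  by (rule prim_cong) (use t in \<open>simp add: F add_left\<close>)
 also have "\<dots> = B F0 (prim g t) + prim (\<lambda>s. B (prim f s) (g s)) t"
  using prim_add[OF 3(2) 2(2) tT] prim_bounded_linear(1)[OF bounded_linear_right g tT] by simp
 finally have b: "prim (\<lambda>s. B (F s) (g s)) t = B F0 (prim g t) + prim (\<lambda>s. B (prim f s) (g s)) t" .
 show "B (F t) (G t) = B F0 G0 + prim (\<lambda>s. B (f s) (G s) + B (F s) (g s)) t"
  using prim_add[OF 1 tT] prim_product[OF B f g t] a b t by (simp add: F G add_left add_right)
qed

section \<open>Gronwall's inequality and Picard iteration with integrable Lipschitz rates\<close>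

lemma prim_power:
 fixes l :: "real => real"
 assumes l: "L1on T l"
 shows "L1on T (\<lambda>s. real (Suc n) * l s * prim l s ^ n) \<and>
  (\<forall>t\<in>{0..T}. prim l t ^ Suc n = prim (\<lambda>s. real (Suc n) * l s * prim l s ^ n) t)"
proof (induction n)
 case (Suc n)
 have B: "bounded_bilinear ((*)::real=>_)" by (rule bounded_bilinear_mult)
 let ?g = "\<lambda>s. real (Suc n) * l s * prim l s ^ n"
 have e: "(\<lambda>s. l s * prim l s ^ Suc n + prim l s * ?g s) = (\<lambda>s. real (Suc (Suc n)) * l s * prim l s ^ Suc n)"
  by (auto simp: algebra_simps)
 from Suc.IH have IH: "t \<in> {0..T} ==> prim l t ^ Suc n = prim ?g t" for t by blast
 have "L1on T (\<lambda>s. l s * prim l s ^ Suc n + prim l s * ?g s)"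
  and "t \<in> {0..T} ==> prim l t * prim l t ^ Suc n = 0 * 0 + prim (\<lambda>s. l s * prim l s ^ Suc n + prim l s * ?g s) t" for t
  using ac_product[OF B l conjunct1[OF Suc.IH], of "prim l" "0::real" "\<lambda>s. prim l s ^ Suc n" "0::real"] IH
  by simp_all
 then show ?case unfolding e by simp
qed (use l in simp)

text \<open>One Picard step: the bound \<open>M * L ^ n / fact n\<close>, with \<open>L\<close> the
  primitive of \<open>l\<close>, is reproduced with \<open>n + 1\<close>. For an integrable rate it
  replaces the powers of \<open>t\<close> that a Lipschitz constant would give.\<close>

lemma prim_power':
 fixes l :: "real => real"
 assumes l: "L1on T l" and t: "t \<in> {0..T}"
 shows "L1on T (\<lambda>s. l s * (M * prim l s ^ n / fact n))"
  and "prim (\<lambda>s. l s * (M * prim l s ^ n / fact n)) t = M * prim l t ^ Suc n / fact (Suc n)"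
proof -
 have e: "(\<lambda>s. l s * (M * prim l s ^ n / fact n)) = (\<lambda>s. M / fact (Suc n) * (real (Suc n) * l s * prim l s ^ n))"
  by (auto simp del: of_nat_Suc)
 show "L1on T (\<lambda>s. l s * (M * prim l s ^ n / fact n))"
  unfolding e using prim_power[OF l, of n] by (intro set_integrable_mult_right) auto
 show "prim (\<lambda>s. l s * (M * prim l s ^ n / fact n)) t = M * prim l t ^ Suc n / fact (Suc n)"
  unfolding e using prim_power[OF l, of n] t by (simp del: power_Suc of_nat_Suc fact_Suc)
qed

lemma tendsto_power_fact: "(\<lambda>n. M * (x::real) ^ n / fact n) \<longlonglongrightarrow> 0"
proof -
 have "(\<lambda>n. M * (inverse (fact n) * x ^ n)) \<longlonglongrightarrow> M * 0"
  by (intro tendsto_mult_left summable_LIMSEQ_zero summable_exp)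
 then show ?thesis by (simp add: field_simps)
qed

text \<open>Start with a bound \<open>M\<close> of the continuous function \<open>d\<close> and feed
  the inequality into itself: after \<open>n\<close> rounds \<open>d\<close> is at most
  \<open>M * L ^ n / fact n\<close>, which tends to 0.\<close>

lemma gronwall_zero:
 fixes l d :: "real => real"
 assumes l: "L1on T l" and l0: "\<And>s. s \<in> {0..T} ==> 0 \<le> l s" and d: "continuous_on {0..T} d"
  and d0: "\<And>t. t \<in> {0..T} ==> 0 \<le> d t" and le: "\<And>t. t \<in> {0..T} ==> d t \<le> prim (\<lambda>s. l s * d s) t"
  and t: "t \<in> {0..T}"
 shows "d t = 0"
proof -
 obtain M where M: "M > 0" "\<And>s. s \<in> {0..T} ==> norm (d s) \<le> M" by (rule continuous_bounded_Icc[OF d]) auto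
 have ld: "L1on T (\<lambda>s. l s * d s)" by (rule L1on_bilinear[OF bounded_bilinear_mult l d])
 have *: "t \<in> {0..T} ==> d t \<le> M * prim l t ^ n / fact n" for n t
 proof (induction n arbitrary: t)
  case 0 then show ?case using M(2)[of t] d0[of t] by simp
 next
  case (Suc n)
  have "d t \<le> prim (\<lambda>s. l s * d s) t" by (rule le) fact
  also have "\<dots> \<le> prim (\<lambda>s. l s * (M * prim l s ^ n / fact n)) t"
   using Suc.prems by (intro prim_mono[OF ld prim_power'(1)[OF l Suc.prems]] mult_left_mono Suc.IH l0) auto
  finally show ?case using prim_power'(2)[OF l Suc.prems] by simp
 qed
 have "d t \<le> 0"
  by (rule LIMSEQ_le_const[OF tendsto_power_fact[of M "prim l t"]]) (use *[OF t] in auto)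
 with d0[OF t] show ?thesis by simp
qed

lemma caratheodory_unique:
 fixes F :: "real => 'a::euclidean_space => 'a" and l :: "real => real"
 assumes l: "L1on T l" and l0: "\<And>s. s \<in> {0..T} ==> 0 \<le> l s"
  and Lip: "\<And>s x y. s \<in> {0..T} ==> norm (F s x - F s y) \<le> l s * norm (x - y)"
  and y: "continuous_on {0..T} y" "L1on T (\<lambda>s. F s (y s))" "\<And>t. t \<in> {0..T} ==> y t = y0 t + prim (\<lambda>s. F s (y s)) t"
  and z: "continuous_on {0..T} z" "L1on T (\<lambda>s. F s (z s))" "\<And>t. t \<in> {0..T} ==> z t = y0 t + prim (\<lambda>s. F s (z s)) t"
  and t: "t \<in> {0..T}"
 shows "y t = z t"
proof -
 have c: "continuous_on {0..T} (\<lambda>t. norm (y t - z t))" by (intro continuous_intros y z)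
 have "norm (y t - z t) = 0"
 proof (rule gronwall_zero[OF l l0 c _ _ t])
  fix t assume t: "t \<in> {0..T}"
  have "y t - z t = prim (\<lambda>s. F s (y s) - F s (z s)) t"
   using prim_diff[OF y(2) z(2), of t] t y(3) z(3) by simp
  also have "norm \<dots> \<le> prim (\<lambda>s. l s * norm (y s - z s)) t"
   by (rule norm_prim_le[where T=T])
     (use y(2) z(2) t Lip in \<open>auto intro!: set_integral_diff L1on_bilinear[OF bounded_bilinear_mult l c]\<close>)
  finally show "norm (y t - z t) \<le> prim (\<lambda>s. l s * norm (y s - z s)) t" .
 qed auto
 then show ?thesis by simp
qed

text \<open>Consecutive Picard iterates differ by at most \<open>M * L ^ n / fact n\<close>, a
  summable sequence, so they converge uniformly by the Weierstrass test. Assumption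
  \<open>int\<close> asks for integrability along continuous functions only, which spares any joint
  measurability of \<open>F\<close>.\<close>

lemma caratheodory_exists:
 fixes F :: "real => 'a::euclidean_space => 'a" and l :: "real => real"
 assumes l: "L1on T l" and l0: "\<And>s. s \<in> {0..T} ==> 0 \<le> l s"
  and Lip: "\<And>s x y. s \<in> {0..T} ==> norm (F s x - F s y) \<le> l s * norm (x - y)"
  and int: "\<And>y. continuous_on {0..T} y ==> L1on T (\<lambda>s. F s (y s))" and y0: "continuous_on {0..T} y0"
 obtains y where "continuous_on {0..T} y" "\<And>t. t \<in> {0..T} ==> y t = y0 t + prim (\<lambda>s. F s (y s)) t"
proof -
 define Y where "Y = rec_nat y0 (\<lambda>_ y t. y0 t + prim (\<lambda>s. F s (y s)) t)"
 have Y0: "Y 0 = y0" and YS: "Y (Suc n) = (\<lambda>t. y0 t + prim (\<lambda>s. F s (Y n s)) t)" for n by (simp_all add: Y_def)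
 have cY: "continuous_on {0..T} (Y n)" for n
  by (induction n) (auto simp: Y0 YS intro!: y0 continuous_on_add prim_continuous int)
 have FI: "L1on T (\<lambda>s. F s (Y n s))" for n by (intro int cY)
 have diffle: "norm (prim (\<lambda>s. F s (u s)) t - prim (\<lambda>s. F s (v s)) t) \<le> prim (\<lambda>s. l s * norm (u s - v s)) t"
  if "continuous_on {0..T} u" "continuous_on {0..T} v" "t \<in> {0..T}" for u v t
 proof -
  have "norm (prim (\<lambda>s. F s (u s) - F s (v s)) t) \<le> prim (\<lambda>s. l s * norm (u s - v s)) t"
   using that by (intro norm_prim_le[where T=T] set_integral_diff(1) int L1on_bilinear[OF bounded_bilinear_mult l] continuous_intros Lip) auto
  then show ?thesis using prim_diff[OF int int] that by simp
 qed
 have "continuous_on {0..T} (\<lambda>s. Y 1 s - Y 0 s)" by (intro continuous_intros cY)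
 then obtain M where M: "M > 0" "\<And>s. s \<in> {0..T} ==> norm (Y 1 s - Y 0 s) \<le> M" by (rule continuous_bounded_Icc) auto
 have bd: "t \<in> {0..T} ==> norm (Y (Suc n) t - Y n t) \<le> M * prim l t ^ n / fact n" for n t
 proof (induction n arbitrary: t)
  case 0 then show ?case using M(2)[of t] by simp
 next
  case (Suc n)
  have "norm (Y (Suc (Suc n)) t - Y (Suc n) t) = norm (prim (\<lambda>s. F s (Y (Suc n) s)) t - prim (\<lambda>s. F s (Y n s)) t)"
   by (simp add: YS)
  also have "\<dots> \<le> prim (\<lambda>s. l s * norm (Y (Suc n) s - Y n s)) t" by (intro diffle cY Suc.prems)
  also have "\<dots> \<le> prim (\<lambda>s. l s * (M * prim l s ^ n / fact n)) t"
   using Suc.prems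
   by (intro prim_mono[OF _ prim_power'(1)[OF l Suc.prems]] mult_left_mono Suc.IH l0 L1on_bilinear[OF bounded_bilinear_mult l] continuous_intros cY) auto
  finally show ?case using prim_power'(2)[OF l Suc.prems] by simp
 qed
 have le: "norm (Y (Suc n) t - Y n t) \<le> M * prim l T ^ n / fact n" if t: "t \<in> {0..T}" for n t
 proof -
  have "prim l t ^ n \<le> prim l T ^ n"
   using t l0 by (intro power_mono prim_mono2[OF l] prim_nonneg) auto
  then show ?thesis using bd[OF t, of n] M(1) by (meson divide_right_mono fact_ge_zero mult_left_mono order_trans less_imp_le)
 qed
 have sM: "summable (\<lambda>n. M * prim l T ^ n / fact n)"
  using summable_mult[OF summable_exp[of "prim l T"], of M] by (simp add: field_simps)
 have "uniform_limit {0..T} (\<lambda>n t. \<Sum>i<n. (Y (Suc i) t - Y i t)) (\<lambda>t. \<Sum>i. (Y (Suc i) t - Y i t)) sequentially"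
  by (rule Weierstrass_m_test[OF le sM])
 then have "uniform_limit {0..T} (\<lambda>n t. Y 0 t + (\<Sum>i<n. (Y (Suc i) t - Y i t))) (\<lambda>t. Y 0 t + (\<Sum>i. (Y (Suc i) t - Y i t))) sequentially"
  by (intro uniform_limit_intros)
 moreover have "(\<lambda>n t. Y 0 t + (\<Sum>i<n. (Y (Suc i) t - Y i t))) = Y"
  using sum_lessThan_telescope[of "\<lambda>i. Y i t" for t] by (simp add: fun_eq_iff)
 ultimately have ul: "uniform_limit {0..T} Y (\<lambda>t. Y 0 t + (\<Sum>i. (Y (Suc i) t - Y i t))) sequentially"
  by metis
 define y where "y = (\<lambda>t. Y 0 t + (\<Sum>i. (Y (Suc i) t - Y i t)))"
 have ul: "uniform_limit {0..T} Y y sequentially" using ul by (simp add: y_def)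
 have cy: "continuous_on {0..T} y"
  by (rule uniform_limit_theorem[OF _ ul]) (auto intro!: cY always_eventually)
 show ?thesis
 proof (rule that[OF cy])
  fix t assume t: "t \<in> {0..T}"
  have "(\<lambda>n. prim (\<lambda>s. F s (Y n s)) t) \<longlonglongrightarrow> prim (\<lambda>s. F s (y s)) t"
  proof (rule LIMSEQ_I)
   fix e :: real assume e: "e > 0"
   \<comment> \<open>The summand 1 keeps the quotient meaningful when the rate has integral
     0.\<close>
   define e' where "e' = e / (prim l t + 1)"
   have pl: "prim l t \<ge> 0" using t l0 by (intro prim_nonneg) auto
   have e': "e' > 0" using e pl by (simp add: e'_def)
   from uniform_limitD[OF ul e'] obtain n0 where n0: "\<And>n s. n \<ge> n0 ==> s \<in> {0..T} ==> dist (Y n s) (y s) < e'"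
    unfolding eventually_sequentially by blast
   show "\<exists>n0. \<forall>n\<ge>n0. norm (prim (\<lambda>s. F s (Y n s)) t - prim (\<lambda>s. F s (y s)) t) < e"
   proof (intro exI allI impI)
    fix n assume n: "n \<ge> n0"
    have "norm (prim (\<lambda>s. F s (Y n s)) t - prim (\<lambda>s. F s (y s)) t) \<le> prim (\<lambda>s. l s * norm (Y n s - y s)) t"
     by (intro diffle cY cy t)
    also have "\<dots> \<le> prim (\<lambda>s. l s * e') t"
     using t l n0[OF n] by (intro prim_mono[where T=T] L1on_bilinear[OF bounded_bilinear_mult l] continuous_intros cY cy mult_left_mono l0)
      (auto simp: dist_norm less_imp_le)
    also have "\<dots> = prim l t * e'" by simp
    also have "\<dots> < e" using pl e by (simp add: e'_def field_simps)
    finally show "norm (prim (\<lambda>s. F s (Y n s)) t - prim (\<lambda>s. F s (y s)) t) < e" .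
   qed
  qed
  then have "(\<lambda>n. Y (Suc n) t) \<longlonglongrightarrow> y0 t + prim (\<lambda>s. F s (y s)) t"
   unfolding YS by (intro tendsto_intros)
  moreover have "(\<lambda>n. Y (Suc n) t) \<longlonglongrightarrow> y t"
   using tendsto_uniform_limitI[OF ul t] by (rule LIMSEQ_Suc)
  ultimately show "y t = y0 t + prim (\<lambda>s. F s (y s)) t" by (rule LIMSEQ_unique[symmetric])
 qed
qed

section \<open>Linear matrix equations and positivity\<close>

lemma transpose_add: "transpose (A + B) = transpose A + transpose (B :: real^'n^'m)"
 and transpose_diff: "transpose (A - B) = transpose A - transpose (B :: real^'n^'m)"
 and transpose_uminus: "transpose (- A) = - transpose (A :: real^'n^'m)"
 and transpose_scaleR: "transpose (r *\<^sub>R A) = r *\<^sub>R transpose (A :: real^'n^'m)"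
 and transpose_zero: "transpose (0 :: real^'n^'m) = 0"
 by (auto simp: transpose_def vec_eq_iff)

lemma norm_transpose: "norm (transpose A) = norm (A :: real^'n^'m)"
proof -
 have "(norm (transpose A))\<^sup>2 = (norm A)\<^sup>2"
  unfolding power2_norm_eq_inner inner_vec_def transpose_def by (simp add: sum.swap[of _ "UNIV::'n set"])
 then show ?thesis by simp
qed

lemma inner_transpose_mv: "(x :: real^'n) \<bullet> (transpose A *v y) = (A *v x) \<bullet> (y :: real^'m)"
 by (metis dot_lmul_matrix inner_commute transpose_matrix_vector)

lemma quadratic_congruence:
 "v \<bullet> ((X ** A ** transpose X) *v v) = (transpose X *v v) \<bullet> (A *v (transpose X *v (v :: real^'n)))"
proof -
 have "(X ** A ** transpose X) *v v = transpose (transpose X) *v (A *v (transpose X *v v))"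
  by (simp only: matrix_vector_mul_assoc matrix_mul_assoc transpose_transpose)
 then show ?thesis by (simp only: inner_transpose_mv)
qed

lemmas mm_simps = matrix_mul_assoc matrix_transpose_mul transpose_add transpose_diff transpose_uminus transpose_scaleR
 bb_mm.add_left bb_mm.add_right bb_mm.diff_left bb_mm.diff_right bb_mm.minus_left bb_mm.minus_right
 bb_mm.scaleR_left bb_mm.scaleR_right bb_mm.zero_left bb_mm.zero_right

lemma L1on_uminus: "L1on T f ==> L1on T (\<lambda>s. - f s)"
 by (simp add: set_integrable_def)

lemma L1on_transpose: "L1on T (f :: real => real^'n^'m) ==> L1on T (\<lambda>s. transpose (f s))"
 by (rule prim_bounded_linear(2)[OF bl_transpose _ order_refl])

lemma prim_transpose: "L1on T (f :: real => real^'n^'m) ==> t \<le> T ==> transpose (prim f t) = prim (\<lambda>s. transpose (f s)) t"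
 by (rule prim_bounded_linear(1)[OF bl_transpose])

lemma continuous_on_transpose [continuous_intros]:
 "continuous_on S (f :: 'a::topological_space => real^'n^'m) ==> continuous_on S (\<lambda>s. transpose (f s))"
 by (rule bounded_linear.continuous_on[OF bl_transpose])

lemmas continuous_on_mm [continuous_intros] = bb_mm.continuous_on
lemmas continuous_on_mv [continuous_intros] = bb_mv.continuous_on

text \<open>The inverse \<open>\<Psi>\<close> is carried along as the solution of the adjoint
  equation, so that products with \<open>\<Psi>\<close> can be treated by the product rule without
  differentiating a matrix inverse.\<close>

definition fundamental :: "real => (real => real^'d^'d) => (real => real^'d^'d) => (real => real^'d^'d) => bool" where
 "fundamental T \<beta> \<Phi> \<Psi> \<longleftrightarrow> continuous_on {0..T} \<Phi> \<and> continuous_on {0..T} \<Psi> \<and>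
   (\<forall>t\<in>{0..T}. \<Phi> t = mat 1 + prim (\<lambda>s. \<beta> s ** \<Phi> s) t \<and> \<Psi> t = mat 1 + prim (\<lambda>s. - (\<Psi> s ** \<beta> s)) t \<and>
    \<Psi> t ** \<Phi> t = mat 1 \<and> \<Phi> t ** \<Psi> t = mat 1)"

text \<open>Both equations are linear, with rate \<open>K * norm (\<beta> s)\<close>. The product
  \<open>\<Psi> ** \<Phi>\<close> has derivative
  \<open>- \<Psi> \<beta> \<Phi> + \<Psi> \<beta> \<Phi> = 0\<close>, hence stays at the identity;
  the opposite product follows because the matrices are square.\<close>

lemma fundamental_exists:
 fixes \<beta> :: "real => real^'d^'d"
 assumes \<beta>: "L1on T \<beta>"
 obtains \<Phi> \<Psi> where "fundamental T \<beta> \<Phi> \<Psi>"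
proof -
 obtain K where K: "\<And>(x :: real^'d^'d) (y :: real^'d^'d). norm (x ** y) \<le> norm x * norm y * K" "K > 0" using bb_mm.pos_bounded by auto
 have l: "L1on T (\<lambda>s. K * norm (\<beta> s))" using L1on_norm[OF \<beta>] by simp
 obtain \<Phi> where \<Phi>: "continuous_on {0..T} \<Phi>" "\<And>t. t \<in> {0..T} ==> \<Phi> t = mat 1 + prim (\<lambda>s. \<beta> s ** \<Phi> s) t"
 proof (rule caratheodory_exists[OF l, of "\<lambda>s y. \<beta> s ** y" "\<lambda>_. mat 1"])
  show "norm (\<beta> s ** x - \<beta> s ** y) \<le> K * norm (\<beta> s) * norm (x - y)" for s and x y :: "real^'d^'d"
   using K(1)[of "\<beta> s" "x - y"] by (simp add: bb_mm.diff_right mult_ac)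
  show "L1on T (\<lambda>s. \<beta> s ** y s)" if "continuous_on {0..T} y" for y by (rule L1on_bilinear[OF bb_mm \<beta> that])
 qed (use K(2) in auto)
 obtain \<Psi> where \<Psi>: "continuous_on {0..T} \<Psi>" "\<And>t. t \<in> {0..T} ==> \<Psi> t = mat 1 + prim (\<lambda>s. - (\<Psi> s ** \<beta> s)) t"
 proof (rule caratheodory_exists[OF l, of "\<lambda>s y. - (y ** \<beta> s)" "\<lambda>_. mat 1"])
  show "norm (- (x ** \<beta> s) - - (y ** \<beta> s)) \<le> K * norm (\<beta> s) * norm (x - y)" for s and x y :: "real^'d^'d"
   using K(1)[of "x - y" "\<beta> s"] by (simp add: bb_mm.diff_left mult_ac norm_minus_commute)
  show "L1on T (\<lambda>s. - (y s ** \<beta> s))" if "continuous_on {0..T} y" for y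
   using L1on_bilinear2[OF bb_mm \<beta> that] set_integrable_mult_right[of "-1"] by (simp add: set_integrable_def)
 qed (use K(2) in auto)
 have a: "L1on T (\<lambda>s. \<beta> s ** \<Phi> s)" "L1on T (\<lambda>s. - (\<Psi> s ** \<beta> s))"
  using L1on_bilinear[OF bb_mm \<beta> \<Phi>(1)] L1on_bilinear2[OF bb_mm \<beta> \<Psi>(1)] by (auto simp: set_integrable_def)
 have 1: "\<Psi> t ** \<Phi> t = mat 1" if t: "t \<in> {0..T}" for t
  using ac_product(2)[OF bb_mm a(2,1) \<Psi>(2) \<Phi>(2) t]
  by (simp add: mm_simps set_lebesgue_integral_def)
 then have "\<Phi> t ** \<Psi> t = mat 1" if t: "t \<in> {0..T}" for t
  using matrix_left_right_inverse that by blast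
 with 1 \<Phi> \<Psi> have "fundamental T \<beta> \<Phi> \<Psi>" unfolding fundamental_def by blast
 then show ?thesis by (rule that)
qed

lemma fundamentalD:
 assumes "fundamental T \<beta> \<Phi> \<Psi>"
 shows "continuous_on {0..T} \<Phi>" "continuous_on {0..T} \<Psi>" "t \<in> {0..T} ==> \<Phi> t = mat 1 + prim (\<lambda>s. \<beta> s ** \<Phi> s) t"
  "t \<in> {0..T} ==> \<Psi> t = mat 1 + prim (\<lambda>s. - (\<Psi> s ** \<beta> s)) t"
  "t \<in> {0..T} ==> \<Psi> t ** \<Phi> t = mat 1" "t \<in> {0..T} ==> \<Phi> t ** \<Psi> t = mat 1"
 using assms unfolding fundamental_def by blast+

text \<open>Variation of constants: multiplication by \<open>\<Psi>\<close> cancels the homogeneous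
  part \<open>\<beta> e\<close> and leaves only \<open>\<Psi> \<eta>\<close>.\<close>

lemma fundamental_mm:
 fixes e :: "real => real^'k^'d"
 assumes F: "fundamental T \<beta> \<Phi> \<Psi>" and \<beta>: "L1on T \<beta>" and \<eta>: "L1on T \<eta>" and ce: "continuous_on {0..T} e"
  and e: "\<And>t. t \<in> {0..T} ==> e t = e0 + prim (\<lambda>s. \<beta> s ** e s + \<eta> s) t" and t: "t \<in> {0..T}"
 shows "\<Psi> t ** e t = e0 + prim (\<lambda>s. \<Psi> s ** \<eta> s) t"
proof -
 note F = fundamentalD[OF F]
 have a: "L1on T (\<lambda>s. - (\<Psi> s ** \<beta> s))" "L1on T (\<lambda>s. \<beta> s ** e s + \<eta> s)"
  by (rule L1on_uminus[OF L1on_bilinear2[OF bb_mm \<beta> F(2)]],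
    rule set_integral_add(1)[OF L1on_bilinear[OF bb_mm \<beta> ce] \<eta>])
 show ?thesis
  using ac_product(2)[OF bb_mm a F(4) e t] by (simp add: mm_simps)
qed

text \<open>The forcing \<open>L\<close> will be a path of a stochastic process, continuous but of
  unbounded variation, so \<open>\<Psi> dL\<close> makes no sense. The difference
  \<open>Y - L\<close> is absolutely continuous, and variation of constants for it involves
  \<open>L\<close> only under a Lebesgue integral.\<close>

lemma fundamental_mv:
 fixes L Y :: "real => real^'d"
 assumes F: "fundamental T \<beta> \<Phi> \<Psi>" and \<beta>: "L1on T \<beta>" and L: "continuous_on {0..T} L"
 shows "continuous_on {0..T} Y ==> (\<And>t. t \<in> {0..T} ==> Y t = L t + prim (\<lambda>s. \<beta> s *v Y s) t) ==> t \<in> {0..T} ==>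
   Y t = L t + \<Phi> t *v prim (\<lambda>s. (\<Psi> s ** \<beta> s) *v L s) t"
  and "(\<And>t. t \<in> {0..T} ==> Y t = L t + \<Phi> t *v prim (\<lambda>s. (\<Psi> s ** \<beta> s) *v L s) t) ==> t \<in> {0..T} ==>
   Y t = L t + prim (\<lambda>s. \<beta> s *v Y s) t"
proof -
 note F = fundamentalD[OF F]
 have \<Psi>\<beta>: "L1on T (\<lambda>s. \<Psi> s ** \<beta> s)" "L1on T (\<lambda>s. - (\<Psi> s ** \<beta> s))"
  using L1on_bilinear2[OF bb_mm \<beta> F(2)] by (auto simp: set_integrable_def)
 have \<Psi>\<beta>L: "L1on T (\<lambda>s. (\<Psi> s ** \<beta> s) *v L s)" by (rule L1on_bilinear[OF bb_mv \<Psi>\<beta>(1) L])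
 have \<beta>\<Phi>: "L1on T (\<lambda>s. \<beta> s ** \<Phi> s)" by (rule L1on_bilinear[OF bb_mm \<beta> F(1)])
 {
  assume Y: "continuous_on {0..T} Y" "\<And>t. t \<in> {0..T} ==> Y t = L t + prim (\<lambda>s. \<beta> s *v Y s) t" and t: "t \<in> {0..T}"
  have e: "t \<in> {0..T} ==> Y t - L t = 0 + prim (\<lambda>s. \<beta> s *v Y s) t" for t using Y(2)[of t] by simp
  have "\<Psi> t *v (Y t - L t) = prim (\<lambda>s. - (\<Psi> s ** \<beta> s) *v (Y s - L s) + \<Psi> s *v (\<beta> s *v Y s)) t"
   using ac_product(2)[OF bb_mv \<Psi>\<beta>(2) L1on_bilinear[OF bb_mv \<beta> Y(1)] F(4) e t] by simp
  also have "\<dots> = prim (\<lambda>s. (\<Psi> s ** \<beta> s) *v L s) t"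
   by (rule prim_cong) (simp add: bb_mv.minus_left bb_mv.diff_right matrix_vector_mul_assoc)
  finally have "\<Phi> t *v (\<Psi> t *v (Y t - L t)) = \<Phi> t *v prim (\<lambda>s. (\<Psi> s ** \<beta> s) *v L s) t" by simp
  then show "Y t = L t + \<Phi> t *v prim (\<lambda>s. (\<Psi> s ** \<beta> s) *v L s) t"
   using F(6)[OF t] by (simp add: matrix_vector_mul_assoc algebra_simps)
 next
  assume Y: "\<And>t. t \<in> {0..T} ==> Y t = L t + \<Phi> t *v prim (\<lambda>s. (\<Psi> s ** \<beta> s) *v L s) t" and t: "t \<in> {0..T}"
  have "\<Phi> t *v prim (\<lambda>s. (\<Psi> s ** \<beta> s) *v L s) t
    = prim (\<lambda>s. (\<beta> s ** \<Phi> s) *v prim (\<lambda>s. (\<Psi> s ** \<beta> s) *v L s) s + \<Phi> s *v ((\<Psi> s ** \<beta> s) *v L s)) t"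
   using ac_product(2)[OF bb_mv \<beta>\<Phi> \<Psi>\<beta>L F(3) _ t, of "\<lambda>t. prim (\<lambda>s. (\<Psi> s ** \<beta> s) *v L s) t" 0] by simp
  also have "\<dots> = prim (\<lambda>s. \<beta> s *v Y s) t"
  proof (rule prim_cong)
   fix s assume "s \<in> {0..t}"
   then have s: "s \<in> {0..T}" using t by auto
   have "\<Phi> s *v ((\<Psi> s ** \<beta> s) *v L s) = \<beta> s *v L s"
    using F(6)[OF s] by (simp add: matrix_vector_mul_assoc matrix_mul_assoc)
   then show "(\<beta> s ** \<Phi> s) *v prim (\<lambda>s. (\<Psi> s ** \<beta> s) *v L s) s + \<Phi> s *v ((\<Psi> s ** \<beta> s) *v L s) = \<beta> s *v Y s"
    by (simp add: Y[OF s] bb_mv.add_right matrix_vector_mul_assoc)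
  qed
  finally show "Y t = L t + prim (\<lambda>s. \<beta> s *v Y s) t" using Y[OF t] by simp
 }
qed

text \<open>The unknown is multiplied from the right, which is how the covariance of a fixed vector
  with a moving state evolves in time.\<close>

lemma linear_right_unique:
 fixes y z :: "real => real^'d^'k"
 assumes b: "L1on T (b :: real => real^'d^'d)" and \<eta>: "L1on T \<eta>"
  and y: "continuous_on {0..T} y" "\<And>t. t \<in> {0..T} ==> y t = y0 + prim (\<lambda>s. y s ** b s + \<eta> s) t"
  and z: "continuous_on {0..T} z" "\<And>t. t \<in> {0..T} ==> z t = y0 + prim (\<lambda>s. z s ** b s + \<eta> s) t"
  and t: "t \<in> {0..T}"
 shows "y t = z t"
proof -
 obtain K where K: "\<And>(x :: real^'d^'k) (y :: real^'d^'d). norm (x ** y) \<le> norm x * norm y * K" "K > 0"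
  using bb_mm.pos_bounded by auto
 have l: "L1on T (\<lambda>s. K * norm (b s))" using L1on_norm[OF b] by simp
 show ?thesis
 proof (rule caratheodory_unique[OF l _ _ y(1) _ y(2) z(1) _ z(2) t])
  show "norm ((x ** b s + \<eta> s) - (y ** b s + \<eta> s)) \<le> K * norm (b s) * norm (x - y)" for s x y
   using K(1)[of "x - y" "b s"] by (simp add: bb_mm.diff_left mult_ac)
  show "L1on T (\<lambda>s. y s ** b s + \<eta> s)" "L1on T (\<lambda>s. z s ** b s + \<eta> s)"
   by (rule set_integral_add(1)[OF L1on_bilinear2[OF bb_mm b y(1)] \<eta>],
     rule set_integral_add(1)[OF L1on_bilinear2[OF bb_mm b z(1)] \<eta>])
  show "0 \<le> K * norm (b s)" for s using K(2) by simp
 qed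
qed

text \<open>The product rule yields that \<open>\<Psi> Y \<Psi>\<^sup>T\<close> equals
  \<open>Y0\<close> plus the integral of \<open>\<Psi> G \<Psi>\<^sup>T\<close>, a sum of positive
  semidefinite matrices; \<open>Y\<close> is congruent to it through \<open>\<Phi>\<close>.\<close>

lemma lyapunov_psd:
 fixes Y :: "real => real^'d^'d"
 assumes \<beta>: "L1on T \<beta>" and G: "L1on T G" and Gp: "\<And>s v. s \<in> {0..T} ==> 0 \<le> v \<bullet> (G s *v v)"
  and Y0: "\<And>v. 0 \<le> v \<bullet> (Y0 *v v)" and Yc: "continuous_on {0..T} Y"
  and Y: "\<And>t. t \<in> {0..T} ==> Y t = Y0 + prim (\<lambda>s. \<beta> s ** Y s + Y s ** transpose (\<beta> s) + G s) t" and t: "t \<in> {0..T}"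
 shows "0 \<le> v \<bullet> (Y t *v v)"
proof -
 obtain \<Phi> \<Psi> where FF: "fundamental T \<beta> \<Phi> \<Psi>" using fundamental_exists[OF \<beta>] .
 note F = fundamentalD[OF FF]
 have tT: "t \<le> T" using t by simp
 let ?\<eta> = "\<lambda>s. Y s ** transpose (\<beta> s) + G s"
 have \<eta>: "L1on T ?\<eta>" by (intro set_integral_add(1) L1on_bilinear2[OF bb_mm L1on_transpose[OF \<beta>] Yc] G)
 have Y': "t \<in> {0..T} ==> Y t = Y0 + prim (\<lambda>s. \<beta> s ** Y s + ?\<eta> s) t" for t
  unfolding add.assoc[symmetric] by (rule Y)
 have 1: "\<Psi> t ** Y t = Y0 + prim (\<lambda>s. \<Psi> s ** ?\<eta> s) t" if "t \<in> {0..T}" for t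
  by (rule fundamental_mm[OF FF \<beta> \<eta> Yc Y' that])
 have \<Psi>\<eta>: "L1on T (\<lambda>s. \<Psi> s ** ?\<eta> s)" by (rule L1on_bilinear2[OF bb_mm \<eta> F(2)])
 have m: "L1on T (\<lambda>s. - (\<Psi> s ** \<beta> s))"
  using L1on_bilinear2[OF bb_mm \<beta> F(2)] by (auto simp: set_integrable_def)
 have m': "L1on T (\<lambda>s. transpose (- (\<Psi> s ** \<beta> s)))" by (rule L1on_transpose[OF m])
 have 2: "transpose (\<Psi> t) = mat 1 + prim (\<lambda>s. transpose (- (\<Psi> s ** \<beta> s))) t" if t: "t \<in> {0..T}" for t
  using t arg_cong[OF F(4)[OF t], of transpose] prim_transpose[OF m, of t] by (simp add: transpose_add)
 have G': "L1on T (\<lambda>s. \<Psi> s ** G s ** transpose (\<Psi> s))"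
  by (rule L1on_bilinear[OF bb_mm L1on_bilinear2[OF bb_mm G F(2)]]) (intro continuous_intros F)
 have "\<Psi> t ** Y t ** transpose (\<Psi> t) = Y0 + prim (\<lambda>s. \<Psi> s ** G s ** transpose (\<Psi> s)) t"
  using ac_product(2)[OF bb_mm \<Psi>\<eta> m' 1 2 t] by (simp add: mm_simps)
 moreover have "\<Phi> t ** (\<Psi> t ** Y t ** transpose (\<Psi> t)) ** transpose (\<Phi> t) = Y t"
 proof -
  have "\<Phi> t ** (\<Psi> t ** Y t ** transpose (\<Psi> t)) ** transpose (\<Phi> t) = (\<Phi> t ** \<Psi> t) ** Y t ** transpose (\<Phi> t ** \<Psi> t)"
   by (simp add: mm_simps)
  then show ?thesis by (simp add: F(6)[OF t])
 qed
 ultimately have e: "Y t = \<Phi> t ** (Y0 + prim (\<lambda>s. \<Psi> s ** G s ** transpose (\<Psi> s)) t) ** transpose (\<Phi> t)" by simp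
 define w where "w = transpose (\<Phi> t) *v v"
 have bl: "bounded_linear (\<lambda>A. w \<bullet> (A *v w))"
  by (rule bounded_linear_compose[OF bounded_linear_inner_right bb_mv.bounded_linear_left])
 have "v \<bullet> (Y t *v v) = w \<bullet> ((Y0 + prim (\<lambda>s. \<Psi> s ** G s ** transpose (\<Psi> s)) t) *v w)"
  unfolding e w_def by (rule quadratic_congruence)
 also have "\<dots> = w \<bullet> (Y0 *v w) + prim (\<lambda>s. w \<bullet> ((\<Psi> s ** G s ** transpose (\<Psi> s)) *v w)) t"
  using prim_bounded_linear(1)[OF bl G' tT] by (simp add: bb_mv.add_left inner_add_right)
 also have "\<dots> \<ge> 0"
 proof (intro add_nonneg_nonneg Y0 prim_nonneg)
  fix s assume "s \<in> {0..t}"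
  then have "s \<in> {0..T}" using t by auto
  from Gp[OF this, of "transpose (\<Psi> s) *v w"] show "0 \<le> w \<bullet> ((\<Psi> s ** G s ** transpose (\<Psi> s)) *v w)"
   by (simp only: quadratic_congruence)
 qed
 finally show ?thesis .
qed

section \<open>A priori bounds and the Riccati equation\<close>

lemma norm_le_diag:
 fixes P :: "real^'d^'d"
 assumes sym: "transpose P = P" and psd: "\<And>v. 0 \<le> v \<bullet> (P *v v)" and le: "\<And>v. v \<bullet> (P *v v) \<le> v \<bullet> (\<Lambda> *v v)"
 shows "norm P \<le> real CARD('d) * real CARD('d) * norm \<Lambda>"
proof -
 have ax: "axis i 1 \<bullet> (A *v axis j 1) = A $ i $ j" for A :: "real^'d^'d" and i j
  by (simp add: inner_axis' matrix_vector_mul_component inner_axis)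
 have s: "P $ i $ j = P $ j $ i" for i j
  using arg_cong[OF sym, of "\<lambda>A. A $ j $ i"] by (simp add: transpose_def)
 have d: "P $ i $ i \<le> norm \<Lambda>" for i
 proof -
  have "P $ i $ i \<le> \<Lambda> $ i $ i" using le[of "axis i 1"] by (simp add: ax)
  also have "\<dots> \<le> norm (\<Lambda> $ i)" using component_le_norm_cart[of "\<Lambda> $ i" i] by simp
  also have "\<dots> \<le> norm \<Lambda>" by (rule Finite_Cartesian_Product.norm_nth_le)
  finally show ?thesis .
 qed
 have b: "\<bar>P $ i $ j\<bar> \<le> norm \<Lambda>" for i j
 proof -
  \<comment> \<open>Testing on the sum and the difference of two unit vectors bounds an off-diagonal
    entry by the mean of the two diagonal ones.\<close>
  have "0 \<le> (axis i 1 + axis j 1) \<bullet> (P *v (axis i 1 + axis j 1))" "0 \<le> (axis i 1 - axis j 1) \<bullet> (P *v (axis i 1 - axis j 1))"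
   by (rule psd)+
  then have "0 \<le> P$i$i + P$j$j + 2 * P$i$j" "0 \<le> P$i$i + P$j$j - 2 * P$i$j"
   using s[of i j] by (simp_all add: bb_mv.add_right bb_mv.diff_right inner_add inner_diff ax)
  then show ?thesis using d[of i] d[of j] by linarith
 qed
 have "norm P \<le> (\<Sum>i\<in>UNIV. norm (P $ i))" unfolding norm_vec_def by (rule L2_set_le_sum) simp
 also have "\<dots> \<le> (\<Sum>i\<in>UNIV. \<Sum>j\<in>UNIV. \<bar>P $ i $ j\<bar>)" by (intro sum_mono norm_le_l1_cart)
 also have "\<dots> \<le> (\<Sum>i\<in>(UNIV::'d set). \<Sum>j\<in>(UNIV::'d set). norm \<Lambda>)" by (intro sum_mono b)
 finally show ?thesis by simp
qed

text \<open>For \<open>R > 0\<close> this is the nearest-point map onto the ball of radius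
  \<open>R\<close>, written without a case distinction; from the identification come its Lipschitz
  constant 1 and its continuity.\<close>

definition radial :: "real => 'a::euclidean_space => 'a" where
 "radial R x = (R / max R (norm x)) *\<^sub>R x"

lemma radial_closest:
 assumes R: "R > 0" shows "radial R x = closest_point (cball 0 R) x"
proof (cases "norm x \<le> R")
 case True
 then show ?thesis using R by (simp add: radial_def closest_point_self max_def)
next
 case False
 have "radial R x = (R / norm x) *\<^sub>R x" using False by (simp add: radial_def max_def)
 moreover have "(R / norm x) *\<^sub>R x = closest_point (cball 0 R) x"
 proof (rule closest_point_unique)
  show "(R / norm x) *\<^sub>R x \<in> cball 0 R" using R by simp
  show "\<forall>z\<in>cball 0 R. dist x ((R / norm x) *\<^sub>R x) \<le> dist x z"
  proof
   fix z :: 'a assume "z \<in> cball 0 R"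
   then have "norm z \<le> R" by simp
   have "x - (R / norm x) *\<^sub>R x = (1 - R / norm x) *\<^sub>R x" by (simp add: algebra_simps)
   then have "dist x ((R / norm x) *\<^sub>R x) = \<bar>1 - R / norm x\<bar> * norm x" by (simp add: dist_norm)
   also have "\<dots> = (1 - R / norm x) * norm x"
   proof -
    have "R / norm x \<le> 1" using False R by (subst pos_divide_le_eq) auto
    then show ?thesis by simp
   qed
   also have "\<dots> = norm x - R"
   proof -
    have "norm x \<noteq> 0" using False R by linarith
    then show ?thesis by (simp add: left_diff_distrib)
   qed
   also have "\<dots> \<le> norm x - norm z" using \<open>norm z \<le> R\<close> by simp
   also have "\<dots> \<le> dist x z" by (simp add: dist_norm norm_triangle_ineq2)
   finally show "dist x ((R / norm x) *\<^sub>R x) \<le> dist x z" .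
  qed
 qed auto
 ultimately show ?thesis by simp
qed

lemma radial_lipschitz: "R > 0 ==> norm (radial R x - radial R y) \<le> norm (x - y)"
 using closest_point_lipschitz[of "cball 0 R" x y] by (simp add: radial_closest dist_norm)

lemma radial_norm: "R > 0 ==> norm (radial R x) \<le> R"
 using closest_point_in_set[of "cball 0 R" x] by (simp add: radial_closest)

lemma radial_id: "R > 0 ==> norm x \<le> R ==> radial R x = x"
 by (simp add: radial_def max_def)

text \<open>Radial truncation makes the quadratic term Lipschitz; comparing the solution with the linear
 equation without quadratic term bounds it a priori, so that the truncation is inactive.\<close>

lemma riccati_exists:
 fixes b :: "real => real^'d^'d" and k :: "real => real^'d^'n" and Q P0 :: "real^'d^'d"
 assumes T: "0 \<le> T" and b: "L1on T b" and k: "L2on T k"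
  and Q: "transpose Q = Q" "\<And>v. 0 \<le> v \<bullet> (Q *v v)" and P0: "transpose P0 = P0" "\<And>v. 0 \<le> v \<bullet> (P0 *v v)"
 obtains P where "continuous_on {0..T} P" "\<And>t. t \<in> {0..T} ==> transpose (P t) = P t"
  "\<And>t. t \<in> {0..T} ==>
    P t = P0 + prim (\<lambda>s. b s ** P s + P s ** transpose (b s) + Q - P s ** (transpose (k s) ** k s) ** P s) t"
proof -
 obtain K where K: "\<And>(x :: real^'d^'d) (y :: real^'d^'d). norm (x ** y) \<le> norm x * norm y * K" "K > 0" using bb_mm.pos_bounded by auto
 define M where "M s = transpose (k s) ** k s" for s
 have M: "L1on T M" unfolding M_def
  by (rule L2on_bilinear[OF bb_mm L2on_linear[OF bl_transpose k] k])
 have Mt: "transpose (M s) = M s" for s by (simp add: M_def mm_simps)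
 have bt: "L1on T (\<lambda>s. transpose (b s))" by (rule L1on_transpose[OF b])
 have Qc: "L1on T (\<lambda>s. Q)" by (rule L1on_continuous) simp
 define l0 where "l0 s = K * norm (b s) + K * norm (transpose (b s))" for s
 have l0: "L1on T l0" unfolding l0_def using L1on_norm[OF b] L1on_norm[OF bt] by (intro set_integral_add(1)) auto
 have l0p: "0 \<le> l0 s" for s using K(2) by (simp add: l0_def)
 have lin: "norm ((b s ** x + x ** transpose (b s)) - (b s ** y + y ** transpose (b s))) \<le> l0 s * norm (x - y)" for s x y
 proof -
  have "(b s ** x + x ** transpose (b s)) - (b s ** y + y ** transpose (b s)) = b s ** (x - y) + (x - y) ** transpose (b s)"
   by (simp add: mm_simps)
  also have "norm \<dots> \<le> norm (b s ** (x - y)) + norm ((x - y) ** transpose (b s))" by (rule norm_triangle_ineq)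
  also have "\<dots> \<le> l0 s * norm (x - y)"
   using K(1)[of "b s" "x - y"] K(1)[of "x - y" "transpose (b s)"] by (simp add: l0_def algebra_simps)
  finally show ?thesis .
 qed
 have linI: "L1on T (\<lambda>s. b s ** y s + y s ** transpose (b s) + Q)" if "continuous_on {0..T} y" for y
  by (rule set_integral_add(1)[OF set_integral_add(1)[OF L1on_bilinear[OF bb_mm b that] L1on_bilinear2[OF bb_mm bt that]] Qc])
 obtain \<Lambda> where \<Lambda>: "continuous_on {0..T} \<Lambda>"
  "\<And>t. t \<in> {0..T} ==> \<Lambda> t = P0 + prim (\<lambda>s. b s ** \<Lambda> s + \<Lambda> s ** transpose (b s) + Q) t"
 proof (rule caratheodory_exists[OF l0, of "\<lambda>s y. b s ** y + y ** transpose (b s) + Q" "\<lambda>_. P0"])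
  show "norm ((b s ** x + x ** transpose (b s) + Q) - (b s ** y + y ** transpose (b s) + Q)) \<le> l0 s * norm (x - y)" for s x y
   using lin[of s x y] by simp
 qed (use l0p linI in auto)
 obtain C where C: "C > 0" "\<And>s. s \<in> {0..T} ==> norm (\<Lambda> s) \<le> C" by (rule continuous_bounded_Icc[OF \<Lambda>(1)]) auto
 \<comment> \<open>The radius is the a priori bound itself: once \<open>P\<close> is known to lie
   between 0 and \<open>\<Lambda>\<close>, \<open>norm_le_diag\<close> bounds it by
   \<open>R\<close>.\<close>
 define R where "R = real CARD('d) * real CARD('d) * C"
 have R: "R > 0" using C(1) by (simp add: R_def)
 define F where "F s y = b s ** y + y ** transpose (b s) + Q - radial R y ** M s ** radial R y" for s y
 define l where "l s = l0 s + 2 * R * K * K * norm (M s)" for s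
 have l: "L1on T l" unfolding l_def using L1on_norm[OF M] by (intro set_integral_add(1) l0 set_integrable_mult_right) auto
 have lp: "0 \<le> l s" for s using l0p[of s] K(2) R by (simp add: l_def)
 have Lip: "norm (F s x - F s y) \<le> l s * norm (x - y)" for s x y
 proof -
  let ?x = "radial R x" and ?y = "radial R y"
  have KK: "norm (u ** M s ** v) \<le> norm u * norm (M s) * norm v * K * K" for u v :: "real^'d^'d"
  proof -
   have "norm (u ** M s ** v) \<le> norm (u ** M s) * norm v * K" by (rule K)
   also have "\<dots> \<le> (norm u * norm (M s) * K) * norm v * K" using K(1)[of u "M s"] K(2) by (intro mult_right_mono) auto
   finally show ?thesis by (simp add: mult_ac)
  qed
  have "?x ** M s ** ?x - ?y ** M s ** ?y = (?x - ?y) ** M s ** ?x + ?y ** M s ** (?x - ?y)"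
   by (simp add: mm_simps)
  also have "norm \<dots> \<le> norm ((?x - ?y) ** M s ** ?x) + norm (?y ** M s ** (?x - ?y))" by (rule norm_triangle_ineq)
  also have "\<dots> \<le> norm (?x - ?y) * norm (M s) * norm ?x * K * K + norm ?y * norm (M s) * norm (?x - ?y) * K * K"
   by (intro add_mono KK)
  also have "\<dots> \<le> norm (x - y) * norm (M s) * R * K * K + R * norm (M s) * norm (x - y) * K * K"
   using radial_lipschitz[OF R, of x y] radial_norm[OF R, of x] radial_norm[OF R, of y] K(2) R
   by (intro add_mono mult_right_mono mult_mono) auto
  finally have q: "norm (?x ** M s ** ?x - ?y ** M s ** ?y) \<le> 2 * R * K * K * norm (M s) * norm (x - y)" by (simp add: mult_ac)
  have "F s x - F s y = ((b s ** x + x ** transpose (b s)) - (b s ** y + y ** transpose (b s))) - (?x ** M s ** ?x - ?y ** M s ** ?y)"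
   by (simp add: F_def)
  also have "norm \<dots> \<le> l0 s * norm (x - y) + 2 * R * K * K * norm (M s) * norm (x - y)"
   by (rule order_trans[OF norm_triangle_ineq4 add_mono[OF lin q]])
  finally show ?thesis by (simp add: l_def algebra_simps)
 qed
 have crad: "continuous_on {0..T} (\<lambda>s. radial R (y s))" if "continuous_on {0..T} y" for y :: "real => real^'d^'d"
  unfolding radial_closest[OF R]
  by (rule continuous_on_compose2[OF continuous_on_closest_point[of "cball 0 R" UNIV] that]) (use R in auto)
 have FI: "L1on T (\<lambda>s. F s (y s))" if "continuous_on {0..T} y" for y unfolding F_def
  by (rule set_integral_diff(1)[OF linI[OF that] L1on_bilinear[OF bb_mm L1on_bilinear2[OF bb_mm M crad[OF that]] crad[OF that]]])
 obtain P where P: "continuous_on {0..T} P" "\<And>t. t \<in> {0..T} ==> P t = P0 + prim (\<lambda>s. F s (P s)) t"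
  using caratheodory_exists[OF l lp Lip FI continuous_on_const] by blast
 have radT: "radial R (transpose x) = transpose (radial R x)" for x :: "real^'d^'d"
  by (simp add: radial_def norm_transpose transpose_scaleR)
 have FT: "F s (transpose x) = transpose (F s x)" for s x
  by (simp add: F_def radT mm_simps Mt Q)
 have sym: "transpose (P t) = P t" if t: "t \<in> {0..T}" for t
 proof (rule caratheodory_unique[OF l lp Lip _ _ _ P(1) FI[OF P(1)] P(2) t])
  show c: "continuous_on {0..T} (\<lambda>t. transpose (P t))" by (intro continuous_intros P)
  show "L1on T (\<lambda>s. F s (transpose (P s)))" by (rule FI[OF c])
  fix t assume t: "t \<in> {0..T}"
  show "transpose (P t) = P0 + prim (\<lambda>s. F s (transpose (P s))) t"
   using arg_cong[OF P(2)[OF t], of transpose] prim_transpose[OF FI[OF P(1)], of t] t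
   by (simp add: transpose_add P0 FT)
 qed
 define \<theta> where "\<theta> s = R / max R (norm (P s))" for s
 have c\<theta>: "continuous_on {0..T} \<theta>" unfolding \<theta>_def using R by (intro continuous_intros P) (auto simp: max_def)
 have rad: "radial R (P s) = \<theta> s *\<^sub>R P s" for s by (simp add: radial_def \<theta>_def)
 \<comment> \<open>Half of the truncated quadratic term is put on either side, so that
   \<open>P\<close> solves a Lyapunov equation with source \<open>Q\<close>. This gives positivity
   before any bound on \<open>P\<close> is available.\<close>
 define \<beta> where "\<beta> s = b s - (\<theta> s * \<theta> s / 2) *\<^sub>R (P s ** M s)" for s
 have \<beta>: "L1on T \<beta>" unfolding \<beta>_def
  by (rule set_integral_diff(1)[OF b L1on_bilinear2[OF bounded_bilinear_scaleR L1on_bilinear2[OF bb_mm M P(1)]]])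
   (intro continuous_intros c\<theta>, simp)
 have psd: "0 \<le> v \<bullet> (P t *v v)" if t: "t \<in> {0..T}" for t v
 proof (rule lyapunov_psd[OF \<beta> Qc Q(2) P0(2) P(1) _ t])
  fix t assume t: "t \<in> {0..T}"
  show "P t = P0 + prim (\<lambda>s. \<beta> s ** P s + P s ** transpose (\<beta> s) + Q) t"
   unfolding P(2)[OF t]
  proof (intro arg_cong2[where f="(+)"] refl prim_cong)
   fix s assume "s \<in> {0..t}"
   then have "s \<in> {0..T}" using t by auto
   from sym[OF this] have s: "transpose (P s) = P s" .
   have h: "x = y + y" if "y = (1/2) *\<^sub>R x" for x y :: "real^'d^'d" using that by (simp flip: scaleR_add_left)
   show "F s (P s) = \<beta> s ** P s + P s ** transpose (\<beta> s) + Q"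
    unfolding F_def rad \<beta>_def using h[OF refl, of "(\<theta> s * \<theta> s) *\<^sub>R (P s ** M s ** P s)"]
    by (simp add: mm_simps s Mt)
  qed
 qed
 \<comment> \<open>The truncated quadratic term is exactly the source of the Lyapunov equation for
   \<open>\<Lambda> - P\<close>; it is positive semidefinite because \<open>P\<close> is
   symmetric.\<close>
 define G where "G s = radial R (P s) ** M s ** radial R (P s)" for s
 have GI: "L1on T G" unfolding G_def by (rule L1on_bilinear[OF bb_mm L1on_bilinear2[OF bb_mm M crad[OF P(1)]] crad[OF P(1)]])
 have Gp: "0 \<le> v \<bullet> (G s *v v)" if s: "s \<in> {0..T}" for s v
 proof -
  define A where "A = k s ** radial R (P s)"
  have "G s *v v = transpose A *v (A *v v)"
   by (simp add: A_def G_def M_def mm_simps matrix_vector_mul_assoc radT[symmetric] sym[OF s])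
  then have "v \<bullet> (G s *v v) = (A *v v) \<bullet> (A *v v)" by (simp only: inner_transpose_mv)
  then show ?thesis by simp
 qed
 have le: "v \<bullet> (P t *v v) \<le> v \<bullet> (\<Lambda> t *v v)" if t: "t \<in> {0..T}" for t v
 proof -
  have "0 \<le> v \<bullet> ((\<Lambda> t - P t) *v v)"
  proof (rule lyapunov_psd[OF b GI Gp, of 0 "\<lambda>t. \<Lambda> t - P t"])
   show "continuous_on {0..T} (\<lambda>t. \<Lambda> t - P t)" by (intro continuous_intros \<Lambda> P)
   fix t assume t: "t \<in> {0..T}"
   have "\<Lambda> t - P t = prim (\<lambda>s. (b s ** \<Lambda> s + \<Lambda> s ** transpose (b s) + Q) - F s (P s)) t"
    using prim_diff[OF linI[OF \<Lambda>(1)] FI[OF P(1)], of t] t \<Lambda>(2)[OF t] P(2)[OF t] by simp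
   also have "\<dots> = prim (\<lambda>s. b s ** (\<Lambda> s - P s) + (\<Lambda> s - P s) ** transpose (b s) + G s) t"
    by (rule prim_cong) (simp add: F_def G_def mm_simps)
   finally show "\<Lambda> t - P t = 0 + prim (\<lambda>s. b s ** (\<Lambda> s - P s) + (\<Lambda> s - P s) ** transpose (b s) + G s) t" by simp
  qed (use t in auto)
  then show ?thesis by (simp add: bb_mv.diff_left inner_diff_right)
 qed
 have bdP: "norm (P t) \<le> R" if t: "t \<in> {0..T}" for t
 proof -
  have "norm (P t) \<le> real CARD('d) * real CARD('d) * norm (\<Lambda> t)" by (rule norm_le_diag[OF sym psd le]) (use t in auto)
  also have "\<dots> \<le> R" unfolding R_def using C(2)[OF t] by (intro mult_left_mono) auto
  finally show ?thesis .
 qed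
 show ?thesis
 proof (rule that[OF P(1) sym])
  fix t assume t: "t \<in> {0..T}"
  show "P t = P0 + prim (\<lambda>s. b s ** P s + P s ** transpose (b s) + Q - P s ** (transpose (k s) ** k s) ** P s) t"
  proof -
   have "F s (P s) = b s ** P s + P s ** transpose (b s) + Q - P s ** (transpose (k s) ** k s) ** P s"
    if "s \<in> {0..t}" for s
    using radial_id[OF R bdP[of s]] that t by (simp add: F_def M_def)
   from prim_cong[OF this] show ?thesis using P(2)[OF t] by simp
  qed
 qed
qed

section \<open>Differentiation of primitives\<close>

lemma prim_FTC:
 fixes F :: "real => 'a::euclidean_space"
 assumes F: "\<And>t. t \<in> {0..T} ==> (F has_vector_derivative f t) (at t within {0..T})" and f: "continuous_on {0..T} f"
  and t: "t \<in> {0..T}"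
 shows "F t = F 0 + prim f t"
proof -
 have "(f has_integral (F t - F 0)) {0..t}"
  by (rule fundamental_theorem_of_calculus)
   (use t in \<open>auto intro!: has_vector_derivative_within_subset[OF F]\<close>)
 then have "integral {0..t} f = F t - F 0" by (rule integral_unique)
 then show ?thesis using prim_eq_integral[OF L1on_continuous[OF f], of t] t by simp
qed

lemma prim_has_vector_derivative:
 fixes f :: "real => 'a::euclidean_space"
 assumes f: "L1on T f" and t: "t \<in> {0..T}" and c: "continuous (at t within {0..T}) f"
 shows "(prim f has_vector_derivative f t) (at t within {0..T})"
proof -
 have "((\<lambda>u. integral {0..u} f) has_vector_derivative f t) (at t within ({0..T} - {}))"
  by (rule integral_has_vector_derivative_continuous_at)
   (use set_borel_integral_eq_integral(1)[OF f] t c in auto)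
 then have "((\<lambda>u. integral {0..u} f) has_vector_derivative f t) (at t within {0..T})" by simp
 then show ?thesis
  by (rule has_vector_derivative_transform[OF t, rotated]) (simp add: prim_eq_integral[OF f])
qed

text \<open>Lebesgue differentiation for averages over \<open>[x, x + h]\<close> controls right
  difference quotients. The left ones are obtained from the same statement for the reflected
  function, and the exceptional sets are united after reflecting the second.\<close>

lemma prim_has_vector_derivative_AE:
 fixes f :: "real => 'a::euclidean_space"
 assumes f: "L1on T f"
 shows "AE t in lborel. t \<in> {0..T} \<longrightarrow> (prim f has_vector_derivative f t) (at t within {0..T})"
proof -
 define F where "F s = indicator {0..T} s *\<^sub>R f s" for s
 have FI: "integrable lborel F" using f unfolding F_def[abs_def] by (simp add: set_integrable_def)
 have Fs: "set_integrable lborel S F" if "S \<in> sets lborel" for S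
  unfolding set_integrable_def by (rule integrable_mult_indicator[OF that FI])
 have Fon: "F integrable_on S" if "S \<in> sets lborel" for S
  by (rule set_borel_integral_eq_integral(1)[OF Fs[OF that]])
 have Ron: "(\<lambda>s. F (- s)) integrable_on cbox a b" for a b
  using Fon[of "{-b..-a}"] Henstock_Kurzweil_Integration.integrable_reflect_real[where f=F and a="-b" and b="-a"] by (simp add: cbox_interval)
 have cb: "cbox a b \<in> sets lborel" for a b :: real by simp
 obtain N1 where N1: "negligible N1" "\<And>x e. \<lbrakk>x \<notin> N1; 0 < e\<rbrakk> \<Longrightarrow>
   \<exists>d>0. \<forall>h. 0 < h \<and> h < d \<longrightarrow> norm (integral (cbox x (x + h *\<^sub>R One)) F /\<^sub>R h ^ DIM(real) - F x) < e"
  by (rule integrable_ccontinuous_explicit[of F, OF Fon[OF cb]]) (rule that)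
 obtain N2 where N2: "negligible N2" "\<And>x e. \<lbrakk>x \<notin> N2; 0 < e\<rbrakk> \<Longrightarrow>
   \<exists>d>0. \<forall>h. 0 < h \<and> h < d \<longrightarrow> norm (integral (cbox x (x + h *\<^sub>R One)) (\<lambda>s. F (- s)) /\<^sub>R h ^ DIM(real) - F (- x)) < e"
  by (rule integrable_ccontinuous_explicit[of "\<lambda>s. F (- s)", OF Ron]) (rule that)
 \<comment> \<open>The exceptional set of the reflected function is carried back by a differentiable
   map, which preserves negligibility.\<close>
 have "negligible (uminus ` N2)" 
  by (rule negligible_differentiable_image_negligible[OF _ N2(1)]) (auto intro!: differentiable_on_minus differentiable_on_ident)
 then have "N1 \<union> uminus ` N2 \<in> null_sets lebesgue" using N1(1) by (intro null_sets.Un) (simp_all add: negligible_iff_null_sets)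
 then have "AE t in lebesgue. t \<notin> N1 \<union> uminus ` N2" by (rule AE_not_in)
 then have "AE t in lborel. t \<notin> N1 \<union> uminus ` N2" by (simp add: AE_completion_iff)
 then show ?thesis
 proof eventually_elim
  case (elim t)
  show ?case
  proof
   assume t: "t \<in> {0..T}"
   have t1: "t \<notin> N1" and t2: "- t \<notin> N2" using elim by force+
   have ftF: "f t = F t" using t by (simp add: F_def)
   have diff: "prim f y - prim f x = integral {x..y} F" if "0 \<le> x" "x \<le> y" "y \<le> T" for x y
   proof -
    have "integral {0..x} F + integral {x..y} F = integral {0..y} F"
     by (rule Henstock_Kurzweil_Integration.integral_combine) (use that Fon in auto)
    moreover have "prim f u = integral {0..u} F" if "u \<le> T" for u
    proof -
     have "prim f u = prim F u" by (rule prim_cong) (use that in \<open>auto simp: F_def\<close>)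
     then show ?thesis using set_borel_integral_eq_integral(2)[OF Fs[of "{0..u}"]] by simp
    qed
    ultimately show ?thesis using that by (simp add: algebra_simps)
   qed
   show "(prim f has_vector_derivative f t) (at t within {0..T})"
    unfolding has_vector_derivative_def has_derivative_within_alt
   proof (intro conjI allI impI)
    show "bounded_linear (\<lambda>x. x *\<^sub>R f t)" by (rule bounded_linear_scaleR_left)
    fix e :: real assume e: "0 < e"
    obtain d1 where d1: "d1 > 0" "\<And>h. 0 < h ==> h < d1 ==> norm (integral {t..t + h} F /\<^sub>R h - F t) < e"
     using N1(2)[OF t1 e] by (auto simp: cbox_interval)
    obtain d2 where d2: "d2 > 0" "\<And>h. 0 < h ==> h < d2 ==> norm (integral {- t..- t + h} (\<lambda>s. F (- s)) /\<^sub>R h - F t) < e"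
     using N2(2)[OF t2 e] by (auto simp: cbox_interval)
    show "\<exists>d>0. \<forall>y\<in>{0..T}. norm (y - t) < d \<longrightarrow> norm (prim f y - prim f t - (y - t) *\<^sub>R f t) \<le> e * norm (y - t)"
    proof (intro exI[of _ "min d1 d2"] conjI ballI impI)
     show "0 < min d1 d2" using d1 d2 by simp
     fix y assume y: "y \<in> {0..T}" and yd: "norm (y - t) < min d1 d2"
     have key: "norm (D - h *\<^sub>R F t) \<le> e * h" if "norm (D /\<^sub>R h - F t) < e" "0 < h" for D h
     proof -
      have "D - h *\<^sub>R F t = h *\<^sub>R (D /\<^sub>R h - F t)" using that(2) by (simp add: algebra_simps)
      then have "norm (D - h *\<^sub>R F t) = h * norm (D /\<^sub>R h - F t)" using that(2) by simp
      then show ?thesis using that by (simp add: mult.commute)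
     qed
     consider "y = t" | "t < y" | "y < t" by linarith
     then show "norm (prim f y - prim f t - (y - t) *\<^sub>R f t) \<le> e * norm (y - t)"
     proof cases
      case 2
      have "norm (integral {t..t + (y - t)} F - (y - t) *\<^sub>R F t) \<le> e * (y - t)"
       by (rule key[OF d1(2)]) (use 2 yd in auto)
      then show ?thesis using diff[of t y] 2 t y by (simp add: ftF)
     next
      case 3
      have "integral {- t..- t + (t - y)} (\<lambda>s. F (- s)) = integral {y..t} F"
       using Henstock_Kurzweil_Integration.integral_reflect_real[of t y F] by simp
      moreover have "norm (integral {- t..- t + (t - y)} (\<lambda>s. F (- s)) - (t - y) *\<^sub>R F t) \<le> e * (t - y)"
       by (rule key[OF d2(2)]) (use 3 yd in auto)
      ultimately have "norm (integral {y..t} F - (t - y) *\<^sub>R F t) \<le> e * (t - y)" by simp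
      moreover have "prim f y - prim f t - (y - t) *\<^sub>R f t = - (integral {y..t} F - (t - y) *\<^sub>R F t)"
       using diff[of y t] 3 t y by (simp add: ftF algebra_simps)
      ultimately show ?thesis using 3 by (simp only: norm_minus_cancel) simp
     qed simp
    qed
   qed
  qed
 qed
qed

section \<open>Step functions on equidistant grids and their density in the square integrable
  functions\<close>

definition stepf :: "real => nat => (nat => 'a::real_vector) => real => 'a" where
 "stepf T K c s = (\<Sum>i<K. indicator {T * real i / real K<..T * real (Suc i) / real K} s *\<^sub>R c i)"

lemma stepf_meas: "stepf T K (c :: nat => 'a::euclidean_space) \<in> borel_measurable borel"
 unfolding stepf_def by (intro borel_measurable_sum borel_measurable_scaleR) auto

text \<open>The cells are open on the left, as in \<open>simple_process\<close>, so the index of the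
  cell of \<open>s\<close> is the ceiling of \<open>s K / T\<close> minus 1. No cell contains time
  0, where a step function has value 0.\<close>

lemma stepf_cell:
 assumes K: "K > 0" and T: "T > 0" and s: "s \<in> {0<..T}"
 obtains i where "i < K" "s \<in> {T * real i / real K<..T * real (Suc i) / real K}" "stepf T K c s = c i"
proof -
 define i where "i = nat (\<lceil>s * real K / T\<rceil> - 1)"
 have p: "0 < s * real K / T" using s K T by simp
 have c1: "\<lceil>s * real K / T\<rceil> \<ge> 1" using p by linarith
 have ri: "real i = of_int \<lceil>s * real K / T\<rceil> - 1" unfolding i_def using c1 by (simp add: of_nat_nat)
 have lo: "real i < s * real K / T" unfolding ri by linarith
 have hi: "s * real K / T \<le> real (Suc i)" using ri by simp
 have "s * real K / T \<le> real K" using s T K by (simp add: field_simps)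
 then have iK: "i < K" using lo by linarith
 have m: "s \<in> {T * real i / real K<..T * real (Suc i) / real K}"
  using lo hi K T by (auto simp: field_simps simp del: of_nat_Suc)
 have u: "j = i" if "s \<in> {T * real j / real K<..T * real (Suc j) / real K}" for j
 proof -
  have "real j < s * real K / T" "s * real K / T \<le> real (Suc j)" using that K T by (auto simp: field_simps simp del: of_nat_Suc)
  then have "real j < real (Suc i)" "real i < real (Suc j)" using lo hi by linarith+
  then show ?thesis by linarith
 qed
 have "stepf T K c s = (\<Sum>j<K. if j = i then c i else 0)"
  unfolding stepf_def
 proof (rule sum.cong[OF refl])
  fix j
  show "indicator {T * real j / real K<..T * real (Suc j) / real K} s *\<^sub>R c j = (if j = i then c i else 0)"
  proof (cases "j = i")
   case True
   with m show ?thesis by (simp add: indicator_def del: of_nat_Suc)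
  next
   case False
   with u[of j] have "s \<notin> {T * real j / real K<..T * real (Suc j) / real K}" by blast
   with False show ?thesis by (simp add: indicator_def)
  qed
 qed
 also have "\<dots> = c i" using iK by simp
 finally show ?thesis by (rule that[OF iK m])
qed

lemma stepf_bounded:
 obtains C where "\<And>s. norm (stepf T K (c :: nat => 'a::euclidean_space) s) \<le> C"
proof
 fix s
 have "norm (stepf T K c s) \<le> (\<Sum>i<K. norm (indicator {T * real i / real K<..T * real (Suc i) / real K} s *\<^sub>R c i))"
  unfolding stepf_def by (rule norm_sum)
 also have "\<dots> \<le> (\<Sum>i<K. norm (c i))" by (intro sum_mono) (auto simp: indicator_def)
 finally show "norm (stepf T K c s) \<le> (\<Sum>i<K. norm (c i))" .
qed

lemma L2on_bounded:
 fixes f :: "real => 'a::euclidean_space"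
 assumes m: "set_borel_measurable lborel {0..T} f" and b: "\<And>s. s \<in> {0..T} ==> norm (f s) \<le> C"
 shows "L2on T f"
 unfolding L2on_def
proof (intro conjI m)
 have "(\<lambda>s. (norm (indicator {0..T} s *\<^sub>R f s))\<^sup>2) \<in> borel_measurable lborel"
  using m unfolding set_borel_measurable_def by measurable
 also have "(\<lambda>s. (norm (indicator {0..T} s *\<^sub>R f s))\<^sup>2) = (\<lambda>s. indicator {0..T} s *\<^sub>R (norm (f s))\<^sup>2)"
  by (auto simp: indicator_def)
 finally have m2: "set_borel_measurable lborel {0..T} (\<lambda>s. (norm (f s))\<^sup>2)" by (simp add: set_borel_measurable_def)
 show "L1on T (\<lambda>s. (norm (f s))\<^sup>2)"
 proof (rule L1on_bound[where g="\<lambda>s. C\<^sup>2", OF L1on_continuous m2])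
  show "norm ((norm (f s))\<^sup>2) \<le> C\<^sup>2" if "s \<in> {0..T}" for s
   using power_mono[OF b[OF that], of 2] by simp
 qed simp
qed

lemma L2on_stepf: "L2on T (stepf T K (c :: nat => 'a::euclidean_space))"
proof -
 obtain C where C: "\<And>s. norm (stepf T K c s) \<le> C" using stepf_bounded[of T K c] by blast
 show ?thesis
  by (rule L2on_bounded[where C=C]) (use C in \<open>auto simp: set_borel_measurable_def intro!: borel_measurable_scaleR stepf_meas\<close>)
qed

lemma L2on_uminus: "L2on T f ==> L2on T (\<lambda>s. - f s)"
 using L2on_linear[of uminus] by (simp add: bounded_linear_minus[OF bounded_linear_ident])

lemma L2on_diff: "L2on T f ==> L2on T g ==> L2on T (\<lambda>s. f s - g s)"
 using L2on_add[OF _ L2on_uminus, of T f g] by simp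

abbreviation (input) sqdist :: "real => (real => 'a::euclidean_space) => (real => 'a) => real" where
 "sqdist T f g \<equiv> prim (\<lambda>s. (norm (f s - g s))\<^sup>2) T"

lemma norm_sq_add_le: "(norm (x + y))\<^sup>2 \<le> 2 * (norm x)\<^sup>2 + 2 * (norm (y :: 'a::real_normed_vector))\<^sup>2"
proof -
 have "(norm (x + y))\<^sup>2 \<le> (norm x + norm y)\<^sup>2" by (intro power_mono norm_triangle_ineq) simp
 also have "\<dots> \<le> 2 * (norm x)\<^sup>2 + 2 * (norm y)\<^sup>2" using sum_squares_bound[of "norm x" "norm y"] by (simp add: power2_sum)
 finally show ?thesis .
qed

text \<open>\<open>sqdist\<close> is a squared distance; the factors 2 come from
  \<open>(x + y)\<^sup>2 \<le> 2 x\<^sup>2 + 2 y\<^sup>2\<close>.\<close>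

lemma sqdist_triangle:
 assumes f: "L2on T f" and g: "L2on T g" and h: "L2on T h"
 shows "sqdist T f h \<le> 2 * sqdist T f g + 2 * sqdist T g h"
proof -
 have i: "L1on T (\<lambda>s. (norm (f s - h s))\<^sup>2)" "L1on T (\<lambda>s. (norm (f s - g s))\<^sup>2)" "L1on T (\<lambda>s. (norm (g s - h s))\<^sup>2)"
  using L2on_diff[OF f h] L2on_diff[OF f g] L2on_diff[OF g h] by (auto simp: L2on_def)
 have "sqdist T f h \<le> prim (\<lambda>s. 2 * (norm (f s - g s))\<^sup>2 + 2 * (norm (g s - h s))\<^sup>2) T"
 proof (rule prim_mono[OF i(1)])
  show "L1on T (\<lambda>s. 2 * (norm (f s - g s))\<^sup>2 + 2 * (norm (g s - h s))\<^sup>2)" using i by (intro set_integral_add(1)) auto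
  show "(norm (f s - h s))\<^sup>2 \<le> 2 * (norm (f s - g s))\<^sup>2 + 2 * (norm (g s - h s))\<^sup>2" for s
   using norm_sq_add_le[of "f s - g s" "g s - h s"] by simp
 qed simp
 also have "\<dots> = 2 * sqdist T f g + 2 * sqdist T g h" using i by (subst set_integral_add(2)) auto
 finally show ?thesis .
qed

lemma sqdist_dominated:
 fixes f :: "real => 'a::euclidean_space"
 assumes f: "L2on T f" and g: "\<And>n. L2on T (g n)" and lim: "AE s in lborel. s \<in> {0..T} \<longrightarrow> (\<lambda>n. g n s) \<longlonglongrightarrow> f s"
  and w: "L1on T w" and bd: "\<And>n s. s \<in> {0..T} ==> (norm (g n s - f s))\<^sup>2 \<le> w s"
 shows "(\<lambda>n. sqdist T (g n) f) \<longlonglongrightarrow> 0"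
proof -
 have i: "L1on T (\<lambda>s. (norm (g n s - f s))\<^sup>2)" for n using L2on_diff[OF g f] by (auto simp: L2on_def)
 have "(\<lambda>n. integral\<^sup>L lborel (\<lambda>s. indicator {0..T} s *\<^sub>R (norm (g n s - f s))\<^sup>2)) \<longlonglongrightarrow> integral\<^sup>L lborel (\<lambda>s::real. 0 :: real)"
 proof (rule integral_dominated_convergence[where w="\<lambda>s. indicator {0..T} s *\<^sub>R w s"])
  show "integrable lborel (\<lambda>s. indicator {0..T} s *\<^sub>R w s)" using w by (simp add: set_integrable_def)
  show "AE s in lborel. (\<lambda>n. indicator {0..T} s *\<^sub>R (norm (g n s - f s))\<^sup>2) \<longlonglongrightarrow> 0"
   using lim
  proof eventually_elim
   case (elim s)
   show ?case
   proof (cases "s \<in> {0..T}")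
    case True
    then have "(\<lambda>n. norm (g n s - f s)) \<longlonglongrightarrow> 0" using elim by (simp add: tendsto_norm_zero_iff LIM_zero_iff)
    then have "(\<lambda>n. (norm (g n s - f s))\<^sup>2) \<longlonglongrightarrow> 0\<^sup>2" by (rule tendsto_power)
    then show ?thesis using True by simp
   qed simp
  qed
  show "AE s in lborel. norm (indicator {0..T} s *\<^sub>R (norm (g n s - f s))\<^sup>2) \<le> indicator {0..T} s *\<^sub>R w s" for n
   using bd by (intro AE_I2) (auto simp: indicator_def)
 qed (use i in \<open>auto simp: set_integrable_def\<close>)
 then show ?thesis by (simp add: set_lebesgue_integral_def)
qed

lemma radial_tendsto: "(\<lambda>n. radial (real (Suc n)) x) \<longlonglongrightarrow> x"
proof -
 obtain n0 where n0: "norm x \<le> real n0" using real_arch_simple by blast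
 have "radial (real (Suc n)) x = x" if "n \<ge> n0" for n using n0 that by (intro radial_id) auto
 then show ?thesis by (intro tendsto_eventually eventually_sequentiallyI)
qed

lemma radial_continuous: "R > 0 ==> continuous_on UNIV (radial R :: 'a::euclidean_space => 'a)"
 unfolding radial_def by (intro continuous_intros) (auto simp: max_def)

lemma radial_norm_le: "R > 0 ==> norm (radial R x - x) \<le> norm x"
proof -
 assume R: "R > 0"
 have t: "0 \<le> R / max R (norm x)" "R / max R (norm x) \<le> 1" using R by (auto simp: divide_le_eq_1 max_def)
 have "radial R x - x = - ((1 - R / max R (norm x)) *\<^sub>R x)" by (simp add: radial_def algebra_simps)
 then have "norm (radial R x - x) = \<bar>1 - R / max R (norm x)\<bar> * norm x" by simp
 also have "\<dots> \<le> 1 * norm x" using t by (intro mult_right_mono) auto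
 finally show ?thesis by simp
qed

text \<open>Truncation makes \<open>f\<close> bounded. A bounded measurable function is an almost
  everywhere limit of continuous ones, and truncating these at the same radius supplies the
  domination that turns this into mean square convergence; a continuous function is sampled on a
  fine grid. The fractions of \<open>e\<close> allow for two uses of the triangle inequality with
  factor 2.\<close>

lemma L2_step_dense:
 fixes f :: "real => 'a::euclidean_space"
 assumes T: "T > 0" and f: "L2on T f" and e: "e > 0"
 obtains K c where "K > 0" "sqdist T (stepf T K c) f < e"
proof -
 have rm: "set_borel_measurable lborel {0..T} (\<lambda>s. radial R (f s))" if "R > 0" for R
 proof -
  have "(\<lambda>s. radial R (indicator {0..T} s *\<^sub>R f s)) \<in> borel_measurable lborel"
   by (rule measurable_compose[OF _ borel_measurable_continuous_onI[OF radial_continuous[OF that]]])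
    (use f in \<open>simp add: L2on_def set_borel_measurable_def\<close>)
  also have "(\<lambda>s. radial R (indicator {0..T} s *\<^sub>R f s)) = (\<lambda>s. indicator {0..T} s *\<^sub>R radial R (f s))"
   by (auto simp: indicator_def radial_def)
  finally show ?thesis by (simp add: set_borel_measurable_def)
 qed
 have rL: "L2on T (\<lambda>s. radial R (f s))" if "R > 0" for R
  by (rule L2on_bounded[OF rm[OF that] radial_norm[OF that]])
 have "(\<lambda>n. sqdist T (\<lambda>s. radial (real (Suc n)) (f s)) f) \<longlonglongrightarrow> 0"
 proof (rule sqdist_dominated[OF f rL, where w="\<lambda>s. (norm (f s))\<^sup>2"])
  show "(norm (radial (real (Suc n)) (f s) - f s))\<^sup>2 \<le> (norm (f s))\<^sup>2" for n s
   by (intro power_mono radial_norm_le) auto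
 qed (use f in \<open>auto simp: L2on_def intro!: AE_I2 radial_tendsto simp del: of_nat_Suc\<close>)
 then have "\<forall>\<^sub>F n in sequentially. sqdist T (\<lambda>s. radial (real (Suc n)) (f s)) f < e / 8"
  by (rule order_tendstoD) (use e in simp)
 then obtain n where n: "sqdist T (\<lambda>s. radial (real (Suc n)) (f s)) f < e / 8" by (auto simp: eventually_sequentially)
 define R where "R = real (Suc n)"
 have R: "R > 0" by (simp add: R_def)
 define fR where "fR s = radial R (f s)" for s
 have fR: "L2on T fR" "sqdist T fR f < e / 8" using rL[OF R] n by (simp_all add: fR_def[abs_def] R_def)
 define F where "F s = indicator {0..T} s *\<^sub>R fR s" for s
 have "F \<in> borel_measurable lebesgue"
  using fR(1) unfolding F_def[abs_def] L2on_def set_borel_measurable_def by (auto intro: measurable_completion)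
 then have "F measurable_on UNIV" by (rule lebesgue_measurable_imp_measurable_on) simp
 then obtain N and gg :: "nat => real => 'a" where N: "negligible N" and gc: "\<And>n. continuous_on UNIV (gg n)"
  and gl: "\<And>x. x \<notin> N ==> (\<lambda>n. gg n x) \<longlonglongrightarrow> F x"
  unfolding measurable_on_def by auto
 define g where "g n s = radial R (gg n s)" for n s
 have gcont: "continuous_on UNIV (g n)" for n unfolding g_def
  by (rule continuous_on_compose2[OF radial_continuous[OF R] gc]) simp
 have gL: "L2on T (g n)" for n by (rule L2on_continuous) (rule continuous_on_subset[OF gcont], simp)
 have Fle: "norm (fR s) \<le> R" for s by (simp add: fR_def radial_norm[OF R])
 have gle: "norm (g n s) \<le> R" for n s by (simp add: g_def radial_norm[OF R])
 have "N \<in> null_sets lebesgue" using N by (simp add: negligible_iff_null_sets)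
 then have "AE s in lebesgue. s \<notin> N" by (rule AE_not_in)
 then have AEN: "AE s in lborel. s \<notin> N" by (simp add: AE_completion_iff)
 have "(\<lambda>n. sqdist T (g n) fR) \<longlonglongrightarrow> 0"
 proof (rule sqdist_dominated[OF fR(1) gL, where w="\<lambda>s. (2 * R)\<^sup>2"])
  show "AE s in lborel. s \<in> {0..T} \<longrightarrow> (\<lambda>n. g n s) \<longlonglongrightarrow> fR s"
   using AEN
  proof eventually_elim
   case (elim s)
   show ?case
   proof
    assume s: "s \<in> {0..T}"
    have "(\<lambda>n. radial R (gg n s)) \<longlonglongrightarrow> radial R (F s)"
     by (rule isCont_tendsto_compose[OF _ gl[OF elim]]) (use radial_continuous[OF R] in \<open>auto simp: continuous_on_eq_continuous_at\<close>)
    also have "radial R (F s) = fR s" using s Fle by (simp add: F_def radial_id[OF R])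
    finally show "(\<lambda>n. g n s) \<longlonglongrightarrow> fR s" by (simp add: g_def)
   qed
  qed
  show "(norm (g n s - fR s))\<^sup>2 \<le> (2 * R)\<^sup>2" for n s
   using norm_triangle_ineq4[of "g n s" "fR s"] gle[of n s] Fle[of s] by (intro power_mono) auto
 qed (rule L1on_continuous, simp)
 then have "\<forall>\<^sub>F n in sequentially. sqdist T (g n) fR < e / 16"
  by (rule order_tendstoD) (use e in simp)
 then obtain m where m: "sqdist T (g m) fR < e / 16" by (auto simp: eventually_sequentially)
 have "uniformly_continuous_on {0..T} (g m)"
  by (rule compact_uniformly_continuous[OF continuous_on_subset[OF gcont]]) auto
 \<comment> \<open>Chosen so that a uniform error \<open>e1\<close> on \<open>[0,T]\<close> costs
   \<open>T * e1\<^sup>2 = e / 16\<close> in squared distance.\<close>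
 moreover define e1 where "e1 = sqrt (e / (16 * T))"
 have e1: "e1 > 0" using e T by (simp add: e1_def)
 ultimately obtain d where d: "d > 0" "\<And>x y. x \<in> {0..T} ==> y \<in> {0..T} ==> dist y x < d ==> dist (g m y) (g m x) < e1"
  unfolding uniformly_continuous_on_def by meson
 obtain K :: nat where K0: "T / d < real K" using reals_Archimedean2 by blast
 have "0 < T / d" using T d(1) by simp
 then have "0 < real K" using K0 by linarith
 then have K: "K > 0" "T / real K < d" using K0 d(1) by (simp_all add: field_simps)
 define c where "c i = g m (T * real (Suc i) / real K)" for i
 have near: "norm (stepf T K c s - g m s) \<le> e1" if s: "s \<in> {0<..T}" for s
 proof -
  obtain i where i: "i < K" "s \<in> {T * real i / real K<..T * real (Suc i) / real K}" "stepf T K c s = c i"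
   by (rule stepf_cell[OF K(1) T s])
  have "T * real (Suc i) / real K \<le> T"
  proof -
   have "T * real (Suc i) \<le> T * real K" using i(1) T by (intro mult_left_mono) auto
   then show ?thesis using K(1) by (simp add: divide_le_eq)
  qed
  moreover have "T * real (Suc i) / real K - s < d"
  proof -
   have "T * real (Suc i) / real K - T * real i / real K = T / real K" by (simp add: distrib_left add_divide_distrib)
   then show ?thesis using i(2) K(2) by (simp only: greaterThanAtMost_iff) linarith
  qed
  ultimately have "dist (g m (T * real (Suc i) / real K)) (g m s) < e1"
   using i(2) s T by (intro d(2)) (auto simp: dist_real_def simp del: of_nat_Suc)
  then show ?thesis by (simp add: i(3) c_def dist_norm del: of_nat_Suc)
 qed
 have "sqdist T (stepf T K c) (g m) \<le> prim (\<lambda>s. e1\<^sup>2) T"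
 proof (rule set_integral_mono_AE)
  show "L1on T (\<lambda>s. (norm (stepf T K c s - g m s))\<^sup>2)" using L2on_diff[OF L2on_stepf gL] by (auto simp: L2on_def)
  show "L1on T (\<lambda>s. e1\<^sup>2)" by (rule L1on_continuous) simp
  show "AE s\<in>{0..T} in lborel. (norm (stepf T K c s - g m s))\<^sup>2 \<le> e1\<^sup>2"
   using AE_lborel_singleton[of 0] by eventually_elim (auto intro!: power_mono near)
 qed
 also have "\<dots> = T * e1\<^sup>2" using T by (simp add: set_integral_const)
 also have "\<dots> = e / 16" using e T by (simp add: e1_def)
 finally have s3: "sqdist T (stepf T K c) (g m) \<le> e / 16" .
 have "sqdist T (stepf T K c) fR \<le> 2 * sqdist T (stepf T K c) (g m) + 2 * sqdist T (g m) fR"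
  by (rule sqdist_triangle[OF L2on_stepf gL fR(1)])
 then have "sqdist T (stepf T K c) fR < e / 4" using s3 m e by simp
 moreover have "sqdist T (stepf T K c) f \<le> 2 * sqdist T (stepf T K c) fR + 2 * sqdist T fR f"
  by (rule sqdist_triangle[OF L2on_stepf fR(1) f])
 ultimately have "sqdist T (stepf T K c) f < e" using fR(2) e by simp
 then show ?thesis by (rule that[OF K(1)])
qed

section \<open>Positive semidefinite matrices and the regularity of the gain\<close>

lemma psd_cauchy_schwarz:
 fixes S :: "real^'d^'d"
 assumes sym: "transpose S = S" and psd: "\<And>v. 0 \<le> v \<bullet> (S *v v)"
 shows "(x \<bullet> (S *v v))\<^sup>2 \<le> (x \<bullet> (S *v x)) * (v \<bullet> (S *v v))"
proof -
 define a b c where "a = v \<bullet> (S *v v)" and "b = x \<bullet> (S *v v)" and "c = x \<bullet> (S *v x)"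
 have b': "v \<bullet> (S *v x) = b"
  using inner_transpose_mv[of v S x] unfolding sym by (simp add: b_def inner_commute)
 have q: "0 \<le> c + 2 * t * b + t\<^sup>2 * a" for t
  using psd[of "x + t *\<^sub>R v"] b'
  by (simp add: a_def b_def c_def bb_mv.add_right bb_mv.scaleR_right inner_add inner_commute power2_eq_square algebra_simps)
 show ?thesis
 proof (cases "a = 0")
  case True
  have "b = 0"
  proof (rule ccontr)
   assume "b \<noteq> 0"
   \<comment> \<open>Without leading coefficient the polynomial is affine in \<open>t\<close>, and
     at this argument it has the value -1.\<close>
   then show False using q[of "- (c + 1) / (2 * b)"] True by (simp add: field_simps)
  qed
  then show ?thesis using True by (simp add: a_def b_def)
 next
  case False
  then have a: "a > 0" using psd[of v] by (simp add: a_def)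
  have "c + 2 * (- b / a) * b + (- b / a)\<^sup>2 * a = c - b\<^sup>2 / a" using a by (simp add: field_simps power2_eq_square)
  with q[of "- b / a"] have "b\<^sup>2 / a \<le> c" by simp
  then have "b\<^sup>2 \<le> c * a" using a by (simp add: pos_divide_le_eq)
  then show ?thesis by (simp add: a_def b_def c_def)
 qed
qed

text \<open>The orthogonal projection onto the kernel of \<open>S\<close>, assembled from an
  orthonormal basis of the kernel; its quadratic form is the sum of the squared coordinates, which
  yields the positivity statements.\<close>

lemma kernel_projection:
 fixes S :: "real^'d^'d"
 obtains E :: "real^'d^'d" where "transpose E = E" "E ** E = E" "S ** E = 0" "\<And>v. 0 \<le> v \<bullet> (E *v v)"
  "\<And>v. v \<bullet> (E *v v) = 0 ==> E *v v = 0" "\<And>v. S *v v = 0 ==> E *v v = v"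
proof -
 let ?K = "{v. S *v v = 0}"
 have sub: "subspace ?K"
  by (auto simp: subspace_def bb_mv.add_right bb_mv.scaleR_right bb_mv.zero_right)
 obtain B where B: "B \<subseteq> ?K" "pairwise orthogonal B" "\<And>x. x \<in> B ==> norm x = 1" "independent B" "span B = ?K"
  using orthonormal_basis_subspace[OF sub] by metis
 have fB: "finite B" using B(4) by (rule independent_imp_finite)
 define E where "E = (\<chi> i j. \<Sum>b\<in>B. b $ i * b $ j)"
 have Ev: "E *v v = (\<Sum>b\<in>B. (b \<bullet> v) *\<^sub>R b)" for v
  by (simp add: E_def matrix_vector_mult_def vec_eq_iff inner_vec_def sum_distrib_left sum_distrib_right mult_ac sum.swap[of _ UNIV B])
 have EK: "S *v (E *v v) = 0" for v
 proof -
  have "E *v v \<in> ?K" unfolding Ev using B(1) by (intro subspace_sum[OF sub] subspace_scale[OF sub]) auto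
  then show ?thesis by simp
 qed
 have bb: "b \<bullet> b' = (if b = b' then 1 else 0)" if "b \<in> B" "b' \<in> B" for b b'
  using B(2,3) that by (auto simp: pairwise_def orthogonal_def dot_square_norm)
 have Eid: "E *v v = v" if v: "S *v v = 0" for v
 proof -
  let ?w = "v - E *v v"
  have "?w \<in> span B" unfolding B(5) using v EK[of v] by (simp add: bb_mv.diff_right)
  moreover have "orthogonal b ?w" if "b \<in> B" for b
  proof -
   have "b \<bullet> (E *v v) = (\<Sum>b'\<in>B. if b = b' then b' \<bullet> v else 0)"
    unfolding Ev inner_sum_right by (intro sum.cong) (auto simp: bb that)
   also have "\<dots> = b \<bullet> v" using that fB by simp
   finally show ?thesis by (simp add: orthogonal_def inner_diff_right)
  qed
  ultimately have "orthogonal ?w ?w" using orthogonal_to_span orthogonal_commute by metis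
  then show ?thesis by (simp add: orthogonal_self)
 qed
 have q: "v \<bullet> (E *v v) = (\<Sum>b\<in>B. (b \<bullet> v)\<^sup>2)" for v
  unfolding Ev inner_sum_right by (simp add: power2_eq_square inner_commute)
 show ?thesis
 proof (rule that[of E])
  show "transpose E = E" by (simp add: E_def transpose_def mult.commute)
  show "E ** E = E" by (simp add: matrix_eq Eid[OF EK] flip: matrix_vector_mul_assoc)
  show "S ** E = 0" by (simp add: matrix_eq EK flip: matrix_vector_mul_assoc)
  show "0 \<le> v \<bullet> (E *v v)" for v unfolding q by (intro sum_nonneg) simp
  show "E *v v = 0" if "v \<bullet> (E *v v) = 0" for v
  proof -
   have "(\<Sum>b\<in>B. (b \<bullet> v)\<^sup>2) = 0" using that q[of v] by simp
   then show ?thesis using fB unfolding Ev by (simp add: sum_nonneg_eq_0_iff)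
  qed
 qed (rule Eid)
qed

lemma prim_exp:
 assumes "t \<in> {0..T}" shows "exp (C * t) = 1 + prim (\<lambda>s. C * exp (C * s)) t"
proof -
 have "((\<lambda>t. exp (C * t)) has_vector_derivative C * exp (C * t)) (at t within {0..T})" for t
  unfolding has_real_derivative_iff_has_vector_derivative[symmetric]
  by (auto intro!: derivative_eq_intros)
 moreover have "continuous_on {0..T} (\<lambda>s. C * exp (C * s))" by (intro continuous_intros)
 ultimately show ?thesis using prim_FTC[of T "\<lambda>t. exp (C * t)" "\<lambda>s. C * exp (C * s)" t] assms by simp
qed

text \<open>Boundedness of \<open>r\<close> and Gronwall's inequality keep the kernel of \<open>S t\<close> constant in time, so \<open>S t + E\<close>
 is invertible and \<open>g' (1 - E) = \<rho>' (S + E)\<^sup>-\<^sup>1\<close>.\<close>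

lemma gain_regular:
 fixes \<rho>' g' :: "real => real^'m^'n" and r :: "real => real^'n^'n" and \<Sigma>0 :: "real^'m^'m"
 assumes T: "0 \<le> T" and sym: "transpose \<Sigma>0 = \<Sigma>0" and \<rho>'c: "continuous_on {0..T} \<rho>'" and rc: "continuous_on {0..T} r"
  and S: "\<And>t. S t = \<Sigma>0 - prim (\<lambda>u. transpose (\<rho>' u) ** \<rho>' u) t"
  and psd: "\<And>t v. t \<in> {0..T} ==> 0 \<le> v \<bullet> (S t *v v)"
  and g': "\<And>t. t \<in> {0..T} ==> g' t ** S t = \<rho>' t"
  and r: "\<And>t. t \<in> {0..T} ==> r t = - (g' t ** transpose (\<rho>' t))"
 obtains E :: "real^'m^'m" where "transpose E = E" "\<Sigma>0 ** E = 0" "\<And>t. t \<in> {0..T} ==> \<rho>' t ** E = 0"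
  "continuous_on {0..T} (\<lambda>t. g' t ** (mat 1 - E))"
  "\<And>t. t \<in> {0..T} ==> (g' t ** (mat 1 - E)) ** S t = \<rho>' t"
proof -
 obtain E :: "real^'m^'m" where E: "transpose E = E" "E ** E = E" "\<Sigma>0 ** E = 0" "\<And>v. 0 \<le> v \<bullet> (E *v v)"
  "\<And>v. v \<bullet> (E *v v) = 0 ==> E *v v = 0" "\<And>v. \<Sigma>0 *v v = 0 ==> E *v v = v"
  using kernel_projection[of \<Sigma>0] by metis
 have \<rho>\<rho>: "continuous_on {0..T} (\<lambda>u. transpose (\<rho>' u) ** \<rho>' u)" by (intro continuous_intros \<rho>'c)
 note \<rho>\<rho>L = L1on_continuous[OF \<rho>\<rho>]
 have Ssym: "transpose (S t) = S t" if "t \<in> {0..T}" for t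
  unfolding S transpose_diff sym using prim_transpose[OF \<rho>\<rho>L, of t] that by (simp add: mm_simps)
 obtain Kr where Kr: "Kr > 0" "\<And>s. s \<in> {0..T} ==> norm (r s) \<le> Kr" by (rule continuous_bounded_Icc[OF rc]) auto
 obtain K where K: "\<And>(x :: real^'n^'n) (y :: real^'n). norm (x *v y) \<le> norm x * norm y * K" "K > 0"
  using bb_mv.pos_bounded by auto
 define C where "C = Kr * K"
 have C: "C > 0" using Kr K by (simp add: C_def)
 have \<phi>: "v \<bullet> (S t *v v) = v \<bullet> (\<Sigma>0 *v v) + prim (\<lambda>u. - (norm (\<rho>' u *v v))\<^sup>2) t" if t: "t \<in> {0..T}" for t v
 proof -
  have bl: "bounded_linear (\<lambda>A :: real^'m^'m. - (v \<bullet> (A *v v)))"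
   by (intro bounded_linear_minus bounded_linear_compose[OF bounded_linear_inner_right bb_mv.bounded_linear_left])
  have "- (v \<bullet> ((transpose A ** A) *v v)) = - (norm (A *v v))\<^sup>2" for A :: "real^'m^'n"
   by (simp only: matrix_vector_mul_assoc[symmetric] inner_transpose_mv power2_norm_eq_inner)
  then show ?thesis
   using prim_bounded_linear(1)[OF bl \<rho>\<rho>L, of t] t by (simp add: S bb_mv.diff_left inner_diff_right)
 qed
 \<comment> \<open>With \<open>w = \<rho>' v = g' S v\<close> and \<open>x = g'\<^sup>T w\<close>
   one has \<open>w \<bullet> w = x \<bullet> S v\<close>. Cauchy-Schwarz for the form
   \<open>S\<close> applies, and \<open>x \<bullet> S x = - w \<bullet> r\<^sup>T w\<close> is
   bounded by \<open>C\<close> times \<open>w \<bullet> w\<close> because \<open>r\<close> is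
   bounded; one factor \<open>w \<bullet> w\<close> cancels.\<close>
 have decay: "(norm (\<rho>' t *v v))\<^sup>2 \<le> C * (v \<bullet> (S t *v v))" if t: "t \<in> {0..T}" for t v
 proof -
  define w where "w = \<rho>' t *v v"
  define x where "x = transpose (g' t) *v w"
  have "w \<bullet> w = x \<bullet> (S t *v v)"
  proof -
   have "w = g' t *v (S t *v v)" using g'[OF t] by (simp add: w_def matrix_vector_mul_assoc)
   then have "w \<bullet> w = (g' t *v (S t *v v)) \<bullet> w" by metis
   also have "\<dots> = (S t *v v) \<bullet> x" unfolding x_def by (rule inner_transpose_mv[symmetric])
   finally show ?thesis by (simp add: inner_commute)
  qed
  then have "(w \<bullet> w)\<^sup>2 \<le> (x \<bullet> (S t *v x)) * (v \<bullet> (S t *v v))"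
   using psd_cauchy_schwarz[OF Ssym[OF t] psd[OF t], of x v] by simp
  moreover have "x \<bullet> (S t *v x) \<le> C * (w \<bullet> w)"
  proof -
   have "x \<bullet> (S t *v x) = w \<bullet> ((g' t ** S t ** transpose (g' t)) *v w)"
    unfolding x_def quadratic_congruence ..
   also have "g' t ** S t ** transpose (g' t) = - transpose (r t)" using r[OF t] g'[OF t] by (simp add: mm_simps)
   also have "w \<bullet> (- transpose (r t) *v w) = - ((r t *v w) \<bullet> w)"
    by (simp only: bb_mv.minus_left inner_minus_right inner_transpose_mv)
   also have "\<dots> \<le> norm (r t *v w) * norm w" using Cauchy_Schwarz_ineq2[of "r t *v w" w] by linarith
   also have "\<dots> \<le> (Kr * norm w * K) * norm w"
    using order_trans[OF K(1)[of "r t" w] mult_right_mono[OF mult_right_mono[OF Kr(2)[OF t]]]] K(2) by (intro mult_right_mono) auto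
   finally show ?thesis by (simp add: C_def dot_square_norm power2_eq_square mult_ac)
  qed
  ultimately have "(w \<bullet> w)\<^sup>2 \<le> C * (w \<bullet> w) * (v \<bullet> (S t *v v))"
   using psd[OF t, of v] by (meson mult_right_mono order_trans)
  then have "(w \<bullet> w) * (w \<bullet> w) \<le> (w \<bullet> w) * (C * (v \<bullet> (S t *v v)))" by (simp add: power2_eq_square mult_ac)
  then have "w \<bullet> w \<le> C * (v \<bullet> (S t *v v))"
   using psd[OF t, of v] C by (cases "w \<bullet> w = 0") (auto simp: mult_le_cancel_left)
  then show ?thesis by (simp add: w_def dot_square_norm)
 qed
 have ker: "\<Sigma>0 *v v = 0 \<longleftrightarrow> S t *v v = 0" if t: "t \<in> {0..T}" for t v
 proof -
  have S0: "S 0 = \<Sigma>0" by (simp add: S)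
  have z: "S s *v v = 0 \<longleftrightarrow> v \<bullet> (S s *v v) = 0" if s: "s \<in> {0..T}" for s
  proof
   assume "v \<bullet> (S s *v v) = 0"
   then have "((S s *v v) \<bullet> (S s *v v))\<^sup>2 \<le> 0"
    using psd_cauchy_schwarz[OF Ssym[OF s] psd[OF s], of "S s *v v" v] by simp
   then show "S s *v v = 0" by simp
  qed simp
  have cn: "continuous_on {0..T} (\<lambda>u. - (norm (\<rho>' u *v v))\<^sup>2)" by (intro continuous_intros \<rho>'c)
  \<comment> \<open>The form \<open>v \<bullet> S v\<close> has derivative minus the squared norm of
    \<open>\<rho>' v\<close>, hence by \<open>decay\<close> falls at rate at most \<open>C\<close>.
    So its product with \<open>exp (C t)\<close> does not decrease and the kernel cannot grow; that
    it cannot shrink is the monotonicity \<open>dn\<close>.\<close>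
  have "exp (C * t) * (v \<bullet> (S t *v v)) = 1 * (v \<bullet> (\<Sigma>0 *v v))
    + prim (\<lambda>s. C * exp (C * s) * (v \<bullet> (S s *v v)) + exp (C * s) * (- (norm (\<rho>' s *v v))\<^sup>2)) t"
   by (rule ac_product(2)[OF bounded_bilinear_mult L1on_continuous L1on_continuous[OF cn] prim_exp \<phi> t])
    (intro continuous_intros)
  moreover have "0 \<le> prim (\<lambda>s. C * exp (C * s) * (v \<bullet> (S s *v v)) + exp (C * s) * (- (norm (\<rho>' s *v v))\<^sup>2)) t"
  proof (rule prim_nonneg)
   fix s assume "s \<in> {0..t}"
   then have "s \<in> {0..T}" using t by auto
   from mult_left_mono[OF decay[OF this, of v], of "exp (C * s)"]
   show "0 \<le> C * exp (C * s) * (v \<bullet> (S s *v v)) + exp (C * s) * (- (norm (\<rho>' s *v v))\<^sup>2)" by (simp add: mult_ac)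
  qed
  ultimately have up: "v \<bullet> (\<Sigma>0 *v v) \<le> exp (C * t) * (v \<bullet> (S t *v v))" by simp
  have "0 \<le> prim (\<lambda>u. (norm (\<rho>' u *v v))\<^sup>2) t" by (rule prim_nonneg) simp
  then have dn: "v \<bullet> (S t *v v) \<le> v \<bullet> (\<Sigma>0 *v v)"
   using \<phi>[OF t, of v] by (simp add: set_lebesgue_integral_def)
  have p0: "0 \<in> {0..T}" using T by simp
  show ?thesis
   unfolding z[OF t] z[OF p0, unfolded S0] using up dn psd[OF p0, of v] psd[OF t, of v] by (auto simp: S0)
 qed
 have SE: "S t ** E = 0" if t: "t \<in> {0..T}" for t
 proof -
  have "\<Sigma>0 *v (E *v v) = 0" for v using E(3) by (simp add: matrix_vector_mul_assoc)
  then show ?thesis using ker[OF t] by (simp add: matrix_eq flip: matrix_vector_mul_assoc)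
 qed
 have ES: "E ** S t = 0" if t: "t \<in> {0..T}" for t
  using arg_cong[OF SE[OF t], of transpose] by (simp add: matrix_transpose_mul E Ssym[OF t] transpose_zero)
 have \<rho>E: "\<rho>' t ** E = 0" if t: "t \<in> {0..T}" for t
  unfolding g'[OF t, symmetric] matrix_mul_assoc[symmetric] SE[OF t] by simp
 define G where "G t = g' t ** (mat 1 - E)" for t
 have GS: "G t ** S t = \<rho>' t" if t: "t \<in> {0..T}" for t
  unfolding G_def using g'[OF t] ES[OF t] by (simp add: mm_simps flip: matrix_mul_assoc) 
 have GE: "G t ** E = 0" for t unfolding G_def using E(2) by (simp add: mm_simps flip: matrix_mul_assoc)
 define A where "A t = S t + E" for t
 have GA: "G t ** A t = \<rho>' t" if "t \<in> {0..T}" for t using GS[OF that] GE[of t] by (simp add: A_def mm_simps)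
 have Ac: "continuous_on {0..T} A" unfolding A_def S by (intro continuous_intros prim_continuous \<rho>\<rho>L)
 have inv: "\<exists>B. A t ** B = mat 1" if t: "t \<in> {0..T}" for t
 proof -
  have "v = 0" if "A t *v v = 0" for v
  proof -
   have "v \<bullet> (S t *v v) + v \<bullet> (E *v v) = 0" using that by (simp add: A_def bb_mv.add_left flip: inner_add_right)
   then have "v \<bullet> (S t *v v) = 0" "v \<bullet> (E *v v) = 0" using psd[OF t, of v] E(4)[of v] by linarith+
   then have "((S t *v v) \<bullet> (S t *v v))\<^sup>2 \<le> 0" and Ev: "E *v v = 0"
    using psd_cauchy_schwarz[OF Ssym[OF t] psd[OF t], of "S t *v v" v] E(5) by auto
   then have "S t *v v = 0" by simp
   then have "E *v v = v" using ker[OF t] E(6) by blast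
   with Ev show "v = 0" by simp
  qed
  then have "\<exists>B. B ** A t = mat 1" by (simp add: matrix_left_invertible_ker)
  then show ?thesis using matrix_left_right_inverse by blast
 qed
 obtain K2 where K2: "\<And>(x :: real^'m^'n) (y :: real^'m^'m). norm (x ** y) \<le> norm x * norm y * K2" "K2 > 0"
  using bb_mm.pos_bounded by auto
 have "continuous_on {0..T} G"
  unfolding continuous_on_def
 proof
  fix t assume t: "t \<in> {0..T}"
  obtain B where B: "A t ** B = mat 1" using inv[OF t] by blast
  let ?F = "at t within {0..T}"
  have lA: "(A \<longlongrightarrow> A t) ?F" and l\<rho>: "(\<rho>' \<longlongrightarrow> \<rho>' t) ?F"
   using Ac \<rho>'c t by (auto simp: continuous_on_def)
  define d where "d s = norm (A s - A t) * K2 * (norm B * K2)" for s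
  define q where "q s = norm (\<rho>' s - \<rho>' t) * (norm B * K2)" for s
  have ld: "(d \<longlongrightarrow> 0) ?F" unfolding d_def
   using tendsto_mult_left_zero[OF tendsto_mult_left_zero[OF tendsto_norm_zero[OF LIM_zero[OF lA]]]] by blast
  have lq: "(q \<longlongrightarrow> 0) ?F" unfolding q_def
   using tendsto_mult_left_zero[OF tendsto_norm_zero[OF LIM_zero[OF l\<rho>]]] by blast
  have ev: "\<forall>\<^sub>F s in ?F. d s < 1 / 2" by (rule order_tendstoD(2)[OF ld]) simp
  have ev2: "\<forall>\<^sub>F s in ?F. s \<in> {0..T}" by (simp add: eventually_at_filter)
  \<comment> \<open>Only the inverse \<open>B\<close> at the fixed time \<open>t\<close> enters, so
    continuity of matrix inversion is not invoked. The factor \<open>G s\<close> on the right is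
    harmless: for \<open>d s < 1 / 2\<close> its deviation from \<open>G t\<close> is absorbed into
    the left side.\<close>
  have est: "norm (G s - G t) \<le> q s + norm (G s) * d s" if s: "s \<in> {0..T}" for s
  proof -
   have "G s - G t = (G s - G t) ** (A t ** B)" by (simp add: B)
   also have "\<dots> = (\<rho>' s - \<rho>' t - G s ** (A s - A t)) ** B"
    by (simp add: matrix_mul_assoc bb_mm.diff_left bb_mm.diff_right GA[OF s] GA[OF t])
   finally have "norm (G s - G t) \<le> norm (\<rho>' s - \<rho>' t - G s ** (A s - A t)) * norm B * K2" using K2(1) by metis
   also have "\<dots> \<le> (norm (\<rho>' s - \<rho>' t) + norm (G s) * norm (A s - A t) * K2) * norm B * K2"
    using order_trans[OF norm_triangle_ineq4 add_left_mono[OF K2(1)]] K2(2) by (intro mult_right_mono) auto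
   also have "\<dots> = q s + norm (G s) * d s" by (simp add: q_def d_def algebra_simps)
   finally show ?thesis .
  qed
  have "((\<lambda>s. G s - G t) \<longlongrightarrow> 0) ?F"
  proof (rule Lim_null_comparison)
   show "((\<lambda>s. 2 * (q s + norm (G t) * d s)) \<longlongrightarrow> 0) ?F"
    using tendsto_mult[OF tendsto_const tendsto_add[OF lq tendsto_mult[OF tendsto_const ld]], of 2 "norm (G t)"] by simp
   show "\<forall>\<^sub>F s in ?F. norm (G s - G t) \<le> 2 * (q s + norm (G t) * d s)"
    using ev ev2
   proof eventually_elim
    case (elim s)
    have d0: "0 \<le> d s" using K2(2) by (simp add: d_def)
    have "norm (G s) \<le> norm (G t) + norm (G s - G t)" by norm
    then have "norm (G s) * d s \<le> (norm (G t) + norm (G s - G t)) * d s" using d0 by (intro mult_right_mono)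
    also have "\<dots> \<le> norm (G t) * d s + norm (G s - G t) * (1 / 2)"
     using elim(1) unfolding distrib_right by (intro add_left_mono mult_left_mono) auto
    finally show ?case using est[OF elim(2)] by simp
   qed
  qed
  then show "(G \<longlongrightarrow> G t) ?F" by (rule LIM_zero_cancel)
 qed
 then show ?thesis
  using E(1,3) \<rho>E GS unfolding G_def[abs_def] by (intro that[of E]) auto
qed

text \<open>The derivative is a pointwise limit of forward difference quotients of a continuous
  extension. It is wanted for \<open>g'\<close>, about which nothing but being a derivative is known
  when \<open>\<Sigma>0\<close> is singular.\<close>

lemma derivative_set_borel_measurable:
 fixes g g' :: "real => 'a::euclidean_space"
 assumes T: "0 < T" and g: "\<And>t. t \<in> {0..T} ==> (g has_vector_derivative g' t) (at t within {0..T})"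
 shows "set_borel_measurable lborel {0..T} g'"
proof -
 define gc where "gc t = g (max 0 (min t T))" for t
 have gcont: "continuous_on {0..T} g"
  unfolding continuous_on_eq_continuous_within using has_vector_derivative_continuous[OF g] by blast
 have gc: "continuous_on UNIV gc" unfolding gc_def
  by (rule continuous_on_compose2[OF gcont]) (use T in \<open>auto intro!: continuous_intros\<close>)
 define q where "q n t = real (Suc n) *\<^sub>R (gc (t + 1 / real (Suc n)) - gc t)" for n t
 have qc: "continuous_on UNIV (q n)" for n unfolding q_def
  by (intro continuous_intros continuous_on_compose2[OF gc]) auto
 have "(\<lambda>n. indicator {0..<T} t *\<^sub>R q n t) \<longlonglongrightarrow> indicator {0..<T} t *\<^sub>R g' t" for t
 proof (cases "t \<in> {0..<T}")
  case True
  show ?thesis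
  proof (rule LIMSEQ_I)
   fix e :: real assume e: "0 < e"
   have "(g has_derivative (\<lambda>x. x *\<^sub>R g' t)) (at t within {0..T})"
    using g[of t] True by (simp add: has_vector_derivative_def)
   then obtain d where d: "d > 0" "\<And>y. y \<in> {0..T} ==> norm (y - t) < d ==>
     norm (g y - g t - (y - t) *\<^sub>R g' t) \<le> e / 2 * norm (y - t)"
    unfolding has_derivative_within_alt using half_gt_zero[OF e] by blast
   obtain n0 where n0: "inverse (real (Suc n0)) < min d (T - t)"
    using reals_Archimedean[of "min d (T - t)"] d(1) True by auto
   show "\<exists>n0. \<forall>n\<ge>n0. norm (indicator {0..<T} t *\<^sub>R q n t - indicator {0..<T} t *\<^sub>R g' t) < e"
   proof (intro exI allI impI)
    fix n assume n: "n \<ge> n0"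
    define z where "z = 1 / real (Suc n)"
    have z: "0 < z" "z < d" "z < T - t"
    proof -
     have "z \<le> inverse (real (Suc n0))" using n by (simp add: z_def field_simps)
     then show "z < d" "z < T - t" using n0 by auto
    qed (simp add: z_def)
    have gg: "gc (t + z) = g (t + z)" "gc t = g t" using True z by (auto simp: gc_def)
    have "q n t - g' t = (1 / z) *\<^sub>R (g (t + z) - g t - z *\<^sub>R g' t)"
     using z(1) gg unfolding q_def z_def[symmetric] by (simp add: z_def scaleR_diff_right)
    then have "norm (q n t - g' t) = (1 / z) * norm (g (t + z) - g t - z *\<^sub>R g' t)" using z(1) by simp
    also have "\<dots> \<le> (1 / z) * (e / 2 * z)"
     using d(2)[of "t + z"] z True by (intro mult_left_mono) auto
    also have "\<dots> < e" using z(1) e by simp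
    finally show "norm (indicator {0..<T} t *\<^sub>R q n t - indicator {0..<T} t *\<^sub>R g' t) < e" using True by simp
   qed
  qed
 qed simp
 then have "(\<lambda>t. indicator {0..<T} t *\<^sub>R g' t) \<in> borel_measurable borel"
  by (rule borel_measurable_LIMSEQ_metric[rotated]) (intro borel_measurable_scaleR borel_measurable_continuous_onI[OF qc], simp)
 \<comment> \<open>At \<open>T\<close> the forward quotients of the extension vanish and miss the
   derivative, so this single value is added separately.\<close>
 then have "(\<lambda>t. indicator {0..<T} t *\<^sub>R g' t + indicator {T} t *\<^sub>R g' T) \<in> borel_measurable borel"
  by (rule borel_measurable_add[OF _ borel_measurable_scaleR]) auto
 also have "(\<lambda>t. indicator {0..<T} t *\<^sub>R g' t + indicator {T} t *\<^sub>R g' T) = (\<lambda>t. indicator {0..T} t *\<^sub>R g' t)"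
  using T by (auto simp: indicator_def fun_eq_iff)
 finally show ?thesis by (simp add: set_borel_measurable_def)
qed

section \<open>Gaussian spaces\<close>

definition outer :: "real^'d => real^'k => real^'k^'d" where
 "outer y z = (\<chi> i j. y $ i * z $ j)"

lemma bb_outer: "bounded_bilinear (outer :: real^'d => real^'k => real^'k^'d)"
 unfolding bilinear_conv_bounded_bilinear[symmetric] bilinear_def
 by (auto intro!: linearI simp: outer_def vec_eq_iff algebra_simps)

interpretation bb_outer: bounded_bilinear "outer :: real^'d => real^'k => real^'k^'d" by (rule bb_outer)

lemma outer_mv_left: "outer (A *v y) z = A ** outer y z"
 by (simp add: outer_def matrix_matrix_mult_def matrix_vector_mult_def vec_eq_iff sum_distrib_right sum_distrib_left mult_ac)

lemma outer_transpose: "transpose (outer y z) = outer z y"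
 by (simp add: outer_def transpose_def mult.commute)

lemma outer_mv_right: "outer y (A *v z) = outer y z ** transpose A"
 by (metis outer_mv_left outer_transpose matrix_transpose_mul transpose_transpose)

lemma borel_measurable_bilinear:
 fixes B :: "'a::euclidean_space => 'b::euclidean_space => 'c::euclidean_space"
 assumes B: "bounded_bilinear B" and "f \<in> borel_measurable N" "g \<in> borel_measurable N"
 shows "(\<lambda>x. B (f x) (g x)) \<in> borel_measurable N"
proof -
 have c: "continuous_on UNIV (\<lambda>x. B (fst x) (snd x))"
  by (rule bounded_bilinear.continuous_on[OF B]) (intro continuous_intros)+
 show ?thesis by (rule borel_measurable_continuous_Pair[OF _ _ c]) (use assms(2,3) in auto)
qed

lemma borel_measurable_mv:
 "f \<in> borel_measurable N ==> (\<lambda>x. (A :: real^'d^'k) *v f x) \<in> borel_measurable N"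
 by (rule borel_measurable_bilinear[OF bb_mv]) auto

lemma borel_measurable_component [measurable (raw)]:
 "(f :: 'w => real^'d) \<in> borel_measurable N ==> (\<lambda>x. f x $ i) \<in> borel_measurable N"
 by (rule measurable_compose[OF _ borel_measurable_continuous_onI]) (auto intro!: continuous_intros)

lemma borel_measurable_vecI:
 fixes f :: "'w => real^'d"
 assumes "\<And>i. (\<lambda>x. f x $ i) \<in> borel_measurable N"
 shows "f \<in> borel_measurable N"
proof (rule borel_measurable_euclidean_space[THEN iffD2], rule ballI)
 fix b :: "real^'d" assume "b \<in> Basis"
 then obtain i where "b = axis i 1" by (auto simp: Basis_vec_def)
 then show "(\<lambda>x. f x \<bullet> b) \<in> borel_measurable N" using assms[of i] by (simp add: inner_axis)
qed

text \<open>The linear hull, built by adding one generator at a time, so that properties of finite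
  linear combinations are proved by induction.\<close>

inductive_set lin :: "('w => real) set => ('w => real) set" for S where
 zero: "(\<lambda>_. 0) \<in> lin S"
| add: "X \<in> S ==> Y \<in> lin S ==> (\<lambda>w. a * X w + Y w) \<in> lin S"

lemma lin_add: "X \<in> lin S ==> Y \<in> lin S ==> (\<lambda>w. X w + Y w) \<in> lin S"
proof (induction rule: lin.induct)
 case (add X Y' a)
 from lin.add[OF add(1) add(3)[OF add(4)], of a] show ?case by (simp add: add.assoc)
qed simp

lemma lin_scale: "X \<in> lin S ==> (\<lambda>w. c * X w) \<in> lin S"
proof (induction rule: lin.induct)
 case (add X Y a)
 from lin.add[OF add(1) add(3), of "c * a"] show ?case by (simp add: distrib_left mult.assoc)
qed (use lin.zero in auto)

lemma lin_base: "X \<in> S ==> X \<in> lin S"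
 using lin.add[OF _ lin.zero, of X S 1] by simp

lemma lin_mono: "S \<subseteq> S' ==> X \<in> lin S ==> X \<in> lin S'"
 by (rotate_tac 1, induction rule: lin.induct) (auto intro: lin.intros)

section \<open>Square integrable random vectors and their second moments\<close>

context prob_space
begin

definition sqint :: "('a => 'b::euclidean_space) => bool" where
 "sqint V \<longleftrightarrow> V \<in> borel_measurable M \<and> integrable M (\<lambda>w. (norm (V w))\<^sup>2)"

definition ms :: "('a => 'b::euclidean_space) => real" where
 "ms V = expectation (\<lambda>w. (norm (V w))\<^sup>2)"

text \<open>No means are subtracted. For centred variables this is the covariance matrix, and every
  member of a Gaussian family below is centred.\<close>

definition cov :: "('a => real^'d) => ('a => real^'k) => real^'k^'d" where
 "cov V Z = expectation (\<lambda>w. outer (V w) (Z w))"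

lemma sqintD [measurable_dest]: "sqint V ==> V \<in> borel_measurable M"
 by (simp add: sqint_def)

lemma sqint_bilinear:
 fixes B :: "'b::euclidean_space => 'c::euclidean_space => 'e::euclidean_space"
 assumes B: "bounded_bilinear B" and V: "sqint V" and Z: "sqint Z"
 shows "integrable M (\<lambda>w. B (V w) (Z w))"
proof -
 obtain K where K: "\<And>x y. norm (B x y) \<le> norm x * norm y * K" "K > 0" using bounded_bilinear.pos_bounded[OF B] by auto
 show ?thesis
 proof (rule Bochner_Integration.integrable_bound[where f="\<lambda>w. ((norm (V w))\<^sup>2 + (norm (Z w))\<^sup>2) * K"])
  show "integrable M (\<lambda>w. ((norm (V w))\<^sup>2 + (norm (Z w))\<^sup>2) * K)" using V Z by (auto simp: sqint_def)
  show "(\<lambda>w. B (V w) (Z w)) \<in> borel_measurable M"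
   by (rule borel_measurable_bilinear[OF B]) (use V Z in \<open>auto simp: sqint_def\<close>)
  have "norm (B (V w) (Z w)) \<le> ((norm (V w))\<^sup>2 + (norm (Z w))\<^sup>2) * K" for w
  proof -
   have "0 \<le> norm (V w) * norm (Z w)" by simp
   then have "norm (V w) * norm (Z w) \<le> (norm (V w))\<^sup>2 + (norm (Z w))\<^sup>2"
    using sum_squares_bound[of "norm (V w)" "norm (Z w)"] by linarith
   from mult_right_mono[OF this] K show ?thesis by (meson less_imp_le order_trans)
  qed
  then show "AE w in M. norm (B (V w) (Z w)) \<le> norm (((norm (V w))\<^sup>2 + (norm (Z w))\<^sup>2) * K)"
   using K(2) by (intro AE_I2) (simp add: abs_mult)
 qed
qed

lemma sqint_mult: "sqint X ==> sqint Y ==> integrable M (\<lambda>w. X w * Y w :: real)"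
 by (rule sqint_bilinear[OF bounded_bilinear_mult])

lemma sqint_const [simp]: "sqint (\<lambda>_. c)"
 by (simp add: sqint_def)

lemma sqint_add: "sqint V ==> sqint Z ==> sqint (\<lambda>w. V w + Z w)"
proof -
 assume VZ: "sqint V" "sqint Z"
 have "integrable M (\<lambda>w. (norm (V w))\<^sup>2 + (norm (Z w))\<^sup>2 + 2 * (V w \<bullet> Z w))"
  using VZ sqint_bilinear[OF bounded_bilinear_inner VZ] by (auto simp: sqint_def)
 moreover have "(norm (V w + Z w))\<^sup>2 = (norm (V w))\<^sup>2 + (norm (Z w))\<^sup>2 + 2 * (V w \<bullet> Z w)" for w
  by (simp add: power2_norm_eq_inner inner_add inner_commute)
 moreover have "(\<lambda>w. V w + Z w) \<in> borel_measurable M" using VZ by (intro borel_measurable_add sqintD)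
 ultimately show ?thesis by (simp add: sqint_def)
qed

lemma sqint_linear: "bounded_linear h ==> sqint V ==> sqint (\<lambda>w. h (V w) :: 'c::euclidean_space)"
proof -
 assume h: "bounded_linear h" and V: "sqint V"
 obtain K where K: "\<And>x. norm (h x) \<le> norm x * K" using bounded_linear.bounded[OF h] by auto
 have hm: "h \<in> borel_measurable borel"
  by (intro borel_measurable_continuous_onI linear_continuous_on h)
 show ?thesis
  unfolding sqint_def
 proof
  show m: "(\<lambda>w. h (V w)) \<in> borel_measurable M"
   by (rule measurable_compose[OF _ hm]) (use V in \<open>simp add: sqint_def\<close>)
  show "integrable M (\<lambda>w. (norm (h (V w)))\<^sup>2)"
  proof (rule Bochner_Integration.integrable_bound[where f="\<lambda>w. (norm (V w))\<^sup>2 * K\<^sup>2"])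
   show "integrable M (\<lambda>w. (norm (V w))\<^sup>2 * K\<^sup>2)" using V by (simp add: sqint_def)
   show "AE w in M. norm ((norm (h (V w)))\<^sup>2) \<le> norm ((norm (V w))\<^sup>2 * K\<^sup>2)"
    using power_mono[OF K, of _ 2] by (intro AE_I2) (simp add: power_mult_distrib)
  qed (use m in measurable)
 qed
qed

lemma sqint_scaleR: "sqint V ==> sqint (\<lambda>w. c *\<^sub>R V w)"
 by (rule sqint_linear[OF bounded_linear_scaleR_right])

lemma sqint_cmult: "sqint V ==> sqint (\<lambda>w. c * V w :: real)"
 using sqint_scaleR[of V c] by simp

lemma sqint_uminus: "sqint V ==> sqint (\<lambda>w. - V w)"
 using sqint_scaleR[of V "-1"] by simp

lemma sqint_diff: "sqint V ==> sqint Z ==> sqint (\<lambda>w. V w - Z w)"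
 using sqint_add[OF _ sqint_uminus, of V Z] by simp

lemma sqint_mv: "sqint V ==> sqint (\<lambda>w. (A :: real^'d^'k) *v V w)"
 by (rule sqint_linear[OF bb_mv.bounded_linear_right])

lemma sqint_component: "sqint (V :: 'a => real^'d) ==> sqint (\<lambda>w. V w $ i)"
 by (rule sqint_linear[OF bounded_linear_vec_nth])

lemma norm_sq_components: "(norm (x :: real^'d))\<^sup>2 = (\<Sum>i\<in>UNIV. (norm (x $ i))\<^sup>2)"
 by (simp only: power2_norm_eq_inner inner_vec_def)

lemma sqint_vecI:
 assumes "\<And>i. sqint (\<lambda>w. (V w :: real^'d) $ i)" shows "sqint V"
 unfolding sqint_def norm_sq_components
 using assms by (auto simp: sqint_def intro!: borel_measurable_vecI Bochner_Integration.integrable_sum)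

lemma ms_components: "sqint V ==> ms (V :: 'a => real^'d) = (\<Sum>i\<in>UNIV. ms (\<lambda>w. V w $ i))"
 unfolding ms_def norm_sq_components
 by (rule Bochner_Integration.integral_sum) (use sqint_component in \<open>auto simp: sqint_def\<close>)

lemma sqint_AE: "sqint V ==> AE w in M. V w = Z w ==> Z \<in> borel_measurable M ==> sqint Z"
 unfolding sqint_def by (auto elim!: integrable_cong_AE_imp)

lemma sqint_integrable: "sqint V ==> integrable M V"
 using sqint_bilinear[OF bounded_bilinear_scaleR sqint_const[of "1::real"], of V] by simp

lemma ms_nonneg: "0 \<le> ms V" by (simp add: ms_def)

lemma ms_add_le: "sqint V ==> sqint Z ==> ms (\<lambda>w. V w + Z w) \<le> 2 * ms V + 2 * ms Z"
proof -
 assume VZ: "sqint V" "sqint Z"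
 have "ms (\<lambda>w. V w + Z w) \<le> expectation (\<lambda>w. 2 * (norm (V w))\<^sup>2 + 2 * (norm (Z w))\<^sup>2)"
  unfolding ms_def by (rule integral_mono) (use VZ sqint_add[OF VZ] in \<open>auto simp: sqint_def intro: norm_sq_add_le\<close>)
 also have "\<dots> = 2 * ms V + 2 * ms Z" unfolding ms_def using VZ by (subst Bochner_Integration.integral_add) (auto simp: sqint_def)
 finally show ?thesis .
qed

lemma ms_scale: "ms (\<lambda>w. c * X w :: real) = c\<^sup>2 * ms X"
 by (simp add: ms_def power_mult_distrib)

lemma ms_real: "ms X = expectation (\<lambda>w. (X w)\<^sup>2 :: real)"
 by (simp add: ms_def)

lemma ms_minus_commute: "ms (\<lambda>w. V w - Z w) = ms (\<lambda>w. Z w - V w)"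
 by (simp add: ms_def norm_minus_commute)

lemma ms_triangle:
 assumes "sqint X" "sqint Y" "sqint Z"
 shows "ms (\<lambda>w. X w - Z w) \<le> 2 * ms (\<lambda>w. X w - Y w) + 2 * ms (\<lambda>w. Y w - Z w)"
 using ms_add_le[OF sqint_diff[OF assms(1,2)] sqint_diff[OF assms(2,3)]] by simp

lemma ms_zero_AE: "sqint V ==> ms V = 0 ==> AE w in M. V w = 0"
 unfolding ms_def sqint_def
 using integral_nonneg_eq_0_iff_AE[of M "\<lambda>w. (norm (V w))\<^sup>2"] by auto

lemma cs: 
 assumes X: "sqint X" and Y: "sqint (Y :: 'a => 'b::euclidean_space)"
 shows "(expectation (\<lambda>w. X w \<bullet> Y w))\<^sup>2 \<le> ms X * ms Y"
proof -
 define b where "b = expectation (\<lambda>w. X w \<bullet> Y w)"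
 have XY: "integrable M (\<lambda>w. X w \<bullet> Y w)" by (rule sqint_bilinear[OF bounded_bilinear_inner X Y])
 have q: "0 \<le> ms X + 2 * t * b + t\<^sup>2 * ms Y" for t
 proof -
  have "ms (\<lambda>w. X w + t *\<^sub>R Y w) = expectation (\<lambda>w. (norm (X w))\<^sup>2 + (2 * t) * (X w \<bullet> Y w) + t\<^sup>2 * (norm (Y w))\<^sup>2)"
   unfolding ms_def
  proof (rule lint_cong[OF refl])
   fix w
   have "(X w + t *\<^sub>R Y w) \<bullet> (X w + t *\<^sub>R Y w) = X w \<bullet> X w + (2 * t) * (X w \<bullet> Y w) + (t * t) * (Y w \<bullet> Y w)"
    by (simp add: inner_add inner_commute)
   then show "(norm (X w + t *\<^sub>R Y w))\<^sup>2 = (norm (X w))\<^sup>2 + (2 * t) * (X w \<bullet> Y w) + t\<^sup>2 * (norm (Y w))\<^sup>2"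
    by (simp only: power2_norm_eq_inner power2_eq_square[of t])
  qed
  also have "\<dots> = ms X + 2 * t * b + t\<^sup>2 * ms Y"
   using X Y XY by (simp add: sqint_def ms_def b_def)
  finally show ?thesis using ms_nonneg[of "\<lambda>w. X w + t *\<^sub>R Y w"] by simp
 qed
 show ?thesis
 proof (cases "ms Y = 0")
  case True
  have "b = 0"
  proof (rule ccontr)
   assume "b \<noteq> 0"
   then show False using q[of "- (ms X + 1) / (2 * b)"] True by (simp add: field_simps)
  qed
  then show ?thesis using True by (simp add: b_def)
 next
  case False
  then have a: "ms Y > 0" using ms_nonneg[of Y] by simp
  have "ms X + 2 * (- b / ms Y) * b + (- b / ms Y)\<^sup>2 * ms Y = ms X - b\<^sup>2 / ms Y" using a by (simp add: field_simps power2_eq_square)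
  with q[of "- b / ms Y"] have "b\<^sup>2 / ms Y \<le> ms X" by simp
  then show ?thesis using a by (simp add: pos_divide_le_eq b_def)
 qed
qed

lemma cov_component: "sqint V ==> sqint Z ==> cov V Z $ i $ j = expectation (\<lambda>w. V w $ i * Z w $ j)"
proof -
 assume VZ: "sqint V" "sqint Z"
 have "bounded_linear (\<lambda>A :: real^'c^'b. A $ i $ j)"
  by (intro bounded_linear_compose[OF bounded_linear_vec_nth bounded_linear_vec_nth])
 from integral_bounded_linear[OF this sqint_bilinear[OF bb_outer VZ]]
 show ?thesis by (simp add: cov_def outer_def)
qed

lemma cov_add_left: "sqint V ==> sqint V' ==> sqint Z ==> cov (\<lambda>w. V w + V' w) Z = cov V Z + cov V' Z"
 unfolding cov_def bb_outer.add_left by (intro Bochner_Integration.integral_add sqint_bilinear[OF bb_outer])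

lemma cov_add_right: "sqint V ==> sqint Z' ==> sqint Z ==> cov V (\<lambda>w. Z w + Z' w) = cov V Z + cov V Z'"
 unfolding cov_def bb_outer.add_right by (intro Bochner_Integration.integral_add sqint_bilinear[OF bb_outer])

lemma cov_diff_left: "sqint V ==> sqint V' ==> sqint Z ==> cov (\<lambda>w. V w - V' w) Z = cov V Z - cov V' Z"
 unfolding cov_def bb_outer.diff_left by (intro lint_diff sqint_bilinear[OF bb_outer])

lemma cov_diff_right: "sqint V ==> sqint Z' ==> sqint Z ==> cov V (\<lambda>w. Z w - Z' w) = cov V Z - cov V Z'"
 unfolding cov_def bb_outer.diff_right by (intro lint_diff sqint_bilinear[OF bb_outer])

lemma cov_mv_left: "sqint V ==> sqint Z ==> cov (\<lambda>w. A *v V w) Z = A ** cov V Z"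
 unfolding cov_def outer_mv_left
 by (rule integral_bounded_linear[OF bb_mm.bounded_linear_right sqint_bilinear[OF bb_outer]])

lemma cov_mv_right: "sqint V ==> sqint Z ==> cov V (\<lambda>w. A *v Z w) = cov V Z ** transpose A"
 unfolding cov_def outer_mv_right
 by (rule integral_bounded_linear[OF bb_mm.bounded_linear_left sqint_bilinear[OF bb_outer]])

lemma cov_transpose: "sqint V ==> sqint Z ==> transpose (cov V Z) = cov Z V"
 unfolding cov_def
 by (subst integral_bounded_linear[OF bl_transpose sqint_bilinear[OF bb_outer], symmetric]) (auto simp: outer_transpose)

lemma cov_AE: "AE w in M. V w = V' w ==> AE w in M. Z w = Z' w ==> sqint V ==> sqint V' ==> sqint Z ==> sqint Z' ==> cov V Z = cov V' Z'"
 unfolding cov_def by (rule integral_cong_AE) (auto simp: sqint_def intro!: borel_measurable_bilinear[OF bb_outer])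

lemma cov_psd: "sqint V ==> 0 \<le> v \<bullet> (cov V V *v v)"
proof -
 assume V: "sqint V"
 have bl: "bounded_linear (\<lambda>A :: real^'b^'b. v \<bullet> (A *v v))"
  by (rule bounded_linear_compose[OF bounded_linear_inner_right bb_mv.bounded_linear_left])
 have "v \<bullet> (cov V V *v v) = expectation (\<lambda>w. v \<bullet> (outer (V w) (V w) *v v))"
  unfolding cov_def by (rule integral_bounded_linear[OF bl sqint_bilinear[OF bb_outer V V], symmetric])
 also have "\<dots> = expectation (\<lambda>w. (V w \<bullet> v)\<^sup>2)"
  by (simp add: outer_def matrix_vector_mult_def inner_vec_def power2_eq_square sum_distrib_left sum_distrib_right mult_ac)
 also have "\<dots> \<ge> 0" by simp
 finally show ?thesis .
qed

lemma cov_tendsto: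
 fixes V :: "nat => 'a => real^'d" and Z :: "'a => real^'k"
 assumes V: "\<And>n. sqint (V n)" and W: "sqint W" and Z: "sqint Z" and lim: "(\<lambda>n. ms (\<lambda>w. V n w - W w)) \<longlonglongrightarrow> 0"
 shows "(\<lambda>n. cov (V n) Z) \<longlonglongrightarrow> cov W Z"
proof (rule vec_tendstoI, rule vec_tendstoI)
 fix i j
 have "(\<lambda>n. expectation (\<lambda>w. (V n w $ i - W w $ i) * Z w $ j)) \<longlonglongrightarrow> 0"
 proof (rule Lim_null_comparison)
  show "(\<lambda>n. sqrt (ms (\<lambda>w. V n w - W w) * ms (\<lambda>w. Z w $ j))) \<longlonglongrightarrow> 0"
   using tendsto_real_sqrt[OF tendsto_mult_left_zero[OF lim]] by simp
  have "\<bar>expectation (\<lambda>w. (V n w $ i - W w $ i) * Z w $ j)\<bar> \<le> sqrt (ms (\<lambda>w. V n w - W w) * ms (\<lambda>w. Z w $ j))" for n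
  proof -
   have d: "sqint (\<lambda>w. V n w - W w)" by (rule sqint_diff[OF V W])
   have "(expectation (\<lambda>w. (V n w $ i - W w $ i) * Z w $ j))\<^sup>2 \<le> ms (\<lambda>w. V n w $ i - W w $ i) * ms (\<lambda>w. Z w $ j)"
    using cs[OF sqint_component[OF d, of i] sqint_component[OF Z, of j]] by simp
   also have "ms (\<lambda>w. V n w $ i - W w $ i) \<le> ms (\<lambda>w. V n w - W w)"
    unfolding ms_components[OF d] using member_le_sum[of i UNIV "\<lambda>i. ms (\<lambda>w. (V n w - W w) $ i)"] by (simp add: ms_nonneg)
   finally show ?thesis by (intro real_le_rsqrt[of "\<bar>x\<bar>" for x, simplified power2_abs]) (simp add: mult_right_mono ms_nonneg)
  qed
  then show "\<forall>\<^sub>F n in sequentially. norm (expectation (\<lambda>w. (V n w $ i - W w $ i) * Z w $ j))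
    \<le> sqrt (ms (\<lambda>w. V n w - W w) * ms (\<lambda>w. Z w $ j))" by simp
 qed
 moreover have "expectation (\<lambda>w. (V n w $ i - W w $ i) * Z w $ j) = cov (V n) Z $ i $ j - cov W Z $ i $ j" for n
  unfolding cov_component[OF V Z] cov_component[OF W Z] left_diff_distrib
  by (intro lint_diff sqint_mult sqint_component V W Z)
 ultimately show "(\<lambda>n. cov (V n) Z $ i $ j) \<longlonglongrightarrow> cov W Z $ i $ j" by (simp add: LIM_zero_iff)
qed

text \<open>The closed linear span in mean square, as a set of functions rather than of classes. The
  integrability conjunct guards against the convention that the integral, and with it
  \<open>ms\<close>, of a non-integrable function is 0.\<close>

definition cspan :: "('a => real) set => ('a => real) set" where
 "cspan S = {Y \<in> borel_measurable M. \<forall>e>0. \<exists>Z\<in>lin S. sqint (\<lambda>w. Y w - Z w) \<and> ms (\<lambda>w. Y w - Z w) < e}"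

definition vspan :: "('a => real) set => ('a => real^'d) => bool" where
 "vspan S V \<longleftrightarrow> (\<forall>i. (\<lambda>w. V w $ i) \<in> cspan S)"

lemma lin_sqint: "X \<in> lin S ==> (\<And>X. X \<in> S ==> sqint X) ==> sqint X"
 by (induction rule: lin.induct) (auto intro!: sqint_add sqint_cmult)

context
 fixes S :: "('a => real) set"
 assumes S: "\<And>X. X \<in> S ==> sqint X"
begin

lemma cspan_sqint: "Y \<in> cspan S ==> sqint Y"
proof -
 assume "Y \<in> cspan S"
 then obtain Z where Z: "Z \<in> lin S" "sqint (\<lambda>w. Y w - Z w)" unfolding cspan_def by (auto dest: spec[of _ 1])
 from sqint_add[OF Z(2) lin_sqint[OF Z(1) S]] show ?thesis by simp
qed

lemma cspanE:
 assumes "Y \<in> cspan S" "e > 0" obtains Z where "Z \<in> lin S" "sqint Z" "sqint (\<lambda>w. Y w - Z w)" "ms (\<lambda>w. Y w - Z w) < e"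
 using assms lin_sqint[OF _ S] unfolding cspan_def by blast

lemma cspanI:
 assumes "\<And>e. e > 0 ==> \<exists>Z\<in>lin S. ms (\<lambda>w. Y w - Z w) < e" "sqint Y"
 shows "Y \<in> cspan S"
 unfolding cspan_def using assms sqint_diff[OF _ lin_sqint[OF _ S]] by (auto simp: sqintD)

lemma lin_cspan: "Y \<in> lin S ==> Y \<in> cspan S"
 by (rule cspanI) (auto simp: ms_def intro: lin_sqint S intro!: bexI[of _ Y])

lemma cspan_base: "Y \<in> S ==> Y \<in> cspan S"
 by (rule lin_cspan[OF lin_base])

lemma cspan_limit:
 assumes "\<And>e. e > 0 ==> \<exists>Z\<in>cspan S. ms (\<lambda>w. Y w - Z w) < e" and Y: "sqint Y"
 shows "Y \<in> cspan S"
proof (rule cspanI[OF _ Y])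
 fix e :: real assume e: "e > 0"
 obtain Z where Z: "Z \<in> cspan S" "ms (\<lambda>w. Y w - Z w) < e / 4" using assms(1)[of "e / 4"] e by auto
 obtain Z' where Z': "Z' \<in> lin S" "sqint Z'" "ms (\<lambda>w. Z w - Z' w) < e / 4" using cspanE[OF Z(1), of "e / 4"] e by auto
 have "ms (\<lambda>w. Y w - Z' w) < e"
  using ms_triangle[OF Y cspan_sqint[OF Z(1)] Z'(2)] Z(2) Z'(3) by simp
 then show "\<exists>Z\<in>lin S. ms (\<lambda>w. Y w - Z w) < e" using Z'(1) by blast
qed

lemma cspan_add: "X \<in> cspan S ==> Y \<in> cspan S ==> (\<lambda>w. X w + Y w) \<in> cspan S"
proof (rule cspanI)
 assume X: "X \<in> cspan S" and Y: "Y \<in> cspan S"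
 show "sqint (\<lambda>w. X w + Y w)" by (intro sqint_add cspan_sqint X Y)
 fix e :: real assume e: "e > 0"
 obtain X' where X': "X' \<in> lin S" "sqint X'" "ms (\<lambda>w. X w - X' w) < e / 4" using cspanE[OF X, of "e / 4"] e by auto
 obtain Y' where Y': "Y' \<in> lin S" "sqint Y'" "ms (\<lambda>w. Y w - Y' w) < e / 4" using cspanE[OF Y, of "e / 4"] e by auto
 have eq: "(\<lambda>w. (X w - X' w) + (Y w - Y' w)) = (\<lambda>w. X w + Y w - (X' w + Y' w))" by auto
 have "ms (\<lambda>w. X w + Y w - (X' w + Y' w)) < e"
  using ms_add_le[OF sqint_diff[OF cspan_sqint[OF X] X'(2)] sqint_diff[OF cspan_sqint[OF Y] Y'(2)]] X'(3) Y'(3)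
  unfolding eq by simp
 then show "\<exists>Z\<in>lin S. ms (\<lambda>w. X w + Y w - Z w) < e" using lin_add[OF X'(1) Y'(1)] by (rule bexI)
qed

lemma cspan_scale: "X \<in> cspan S ==> (\<lambda>w. c * X w) \<in> cspan S"
proof (rule cspanI)
 assume X: "X \<in> cspan S"
 show "sqint (\<lambda>w. c * X w)" by (intro sqint_cmult cspan_sqint X)
 fix e :: real assume e: "e > 0"
 have c: "c\<^sup>2 + 1 > 0" by (simp add: add_nonneg_pos)
 obtain X' where X': "X' \<in> lin S" "ms (\<lambda>w. X w - X' w) < e / (c\<^sup>2 + 1)"
  using cspanE[OF X, of "e / (c\<^sup>2 + 1)"] e c by (metis divide_pos_pos)
 have "ms (\<lambda>w. c * X w - c * X' w) = c\<^sup>2 * ms (\<lambda>w. X w - X' w)"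
  using ms_scale[of c "\<lambda>w. X w - X' w"] by (simp add: right_diff_distrib)
 also have "\<dots> \<le> (c\<^sup>2 + 1) * ms (\<lambda>w. X w - X' w)" by (intro mult_right_mono ms_nonneg) simp
 also have "\<dots> < e" using X'(2) c by (simp add: pos_less_divide_eq mult.commute)
 finally show "\<exists>Z\<in>lin S. ms (\<lambda>w. c * X w - Z w) < e" using lin_scale[OF X'(1), of c] by (rule bexI)
qed

lemma cspan_zero: "(\<lambda>_. 0) \<in> cspan S" by (rule lin_cspan[OF lin.zero])

lemma cspan_diff: "X \<in> cspan S ==> Y \<in> cspan S ==> (\<lambda>w. X w - Y w) \<in> cspan S"
 using cspan_add[OF _ cspan_scale[of Y "-1"], of X] by simp

lemma cspan_sum: "(\<And>i. i \<in> I ==> X i \<in> cspan S) ==> (\<lambda>w. \<Sum>i\<in>I. X i w) \<in> cspan S"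
 by (induction I rule: infinite_finite_induct) (auto intro!: cspan_add cspan_zero)

lemma cspan_AE: "X \<in> cspan S ==> AE w in M. X w = Y w ==> Y \<in> borel_measurable M ==> Y \<in> cspan S"
proof (rule cspan_limit)
 assume X: "X \<in> cspan S" and ae: "AE w in M. X w = Y w" and Y: "Y \<in> borel_measurable M"
 show "sqint Y" by (rule sqint_AE[OF cspan_sqint[OF X] ae Y])
 have [measurable]: "X \<in> borel_measurable M" "Y \<in> borel_measurable M" using cspan_sqint[OF X] Y by (auto simp: sqint_def)
 have "ms (\<lambda>w. Y w - X w) = expectation (\<lambda>w. 0)" unfolding ms_def
  by (rule integral_cong_AE) (use ae in auto)
 then show "\<exists>Z\<in>cspan S. ms (\<lambda>w. Y w - Z w) < e" if "e > 0" for e using that by (intro bexI[OF _ X]) simp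
qed

lemma cspan_idem: "(\<And>X. X \<in> S' ==> X \<in> cspan S) ==> Y \<in> cspan S' ==> Y \<in> cspan S"
proof -
 assume S': "\<And>X. X \<in> S' ==> X \<in> cspan S" and Y: "Y \<in> cspan S'"
 have l: "Z \<in> lin S' ==> Z \<in> cspan S" for Z
 proof (induction rule: lin.induct)
  case (add X Y a)
  show ?case by (rule cspan_add[OF cspan_scale[OF S'[OF add(1)]] add(3)])
 qed (rule cspan_zero)
 have "\<exists>Z\<in>cspan S. sqint (\<lambda>w. Y w - Z w) \<and> ms (\<lambda>w. Y w - Z w) < e" if "e > 0" for e
  using Y l that unfolding cspan_def by blast
 moreover from this[of 1] obtain Z where "Z \<in> cspan S" "sqint (\<lambda>w. Y w - Z w)" by auto
 then have "sqint Y" using sqint_add[OF _ cspan_sqint, of "\<lambda>w. Y w - Z w" Z] by simp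
 ultimately show ?thesis by (intro cspan_limit) auto
qed

text \<open>Approximate \<open>Y\<close> by linear combinations, for which the claim is immediate;
  Cauchy-Schwarz bounds the square of the expectation by any positive \<open>e\<close>.\<close>

lemma cspan_orthogonal:
 assumes Y: "Y \<in> cspan S" and Z: "sqint Z" and orth: "\<And>X. X \<in> S ==> expectation (\<lambda>w. X w * Z w) = 0"
 shows "expectation (\<lambda>w. Y w * Z w) = (0::real)"
proof -
 have l: "expectation (\<lambda>w. X w * Z w) = 0" if "X \<in> lin S" for X using that
 proof (induction rule: lin.induct)
  case (add X Y a)
  have "expectation (\<lambda>w. a * (X w * Z w) + Y w * Z w) = a * expectation (\<lambda>w. X w * Z w) + expectation (\<lambda>w. Y w * Z w)"
   using sqint_mult[OF S[OF add(1)] Z] sqint_mult[OF lin_sqint[OF add(2) S] Z] by simp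
  then show ?case using add orth by (simp add: distrib_right mult.assoc)
 qed simp
 have "(expectation (\<lambda>w. Y w * Z w))\<^sup>2 \<le> 0"
 proof (rule field_le_epsilon)
  fix e :: real assume e: "e > 0"
  have p: "ms Z + 1 > 0" using ms_nonneg[of Z] by linarith
  obtain Y' where Y': "Y' \<in> lin S" "sqint Y'" "sqint (\<lambda>w. Y w - Y' w)" "ms (\<lambda>w. Y w - Y' w) < e / (ms Z + 1)"
   using cspanE[OF Y divide_pos_pos[OF e p]] by metis
  have "expectation (\<lambda>w. (Y w - Y' w) * Z w) = expectation (\<lambda>w. Y w * Z w) - expectation (\<lambda>w. Y' w * Z w)"
   unfolding left_diff_distrib by (intro lint_diff sqint_mult cspan_sqint Y Z Y'(2))
  then have "expectation (\<lambda>w. Y w * Z w) = expectation (\<lambda>w. (Y w - Y' w) \<bullet> Z w)" using l[OF Y'(1)] by simp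
  then have "(expectation (\<lambda>w. Y w * Z w))\<^sup>2 \<le> ms (\<lambda>w. Y w - Y' w) * ms Z" using cs[OF Y'(3) Z] by simp
  also have "\<dots> \<le> e / (ms Z + 1) * (ms Z + 1)" using Y'(4) ms_nonneg[of Z] by (intro mult_mono) (auto simp: ms_nonneg e p less_imp_le)
  finally show "(expectation (\<lambda>w. Y w * Z w))\<^sup>2 \<le> 0 + e" using p by simp
 qed
 then show ?thesis by simp
qed

lemma vspan_sqint: "vspan S V ==> sqint V"
 unfolding vspan_def by (intro sqint_vecI cspan_sqint) auto

lemma vspan_add: "vspan S V ==> vspan S Z ==> vspan S (\<lambda>w. V w + Z w)"
 unfolding vspan_def by (auto intro!: cspan_add)

lemma vspan_diff: "vspan S V ==> vspan S Z ==> vspan S (\<lambda>w. V w - Z w)"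
 unfolding vspan_def by (auto intro!: cspan_diff)

lemma vspan_mv: "vspan S V ==> vspan S (\<lambda>w. A *v V w)"
 unfolding vspan_def matrix_vector_mult_def by (auto intro!: cspan_sum cspan_scale)

lemma vspan_sum: "(\<And>i. i \<in> I ==> vspan S (X i)) ==> vspan S (\<lambda>w. \<Sum>i\<in>I. X i w)"
 unfolding vspan_def by (auto intro!: cspan_sum)

lemma vspan_orthogonal:
 assumes V: "vspan S V" and Z: "sqint Z" and o: "\<And>X j. X \<in> S ==> expectation (\<lambda>w. X w * Z w $ j) = 0"
 shows "cov V Z = 0"
 using cspan_orthogonal[OF _ sqint_component[OF Z] o] V
 by (simp add: vec_eq_iff cov_component[OF vspan_sqint[OF V] Z] vspan_def)

lemma vspan_AE: "vspan S X ==> AE w in M. X w = Y w ==> Y \<in> borel_measurable M ==> vspan S Y"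
 unfolding vspan_def
proof
 fix i assume a: "\<forall>i. (\<lambda>w. X w $ i) \<in> cspan S" "AE w in M. X w = Y w" "Y \<in> borel_measurable M"
 show "(\<lambda>w. Y w $ i) \<in> cspan S"
  by (rule cspan_AE[OF spec[OF a(1), of i]]) (use a(2,3) in auto)
qed

end

lemma cspan_mono: "S \<subseteq> S' ==> Y \<in> cspan S ==> Y \<in> cspan S'"
 unfolding cspan_def using lin_mono by blast

lemma vspan_mono: "S \<subseteq> S' ==> vspan S V ==> vspan S' V"
 unfolding vspan_def using cspan_mono by blast

end

section \<open>Uniqueness and independence through characteristic functions\<close>

context prob_space
begin

lemma integrable_bounded:
 "f \<in> borel_measurable M ==> (\<And>w. norm (f w :: 'b::{banach,second_countable_topology}) \<le> c) ==> integrable M f"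
 by (rule integrable_const_bound[where B=c]) auto

lemma integrable_cos_sin:
 assumes "w \<in> borel_measurable M" "\<And>z. \<bar>w z :: real\<bar> \<le> c" "X \<in> borel_measurable M"
 shows "integrable M (\<lambda>z. w z * cos (X z))" "integrable M (\<lambda>z. w z * sin (X z))"
proof -
 have [measurable]: "w \<in> borel_measurable M" "X \<in> borel_measurable M" by fact+
 have c: "0 \<le> c" using assms(2)[of undefined] by linarith
 have "\<bar>w z * cos (X z)\<bar> \<le> c * 1" for z
  unfolding abs_mult by (rule mult_mono[OF assms(2) abs_cos_le_one]) (use c in auto)
 moreover have "\<bar>w z * sin (X z)\<bar> \<le> c * 1" for z
  unfolding abs_mult by (rule mult_mono[OF assms(2) abs_sin_le_one]) (use c in auto)
 ultimately show "integrable M (\<lambda>z. w z * cos (X z))" "integrable M (\<lambda>z. w z * sin (X z))"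
  by (intro integrable_bounded[where c=c]; simp)+
qed

text \<open>Weighting the probability by \<open>1 + w\<close> makes characteristic functions applicable to the signed
 measure with density \<open>w\<close>.\<close>

lemma weighted_uniqueness:
 fixes w Z :: "'a => real" and f :: "real => real"
 assumes w: "w \<in> borel_measurable M" "\<And>z. \<bar>w z\<bar> \<le> 1" and Z: "Z \<in> borel_measurable M"
  and c: "\<And>t. expectation (\<lambda>z. w z * cos (t * Z z)) = 0" and s: "\<And>t. expectation (\<lambda>z. w z * sin (t * Z z)) = 0"
  and f: "f \<in> borel_measurable borel" and fi: "integrable M (\<lambda>z. f (Z z))"
 shows "expectation (\<lambda>z. w z * f (Z z)) = 0"
proof -
 have [measurable]: "w \<in> borel_measurable M" "Z \<in> borel_measurable M" "f \<in> borel_measurable borel" by fact+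
 have w1: "0 \<le> 1 + w z" for z using w(2)[of z] by linarith
 define D where "D = density M (\<lambda>z. ennreal (1 + w z))"
 have wi: "integrable M w" by (rule integrable_bounded[where c=1]) (use w in auto)
 have Ew: "expectation w = 0" using c[of 0] by simp
 have "prob_space D"
 proof
  have "emeasure D (space D) = (\<integral>\<^sup>+z. ennreal (1 + w z) \<partial>M)" by (simp add: D_def emeasure_density cong: nn_integral_cong)
  also have "\<dots> = ennreal (expectation (\<lambda>z. 1 + w z))" by (rule nn_integral_eq_integral) (use wi w1 in auto)
  also have "\<dots> = 1" using wi Ew by (simp add: prob_space)
  finally show "emeasure D (space D) = 1" .
 qed
 then interpret D: prob_space D .
 have [measurable]: "Z \<in> borel_measurable D" by (simp add: D_def)
 have r1: "real_distribution (distr D borel Z)" and r2: "real_distribution (distr M borel Z)"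
  by (auto intro!: D.real_distribution_distr real_distribution_distr)
 have Di: "integral\<^sup>L D g = integral\<^sup>L M (\<lambda>z. (1 + w z) *\<^sub>R g z)" if "g \<in> borel_measurable M" for g :: "'a => complex"
  unfolding D_def by (rule integral_density) (use that w1 in auto)
 have "char (distr D borel Z) = char (distr M borel Z)"
 proof
  fix t
  have ie: "integrable M (\<lambda>z. iexp (t * Z z))" by (rule integrable_bounded[where c=1]) auto
  have wie: "integrable M (\<lambda>z. w z *\<^sub>R iexp (t * Z z))" by (rule integrable_bounded[where c=1]) (use w in auto)
  have "complex_lebesgue_integral M (\<lambda>z. w z *\<^sub>R iexp (t * Z z)) = 0"
  proof (rule complex_eqI)
   show "Re (complex_lebesgue_integral M (\<lambda>z. w z *\<^sub>R iexp (t * Z z))) = Re 0"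
    using c[of t] integral_Re[OF wie] by (simp add: Re_exp)
   show "Im (complex_lebesgue_integral M (\<lambda>z. w z *\<^sub>R iexp (t * Z z))) = Im 0"
    using s[of t] integral_Im[OF wie] by (simp add: Im_exp)
  qed
  then have "complex_lebesgue_integral M (\<lambda>z. (1 + w z) *\<^sub>R iexp (t * Z z)) = complex_lebesgue_integral M (\<lambda>z. iexp (t * Z z))"
   using ie wie by (simp add: scaleR_add_left)
  then show "char (distr D borel Z) t = char (distr M borel Z) t"
   by (simp add: char_def integral_distr Di)
 qed
 then have eq: "distr D borel Z = distr M borel Z" by (rule Levy_uniqueness[OF r1 r2])
 have "expectation (\<lambda>z. (1 + w z) * f (Z z)) = expectation (\<lambda>z. f (Z z))"
 proof -
  have "integral\<^sup>L D (\<lambda>z. f (Z z)) = expectation (\<lambda>z. (1 + w z) * f (Z z))"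
   unfolding D_def using integral_density[of "\<lambda>z. f (Z z)" M "\<lambda>z. 1 + w z"] w1 by simp
  moreover have "integral\<^sup>L D (\<lambda>z. f (Z z)) = integral\<^sup>L (distr D borel Z) f" by (simp add: integral_distr)
  moreover have "expectation (\<lambda>z. f (Z z)) = integral\<^sup>L (distr M borel Z) f" by (simp add: integral_distr)
  ultimately show ?thesis unfolding eq by simp
 qed
 moreover have "integrable M (\<lambda>z. w z * f (Z z))"
 proof (rule Bochner_Integration.integrable_bound[OF fi])
  show "AE z in M. norm (w z * f (Z z)) \<le> norm (f (Z z))"
   using w(2) by (intro AE_I2) (simp add: abs_mult mult_left_le_one_le)
 qed measurable
 ultimately show ?thesis using fi by (simp add: distrib_right)
qed

text \<open>Each indicator is absorbed into the weight, one variable at a time. The addition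
  formulas turn the hypothesis for \<open>L + t Z\<close> and \<open>L - t Z\<close> into vanishing
  integrals of \<open>w cos L\<close> and \<open>w sin L\<close> against \<open>cos (t Z)\<close>
  and \<open>sin (t Z)\<close>, so \<open>weighted_uniqueness\<close> applies with these two new
  weights.\<close>

lemma weighted_uniqueness_list:
 fixes w :: "'a => real"
 assumes "w \<in> borel_measurable M" "\<And>z. \<bar>w z\<bar> \<le> 1" "\<And>Z A. (Z, A) \<in> set zs ==> Z \<in> borel_measurable M \<and> A \<in> sets borel"
  and "\<And>L. L \<in> lin (fst ` set zs) ==> expectation (\<lambda>z. w z * cos (L z)) = 0 \<and> expectation (\<lambda>z. w z * sin (L z)) = 0"
 shows "expectation (\<lambda>z. w z * (\<Prod>(Z, A)\<leftarrow>zs. indicator A (Z z))) = 0"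
 using assms
proof (induction zs arbitrary: w)
 case Nil
 from Nil(4)[OF lin.zero] show ?case by simp
next
 case (Cons a zs)
 obtain Z A where a: "a = (Z, A)" by (cases a)
 note w [measurable] = Cons.prems(1)
 have Zm [measurable]: "Z \<in> borel_measurable M" and Am [measurable]: "A \<in> sets borel" using Cons.prems(3)[of Z A] a by auto
 let ?w = "\<lambda>z. w z * indicator A (Z z)"
 have "expectation (\<lambda>z. ?w z * (\<Prod>(Z, A)\<leftarrow>zs. indicator A (Z z))) = 0"
 proof (rule Cons.IH)
  show "?w \<in> borel_measurable M" by measurable
  show "\<bar>?w z\<bar> \<le> 1" for z using Cons.prems(2)[of z] by (simp add: indicator_def)
  show "Z \<in> borel_measurable M \<and> A \<in> sets borel" if "(Z, A) \<in> set zs" for Z A using Cons.prems(3)[of Z A] that by simp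
  fix L assume L: "L \<in> lin (fst ` set zs)"
  have Ll: "L \<in> lin (fst ` set (a # zs))" by (rule lin_mono[OF _ L]) auto
  have Zl: "Z \<in> lin (fst ` set (a # zs))" by (rule lin_base) (simp add: a)
  have fm: "X \<in> borel_measurable M" if "X \<in> fst ` set zs" for X
   using that Cons.prems(3) by force
  have "X \<in> lin (fst ` set zs) ==> X \<in> borel_measurable M" for X
  proof (induction rule: lin.induct)
   case (add X Y a)
   show ?case by (intro borel_measurable_add borel_measurable_times fm add measurable_const) simp
  qed simp
  then have Lm [measurable]: "L \<in> borel_measurable M" using L by blast
  have pm: "(\<lambda>z. L z + t * Z z) \<in> lin (fst ` set (a # zs))" for t by (rule lin_add[OF Ll lin_scale[OF Zl]])
  have ic: "integrable M (\<lambda>z. w z * cos (L z + t * Z z))" "integrable M (\<lambda>z. w z * sin (L z + t * Z z))" for t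
   by (rule integrable_cos_sin[OF w Cons.prems(2)], measurable)+
  have E: "expectation (\<lambda>z. w z * cos (L z + t * Z z)) = 0" "expectation (\<lambda>z. w z * sin (L z + t * Z z)) = 0" for t
   using Cons.prems(4)[OF pm] by auto
  have ind: "integrable M (\<lambda>z. indicator A (Z z) :: real)" by (rule integrable_bounded[where c=1]) (auto simp: indicator_def)
  have "expectation (\<lambda>z. (w z * cos (L z)) * indicator A (Z z)) = 0"
  proof (rule weighted_uniqueness[OF _ _ Zm _ _ _ ind])
   show "\<bar>w z * cos (L z)\<bar> \<le> 1" for z
    using mult_mono[OF Cons.prems(2)[of z] abs_cos_le_one[of "L z"]] by (simp add: abs_mult)
   fix t
   have "(\<lambda>z. w z * cos (L z) * cos (t * Z z)) = (\<lambda>z. (w z * cos (L z + t * Z z) + w z * cos (L z + (-t) * Z z)) / 2)"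
    by (auto simp: cos_add cos_diff field_simps)
   then show "expectation (\<lambda>z. w z * cos (L z) * cos (t * Z z)) = 0"
    using ic(1)[of t] ic(1)[of "-t"] E(1)[of t] E(1)[of "-t"] by simp
   have "(\<lambda>z. w z * cos (L z) * sin (t * Z z)) = (\<lambda>z. (w z * sin (L z + t * Z z) - w z * sin (L z + (-t) * Z z)) / 2)"
    by (auto simp: sin_add sin_diff field_simps)
   then show "expectation (\<lambda>z. w z * cos (L z) * sin (t * Z z)) = 0"
    using ic(2)[of t] ic(2)[of "-t"] E(2)[of t] E(2)[of "-t"] by simp
  qed measurable
  moreover have "expectation (\<lambda>z. (w z * sin (L z)) * indicator A (Z z)) = 0"
  proof (rule weighted_uniqueness[OF _ _ Zm _ _ _ ind])
   show "\<bar>w z * sin (L z)\<bar> \<le> 1" for z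
    using mult_mono[OF Cons.prems(2)[of z] abs_sin_le_one[of "L z"]] by (simp add: abs_mult)
   fix t
   have "(\<lambda>z. w z * sin (L z) * cos (t * Z z)) = (\<lambda>z. (w z * sin (L z + t * Z z) + w z * sin (L z + (-t) * Z z)) / 2)"
    by (auto simp: sin_add sin_diff field_simps)
   then show "expectation (\<lambda>z. w z * sin (L z) * cos (t * Z z)) = 0"
    using ic(2)[of t] ic(2)[of "-t"] E(2)[of t] E(2)[of "-t"] by simp
   have "(\<lambda>z. w z * sin (L z) * sin (t * Z z)) = (\<lambda>z. (w z * cos (L z + (-t) * Z z) - w z * cos (L z + t * Z z)) / 2)"
    by (auto simp: cos_add cos_diff field_simps)
   then show "expectation (\<lambda>z. w z * sin (L z) * sin (t * Z z)) = 0"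
    using ic(1)[of t] ic(1)[of "-t"] E(1)[of t] E(1)[of "-t"] by simp
  qed measurable
  ultimately show "expectation (\<lambda>z. ?w z * cos (L z)) = 0 \<and> expectation (\<lambda>z. ?w z * sin (L z)) = 0"
   by (simp add: mult_ac)
 qed
 then show ?case by (simp add: a mult.assoc)
qed

text \<open>Cylinders constraining finitely many of the variables are stable under intersection and
  generate the \<sigma>-algebra; the Dynkin argument extends the vanishing from them to all its
  sets.\<close>

lemma weighted_uniqueness_sigma:
 fixes w :: "'a => real" and ZZ :: "('a => real) set"
 assumes w: "w \<in> borel_measurable M" "\<And>z. \<bar>w z\<bar> \<le> 1" and ZZ: "\<And>Z. Z \<in> ZZ ==> Z \<in> borel_measurable M"
  and L: "\<And>L. L \<in> lin ZZ ==> expectation (\<lambda>z. w z * cos (L z)) = 0 \<and> expectation (\<lambda>z. w z * sin (L z)) = 0"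
  and A: "A \<in> sigma_sets (space M) {Z -` B \<inter> space M | Z B. Z \<in> ZZ \<and> B \<in> sets borel}"
 shows "expectation (\<lambda>z. w z * indicator A z) = 0"
proof -
 define cyl where "cyl = {{z \<in> space M. \<forall>(Z, B)\<in>set zs. Z z \<in> B} | zs. \<forall>(Z, B)\<in>set zs. Z \<in> ZZ \<and> B \<in> sets borel}"
 have wi: "integrable M (\<lambda>z. w z * indicator A z)" if "A \<in> events" for A
  by (rule integrable_bounded[where c=1]) (use w that in \<open>auto simp: indicator_def\<close>)
 have base: "expectation (\<lambda>z. w z * indicator A z) = 0 \<and> A \<in> events" if "A \<in> cyl" for A
 proof -
  obtain zs where zs: "A = {z \<in> space M. \<forall>(Z, B)\<in>set zs. Z z \<in> B}" "\<forall>(Z, B)\<in>set zs. Z \<in> ZZ \<and> B \<in> sets borel"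
   using \<open>A \<in> cyl\<close> unfolding cyl_def by blast
  have "(\<Prod>(Z, B)\<leftarrow>zs. indicator B (Z z)) = (indicator A z :: real)" if "z \<in> space M" for z
   using that unfolding zs(1) by (induction zs) (auto simp: indicator_def)
  then have "expectation (\<lambda>z. w z * indicator A z) = expectation (\<lambda>z. w z * (\<Prod>(Z, B)\<leftarrow>zs. indicator B (Z z)))"
   by (intro lint_cong) auto
  also have "\<dots> = 0"
  proof (rule weighted_uniqueness_list[OF w])
   have "fst ` set zs \<subseteq> ZZ" using zs(2) by auto
   then show "expectation (\<lambda>z. w z * cos (L z)) = 0 \<and> expectation (\<lambda>z. w z * sin (L z)) = 0"
    if "L \<in> lin (fst ` set zs)" for L using L[OF lin_mono[OF _ that]] by blast
  qed (use zs(2) ZZ in auto)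
  finally have 1: "expectation (\<lambda>z. w z * indicator A z) = 0" .
  have "A \<in> events" unfolding zs(1) split_beta'
  proof (rule sets.sets_Collect_finite_All)
   fix x assume "x \<in> set zs"
   then have "fst x \<in> borel_measurable M" "snd x \<in> sets borel" using zs(2) ZZ by auto
   from measurable_sets[OF this] show "{z \<in> space M. fst x z \<in> snd x} \<in> events" by (simp add: vimage_def Int_def conj_commute)
  qed simp
  with 1 show ?thesis by blast
 qed
 have int: "Int_stable cyl"
 proof (rule Int_stableI)
  fix a b assume "a \<in> cyl" "b \<in> cyl"
  then obtain zs zs' where zs: "a = {z \<in> space M. \<forall>(Z, B)\<in>set zs. Z z \<in> B}" "\<forall>(Z, B)\<in>set zs. Z \<in> ZZ \<and> B \<in> sets borel"
   and zs': "b = {z \<in> space M. \<forall>(Z, B)\<in>set zs'. Z z \<in> B}" "\<forall>(Z, B)\<in>set zs'. Z \<in> ZZ \<and> B \<in> sets borel"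
   by (auto simp: cyl_def)
  show "a \<inter> b \<in> cyl" unfolding cyl_def
   by (rule CollectI, rule exI[of _ "zs @ zs'"]) (use zs zs' in auto)
 qed
 have sp: "cyl \<subseteq> Pow (space M)" by (auto simp: cyl_def)
 have "{Z -` B \<inter> space M | Z B. Z \<in> ZZ \<and> B \<in> sets borel} \<subseteq> cyl"
 proof
  fix x assume "x \<in> {Z -` B \<inter> space M | Z B. Z \<in> ZZ \<and> B \<in> sets borel}"
  then obtain Z B where "x = Z -` B \<inter> space M" "Z \<in> ZZ" "B \<in> sets borel" by auto
  then show "x \<in> cyl" unfolding cyl_def by (intro CollectI exI[of _ "[(Z, B)]"]) auto
 qed
 then have Ac: "A \<in> sigma_sets (space M) cyl" using A sigma_sets_mono' by blast
 have "expectation (\<lambda>z. w z * indicator A z) = 0 \<and> A \<in> events"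
  using int sp Ac
 proof (induction rule: sigma_sets_induct_disjoint)
  case (basic A) then show ?case by (rule base)
 next
  case empty then show ?case by simp
 next
  case (compl A)
  have "space M \<in> cyl" unfolding cyl_def by (rule CollectI, rule exI[of _ "[]"]) auto
  then have s: "expectation (\<lambda>z. w z * indicator (space M) z) = 0" using base by blast
  have "expectation (\<lambda>z. w z * indicator (space M - A) z) = expectation (\<lambda>z. w z * indicator (space M) z - w z * indicator A z)"
   by (rule lint_cong) (auto simp: indicator_def)
  also have "\<dots> = 0" using compl(2) s wi[of A] wi[of "space M"] by (subst lint_diff) auto
  finally show ?case using compl(2) by auto
 next
  case (union A)
  have ev: "range A \<subseteq> events" using union(3) by auto
  have "(\<lambda>n. expectation (\<lambda>z. \<Sum>i<n. w z * indicator (A i) z)) \<longlonglongrightarrow> expectation (\<lambda>z. w z * indicator (\<Union>i. A i) z)"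
  proof (rule integral_dominated_convergence[where w="\<lambda>_. 1"])
   show "(\<lambda>z. w z * indicator (\<Union>i. A i) z) \<in> borel_measurable M" using w ev by measurable
   show "(\<lambda>z. \<Sum>i<n. w z * indicator (A i) z) \<in> borel_measurable M" for n using w ev by measurable
   have sumind: "(\<Sum>i<n. indicator (A i) z) = (indicator (\<Union>i<n. A i) z :: real)" for n z
    by (rule indicator_UN_disjoint[symmetric]) (use union(1) in \<open>auto simp: disjoint_family_on_def\<close>)
   show "AE z in M. (\<lambda>n. \<Sum>i<n. w z * indicator (A i) z) \<longlonglongrightarrow> w z * indicator (\<Union>i. A i) z"
    unfolding sum_distrib_left[symmetric] sumind by (intro AE_I2 tendsto_intros LIMSEQ_indicator_UN)
   show "AE z in M. norm (\<Sum>i<n. w z * indicator (A i) z) \<le> 1" for n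
    unfolding sum_distrib_left[symmetric] sumind using w(2) by (intro AE_I2) (auto simp: indicator_def)
  qed auto
  moreover have "expectation (\<lambda>z. \<Sum>i<n. w z * indicator (A i) z) = 0" for n
   using union(3) wi by (subst Bochner_Integration.integral_sum) auto
  ultimately have "expectation (\<lambda>z. w z * indicator (\<Union>i. A i) z) = 0" using LIMSEQ_unique tendsto_const by simp blast
  then show ?case using ev by auto
 qed
 then show ?thesis by blast
qed

text \<open>Joint Gaussianity through characteristic functions: as \<open>lin S\<close> is closed
  under scaling, the values at argument 1 determine those at all arguments. Splitting into cosine
  and sine keeps everything real, and degenerate variables are covered by
  \<open>ms Y = 0\<close>.\<close>

definition gaussian_family :: "('a => real) set => bool" where
 "gaussian_family S \<longleftrightarrow> (\<forall>X\<in>S. sqint X) \<and> (\<forall>Y\<in>lin S. expectation Y = 0 \<and>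
   expectation (\<lambda>w. cos (Y w)) = exp (- ms Y / 2) \<and> expectation (\<lambda>w. sin (Y w)) = 0)"

context
 fixes S :: "('a => real) set"
 assumes G: "gaussian_family S"
begin

lemma gf_sqint: "X \<in> S ==> sqint X"
 using G by (simp add: gaussian_family_def)

text \<open>All three formulas are stable under mean square limits: the identity, cosine and sine
  are 1-Lipschitz, so their expectations converge with the mean absolute error, and
  \<open>ms\<close> is continuous. The approximation error is squared so that the mean absolute
  error is at most \<open>1 / (n + 1)\<close>.\<close>

lemma gf_cspan:
 assumes Y: "Y \<in> cspan S"
 shows "expectation Y = 0" "expectation (\<lambda>w. cos (Y w)) = exp (- ms Y / 2)" "expectation (\<lambda>w. sin (Y w)) = 0"
proof -
 note sq = cspan_sqint[OF gf_sqint Y]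
 have "\<exists>X. X \<in> lin S \<and> sqint X \<and> ms (\<lambda>w. Y w - X w) < (inverse (real (Suc n)))\<^sup>2" for n
  using cspanE[OF gf_sqint Y, of "(inverse (real (Suc n)))\<^sup>2"] by (metis zero_less_power inverse_positive_iff_positive of_nat_0_less_iff zero_less_Suc)
 then obtain X where X: "\<And>n. X n \<in> lin S" "\<And>n. sqint (X n)" "\<And>n. ms (\<lambda>w. Y w - X n w) < (inverse (real (Suc n)))\<^sup>2"
  by metis
 have d: "sqint (\<lambda>w. Y w - X n w)" for n by (rule sqint_diff[OF sq X(2)])
 have L1: "expectation (\<lambda>w. \<bar>Y w - X n w\<bar>) \<le> inverse (real (Suc n))" for n
 proof -
  have "(expectation (\<lambda>w. \<bar>Y w - X n w\<bar> \<bullet> 1))\<^sup>2 \<le> ms (\<lambda>w. \<bar>Y w - X n w\<bar>) * ms (\<lambda>w. 1 :: real)"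
   by (rule cs) (use d[of n] in \<open>auto simp: sqint_def\<close>)
  also have "\<dots> = ms (\<lambda>w. Y w - X n w)" by (simp add: ms_def prob_space)
  finally have "(expectation (\<lambda>w. \<bar>Y w - X n w\<bar> \<bullet> 1))\<^sup>2 \<le> (inverse (real (Suc n)))\<^sup>2" using X(3)[of n] by linarith
  then have "(expectation (\<lambda>w. \<bar>Y w - X n w\<bar>))\<^sup>2 \<le> (inverse (real (Suc n)))\<^sup>2" by (simp only: inner_real_def mult_1_right)
  then show ?thesis by (rule power2_le_imp_le) simp
 qed
 have lip: "(\<lambda>n. expectation (\<lambda>w. h (X n w))) \<longlonglongrightarrow> expectation (\<lambda>w. h (Y w))"
  if h: "\<And>x y. \<bar>h x - h y :: real\<bar> \<le> \<bar>x - y\<bar>" and hm: "h \<in> borel_measurable borel"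
   and hi: "\<And>V. sqint V ==> integrable M (\<lambda>w. h (V w))" for h
 proof (rule LIM_zero_cancel, rule Lim_null_comparison)
  show "(\<lambda>n. inverse (real (Suc n))) \<longlonglongrightarrow> 0" by (rule LIMSEQ_inverse_real_of_nat)
  have "norm (expectation (\<lambda>w. h (X n w)) - expectation (\<lambda>w. h (Y w))) \<le> inverse (real (Suc n))" for n
  proof -
   have "norm (expectation (\<lambda>w. h (X n w)) - expectation (\<lambda>w. h (Y w))) = \<bar>expectation (\<lambda>w. h (X n w) - h (Y w))\<bar>"
    using hi[OF X(2)[of n]] hi[OF sq] by simp
   also have "\<dots> \<le> expectation (\<lambda>w. \<bar>h (X n w) - h (Y w)\<bar>)" by (rule integral_abs_bound)
   also have "\<dots> \<le> expectation (\<lambda>w. \<bar>Y w - X n w\<bar>)"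
    by (rule integral_mono) (use h hi[OF X(2)[of n]] hi[OF sq] sqint_integrable[OF d[of n]] in \<open>auto simp: abs_minus_commute\<close>)
   finally show ?thesis using L1[of n] by linarith
  qed
  then show "\<forall>\<^sub>F n in sequentially. norm (expectation (\<lambda>w. h (X n w)) - expectation (\<lambda>w. h (Y w))) \<le> inverse (real (Suc n))"
   by simp
 qed
 have ms: "(\<lambda>n. ms (X n)) \<longlonglongrightarrow> ms Y"
 proof (rule LIM_zero_cancel, rule Lim_null_comparison)
  define e where "e n = inverse (real (Suc n))" for n
  have e0: "e \<longlonglongrightarrow> 0" unfolding e_def by (rule LIMSEQ_inverse_real_of_nat)
  show "(\<lambda>n. (e n)\<^sup>2 + 2 * (e n * sqrt (ms Y))) \<longlonglongrightarrow> 0"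
   using tendsto_add[OF tendsto_power[OF e0, of 2] tendsto_mult[OF tendsto_const[of 2] tendsto_mult[OF e0 tendsto_const[of "sqrt (ms Y)"]]]] by simp
  have "norm (ms (X n) - ms Y) \<le> (e n)\<^sup>2 + 2 * (e n * sqrt (ms Y))" for n
  proof -
   define D where "D w = Y w - X n w" for w
   have D: "sqint D" using d[of n] by (simp add: D_def[abs_def])
   have "ms (X n) = expectation (\<lambda>w. (Y w)\<^sup>2 + (D w)\<^sup>2 - 2 * (D w * Y w))"
    unfolding ms_real by (rule lint_cong) (auto simp: D_def power2_eq_square algebra_simps)
   also have "\<dots> = ms Y + ms D - 2 * expectation (\<lambda>w. D w * Y w)"
    using sq D sqint_mult[OF D sq] by (simp add: ms_real sqint_def)
   finally have "\<bar>ms (X n) - ms Y\<bar> \<le> ms D + 2 * \<bar>expectation (\<lambda>w. D w * Y w)\<bar>" using ms_nonneg[of D] by linarith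
   moreover have mD: "ms D \<le> (e n)\<^sup>2" using X(3)[of n] by (simp add: D_def[abs_def] e_def)
   moreover have "\<bar>expectation (\<lambda>w. D w * Y w)\<bar> \<le> e n * sqrt (ms Y)"
   proof -
    have "(expectation (\<lambda>w. D w * Y w))\<^sup>2 \<le> ms D * ms Y" using cs[OF D sq] by simp
    also have "\<dots> \<le> (e n)\<^sup>2 * ms Y" by (rule mult_right_mono[OF mD ms_nonneg])
    also have "\<dots> = (e n * sqrt (ms Y))\<^sup>2" by (simp add: power_mult_distrib ms_nonneg)
    finally show ?thesis using ms_nonneg[of Y] by (intro power2_le_imp_le[of "\<bar>x\<bar>" for x]) (auto simp: e_def)
   qed
   ultimately show ?thesis by simp
  qed
  then show "\<forall>\<^sub>F n in sequentially. norm (ms (X n) - ms Y) \<le> (e n)\<^sup>2 + 2 * (e n * sqrt (ms Y))" by simp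
 qed
 have gl: "expectation (X n) = 0" "expectation (\<lambda>w. cos (X n w)) = exp (- ms (X n) / 2)" "expectation (\<lambda>w. sin (X n w)) = 0" for n
  using G X(1)[of n] by (auto simp: gaussian_family_def)
 have "(\<lambda>n. expectation (\<lambda>w. X n w)) \<longlonglongrightarrow> expectation (\<lambda>w. Y w)" by (rule lip[of "\<lambda>x. x"]) (auto intro: sqint_integrable)
 then show "expectation Y = 0" unfolding gl using LIMSEQ_unique[OF _ tendsto_const] by auto
 have lc: "\<bar>cos x - cos y\<bar> \<le> \<bar>x - y\<bar>" and ls: "\<bar>sin x - sin y\<bar> \<le> \<bar>x - y\<bar>" for x y :: real
 proof -
  have "\<bar>cos x - cos y\<bar> = 2 * (\<bar>sin ((x + y) / 2)\<bar> * \<bar>sin ((y - x) / 2)\<bar>)" by (simp add: cos_diff_cos abs_mult)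
  also have "\<dots> \<le> 2 * (1 * \<bar>(y - x) / 2\<bar>)"
   by (intro mult_left_mono mult_mono abs_sin_le_one abs_sin_x_le_abs_x) auto
  finally show "\<bar>cos x - cos y\<bar> \<le> \<bar>x - y\<bar>" by (simp add: abs_minus_commute)
  have "\<bar>sin x - sin y\<bar> = 2 * (\<bar>sin ((x - y) / 2)\<bar> * \<bar>cos ((x + y) / 2)\<bar>)" by (simp add: sin_diff_sin abs_mult)
  also have "\<dots> \<le> 2 * (\<bar>(x - y) / 2\<bar> * 1)"
   by (intro mult_left_mono mult_mono abs_cos_le_one abs_sin_x_le_abs_x) auto
  finally show "\<bar>sin x - sin y\<bar> \<le> \<bar>x - y\<bar>" by simp
 qed
 have "(\<lambda>n. expectation (\<lambda>w. cos (X n w))) \<longlonglongrightarrow> expectation (\<lambda>w. cos (Y w))"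
  by (rule lip[OF lc]) (auto intro!: integrable_bounded[where c=1] dest: sqintD)
 moreover have "(\<lambda>n. exp (- ms (X n) / 2)) \<longlonglongrightarrow> exp (- ms Y / 2)" by (intro tendsto_intros ms) simp
 ultimately show "expectation (\<lambda>w. cos (Y w)) = exp (- ms Y / 2)" unfolding gl by (rule LIMSEQ_unique)
 have "(\<lambda>n. expectation (\<lambda>w. sin (X n w))) \<longlonglongrightarrow> expectation (\<lambda>w. sin (Y w))"
  by (rule lip[OF ls]) (auto intro!: integrable_bounded[where c=1] dest: sqintD)
 then show "expectation (\<lambda>w. sin (Y w)) = 0" unfolding gl using LIMSEQ_unique[OF _ tendsto_const] by auto
qed

text \<open>For Gaussian variables almost sure convergence improves to mean square convergence: the
 characteristic function controls the variance of the differences.\<close>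

lemma gf_AE_limit:
 assumes X: "\<And>n. X n \<in> cspan S" and lim: "AE z in M. (\<lambda>n. X n z) \<longlonglongrightarrow> Y z" and Y: "Y \<in> borel_measurable M"
 shows "Y \<in> cspan S" "(\<lambda>n. ms (\<lambda>z. X n z - Y z)) \<longlonglongrightarrow> 0"
proof -
 note sq = cspan_sqint[OF gf_sqint X]
 note [measurable] = Y sqintD[OF sq]
 have cau: "\<exists>N. \<forall>n\<ge>N. \<forall>m\<ge>N. ms (\<lambda>z. X n z - X m z) < e" if e: "e > 0" for e
 proof (rule ccontr)
  assume "\<nexists>N. \<forall>n\<ge>N. \<forall>m\<ge>N. ms (\<lambda>z. X n z - X m z) < e"
  then have "\<forall>N. \<exists>n m. n \<ge> N \<and> m \<ge> N \<and> e \<le> ms (\<lambda>z. X n z - X m z)" by (meson not_le)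
  then obtain n m where nm: "\<And>N. n N \<ge> N" "\<And>N. m N \<ge> N" "\<And>N. e \<le> ms (\<lambda>z. X (n N) z - X (m N) z)" by metis
  have fn: "filterlim n at_top sequentially" and fm: "filterlim m at_top sequentially"
   using nm by (auto intro!: filterlim_at_top_mono[OF filterlim_ident])
  have "(\<lambda>N. expectation (\<lambda>z. cos (X (n N) z - X (m N) z))) \<longlonglongrightarrow> expectation (\<lambda>z. cos 0)"
  proof (rule integral_dominated_convergence[where w="\<lambda>_. 1"])
   show "AE z in M. (\<lambda>N. cos (X (n N) z - X (m N) z)) \<longlonglongrightarrow> cos 0"
    using lim
   proof eventually_elim
    case (elim z)
    have "(\<lambda>N. X (n N) z - X (m N) z) \<longlonglongrightarrow> Y z - Y z"
     by (intro tendsto_diff filterlim_compose[OF elim fn] filterlim_compose[OF elim fm])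
    then show ?case by (intro tendsto_cos) simp
   qed
  qed auto
  then have "(\<lambda>N. exp (- ms (\<lambda>z. X (n N) z - X (m N) z) / 2)) \<longlonglongrightarrow> 1"
   using gf_cspan(2)[OF cspan_diff[OF gf_sqint X X]] by (simp add: prob_space)
  moreover have "exp (- ms (\<lambda>z. X (n N) z - X (m N) z) / 2) \<le> exp (- e / 2)" for N using nm(3)[of N] by simp
  ultimately have "1 \<le> exp (- e / 2)" by (intro LIMSEQ_le_const2) auto
  then show False using e by simp
 qed
 \<comment> \<open>Fatou's lemma carries the Cauchy estimate between members of the sequence over to
   the almost sure limit, whose square integrability is not yet known.\<close>
 have fat: "sqint (\<lambda>z. X n z - Y z) \<and> ms (\<lambda>z. X n z - Y z) \<le> e"
  if N: "\<forall>n\<ge>N. \<forall>m\<ge>N. ms (\<lambda>z. X n z - X m z) < e" and n: "n \<ge> N" for n N e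
 proof -
  have "(\<integral>\<^sup>+z. ennreal ((X n z - Y z)\<^sup>2) \<partial>M) = (\<integral>\<^sup>+z. liminf (\<lambda>m. ennreal ((X n z - X m z)\<^sup>2)) \<partial>M)"
  proof (rule nn_integral_cong_AE)
   show "AE z in M. ennreal ((X n z - Y z)\<^sup>2) = liminf (\<lambda>m. ennreal ((X n z - X m z)\<^sup>2))"
    using lim
   proof eventually_elim
    case (elim z)
    have "(\<lambda>m. ennreal ((X n z - X m z)\<^sup>2)) \<longlonglongrightarrow> ennreal ((X n z - Y z)\<^sup>2)"
     by (intro tendsto_ennrealI tendsto_intros elim)
    from lim_imp_Liminf[OF _ this] show ?case by simp
   qed
  qed
  also have "\<dots> \<le> liminf (\<lambda>m. \<integral>\<^sup>+z. ennreal ((X n z - X m z)\<^sup>2) \<partial>M)"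
   by (rule nn_integral_liminf) measurable
  also have "\<dots> \<le> ennreal e"
  proof (rule Liminf_le)
   show "\<forall>\<^sub>F m in sequentially. (\<integral>\<^sup>+z. ennreal ((X n z - X m z)\<^sup>2) \<partial>M) \<le> ennreal e"
   proof (rule eventually_sequentiallyI[of N])
    fix m assume m: "m \<ge> N"
    have "(\<integral>\<^sup>+z. ennreal ((X n z - X m z)\<^sup>2) \<partial>M) = ennreal (ms (\<lambda>z. X n z - X m z))"
     unfolding ms_real by (rule nn_integral_eq_integral) (use sqint_diff[OF sq sq, of n m] in \<open>auto simp: sqint_def\<close>)
    then show "(\<integral>\<^sup>+z. ennreal ((X n z - X m z)\<^sup>2) \<partial>M) \<le> ennreal e"
     using ennreal_leI[OF less_imp_le[OF N[rule_format, OF n m]]] by simp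
   qed
  qed simp
  finally have le: "(\<integral>\<^sup>+z. ennreal ((X n z - Y z)\<^sup>2) \<partial>M) \<le> ennreal e" .
  have e0: "0 \<le> e" using N n ms_nonneg[of "\<lambda>z. X n z - X n z"] by (meson less_imp_le order_trans)
  have i: "integrable M (\<lambda>z. (X n z - Y z)\<^sup>2)"
   by (rule integrableI_bounded) (use le in \<open>auto simp: le_less_trans[OF _ ennreal_less_top]\<close>)
  have "ennreal (ms (\<lambda>z. X n z - Y z)) = (\<integral>\<^sup>+z. ennreal ((X n z - Y z)\<^sup>2) \<partial>M)"
   unfolding ms_real by (rule nn_integral_eq_integral[symmetric]) (use i in auto)
  with le have "ms (\<lambda>z. X n z - Y z) \<le> e" using e0 by (metis ennreal_le_iff)
  with i show ?thesis by (simp add: sqint_def)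
 qed
 show l: "(\<lambda>n. ms (\<lambda>z. X n z - Y z)) \<longlonglongrightarrow> 0"
 proof (rule LIMSEQ_I)
  fix e :: real assume e: "e > 0"
  obtain N where N: "\<forall>n\<ge>N. \<forall>m\<ge>N. ms (\<lambda>z. X n z - X m z) < e / 2" using cau[of "e / 2"] e by auto
  show "\<exists>N. \<forall>n\<ge>N. norm (ms (\<lambda>z. X n z - Y z) - 0) < e"
  proof (intro exI allI impI)
   fix n assume "n \<ge> N"
   from fat[OF N this] e ms_nonneg[of "\<lambda>z. X n z - Y z"] show "norm (ms (\<lambda>z. X n z - Y z) - 0) < e" by simp
  qed
 qed
 obtain N where N: "\<forall>n\<ge>N. \<forall>m\<ge>N. ms (\<lambda>z. X n z - X m z) < 1" using cau[of 1] by auto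
 have "sqint (\<lambda>z. X N z - (X N z - Y z))" by (rule sqint_diff[OF sq]) (use fat[OF N, of N] in auto)
 then have sY: "sqint Y" by simp
 show "Y \<in> cspan S"
 proof (rule cspan_limit[OF gf_sqint _ sY])
  fix e :: real assume e: "e > 0"
  then have "\<forall>\<^sub>F n in sequentially. ms (\<lambda>z. X n z - Y z) < e" using order_tendstoD(2)[OF l] by blast
  then obtain n where "ms (\<lambda>z. X n z - Y z) < e" by (auto simp: eventually_sequentially)
  then show "\<exists>Z\<in>cspan S. ms (\<lambda>z. Y z - Z z) < e" using X[of n] by (auto simp: ms_minus_commute)
 qed
qed

text \<open>For orthogonal \<open>L\<close> and \<open>Y\<close> the second moments of
  \<open>L + t Y\<close> add up, so the characteristic function factorises. Uniqueness is then used
  twice: with the centred cosine and sine of \<open>t Y\<close> as weights, to reach events of the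
  \<sigma>-algebra generated by \<open>ZZ\<close>, and with the centred indicator of
  \<open>A\<close> as weight, to reach functions of \<open>Y\<close>.\<close>

lemma gf_independent:
 assumes Y: "Y \<in> cspan S" and ZZ: "ZZ \<subseteq> cspan S" and orth: "\<And>Z. Z \<in> ZZ ==> expectation (\<lambda>w. Z w * Y w) = 0"
  and A: "A \<in> sigma_sets (space M) {Z -` B \<inter> space M | Z B. Z \<in> ZZ \<and> B \<in> sets borel}" and AM: "A \<in> events"
  and f: "f \<in> borel_measurable borel" and fi: "integrable M (\<lambda>w. f (Y w))"
 shows "expectation (\<lambda>w. f (Y w) * indicator A w) = expectation (\<lambda>w. f (Y w)) * prob A"
proof -
 note sY = cspan_sqint[OF gf_sqint Y]
 have ZZsq: "Z \<in> ZZ ==> sqint Z" for Z using ZZ cspan_sqint[OF gf_sqint] by blast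
 note [measurable] = sqintD[OF sY] AM f
 have Lc: "L \<in> cspan S" "expectation (\<lambda>w. L w * Y w) = 0" if "L \<in> lin ZZ" for L
 proof -
  have "L \<in> cspan ZZ" by (rule lin_cspan[OF ZZsq that])
  then show "L \<in> cspan S" using cspan_idem[where S=S and S'=ZZ, OF gf_sqint] ZZ by blast
  show "expectation (\<lambda>w. L w * Y w) = 0" by (rule cspan_orthogonal[OF ZZsq \<open>L \<in> cspan ZZ\<close> sY orth])
 qed
 have comb: "expectation (\<lambda>w. cos (L w + t * Y w)) = exp (- ms L / 2) * exp (- ms (\<lambda>w. t * Y w) / 2)"
  "expectation (\<lambda>w. sin (L w + t * Y w)) = 0" if L: "L \<in> lin ZZ" for L t
 proof -
  note c = cspan_add[OF gf_sqint Lc(1)[OF L] cspan_scale[OF gf_sqint Y]]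
  note sL = cspan_sqint[OF gf_sqint Lc(1)[OF L]]
  have "ms (\<lambda>w. L w + t * Y w) = expectation (\<lambda>w. (L w)\<^sup>2 + (t * Y w)\<^sup>2 + (2 * t) * (L w * Y w))"
   unfolding ms_real by (rule lint_cong) (auto simp: power2_eq_square algebra_simps)
  also have "\<dots> = ms L + ms (\<lambda>w. t * Y w)"
   using sL sqint_cmult[OF sY, of t] sqint_mult[OF sL sY] Lc(2)[OF L] by (simp add: ms_real sqint_def)
  finally have "ms (\<lambda>w. L w + t * Y w) = ms L + ms (\<lambda>w. t * Y w)" .
  then show "expectation (\<lambda>w. cos (L w + t * Y w)) = exp (- ms L / 2) * exp (- ms (\<lambda>w. t * Y w) / 2)"
   using gf_cspan(2)[OF c] by (simp add: exp_add[symmetric] add_divide_distrib)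
  show "expectation (\<lambda>w. sin (L w + t * Y w)) = 0" by (rule gf_cspan(3)[OF c])
 qed
 have bi: "integrable M (\<lambda>w. cos (V w))" "integrable M (\<lambda>w. sin (V w))" if "sqint V" for V :: "'a => real"
  by (rule integrable_bounded[where c=1]; use sqintD[OF that] in simp)+
 have tY: "(\<lambda>w. t * Y w) \<in> cspan S" for t by (rule cspan_scale[OF gf_sqint Y])
 have trig: "expectation (\<lambda>w. cos (t * Y w) * cos (L w)) = expectation (\<lambda>w. cos (t * Y w)) * expectation (\<lambda>w. cos (L w))"
  "expectation (\<lambda>w. cos (t * Y w) * sin (L w)) = 0" "expectation (\<lambda>w. sin (t * Y w) * cos (L w)) = 0"
  "expectation (\<lambda>w. sin (t * Y w) * sin (L w)) = 0" if L: "L \<in> lin ZZ" for L t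
 proof -
  note sL = cspan_sqint[OF gf_sqint Lc(1)[OF L]]
  have i: "integrable M (\<lambda>w. cos (L w + t * Y w))" "integrable M (\<lambda>w. sin (L w + t * Y w))" for t
   using bi[OF sqint_add[OF sL sqint_cmult[OF sY, of t]]] by auto
  have m: "ms (\<lambda>w. - t * Y w) = ms (\<lambda>w. t * Y w)" using ms_scale[of t Y] ms_scale[of "-t" Y] by simp
  have "(\<lambda>w. cos (t * Y w) * cos (L w)) = (\<lambda>w. (cos (L w + t * Y w) + cos (L w + (-t) * Y w)) / 2)"
   by (auto simp: cos_add cos_diff field_simps)
  then show "expectation (\<lambda>w. cos (t * Y w) * cos (L w)) = expectation (\<lambda>w. cos (t * Y w)) * expectation (\<lambda>w. cos (L w))"
   using i(1)[of t] i(1)[of "-t"] comb(1)[OF L, of t] comb(1)[OF L, of "-t"] m gf_cspan(2)[OF tY] gf_cspan(2)[OF Lc(1)[OF L]] by simp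
  have "(\<lambda>w. cos (t * Y w) * sin (L w)) = (\<lambda>w. (sin (L w + t * Y w) + sin (L w + (-t) * Y w)) / 2)"
   by (auto simp: sin_add sin_diff field_simps)
  then show "expectation (\<lambda>w. cos (t * Y w) * sin (L w)) = 0"
   using i(2)[of t] i(2)[of "-t"] comb(2)[OF L, of t] comb(2)[OF L, of "-t"] by simp
  have "(\<lambda>w. sin (t * Y w) * cos (L w)) = (\<lambda>w. (sin (L w + t * Y w) - sin (L w + (-t) * Y w)) / 2)"
   by (auto simp: sin_add sin_diff field_simps)
  then show "expectation (\<lambda>w. sin (t * Y w) * cos (L w)) = 0"
   using i(2)[of t] i(2)[of "-t"] comb(2)[OF L, of t] comb(2)[OF L, of "-t"] by simp
  have "(\<lambda>w. sin (t * Y w) * sin (L w)) = (\<lambda>w. (cos (L w + (-t) * Y w) - cos (L w + t * Y w)) / 2)"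
   by (auto simp: cos_add cos_diff field_simps)
  then show "expectation (\<lambda>w. sin (t * Y w) * sin (L w)) = 0"
   using i(1)[of t] i(1)[of "-t"] comb(1)[OF L, of t] comb(1)[OF L, of "-t"] m by simp
 qed
 have ZZm: "Z \<in> ZZ ==> Z \<in> borel_measurable M" for Z using ZZsq sqintD by blast
 have Ai: "integrable M (\<lambda>w. indicator A w :: real)"
  by (rule integrable_bounded[where c=1]) (auto simp: indicator_def)
 \<comment> \<open>The claim says that this centred indicator is orthogonal to
   \<open>f (Y)\<close>.\<close>
 define v where "v w = indicator A w - prob A" for w
 have vm [measurable]: "v \<in> borel_measurable M" unfolding v_def[abs_def] by measurable
 have v1: "\<bar>v w\<bar> \<le> 1" for w using prob_le_1[of A] by (auto simp: v_def indicator_def)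
 have vE: "expectation (\<lambda>w. v w * h w) = 0" if hA: "expectation (\<lambda>w. (h w - expectation h) / 2 * indicator A w) = 0"
  and h: "h \<in> borel_measurable M" "\<And>w. \<bar>h w\<bar> \<le> 1" for h
 proof -
  have hi: "integrable M h" by (rule integrable_bounded[where c=1]) (use h in auto)
  have hAi: "integrable M (\<lambda>w. h w * indicator A w)" by (rule integrable_bounded[where c=1]) (use h in \<open>auto simp: indicator_def\<close>)
  have "expectation (\<lambda>w. (h w - expectation h) / 2 * indicator A w) = expectation (\<lambda>w. (h w * indicator A w - expectation h * indicator A w) / 2)"
   by (rule lint_cong) (auto simp: field_simps)
  also have "\<dots> = (expectation (\<lambda>w. h w * indicator A w) - expectation h * prob A) / 2" using hAi Ai by simp
  finally have "expectation (\<lambda>w. h w * indicator A w) = expectation h * prob A" using hA by simp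
  moreover have "expectation (\<lambda>w. v w * h w) = expectation (\<lambda>w. h w * indicator A w - prob A * h w)"
   by (rule lint_cong) (auto simp: v_def algebra_simps)
  ultimately show ?thesis using hAi hi by simp
 qed
 have "expectation (\<lambda>w. v w * f (Y w)) = 0"
 proof (rule weighted_uniqueness[OF vm v1 _ _ _ f fi])
  fix t
  have i: "integrable M (\<lambda>w. cos (t * Y w) * cos (L w))" "integrable M (\<lambda>w. cos (t * Y w) * sin (L w))"
    "integrable M (\<lambda>w. cos (L w))" "integrable M (\<lambda>w. sin (L w))" if "L \<in> lin ZZ" for L
   using integrable_cos_sin[of "\<lambda>w. cos (t * Y w)" 1 L] sqintD[OF cspan_sqint[OF gf_sqint Lc(1)[OF that]]]
    bi[OF cspan_sqint[OF gf_sqint Lc(1)[OF that]]] by simp_all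
  show "expectation (\<lambda>w. v w * cos (t * Y w)) = 0"
  proof (rule vE)
   let ?m = "expectation (\<lambda>w. cos (t * Y w))"
   have m1: "\<bar>?m\<bar> \<le> 1" unfolding gf_cspan(2)[OF tY] using ms_nonneg[of "\<lambda>w. t * Y w"] by simp
   \<comment> \<open>Halving keeps the weight bounded by 1, as the uniqueness lemma demands.\<close>
   show "expectation (\<lambda>w. (cos (t * Y w) - ?m) / 2 * indicator A w) = 0"
   proof (rule weighted_uniqueness_sigma[OF _ _ ZZm _ A])
    show "\<bar>(cos (t * Y w) - ?m) / 2\<bar> \<le> 1" for w
    proof -
     have "\<bar>cos (t * Y w) - ?m\<bar> \<le> 2"
      using abs_triangle_ineq4[of "cos (t * Y w)" ?m] abs_cos_le_one[of "t * Y w"] m1 by linarith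
     then show ?thesis by simp
    qed
    fix L assume L: "L \<in> lin ZZ"
    have "expectation (\<lambda>w. (cos (t * Y w) - ?m) / 2 * cos (L w)) = expectation (\<lambda>w. (cos (t * Y w) * cos (L w) - ?m * cos (L w)) / 2)"
     by (rule lint_cong) (auto simp: field_simps)
    also have "\<dots> = 0" using i[OF L] trig(1)[OF L] by simp
    finally have 1: "expectation (\<lambda>w. (cos (t * Y w) - ?m) / 2 * cos (L w)) = 0" .
    have "expectation (\<lambda>w. (cos (t * Y w) - ?m) / 2 * sin (L w)) = expectation (\<lambda>w. (cos (t * Y w) * sin (L w) - ?m * sin (L w)) / 2)"
     by (rule lint_cong) (auto simp: field_simps)
    also have "\<dots> = 0" using i[OF L] trig(2)[OF L] gf_cspan(3)[OF Lc(1)[OF L]] by simp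
    finally show "expectation (\<lambda>w. (cos (t * Y w) - ?m) / 2 * cos (L w)) = 0 \<and> expectation (\<lambda>w. (cos (t * Y w) - ?m) / 2 * sin (L w)) = 0"
     using 1 by simp
   qed measurable
  qed auto
  show "expectation (\<lambda>w. v w * sin (t * Y w)) = 0"
  proof (rule vE)
   show "expectation (\<lambda>w. (sin (t * Y w) - expectation (\<lambda>w. sin (t * Y w))) / 2 * indicator A w) = 0"
    unfolding gf_cspan(3)[OF tY]
   proof (rule weighted_uniqueness_sigma[OF _ _ ZZm _ A])
    show "\<bar>(sin (t * Y w) - 0) / 2\<bar> \<le> 1" for w
    proof -
     have "\<bar>sin (t * Y w)\<bar> \<le> 2" using abs_sin_le_one[of "t * Y w"] by linarith
     then show ?thesis by simp
    qed
    fix L assume L: "L \<in> lin ZZ"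
    show "expectation (\<lambda>w. (sin (t * Y w) - 0) / 2 * cos (L w)) = 0 \<and> expectation (\<lambda>w. (sin (t * Y w) - 0) / 2 * sin (L w)) = 0"
     using trig(3,4)[OF L] by simp
   qed measurable
  qed auto
 qed measurable
 moreover have "expectation (\<lambda>w. v w * f (Y w)) = expectation (\<lambda>w. f (Y w) * indicator A w - prob A * f (Y w))"
  by (rule lint_cong) (auto simp: v_def algebra_simps)
 moreover have "integrable M (\<lambda>w. f (Y w) * indicator A w)" using integrable_mult_indicator[OF AM fi] by (simp add: mult.commute)
 ultimately show ?thesis using fi by simp
qed

end

end

section \<open>Riemann sums and Gaussian processes with continuous paths\<close>

definition clampT :: "real => real => real" where "clampT T t = max 0 (min t T)"

lemma clampT_in: "0 \<le> T ==> clampT T t \<in> {0..T}"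
 and clampT_id: "t \<in> {0..T} ==> clampT T t = t"
 by (auto simp: clampT_def)

lemma clampT_continuous: "continuous_on UNIV (clampT T)"
 unfolding clampT_def by (intro continuous_intros)

lemma stepf_tendsto:
 fixes y :: "real => 'a::euclidean_space"
 assumes t: "t > 0" and y: "continuous_on {0..t} y" and s: "s \<in> {0<..t}"
 shows "(\<lambda>n. stepf t (Suc n) (\<lambda>i. y (t * real (Suc i) / real (Suc n))) s) \<longlonglongrightarrow> y s"
proof -
 have "\<exists>u. u \<in> {s..t} \<and> u - s \<le> t / real (Suc n) \<and> stepf t (Suc n) (\<lambda>i. y (t * real (Suc i) / real (Suc n))) s = y u" for n
 proof -
  obtain i where i: "i < Suc n" "s \<in> {t * real i / real (Suc n)<..t * real (Suc i) / real (Suc n)}"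
   "stepf t (Suc n) (\<lambda>i. y (t * real (Suc i) / real (Suc n))) s = y (t * real (Suc i) / real (Suc n))"
   using stepf_cell[of "Suc n" t s "\<lambda>i. y (t * real (Suc i) / real (Suc n))"] t s by blast
  have "t * real (Suc i) \<le> t * real (Suc n)" using i(1) t by (intro mult_left_mono) auto
  then have "t * real (Suc i) / real (Suc n) \<le> t" by (subst pos_divide_le_eq) auto
  moreover have "t * real (Suc i) / real (Suc n) - t * real i / real (Suc n) = t / real (Suc n)"
   by (simp add: distrib_left add_divide_distrib)
  moreover have "t * real i / real (Suc n) < s" "s \<le> t * real (Suc i) / real (Suc n)"
   using i(2) by (simp_all only: greaterThanAtMost_iff)
  ultimately have "t * real (Suc i) / real (Suc n) \<in> {s..t}" "t * real (Suc i) / real (Suc n) - s \<le> t / real (Suc n)"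
   unfolding atLeastAtMost_iff by (blast, linarith)
  then show ?thesis using i(3) by blast
 qed
 then obtain u where u: "\<And>n. u n \<in> {s..t}" "\<And>n. u n - s \<le> t / real (Suc n)"
  "\<And>n. stepf t (Suc n) (\<lambda>i. y (t * real (Suc i) / real (Suc n))) s = y (u n)" by metis
 have "(\<lambda>n. u n - s) \<longlonglongrightarrow> 0"
 proof (rule tendsto_sandwich[of "\<lambda>_. 0" _ _ "\<lambda>n. t / real (Suc n)"])
  show "(\<lambda>n. t / real (Suc n)) \<longlonglongrightarrow> 0" by (rule LIMSEQ_Suc[OF lim_const_over_n])
 qed (use u in auto)
 then have "u \<longlonglongrightarrow> s" by (rule LIM_zero_cancel)
 then have "(\<lambda>n. y (u n)) \<longlonglongrightarrow> y s"
  by (rule continuous_on_tendsto_compose[OF y]) (use u(1) s in \<open>auto intro!: always_eventually intro: order_trans[of _ s]\<close>)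
 then show ?thesis by (simp only: u(3))
qed

text \<open>The matrix function is only integrable and cannot be sampled, so it is integrated
  exactly over each cell while the continuous \<open>y\<close> is sampled at the right endpoint. The
  samples stay in \<open>(0,t]\<close>, so only values of \<open>y\<close> up to time
  \<open>t\<close> enter.\<close>

lemma riemann_tendsto:
 fixes A :: "real => real^'d^'k" and y :: "real => real^'d"
 assumes t: "t > 0" and A: "L1on t A" and y: "continuous_on {0..t} y"
 shows "(\<lambda>n. \<Sum>i<Suc n. (LINT s:{t * real i / real (Suc n)<..t * real (Suc i) / real (Suc n)}|lborel. A s) *v y (t * real (Suc i) / real (Suc n)))
  \<longlonglongrightarrow> prim (\<lambda>s. A s *v y s) t"
proof -
 obtain C where C: "C > 0" "\<And>s. s \<in> {0..t} ==> norm (y s) \<le> C" by (rule continuous_bounded_Icc[OF y]) auto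
 obtain K where K: "\<And>(x :: real^'d^'k) y. norm (x *v y) \<le> norm x * norm y * K" "K > 0" using bb_mv.pos_bounded by auto
 define Y where "Y n = stepf t (Suc n) (\<lambda>i. y (t * real (Suc i) / real (Suc n)))" for n
 define J where "J n i = {t * real i / real (Suc n)<..t * real (Suc i) / real (Suc n)}" for n i
 have Jsub: "J n i \<subseteq> {0..t}" if "i < Suc n" for n i
 proof
  fix x assume x: "x \<in> J n i"
  have "t * real (Suc i) \<le> t * real (Suc n)" using that t by (intro mult_left_mono) auto
  then have "t * real (Suc i) / real (Suc n) \<le> t" by (subst pos_divide_le_eq) auto
  moreover have "0 \<le> t * real i / real (Suc n)" using t by simp
  ultimately show "x \<in> {0..t}" using x unfolding J_def by (simp only: greaterThanAtMost_iff atLeastAtMost_iff) linarith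
 qed
 have AJ: "integrable lborel (\<lambda>s. indicator (J n i) s *\<^sub>R A s)" if "i < Suc n" for n i
  using set_integrable_subset[OF A _ Jsub[OF that]] by (simp add: set_integrable_def J_def)
 have sumeq: "(\<Sum>i<Suc n. (LINT s:J n i|lborel. A s) *v y (t * real (Suc i) / real (Suc n)))
   = integral\<^sup>L lborel (\<lambda>s. indicator {0..t} s *\<^sub>R (A s *v Y n s))" for n
 proof -
  have "(LINT s:J n i|lborel. A s) *v y (t * real (Suc i) / real (Suc n))
    = (\<integral>s. indicator (J n i) s *\<^sub>R (A s *v y (t * real (Suc i) / real (Suc n))) \<partial>lborel)" if "i < Suc n" for i
   unfolding set_lebesgue_integral_def
   by (subst integral_bounded_linear[OF bb_mv.bounded_linear_left AJ[OF that], symmetric]) (simp add: bb_mv.scaleR_left)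
  then have "(\<Sum>i<Suc n. (LINT s:J n i|lborel. A s) *v y (t * real (Suc i) / real (Suc n)))
    = (\<Sum>i<Suc n. (\<integral>s. indicator (J n i) s *\<^sub>R (A s *v y (t * real (Suc i) / real (Suc n))) \<partial>lborel))"
   by (intro sum.cong) auto
  also have "\<dots> = (\<integral>s. (\<Sum>i<Suc n. indicator (J n i) s *\<^sub>R (A s *v y (t * real (Suc i) / real (Suc n)))) \<partial>lborel)"
  proof (rule Bochner_Integration.integral_sum[symmetric])
   fix i assume "i \<in> {..<Suc n}"
   from integrable_bounded_linear[OF bb_mv.bounded_linear_left AJ, of i n] this
   show "integrable lborel (\<lambda>s. indicator (J n i) s *\<^sub>R (A s *v y (t * real (Suc i) / real (Suc n))))"
    by (simp add: bb_mv.scaleR_left)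
  qed
  also have "\<dots> = integral\<^sup>L lborel (\<lambda>s. indicator {0..t} s *\<^sub>R (A s *v Y n s))"
  proof (rule lint_cong[OF refl])
   fix s
   have e1: "A s *v Y n s = (\<Sum>i<Suc n. indicator (J n i) s *\<^sub>R (A s *v y (t * real (Suc i) / real (Suc n))))"
    unfolding Y_def stepf_def J_def bb_mv.sum_right bb_mv.scaleR_right ..
   have e2: "indicator {0..t} s *\<^sub>R (\<Sum>i<Suc n. indicator (J n i) s *\<^sub>R v i) = (\<Sum>i<Suc n. indicator (J n i) s *\<^sub>R (v i :: real^'k))" for v
    unfolding scaleR_sum_right
   proof (rule sum.cong[OF refl])
    fix i assume "i \<in> {..<Suc n}"
    then have "J n i \<subseteq> {0..t}" by (intro Jsub) simp
    then show "indicator {0..t} s *\<^sub>R indicator (J n i) s *\<^sub>R v i = indicator (J n i) s *\<^sub>R v i" by (auto simp: indicator_def)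
   qed
   show "(\<Sum>i<Suc n. indicator (J n i) s *\<^sub>R (A s *v y (t * real (Suc i) / real (Suc n)))) = indicator {0..t} s *\<^sub>R (A s *v Y n s)"
    by (simp only: e1 e2)
  qed
  finally show ?thesis .
 qed
 have Am: "(\<lambda>s. indicator {0..t} s *\<^sub>R A s) \<in> borel_measurable lborel" using L1on_meas[OF A] by (simp add: set_borel_measurable_def)
 have "(\<lambda>n. integral\<^sup>L lborel (\<lambda>s. indicator {0..t} s *\<^sub>R (A s *v Y n s))) \<longlonglongrightarrow> integral\<^sup>L lborel (\<lambda>s. indicator {0..t} s *\<^sub>R (A s *v y s))"
 proof (rule integral_dominated_convergence[where w="\<lambda>s. indicator {0..t} s *\<^sub>R (norm (A s) * (C * K))"])
  show "integrable lborel (\<lambda>s. indicator {0..t} s *\<^sub>R (norm (A s) * (C * K)))"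
   using L1on_norm[OF A] unfolding set_integrable_def[symmetric] by simp
  show "(\<lambda>s. indicator {0..t} s *\<^sub>R (A s *v y s)) \<in> borel_measurable lborel"
   using L1on_meas[OF L1on_bilinear[OF bb_mv A y]] by (simp add: set_borel_measurable_def)
  show "(\<lambda>s. indicator {0..t} s *\<^sub>R (A s *v Y n s)) \<in> borel_measurable lborel" for n
  proof -
   have "(\<lambda>s. (indicator {0..t} s *\<^sub>R A s) *v Y n s) \<in> borel_measurable lborel"
    by (rule borel_measurable_bilinear[OF bb_mv Am]) (simp add: Y_def stepf_meas)
   then show ?thesis by (simp add: bb_mv.scaleR_left)
  qed
  show "AE s in lborel. (\<lambda>n. indicator {0..t} s *\<^sub>R (A s *v Y n s)) \<longlonglongrightarrow> indicator {0..t} s *\<^sub>R (A s *v y s)"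
   using AE_lborel_singleton[of 0]
  proof eventually_elim
   case (elim s)
   show ?case
   proof (cases "s \<in> {0..t}")
    case True
    then have "(\<lambda>n. Y n s) \<longlonglongrightarrow> y s" unfolding Y_def using elim by (intro stepf_tendsto[OF t y]) auto
    then show ?thesis by (intro tendsto_intros bb_mv.tendsto)
   qed simp
  qed
  show "AE s in lborel. norm (indicator {0..t} s *\<^sub>R (A s *v Y n s)) \<le> indicator {0..t} s *\<^sub>R (norm (A s) * (C * K))" for n
   using AE_lborel_singleton[of 0]
  proof eventually_elim
   case (elim s)
   show ?case
   proof (cases "s \<in> {0..t}")
    case True
    then obtain i where i: "i < Suc n" "s \<in> J n i" "Y n s = y (t * real (Suc i) / real (Suc n))"
     unfolding J_def Y_def using stepf_cell[of "Suc n" t s "\<lambda>i. y (t * real (Suc i) / real (Suc n))"] t elim by auto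
    have "t * real (Suc i) \<le> t * real (Suc n)" using i(1) t by (intro mult_left_mono) auto
    then have "t * real (Suc i) / real (Suc n) \<le> t" by (subst pos_divide_le_eq) auto
    then have "norm (Y n s) \<le> C" unfolding i(3) using t by (intro C(2)) auto
    then have "norm (A s *v Y n s) \<le> norm (A s) * C * K"
     using K(2) by (intro order_trans[OF K(1)] mult_right_mono mult_left_mono) auto
    then show ?thesis using True by (simp add: mult.assoc)
   qed simp
  qed
 qed
 then show ?thesis by (simp add: sumeq[symmetric] J_def set_lebesgue_integral_def[of lborel "{0..t}"])
qed

context prob_space
begin

text \<open>Continuity is required of every path, not almost every one, so that integrals along
  paths satisfy their identities everywhere; the given processes are modified on a null set to meet
  this.\<close>

definition cproc :: "real => (real => 'a => 'b::euclidean_space) => bool" where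
 "cproc T Y \<longleftrightarrow> (\<forall>t\<in>{0..T}. Y t \<in> borel_measurable M) \<and> (\<forall>w\<in>space M. continuous_on {0..T} (\<lambda>t. Y t w))"

lemma cprocD: "cproc T Y ==> t \<in> {0..T} ==> Y t \<in> borel_measurable M"
 "cproc T Y ==> w \<in> space M ==> continuous_on {0..T} (\<lambda>t. Y t w)"
 by (auto simp: cproc_def)

text \<open>Freezing time at the grid point below \<open>t\<close> of mesh
  \<open>1 / (n + 1)\<close> gives a function with countably many measurable pieces; path continuity
  makes it converge. Clamping extends the process to the whole line.\<close>

lemma cproc_joint:
 assumes T: "0 \<le> T" and Y: "cproc T Y"
 shows "(\<lambda>(t, w). Y (clampT T t) w) \<in> borel_measurable (borel \<Otimes>\<^sub>M M)"
proof (rule borel_measurable_LIMSEQ_metric)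
 let ?f = "\<lambda>n (i::int) x. Y (clampT T (of_int i / real (Suc n))) (snd x)"
 let ?g = "\<lambda>n x. \<lfloor>real (Suc n) * fst x\<rfloor>"
 show "(\<lambda>x. ?f n (?g n x) x) \<in> borel_measurable (borel \<Otimes>\<^sub>M M)" for n
 proof (rule measurable_compose_countable[where f="?f n" and g="?g n"])
  show "?f n i \<in> borel_measurable (borel \<Otimes>\<^sub>M M)" for i
   by (rule measurable_compose[OF measurable_snd cprocD(1)[OF Y clampT_in[OF T]]])
  show "?g n \<in> measurable (borel \<Otimes>\<^sub>M M) (count_space UNIV)" by measurable
 qed
 fix x :: "real \<times> 'a" assume "x \<in> space (borel \<Otimes>\<^sub>M M)"
 then obtain t w where x: "x = (t, w)" "w \<in> space M" by (auto simp: space_pair_measure)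
 have "(\<lambda>n. of_int \<lfloor>real (Suc n) * t\<rfloor> / real (Suc n)) \<longlonglongrightarrow> t"
 proof (rule LIM_zero_cancel, rule Lim_null_comparison)
  show "(\<lambda>n. 1 / real (Suc n)) \<longlonglongrightarrow> 0" by (rule LIMSEQ_Suc[OF lim_const_over_n])
  have "norm (of_int \<lfloor>real (Suc n) * t\<rfloor> / real (Suc n) - t) \<le> 1 / real (Suc n)" for n
  proof -
   have "of_int \<lfloor>real (Suc n) * t\<rfloor> / real (Suc n) - t = (of_int \<lfloor>real (Suc n) * t\<rfloor> - real (Suc n) * t) / real (Suc n)"
    by (simp add: diff_divide_distrib)
   moreover have "\<bar>of_int \<lfloor>real (Suc n) * t\<rfloor> - real (Suc n) * t\<bar> \<le> 1" by linarith
   ultimately show ?thesis by (simp only: real_norm_def abs_divide abs_of_nat) (rule divide_right_mono, auto)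
  qed
  then show "\<forall>\<^sub>F n in sequentially. norm (of_int \<lfloor>real (Suc n) * t\<rfloor> / real (Suc n) - t) \<le> 1 / real (Suc n)" by simp
 qed
 moreover have "continuous_on UNIV (\<lambda>t. Y (clampT T t) w)"
  by (rule continuous_on_compose2[OF cprocD(2)[OF Y x(2)] clampT_continuous]) (use clampT_in[OF T] in auto)
 ultimately have "(\<lambda>n. Y (clampT T (of_int \<lfloor>real (Suc n) * t\<rfloor> / real (Suc n))) w) \<longlonglongrightarrow> Y (clampT T t) w"
  by (intro isCont_tendsto_compose[of t "\<lambda>t. Y (clampT T t) w"]) (auto simp: continuous_on_eq_continuous_at)
 then show "(\<lambda>n. ?f n (?g n x) x) \<longlonglongrightarrow> (case x of (t, w) => Y (clampT T t) w)" by (simp add: x)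
qed

lemma cproc_joint_swap:
 assumes T: "0 \<le> T" and Y: "cproc T Y"
 shows "(\<lambda>x. Y (clampT T (snd x)) (fst x)) \<in> borel_measurable (M \<Otimes>\<^sub>M lborel)"
  "(\<lambda>x. Y (clampT T (fst x)) (snd x)) \<in> borel_measurable (lborel \<Otimes>\<^sub>M M)"
proof -
 have s: "sets (lborel \<Otimes>\<^sub>M M) = sets (borel \<Otimes>\<^sub>M M)" by (rule sets_pair_measure_cong) auto
 show 1: "(\<lambda>x. Y (clampT T (fst x)) (snd x)) \<in> borel_measurable (lborel \<Otimes>\<^sub>M M)"
  using cproc_joint[OF T Y] measurable_cong_sets[OF s refl] by (auto simp: split_beta')
 show "(\<lambda>x. Y (clampT T (snd x)) (fst x)) \<in> borel_measurable (M \<Otimes>\<^sub>M lborel)"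
  using measurable_compose[OF measurable_pair_swap'[of M lborel] 1] by (simp add: split_beta')
qed

lemma cproc_prim:
 fixes A :: "real => real^'d^'k" and Y :: "real => 'a => real^'d"
 assumes T: "0 \<le> T" and Y: "cproc T Y" and A: "L1on T A"
 shows "cproc T (\<lambda>t w. prim (\<lambda>s. A s *v Y s w) t)"
 unfolding cproc_def
proof (intro conjI ballI)
 fix t assume t: "t \<in> {0..T}"
 have "(\<lambda>w. \<integral>s. (indicator {0..t} s *\<^sub>R (indicator {0..T} s *\<^sub>R A s)) *v Y (clampT T s) w \<partial>lborel) \<in> borel_measurable M"
 proof (rule lborel.borel_measurable_lebesgue_integral, unfold split_beta', rule borel_measurable_bilinear[OF bb_mv _ cproc_joint_swap(1)[OF T Y]])
  have "(\<lambda>s. indicator {0..T} s *\<^sub>R A s) \<in> borel_measurable lborel"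
   using L1on_meas[OF A] by (simp add: set_borel_measurable_def)
  then have "(\<lambda>s. indicator {0..t} s *\<^sub>R (indicator {0..T} s *\<^sub>R A s)) \<in> borel_measurable lborel"
   by (rule borel_measurable_scaleR[rotated]) simp
  from measurable_compose[OF measurable_snd this]
  show "(\<lambda>x. indicator {0..t} (snd x) *\<^sub>R (indicator {0..T} (snd x) *\<^sub>R A (snd x))) \<in> borel_measurable (M \<Otimes>\<^sub>M lborel)" .
 qed
 also have "(\<lambda>w. \<integral>s. (indicator {0..t} s *\<^sub>R (indicator {0..T} s *\<^sub>R A s)) *v Y (clampT T s) w \<partial>lborel) = (\<lambda>w. prim (\<lambda>s. A s *v Y s w) t)"
  unfolding set_lebesgue_integral_def using t
  by (intro ext lint_cong) (auto simp: indicator_def clampT_id bb_mv.zero_left)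
 finally show "(\<lambda>w. prim (\<lambda>s. A s *v Y s w) t) \<in> borel_measurable M" .
next
 fix w assume "w \<in> space M"
 then show "continuous_on {0..T} (\<lambda>t. prim (\<lambda>s. A s *v Y s w) t)"
  by (intro prim_continuous L1on_bilinear[OF bb_mv A] cprocD(2)[OF Y])
qed

lemma cproc_add: "cproc T Y ==> cproc T Z ==> cproc T (\<lambda>t w. Y t w + Z t w)"
 unfolding cproc_def by (auto intro!: continuous_intros borel_measurable_add borel_measurable_diff)

lemma cproc_diff: "cproc T Y ==> cproc T Z ==> cproc T (\<lambda>t w. Y t w - Z t w)"
 unfolding cproc_def by (auto intro!: continuous_intros borel_measurable_add borel_measurable_diff)

lemma cproc_mv: "cproc T (Y :: _ => _ => real^'d) ==> continuous_on {0..T} A ==> cproc T (\<lambda>t w. (A t :: real^'d^'k) *v Y t w)"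
 unfolding cproc_def by (auto intro!: continuous_intros borel_measurable_mv)

lemma cproc_const: "V \<in> borel_measurable M ==> cproc T (\<lambda>t. V)"
 by (simp add: cproc_def)

text \<open>Fubini's theorem. The uniform bound \<open>C\<close> on the second moments makes the
  norm of the integrand integrable over time and probability jointly.\<close>

lemma cov_prim:
 fixes A :: "real => real^'d^'k" and Y :: "real => 'a => real^'d" and Z :: "'a => real^'e"
 assumes T: "0 \<le> T" and Y: "cproc T Y" and A: "L1on T A" and sq: "\<And>s. s \<in> {0..T} ==> sqint (Y s)"
  and bd: "\<And>s. s \<in> {0..T} ==> ms (Y s) \<le> C" and Z: "sqint Z" and t: "t \<in> {0..T}"
 shows "cov (\<lambda>z. prim (\<lambda>s. A s *v Y s z) t) Z = prim (\<lambda>s. A s ** cov (Y s) Z) t"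
proof -
 interpret P: pair_sigma_finite lborel M ..
 define a where "a s = indicator {0..t} s *\<^sub>R A s" for s
 define y where "y s = Y (clampT T s)" for s
 have ysq: "sqint (y s)" and ybd: "ms (y s) \<le> C" for s using sq[OF clampT_in[OF T]] bd[OF clampT_in[OF T]] by (auto simp: y_def)
 have aI: "integrable lborel a" using L1on_subset[OF A, of t] t unfolding a_def[abs_def] by (simp add: set_integrable_def)
 define H where "H x = outer (a (fst x) *v y (fst x) (snd x)) (Z (snd x))" for x
 have Hm: "H \<in> borel_measurable (lborel \<Otimes>\<^sub>M M)"
  unfolding H_def[abs_def] y_def
  by (intro borel_measurable_bilinear[OF bb_outer borel_measurable_bilinear[OF bb_mv _ cproc_joint_swap(2)[OF T Y]]]
    measurable_compose[OF measurable_fst] measurable_compose[OF measurable_snd] borel_measurable_integrable[OF aI] sqintD[OF Z])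
 obtain K1 where K1: "\<And>(x :: real^'k) (y :: real^'e). norm (outer x y) \<le> norm x * norm y * K1" "K1 > 0"
  using bb_outer.pos_bounded by auto
 obtain K2 where K2: "\<And>(x :: real^'d^'k) y. norm (x *v y) \<le> norm x * norm y * K2" "K2 > 0" using bb_mv.pos_bounded by auto
 have Hs: "integrable M (\<lambda>z. H (s, z))" for s
  unfolding H_def using sqint_bilinear[OF bb_outer sqint_mv[OF ysq] Z] by simp
 have HI: "integrable (lborel \<Otimes>\<^sub>M M) H"
 proof (rule P.Fubini_integrable[OF Hm])
  show "AE s in lborel. integrable M (\<lambda>z. H (s, z))" using Hs by simp
  show "integrable lborel (\<lambda>s. \<integral>z. norm (H (s, z)) \<partial>M)"
  proof (rule Bochner_Integration.integrable_bound)
   show "integrable lborel (\<lambda>s. norm (a s) * (K1 * K2 * (C + ms Z)))" using aI by (intro integrable_mult_left integrable_norm)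
   show "(\<lambda>s. \<integral>z. norm (H (s, z)) \<partial>M) \<in> borel_measurable lborel"
    by (rule borel_measurable_lebesgue_integral) (use measurable_compose[OF Hm borel_measurable_norm] in \<open>simp add: split_beta'\<close>)
   have "(\<integral>z. norm (H (s, z)) \<partial>M) \<le> norm (a s) * (K1 * K2 * (C + ms Z))" for s
   proof -
    have "norm (H (s, z)) \<le> norm (a s) * (K1 * K2) * ((norm (y s z))\<^sup>2 + (norm (Z z))\<^sup>2)" for z
    proof -
     have "norm (H (s, z)) \<le> norm (a s *v y s z) * norm (Z z) * K1" unfolding H_def fst_conv snd_conv by (rule K1)
     also have "\<dots> \<le> (norm (a s) * norm (y s z) * K2) * norm (Z z) * K1"
      using K1(2) by (intro mult_right_mono K2(1)) auto
     also have "\<dots> = norm (a s) * (K1 * K2) * (norm (y s z) * norm (Z z))" by (simp add: mult_ac)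
     also have "\<dots> \<le> norm (a s) * (K1 * K2) * ((norm (y s z))\<^sup>2 + (norm (Z z))\<^sup>2)"
     proof (rule mult_left_mono)
      have "0 \<le> norm (y s z) * norm (Z z)" by simp
      then show "norm (y s z) * norm (Z z) \<le> (norm (y s z))\<^sup>2 + (norm (Z z))\<^sup>2"
       using sum_squares_bound[of "norm (y s z)" "norm (Z z)"] by linarith
     qed (use K1 K2 in auto)
     finally show ?thesis .
    qed
    then have "(\<integral>z. norm (H (s, z)) \<partial>M) \<le> (\<integral>z. norm (a s) * (K1 * K2) * ((norm (y s z))\<^sup>2 + (norm (Z z))\<^sup>2) \<partial>M)"
     using Hs[of s] ysq[of s] Z by (intro integral_mono integrable_norm integrable_mult_right) (auto simp: sqint_def)
    also have "\<dots> = norm (a s) * (K1 * K2) * (ms (y s) + ms Z)"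
     using ysq[of s] Z by (simp add: sqint_def ms_def)
    also have "\<dots> \<le> norm (a s) * (K1 * K2) * (C + ms Z)"
     using ybd[of s] K1(2) K2(2) by (intro mult_left_mono) auto
    finally show ?thesis by (simp add: mult_ac)
   qed
   then show "AE s in lborel. norm (\<integral>z. norm (H (s, z)) \<partial>M) \<le> norm (norm (a s) * (K1 * K2 * (C + ms Z)))"
    by (intro AE_I2) (auto simp: integral_nonneg_AE intro: order_trans[OF _ abs_ge_self])
  qed
 qed
 have "cov (\<lambda>z. prim (\<lambda>s. A s *v Y s z) t) Z = (\<integral>z. (\<integral>s. H (s, z) \<partial>lborel) \<partial>M)"
  unfolding cov_def
 proof (rule lint_cong[OF refl])
  fix z assume w: "z \<in> space M"
  have e: "a s *v y s z = indicator {0..t} s *\<^sub>R (A s *v Y s z)" for s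
   using t by (auto simp: a_def y_def indicator_def clampT_id bb_mv.zero_left)
  have "L1on t (\<lambda>s. A s *v Y s z)" by (rule L1on_subset[OF L1on_bilinear[OF bb_mv A cprocD(2)[OF Y w]]]) (use t in simp)
  then have "integrable lborel (\<lambda>s. a s *v y s z)" unfolding e by (simp add: set_integrable_def)
  from integral_bounded_linear[OF bb_outer.bounded_linear_left[of "Z z"] this]
  show "outer (prim (\<lambda>s. A s *v Y s z) t) (Z z) = (\<integral>s. H (s, z) \<partial>lborel)"
   by (simp add: H_def e set_lebesgue_integral_def)
 qed
 also have "\<dots> = integral\<^sup>L (lborel \<Otimes>\<^sub>M M) H"
  using P.integral_snd[of "\<lambda>s z. H (s, z)"] HI by (simp add: split_beta')
 also have "\<dots> = (\<integral>s. (\<integral>z. H (s, z) \<partial>M) \<partial>lborel)" by (rule P.integral_fst'[OF HI, symmetric])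
 also have "\<dots> = prim (\<lambda>s. A s ** cov (Y s) Z) t"
  unfolding set_lebesgue_integral_def
 proof (rule lint_cong[OF refl])
  fix s :: real
  have "(\<integral>z. H (s, z) \<partial>M) = a s ** cov (y s) Z" unfolding H_def using cov_mv_left[OF ysq Z] by (simp add: cov_def)
  also have "\<dots> = indicator {0..t} s *\<^sub>R (A s ** cov (Y s) Z)"
   using t by (auto simp: a_def y_def indicator_def clampT_id bb_mm.zero_left)
  finally show "(\<integral>z. H (s, z) \<partial>M) = indicator {0..t} s *\<^sub>R (A s ** cov (Y s) Z)" .
 qed
 finally show ?thesis .
qed

definition gproc :: "real => ('a => real) set => (real => 'a => real^'d) => bool" where
 "gproc T S Y \<longleftrightarrow> cproc T Y \<and> (\<forall>t\<in>{0..T}. vspan S (Y t))"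

lemma gprocD: "gproc T S Y ==> cproc T Y" "gproc T S Y ==> t \<in> {0..T} ==> vspan S (Y t)"
 by (auto simp: gproc_def)

lemmas gproc_path = cprocD(2)[OF gprocD(1)]

context
 fixes S :: "('a => real) set"
 assumes G: "gaussian_family S"
begin

lemma gv_sqint: "vspan S V ==> sqint V"
 by (rule vspan_sqint[OF gf_sqint[OF G]])

lemma gv_AE_limit:
 fixes X :: "nat => 'a => real^'d"
 assumes X: "\<And>n. vspan S (X n)" and lim: "AE w in M. (\<lambda>n. X n w) \<longlonglongrightarrow> Y w" and Y: "Y \<in> borel_measurable M"
 shows "vspan S Y" "(\<lambda>n. ms (\<lambda>w. X n w - Y w)) \<longlonglongrightarrow> 0"
proof -
 have c: "AE w in M. (\<lambda>n. X n w $ i) \<longlonglongrightarrow> Y w $ i" for i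
  using lim by eventually_elim (rule tendsto_vec_nth)
 have Xi: "(\<lambda>w. X n w $ i) \<in> cspan S" for n i using X by (simp add: vspan_def)
 have Yi: "(\<lambda>w. Y w $ i) \<in> borel_measurable M" for i using Y by measurable
 show Ys: "vspan S Y" unfolding vspan_def using gf_AE_limit(1)[OF G Xi c Yi] by blast
 have "ms (\<lambda>w. X n w - Y w) = (\<Sum>i\<in>UNIV. ms (\<lambda>w. X n w $ i - Y w $ i))" for n
  using ms_components[OF sqint_diff[OF gv_sqint[OF X] gv_sqint[OF Ys]]] by simp
 moreover have "(\<lambda>n. \<Sum>i\<in>UNIV. ms (\<lambda>w. X n w $ i - Y w $ i)) \<longlonglongrightarrow> (\<Sum>i\<in>(UNIV::'d set). 0)"
  by (intro tendsto_sum gf_AE_limit(2)[OF G Xi c Yi])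
 ultimately show "(\<lambda>n. ms (\<lambda>w. X n w - Y w)) \<longlonglongrightarrow> 0" by simp
qed

text \<open>The Riemann sums lie in the closed span and converge for every path;
  \<open>gf_AE_limit\<close> upgrades this to mean square convergence. Membership is needed only up
  to time \<open>t\<close>, so the lemma also applies to the span of a past.\<close>

lemma gv_prim:
 fixes A :: "real => real^'d^'k" and Y :: "real => 'a => real^'d"
 assumes T: "0 \<le> T" and Y: "cproc T Y" and A: "L1on T A" and t: "t \<in> {0..T}" and v: "\<And>s. s \<in> {0..t} ==> vspan S (Y s)"
 shows "vspan S (\<lambda>w. prim (\<lambda>s. A s *v Y s w) t)"
proof (cases "t = 0")
 case True
 then show ?thesis by (simp add: vspan_def cspan_zero[OF gf_sqint[OF G]])
next
 case False
 then have t0: "t > 0" using t by simp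
 let ?X = "\<lambda>n w. \<Sum>i<Suc n. (LINT s:{t * real i / real (Suc n)<..t * real (Suc i) / real (Suc n)}|lborel. A s) *v Y (t * real (Suc i) / real (Suc n)) w"
 show ?thesis
 proof (rule gv_AE_limit(1)[where X="?X"])
  show "vspan S (?X n)" for n
  proof (intro vspan_sum[OF gf_sqint[OF G]] vspan_mv[OF gf_sqint[OF G]] v)
   fix i assume "i \<in> {..<Suc n}"
   then have "t * real (Suc i) \<le> t * real (Suc n)" using t0 by (intro mult_left_mono) auto
   then have "t * real (Suc i) / real (Suc n) \<le> t" by (subst pos_divide_le_eq) auto
   then show "t * real (Suc i) / real (Suc n) \<in> {0..t}" using t0 by simp
  qed
  show "AE w in M. (\<lambda>n. ?X n w) \<longlonglongrightarrow> prim (\<lambda>s. A s *v Y s w) t"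
  proof (rule AE_I2, rule riemann_tendsto[OF t0])
   show "L1on t A" by (rule L1on_subset[OF A]) (use t in simp)
   show "continuous_on {0..t} (\<lambda>s. Y s w)" if "w \<in> space M" for w
    by (rule continuous_on_subset[OF cprocD(2)[OF Y that]]) (use t in auto)
  qed
  show "(\<lambda>w. prim (\<lambda>s. A s *v Y s w) t) \<in> borel_measurable M" by (rule cprocD(1)[OF cproc_prim[OF T Y A] t])
 qed
qed

lemma gproc_prim:
 fixes A :: "real => real^'d^'k"
 assumes "0 \<le> T" "gproc T S Y" "L1on T A"
 shows "gproc T S (\<lambda>t w. prim (\<lambda>s. A s *v Y s w) t)"
 unfolding gproc_def using assms by (auto intro!: cproc_prim gv_prim simp: gproc_def)

lemma gproc_add: "gproc T S Y ==> gproc T S Z ==> gproc T S (\<lambda>t w. Y t w + Z t w)"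
 unfolding gproc_def by (auto intro!: cproc_add vspan_add[OF gf_sqint[OF G]])

lemma gproc_diff: "gproc T S Y ==> gproc T S Z ==> gproc T S (\<lambda>t w. Y t w - Z t w)"
 unfolding gproc_def by (auto intro!: cproc_diff vspan_diff[OF gf_sqint[OF G]])

lemma gproc_mv: "gproc T S (Y :: _ => _ => real^'d) ==> continuous_on {0..T} A ==> gproc T S (\<lambda>t w. (A t :: real^'d^'k) *v Y t w)"
 unfolding gproc_def by (auto intro!: cproc_mv vspan_mv[OF gf_sqint[OF G]])

lemma gproc_const: "vspan S V ==> gproc T S (\<lambda>t. V)"
 unfolding gproc_def by (auto intro!: cproc_const sqintD[OF gv_sqint])

lemma gproc_sqint: "gproc T S Y ==> t \<in> {0..T} ==> sqint (Y t)"
 by (intro gv_sqint gprocD(2))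

text \<open>In a Gaussian space path continuity already implies mean square continuity, so no moment
  estimate on increments has to be supplied.\<close>

lemma gproc_ms_tendsto:
 assumes Y: "gproc T S (Y :: real => 'a => real^'d)" and t: "t \<in> {0..T}" and u: "\<And>n. u n \<in> {0..T}" "u \<longlonglongrightarrow> t"
 shows "(\<lambda>n. ms (\<lambda>w. Y (u n) w - Y t w)) \<longlonglongrightarrow> 0"
proof (rule gv_AE_limit(2))
 show "vspan S (Y (u n))" for n by (rule gprocD(2)[OF Y u(1)])
 show "Y t \<in> borel_measurable M" by (rule cprocD(1)[OF gprocD(1)[OF Y] t])
 show "AE w in M. (\<lambda>n. Y (u n) w) \<longlonglongrightarrow> Y t w"
  by (rule AE_I2, rule continuous_on_tendsto_compose[OF gproc_path[OF Y] u(2) t]) (use u(1) in \<open>auto intro!: always_eventually\<close>)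
qed

lemma gproc_cov_continuous:
 assumes Y: "gproc T S (Y :: real => 'a => real^'d)" and Z: "sqint (Z :: 'a => real^'k)"
 shows "continuous_on {0..T} (\<lambda>t. cov (Y t) Z)"
 unfolding continuous_on_sequentially comp_def
proof (intro ballI allI impI)
 fix u t assume t: "t \<in> {0..T}" and u: "(\<forall>n. u n \<in> {0..T}) \<and> u \<longlonglongrightarrow> t"
 show "(\<lambda>n. cov (Y (u n)) Z) \<longlonglongrightarrow> cov (Y t) Z"
  by (rule cov_tendsto[OF _ _ Z gproc_ms_tendsto[OF Y t]]) (use u t gproc_sqint[OF Y] in auto)
qed

text \<open>Times with unbounded second moments would accumulate in the compact interval, against
  mean square continuity at the accumulation point.\<close>

lemma gproc_ms_bounded:
 assumes Y: "gproc T S (Y :: real => 'a => real^'d)"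
 obtains C where "\<And>t. t \<in> {0..T} ==> ms (Y t) \<le> C"
proof -
 have "\<exists>C. \<forall>t\<in>{0..T}. ms (Y t) \<le> C"
 proof (rule ccontr)
  assume "\<nexists>C. \<forall>t\<in>{0..T}. ms (Y t) \<le> C"
  then have "\<forall>n::nat. \<exists>t\<in>{0..T}. real n < ms (Y t)" by (meson not_le)
  then obtain u where u: "\<And>n::nat. u n \<in> {0..T}" "\<And>n. real n < ms (Y (u n))" by metis
  obtain t r where r: "t \<in> {0..T}" "strict_mono r" "(u \<circ> r) \<longlonglongrightarrow> t"
   using compact_imp_seq_compact[OF compact_Icc, of 0 T] u(1) unfolding seq_compact_def by metis
  have "(\<lambda>n. ms (\<lambda>w. Y (u (r n)) w - Y t w)) \<longlonglongrightarrow> 0"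
   by (rule gproc_ms_tendsto[OF Y r(1)]) (use u(1) r(3) in \<open>auto simp: comp_def\<close>)
  then have "\<forall>\<^sub>F n in sequentially. ms (\<lambda>w. Y (u (r n)) w - Y t w) < 1" by (rule order_tendstoD) simp
  then obtain N where N: "\<And>n. n \<ge> N ==> ms (\<lambda>w. Y (u (r n)) w - Y t w) < 1" by (auto simp: eventually_sequentially)
  obtain n where n: "n \<ge> N" "real n \<ge> 2 + 2 * ms (Y t)"
   by (meson le_cases nat_le_real_less of_nat_le_iff order_trans real_arch_simple)
  have "ms (Y (u (r n))) \<le> 2 * ms (\<lambda>w. Y (u (r n)) w - Y t w) + 2 * ms (Y t)"
   using ms_add_le[OF sqint_diff[OF gproc_sqint[OF Y u(1)[of "r n"]] gproc_sqint[OF Y r(1)]] gproc_sqint[OF Y r(1)]] by simp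
  moreover have "real n \<le> real (r n)" using seq_suble[OF r(2), of n] by simp
  ultimately show False using N[OF n(1)] n(2) u(2)[of "r n"] by linarith
 qed
 then show ?thesis using that by blast
qed

lemma gproc_cov_prim:
 fixes A :: "real => real^'d^'k" and Z :: "'a => real^'e"
 assumes T: "0 \<le> T" and Y: "gproc T S Y" and A: "L1on T A" and Z: "sqint Z" and t: "t \<in> {0..T}"
 shows "cov (\<lambda>w. prim (\<lambda>s. A s *v Y s w) t) Z = prim (\<lambda>s. A s ** cov (Y s) Z) t"
  and "L1on T (\<lambda>s. A s ** cov (Y s) Z)"
proof -
 obtain C where C: "\<And>t. t \<in> {0..T} ==> ms (Y t) \<le> C" using gproc_ms_bounded[OF Y] by blast
 show "cov (\<lambda>w. prim (\<lambda>s. A s *v Y s w) t) Z = prim (\<lambda>s. A s ** cov (Y s) Z) t"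
  by (rule cov_prim[OF T gprocD(1)[OF Y] A gproc_sqint[OF Y] C Z t])
 show "L1on T (\<lambda>s. A s ** cov (Y s) Z)" by (rule L1on_bilinear[OF bb_mm A gproc_cov_continuous[OF Y Z]])
qed

end

end

section \<open>Orthogonality to the past and a maximal inequality\<close>

context prob_space
begin

definition gen :: "('a => real) set => 'a measure" where
 "gen ZZ = sigma (space M) {Z -` B \<inter> space M | Z B. Z \<in> ZZ \<and> B \<in> sets borel}"

lemma space_gen [simp]: "space (gen ZZ) = space M"
 by (simp add: gen_def space_measure_of_conv)

lemma sets_gen: "sets (gen ZZ) = sigma_sets (space M) {Z -` B \<inter> space M | Z B. Z \<in> ZZ \<and> B \<in> sets borel}"
 unfolding gen_def by (rule sets_measure_of) auto

lemma subalgebra_gen: "(\<And>Z. Z \<in> ZZ ==> Z \<in> borel_measurable M) ==> subalgebra M (gen ZZ)"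
 unfolding subalgebra_def sets_gen by (auto intro!: sets.sigma_sets_subset measurable_sets)

lemma gen_measurable: "Z \<in> ZZ ==> Z \<in> borel_measurable (gen ZZ)"
 by (rule measurableI) (auto simp: sets_gen intro!: sigma_sets.Basic)

lemma finite_measure_subalgebraI: "subalgebra M F ==> sigma_finite_subalgebra M F"
 by (intro finite_measure_subalgebra_is_sigma_finite) (simp add: finite_measure_subalgebra_def finite_measure_subalgebra_axioms_def finite_measure_axioms)

lemma gaussian_family_subset:
 assumes "gaussian_family S" "S' \<subseteq> cspan S" shows "gaussian_family S'"
proof -
 have sq: "X \<in> S' ==> sqint X" for X using assms(2) cspan_sqint[OF gf_sqint[OF assms(1)]] by blast
 have "Y \<in> cspan S" if "Y \<in> lin S'" for Y
  using cspan_idem[where S=S and S'=S', OF gf_sqint[OF assms(1)]] lin_cspan[OF sq that] assms(2) by blast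
 then show ?thesis unfolding gaussian_family_def using sq gf_cspan[OF assms(1)] by blast
qed

context
 fixes S :: "('a => real) set"
 assumes G: "gaussian_family S"
begin

text \<open>Orthogonality to the generators is independence of the \<sigma>-algebra, so
  \<open>Y\<close> is orthogonal even to nonlinear functionals \<open>W\<close> of the past. The
  maximal inequality uses this with a value times the indicator of a first passage event.\<close>

lemma gf_orth_past:
 assumes Y: "Y \<in> cspan S" and ZZ: "ZZ \<subseteq> cspan S" and orth: "\<And>Z. Z \<in> ZZ ==> expectation (\<lambda>w. Z w * Y w) = 0"
 shows "AE w in M. real_cond_exp M (gen ZZ) Y w = 0"
  and "W \<in> borel_measurable (gen ZZ) ==> integrable M (\<lambda>w. W w * Y w) ==> expectation (\<lambda>w. W w * Y w) = 0"
proof -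
 have sY: "sqint Y" by (rule cspan_sqint[OF gf_sqint[OF G] Y])
 have Ym: "Y \<in> borel_measurable M" by (rule sqintD[OF sY])
 have sub: "subalgebra M (gen ZZ)"
  by (rule subalgebra_gen) (use ZZ sqintD[OF cspan_sqint[OF gf_sqint[OF G]]] in blast)
 interpret F: sigma_finite_subalgebra M "gen ZZ" by (rule finite_measure_subalgebraI[OF sub])
 have iY: "integrable M Y" by (rule sqint_integrable[OF sY])
 show ae: "AE w in M. real_cond_exp M (gen ZZ) Y w = 0"
 proof (rule F.real_cond_exp_charact[OF _ iY])
  fix A assume A: "A \<in> sets (gen ZZ)"
  then have AM: "A \<in> events" using sub by (auto simp: subalgebra_def)
  have "expectation (\<lambda>w. Y w * indicator A w) = expectation (\<lambda>w. Y w) * prob A"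
   by (rule gf_independent[OF G Y ZZ orth _ AM, of "\<lambda>x. x"]) (use A sets_gen iY in auto)
  then show "(LINT w:A|M. Y w) = (LINT w:A|M. 0)"
   using gf_cspan(1)[OF G Y] by (simp add: set_lebesgue_integral_def mult.commute)
 qed auto
 assume W: "W \<in> borel_measurable (gen ZZ)" and WY: "integrable M (\<lambda>w. W w * Y w)"
 have "expectation (\<lambda>w. W w * Y w) = expectation (\<lambda>w. W w * real_cond_exp M (gen ZZ) Y w)"
  by (rule F.real_cond_exp_intg(2)[OF WY W Ym, symmetric])
 also have "\<dots> = expectation (\<lambda>w. 0)"
  by (rule integral_cong_AE) (use ae measurable_from_subalg[OF sub W] in \<open>auto intro!: borel_measurable_times\<close>)
 finally show "expectation (\<lambda>w. W w * Y w) = 0" by simp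
qed

text \<open>Kolmogorov's argument: decompose by the first index \<open>k\<close> at which the level
  is reached. The remaining increment is orthogonal to the past, so the mixed term vanishes and the
  second moment of \<open>X n\<close> on \<open>A k\<close> is at least that of
  \<open>X k\<close>.\<close>

lemma maximal_inequality:
 fixes X :: "nat => 'a => real"
 assumes X: "\<And>k. k \<le> n ==> X k \<in> cspan S" and orth: "\<And>j k. j \<le> k ==> k \<le> n ==> expectation (\<lambda>z. X j z * (X n z - X k z)) = 0"
  and l: "l > 0"
 shows "prob {z \<in> space M. \<exists>k\<le>n. l \<le> \<bar>X k z\<bar>} \<le> ms (X n) / l\<^sup>2"
proof -
 have sq: "k \<le> n ==> sqint (X k)" for k by (rule cspan_sqint[OF gf_sqint[OF G] X])
 have Xm: "k \<le> n ==> X k \<in> borel_measurable M" for k by (rule sqintD[OF sq])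
 define A where "A k = {z \<in> space M. l \<le> \<bar>X k z\<bar> \<and> (\<forall>j\<in>{..<k}. \<bar>X j z\<bar> < l)}" for k
 define F where "F k = gen (X ` {..k})" for k
 have sub: "subalgebra M (F k)" if "k \<le> n" for k
  unfolding F_def by (rule subalgebra_gen) (use that Xm in auto)
 have XF: "X j \<in> borel_measurable (F k)" if "j \<le> k" for j k
  unfolding F_def by (rule gen_measurable) (use that in auto)
 have AF: "A k \<in> sets (F k)" for k
 proof -
  have [measurable]: "X k \<in> borel_measurable (F k)" "\<And>j. j \<in> {..<k} ==> X j \<in> borel_measurable (F k)" by (auto intro: XF)
  have "A k = {z \<in> space (F k). l \<le> \<bar>X k z\<bar> \<and> (\<forall>j\<in>{..<k}. \<bar>X j z\<bar> < l)}" by (simp add: A_def F_def)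
  also have "\<dots> \<in> sets (F k)" by measurable
  finally show ?thesis .
 qed
 have AM: "A k \<in> events" if "k \<le> n" for k using AF[of k] sub[OF that] by (auto simp: subalgebra_def)
 have dis: "disjoint_family_on A {..n}"
  unfolding disjoint_family_on_def
 proof (intro ballI impI)
  fix j k :: nat assume "j \<noteq> k"
  then consider "j < k" | "k < j" by linarith
  then show "A j \<inter> A k = {}" by cases (force simp: A_def)+
 qed
 have cover: "{z \<in> space M. \<exists>k\<le>n. l \<le> \<bar>X k z\<bar>} = (\<Union>k\<le>n. A k)"
 proof (intro set_eqI iffI)
  fix z assume "z \<in> {z \<in> space M. \<exists>k\<le>n. l \<le> \<bar>X k z\<bar>}"
  then have w: "z \<in> space M" and ex: "\<exists>k. k \<le> n \<and> l \<le> \<bar>X k z\<bar>" by auto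
  define k where "k = (LEAST k. k \<le> n \<and> l \<le> \<bar>X k z\<bar>)"
  have k: "k \<le> n" "l \<le> \<bar>X k z\<bar>" using LeastI_ex[OF ex] by (auto simp: k_def)
  have "\<bar>X j z\<bar> < l" if "j < k" for j
   using not_less_Least[OF that[unfolded k_def]] that k(1) by auto
  then show "z \<in> (\<Union>k\<le>n. A k)" using w k by (auto simp: A_def)
 qed (auto simp: A_def)
 have each: "l\<^sup>2 * prob (A k) \<le> expectation (\<lambda>z. (X n z)\<^sup>2 * indicator (A k) z)" if k: "k \<le> n" for k
 proof -
  define D where "D z = X n z - X k z" for z
  have Dc: "D \<in> cspan S" unfolding D_def[abs_def] by (rule cspan_diff[OF gf_sqint[OF G] X X]) (use k in auto)
  note sD = cspan_sqint[OF gf_sqint[OF G] Dc]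
  have i1: "integrable M (\<lambda>z. (X k z * indicator (A k) z) * D z)"
   using integrable_mult_indicator[OF AM[OF k] sqint_mult[OF sq[OF k] sD]] by (simp add: mult_ac)
  have i2: "integrable M (\<lambda>z. (X k z)\<^sup>2 * indicator (A k) z)" "integrable M (\<lambda>z. (D z)\<^sup>2 * indicator (A k) z)"
   using integrable_mult_indicator[OF AM[OF k], of "\<lambda>z. (X k z)\<^sup>2"] integrable_mult_indicator[OF AM[OF k], of "\<lambda>z. (D z)\<^sup>2"]
    sq[OF k] sD by (auto simp: sqint_def mult.commute)
  have "expectation (\<lambda>z. (X k z * indicator (A k) z) * D z) = 0"
  proof (rule gf_orth_past(2)[OF Dc, of "X ` {..k}"])
   show "X ` {..k} \<subseteq> cspan S" using X k by auto
   show "(\<lambda>z. X k z * indicator (A k) z) \<in> borel_measurable (gen (X ` {..k}))"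
    using XF[OF order_refl, of k] AF[of k] unfolding F_def by measurable
   show "expectation (\<lambda>z. Z z * D z) = 0" if "Z \<in> X ` {..k}" for Z
    using that orth[OF _ k] by (auto simp: D_def)
  qed (rule i1)
  moreover have "(X n z)\<^sup>2 * indicator (A k) z = (X k z)\<^sup>2 * indicator (A k) z + 2 * ((X k z * indicator (A k) z) * D z) + (D z)\<^sup>2 * indicator (A k) z" for z
   by (simp add: D_def power2_eq_square algebra_simps)
  ultimately have "expectation (\<lambda>z. (X n z)\<^sup>2 * indicator (A k) z) = expectation (\<lambda>z. (X k z)\<^sup>2 * indicator (A k) z) + expectation (\<lambda>z. (D z)\<^sup>2 * indicator (A k) z)"
   using i1 i2 by simp
  moreover have "0 \<le> expectation (\<lambda>z. (D z)\<^sup>2 * indicator (A k) z)" by (rule integral_nonneg_AE) auto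
  moreover have "l\<^sup>2 * prob (A k) \<le> expectation (\<lambda>z. (X k z)\<^sup>2 * indicator (A k) z)"
  proof -
   have "l\<^sup>2 * prob (A k) = expectation (\<lambda>z. l\<^sup>2 * indicator (A k) z)" using AM[OF k] by simp
   also have "\<dots> \<le> expectation (\<lambda>z. (X k z)\<^sup>2 * indicator (A k) z)"
   proof (rule integral_mono[OF _ i2(1)])
    show "integrable M (\<lambda>z. l\<^sup>2 * indicator (A k) z :: real)" using AM[OF k] by (intro integrable_mult_right integrable_real_indicator) (auto simp: emeasure_eq_measure)
    fix z
    show "l\<^sup>2 * indicator (A k) z \<le> (X k z)\<^sup>2 * indicator (A k) z"
    proof (cases "z \<in> A k")
     case True
     then have "l\<^sup>2 \<le> \<bar>X k z\<bar>\<^sup>2" using l by (intro power_mono) (auto simp: A_def)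
     then show ?thesis using True by simp
    qed simp
   qed
   finally show ?thesis .
  qed
  ultimately show ?thesis by linarith
 qed
 have Xi: "integrable M (\<lambda>z. (X n z)\<^sup>2 * indicator (A k) z)" if "k \<le> n" for k
  using integrable_mult_indicator[OF AM[OF that], of "\<lambda>z. (X n z)\<^sup>2"] sq[of n] by (auto simp: sqint_def mult.commute)
 have "l\<^sup>2 * prob {z \<in> space M. \<exists>k\<le>n. l \<le> \<bar>X k z\<bar>} = (\<Sum>k\<le>n. l\<^sup>2 * prob (A k))"
  unfolding cover sum_distrib_left[symmetric]
  by (subst finite_measure_finite_Union[OF _ _ dis]) (use AM in auto)
 also have "\<dots> \<le> (\<Sum>k\<le>n. expectation (\<lambda>z. (X n z)\<^sup>2 * indicator (A k) z))" by (intro sum_mono each) simp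
 also have "\<dots> = expectation (\<lambda>z. \<Sum>k\<le>n. (X n z)\<^sup>2 * indicator (A k) z)"
  by (rule Bochner_Integration.integral_sum[symmetric]) (use Xi in auto)
 also have "\<dots> \<le> expectation (\<lambda>z. (X n z)\<^sup>2)"
 proof (rule integral_mono)
  show "integrable M (\<lambda>z. \<Sum>k\<le>n. (X n z)\<^sup>2 * indicator (A k) z)" by (intro Bochner_Integration.integrable_sum Xi) simp
  show "integrable M (\<lambda>z. (X n z)\<^sup>2)" using sq[of n] by (simp add: sqint_def)
  fix z
  have "(\<Sum>k\<le>n. indicator (A k) z) = (indicator (\<Union>k\<le>n. A k) z :: real)"
   by (rule indicator_UN_disjoint[symmetric]) (use dis in auto)
  also have "\<dots> \<le> 1" by (auto simp: indicator_def)
  finally have "(X n z)\<^sup>2 * (\<Sum>k\<le>n. indicator (A k) z) \<le> (X n z)\<^sup>2 * 1" by (rule mult_left_mono) simp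
  then show "(\<Sum>k\<le>n. (X n z)\<^sup>2 * indicator (A k) z) \<le> (X n z)\<^sup>2" by (simp add: sum_distrib_left)
 qed
 finally show ?thesis using l by (simp add: ms_real pos_le_divide_eq mult.commute)
qed

text \<open>The discrete inequality is applied on dyadic grids. They are nested, so the exceptional
  events increase and their union obeys the same bound; off the union the values on all grids stay
  below \<open>l\<close>, and continuity extends this to all times.\<close>

lemma maximal_inequality_continuous:
 fixes Y :: "real => 'a => real"
 assumes T: "T > 0" and Y: "\<And>t. t \<in> {0..T} ==> Y t \<in> cspan S" and c: "\<And>z. z \<in> space M ==> continuous_on {0..T} (\<lambda>t. Y t z)"
  and orth: "\<And>s u. 0 \<le> s ==> s \<le> u ==> u \<le> T ==> expectation (\<lambda>z. Y s z * (Y T z - Y u z)) = 0"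
  and l: "l > 0"
 obtains B where "B \<in> events" "prob B \<le> ms (Y T) / l\<^sup>2" "\<And>z t. z \<in> space M - B ==> t \<in> {0..T} ==> \<bar>Y t z\<bar> \<le> l"
proof -
 define g where "g n k = T * real k / 2 ^ n" for n k :: nat
 have gin: "g n k \<in> {0..T}" if "k \<le> 2 ^ n" for n k
  using that T by (auto simp: g_def divide_le_eq intro!: mult_left_mono)
 have gT: "g n (2 ^ n) = T" for n by (simp add: g_def)
 define B where "B n = {z \<in> space M. \<exists>k\<le>2 ^ n. l \<le> \<bar>Y (g n k) z\<bar>}" for n
 have Ym: "t \<in> {0..T} ==> Y t \<in> borel_measurable M" for t by (rule sqintD[OF cspan_sqint[OF gf_sqint[OF G] Y]])
 have Bev: "B n \<in> events" for n
 proof -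
  have "B n = (\<Union>k\<in>{..2 ^ n}. {z \<in> space M. l \<le> \<bar>Y (g n k) z\<bar>})" by (auto simp: B_def)
  moreover have "{z \<in> space M. l \<le> \<bar>Y (g n k) z\<bar>} \<in> events" if "k \<in> {..2 ^ n}" for k
  proof -
   have [measurable]: "Y (g n k) \<in> borel_measurable M" by (rule Ym[OF gin]) (use that in simp)
   show ?thesis by measurable
  qed
  ultimately show ?thesis by auto
 qed
 have Bp: "prob (B n) \<le> ms (Y T) / l\<^sup>2" for n
 proof -
  have "prob {z \<in> space M. \<exists>k\<le>2 ^ n. l \<le> \<bar>Y (g n k) z\<bar>} \<le> ms (Y (g n (2 ^ n))) / l\<^sup>2"
  proof (rule maximal_inequality[OF _ _ l])
   show "Y (g n k) \<in> cspan S" if "k \<le> 2 ^ n" for k by (rule Y[OF gin[OF that]])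
   fix j k :: nat assume jk: "j \<le> k" "k \<le> 2 ^ n"
   have "g n j \<le> g n k" using jk(1) T by (simp add: g_def divide_right_mono)
   then show "expectation (\<lambda>z. Y (g n j) z * (Y (g n (2 ^ n)) z - Y (g n k) z)) = 0"
    unfolding gT using gin[of j n] gin[of k n] jk by (intro orth) auto
  qed
  then show ?thesis by (simp add: B_def gT)
 qed
 have inc: "incseq B"
 proof (rule incseq_SucI, rule subsetI)
  fix n z assume "z \<in> B n"
  then obtain k where k: "z \<in> space M" "k \<le> 2 ^ n" "l \<le> \<bar>Y (g n k) z\<bar>" by (auto simp: B_def)
  have "g (Suc n) (2 * k) = g n k" by (simp add: g_def)
  then show "z \<in> B (Suc n)" unfolding B_def using k by (intro CollectI conjI exI[of _ "2 * k"]) auto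
 qed
 have "(\<lambda>n. prob (B n)) \<longlonglongrightarrow> prob (\<Union>n. B n)"
  by (rule finite_Lim_measure_incseq[OF _ inc]) (use Bev in auto)
 then have "prob (\<Union>n. B n) \<le> ms (Y T) / l\<^sup>2" by (rule LIMSEQ_le_const2) (use Bp in auto)
 moreover have "\<bar>Y t z\<bar> \<le> l" if w: "z \<in> space M - (\<Union>n. B n)" and t: "t \<in> {0..T}" for z t
 proof -
  define k where "k n = nat \<lfloor>t / T * 2 ^ n\<rfloor>" for n
  have tT: "0 \<le> t / T" "t / T \<le> 1" using t T by auto
  have k1: "real (k n) \<le> t / T * 2 ^ n" "t / T * 2 ^ n - 1 < real (k n)" for n
  proof -
   have f: "0 \<le> t / T * 2 ^ n" by (rule mult_nonneg_nonneg[OF tT(1)]) simp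
   then have "real (k n) = of_int \<lfloor>t / T * 2 ^ n\<rfloor>" unfolding k_def by (intro of_nat_nat) simp
   then show "real (k n) \<le> t / T * 2 ^ n" "t / T * 2 ^ n - 1 < real (k n)" by linarith+
  qed
  have k2: "k n \<le> 2 ^ n" for n
  proof -
   have "real (k n) \<le> 1 * 2 ^ n" by (rule order_trans[OF k1(1) mult_right_mono[OF tT(2)]]) simp
   then show ?thesis by (simp flip: of_nat_le_iff)
  qed
  have "(\<lambda>n. g n (k n)) \<longlonglongrightarrow> t"
  proof (rule LIM_zero_cancel, rule Lim_null_comparison)
   show "(\<lambda>n. T * (1 / 2) ^ n) \<longlonglongrightarrow> 0" using tendsto_mult_right_zero[OF LIMSEQ_realpow_zero[of "1/2"]] by simp
   have "norm (g n (k n) - t) \<le> T * (1 / 2) ^ n" for n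
   proof -
    have "g n (k n) - t = T / 2 ^ n * (real (k n) - t / T * 2 ^ n)" using T by (simp add: g_def field_simps)
    moreover have "\<bar>real (k n) - t / T * 2 ^ n\<bar> \<le> 1" using k1[of n] by linarith
    ultimately have "norm (g n (k n) - t) \<le> T / 2 ^ n * 1"
     using T by (simp only: real_norm_def abs_mult) (intro mult_mono, auto)
    then show ?thesis by (simp add: power_one_over)
   qed
   then show "\<forall>\<^sub>F n in sequentially. norm (g n (k n) - t) \<le> T * (1 / 2) ^ n" by simp
  qed
  then have "(\<lambda>n. Y (g n (k n)) z) \<longlonglongrightarrow> Y t z"
   by (rule continuous_on_tendsto_compose[OF c[of z] _ t, rotated]) (use w gin[OF k2] in \<open>auto intro!: always_eventually\<close>)
  then have "(\<lambda>n. \<bar>Y (g n (k n)) z\<bar>) \<longlonglongrightarrow> \<bar>Y t z\<bar>" by (rule tendsto_rabs)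
  moreover have "\<bar>Y (g n (k n)) z\<bar> \<le> l" for n using w k2[of n] by (force simp: B_def)
  ultimately show ?thesis by (intro LIMSEQ_le_const2) auto
 qed
 moreover have "(\<Union>n. B n) \<in> events" using Bev by auto
 ultimately show ?thesis using that by blast
qed

end

end

section \<open>The Wiener integral\<close>

lemma L2_tendsto:
 fixes B :: "'a::euclidean_space => 'b::euclidean_space => 'c::euclidean_space"
 assumes B: "bounded_bilinear B" and F: "\<And>j. L2on T (F j)" and f: "L2on T f" and lim: "(\<lambda>j. sqdist T (F j) f) \<longlonglongrightarrow> 0"
  and q: "L2on T q" and t: "t \<in> {0..T}"
 shows "(\<lambda>j. prim (\<lambda>s. B (F j s) (q s)) t) \<longlonglongrightarrow> prim (\<lambda>s. B (f s) (q s)) t"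
proof (rule LIMSEQ_I)
 fix e :: real assume e: "e > 0"
 obtain K where K: "\<And>x y. norm (B x y) \<le> norm x * norm y * K" "K > 0" using bounded_bilinear.pos_bounded[OF B] by auto
 have tT: "t \<le> T" using t by simp
 define Q where "Q = prim (\<lambda>s. (norm (q s))\<^sup>2) T"
 have Q0: "0 \<le> Q" unfolding Q_def by (rule prim_nonneg) simp
 \<comment> \<open>Weight in \<open>K x y \<le> (K l / 2) x\<^sup>2 + K / (2 l) y\<^sup>2\<close>,
   chosen so that the second term contributes at most \<open>e / 2\<close> after integration. Adding
   1 covers \<open>Q = 0\<close>.\<close>
 define l where "l = K * (Q + 1) / e"
 have l: "l > 0" using K(2) Q0 e by (simp add: l_def)
 have "\<forall>\<^sub>F j in sequentially. sqdist T (F j) f < e / (K * l)"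
  by (rule order_tendstoD(2)[OF lim]) (use e K(2) l in simp)
 then obtain J where J: "\<And>j. j \<ge> J ==> sqdist T (F j) f < e / (K * l)" by (auto simp: eventually_sequentially)
 show "\<exists>J. \<forall>j\<ge>J. norm (prim (\<lambda>s. B (F j s) (q s)) t - prim (\<lambda>s. B (f s) (q s)) t) < e"
 proof (intro exI allI impI)
  fix j assume j: "j \<ge> J"
  note d = L2on_diff[OF F[of j] f]
  have i: "L1on T (\<lambda>s. (norm (F j s - f s))\<^sup>2)" "L1on T (\<lambda>s. (norm (q s))\<^sup>2)" using d q by (auto simp: L2on_def)
  have iw: "L1on T (\<lambda>s. K * l / 2 * (norm (F j s - f s))\<^sup>2 + K / (2 * l) * (norm (q s))\<^sup>2)"
   by (rule set_integral_add(1)) (use i in auto)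
  have "prim (\<lambda>s. B (F j s) (q s)) t - prim (\<lambda>s. B (f s) (q s)) t = prim (\<lambda>s. B (F j s - f s) (q s)) t"
   using prim_diff[OF L2on_bilinear[OF B F[of j] q] L2on_bilinear[OF B f q] tT] by (simp add: bounded_bilinear.diff_left[OF B])
  also have "norm \<dots> \<le> prim (\<lambda>s. K * l / 2 * (norm (F j s - f s))\<^sup>2 + K / (2 * l) * (norm (q s))\<^sup>2) t"
  proof (rule norm_prim_le[OF L2on_bilinear[OF B d q] iw _ tT])
   fix s
   let ?x = "norm (F j s - f s)" and ?y = "norm (q s)"
   have "0 \<le> (l * ?x - ?y)\<^sup>2" by simp
   then have "2 * l * (?x * ?y) \<le> l\<^sup>2 * ?x\<^sup>2 + ?y\<^sup>2" by (simp add: power2_eq_square algebra_simps)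
   then have "?x * ?y \<le> (l\<^sup>2 * ?x\<^sup>2 + ?y\<^sup>2) / (2 * l)" using l by (simp add: pos_le_divide_eq mult_ac)
   also have "\<dots> = l / 2 * ?x\<^sup>2 + 1 / (2 * l) * ?y\<^sup>2" using l by (simp add: field_simps power2_eq_square)
   finally have "?x * ?y * K \<le> (l / 2 * ?x\<^sup>2 + 1 / (2 * l) * ?y\<^sup>2) * K" using K(2) by (intro mult_right_mono) auto
   then show "norm (B (F j s - f s) (q s)) \<le> K * l / 2 * ?x\<^sup>2 + K / (2 * l) * ?y\<^sup>2"
    using K(1)[of "F j s - f s" "q s"] by (simp add: algebra_simps)
  qed
  also have "\<dots> \<le> prim (\<lambda>s. K * l / 2 * (norm (F j s - f s))\<^sup>2 + K / (2 * l) * (norm (q s))\<^sup>2) T"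
   using t K(2) l by (intro prim_mono2[OF iw]) auto
  also have "\<dots> = K * l / 2 * sqdist T (F j) f + K / (2 * l) * Q"
   unfolding Q_def using i by (subst set_integral_add(2)) auto
  also have "K * l / 2 * sqdist T (F j) f < K * l / 2 * (e / (K * l))" using J[OF j] K(2) l by (intro mult_strict_left_mono) auto
  also have "K * l / 2 * (e / (K * l)) = e / 2" using K(2) l by simp
  also have "K / (2 * l) * Q \<le> e / 2"
  proof -
   have "K / (2 * l) * Q = e / 2 * (Q / (Q + 1))" using K(2) by (simp add: l_def)
   also have "\<dots> \<le> e / 2 * 1" using Q0 e by (intro mult_left_mono) auto
   finally show ?thesis by simp
  qed
  finally show "norm (prim (\<lambda>s. B (F j s) (q s)) t - prim (\<lambda>s. B (f s) (q s)) t) < e" by simp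
 qed
qed

lemma L2on_indicator:
 assumes f: "L2on T f" and A: "A \<in> sets borel"
 shows "L2on T (\<lambda>s. indicator A s *\<^sub>R f s)"
proof -
 have m: "set_borel_measurable lborel {0..T} (\<lambda>s. indicator A s :: real)" using A by (simp add: set_borel_measurable_def)
 have fm: "set_borel_measurable lborel {0..T} f" "L1on T (\<lambda>s. (norm (f s))\<^sup>2)" using f by (auto simp: L2on_def)
 have m2: "set_borel_measurable lborel {0..T} (\<lambda>s. indicator A s * (norm (f s))\<^sup>2)"
  by (rule set_borel_measurable_bilinear[OF bounded_bilinear_mult m L1on_meas[OF fm(2)]])
 have e: "(norm (indicator A s *\<^sub>R f s))\<^sup>2 = indicator A s * (norm (f s))\<^sup>2" for s by (simp add: indicator_def)
 have "L1on T (\<lambda>s. (norm (indicator A s *\<^sub>R f s))\<^sup>2)" unfolding e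
  by (rule L1on_bound[OF fm(2) m2]) (simp add: indicator_def)
 then show ?thesis unfolding L2on_def using set_borel_measurable_bilinear[OF bounded_bilinear_scaleR m fm(1)] by blast
qed

lemma prim_indicator: "0 \<le> t ==> 0 \<le> v ==> prim (\<lambda>s. indicator {0..v} s *\<^sub>R f s) t = prim f (min t v)"
 unfolding set_lebesgue_integral_def by (rule lint_cong) (auto simp: indicator_def)

lemma prim_interval:
 assumes f: "L1on T f" and ab: "0 \<le> a" "a \<le> b" "b \<le> T"
 shows "prim f b - prim f a = integral\<^sup>L lborel (\<lambda>s. indicator {a<..b} s *\<^sub>R f s)"
proof -
 have i: "integrable lborel (\<lambda>s. indicator {0..b} s *\<^sub>R f s)" "integrable lborel (\<lambda>s. indicator {0..a} s *\<^sub>R f s)"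
  using L1on_subset[OF f, of b] L1on_subset[OF f, of a] ab by (auto simp: set_integrable_def)
 show ?thesis
  unfolding set_lebesgue_integral_def lint_diff[OF i, symmetric]
  by (rule lint_cong) (use ab in \<open>auto simp: indicator_def\<close>)
qed

text \<open>Grid points stopped at \<open>t\<close>: increments beyond \<open>t\<close> vanish, so
  the sum over all cells is the integral up to \<open>t\<close>, exactly as in
  \<open>simple_integral\<close>.\<close>

definition node :: "real => nat => real => nat => real" where
 "node T K t i = min (T * real i / real K) t"

lemma node_bounds:
 assumes "0 \<le> T" "t \<in> {0..T}"
 shows "node T K t i \<in> {0..t}" "node T K t i \<le> node T K t (Suc i)" "node T K t i \<in> {0..T}"
 using assms by (auto simp: node_def min_le_iff_disj divide_right_mono mult_left_mono intro: min.mono)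

text \<open>An elementary integral against an absolutely continuous integrator is a Lebesgue
  integral of the step function. It serves both for covariances of elementary integrals and for the
  drift of the integrator along a path.\<close>

lemma stepf_prim:
 fixes B :: "'a::euclidean_space => 'b::euclidean_space => 'c::euclidean_space" and c :: "nat => 'a" and q :: "real => 'b"
 assumes B: "bounded_bilinear B" and T: "0 \<le> T" and q: "L1on T q" and t: "t \<in> {0..T}"
 shows "(\<Sum>i<K. B (c i) (prim q (node T K t (Suc i)) - prim q (node T K t i))) = prim (\<lambda>s. B (stepf T K c s) (q s)) t"
proof -
 interpret bounded_bilinear B by fact
 note nb = node_bounds[OF T t]
 have iJ: "integrable lborel (\<lambda>s. indicator {node T K t i<..node T K t (Suc i)} s *\<^sub>R q s)" for i
 proof -
  have "{node T K t i<..node T K t (Suc i)} \<subseteq> {0..T}" using nb(3)[of K i] nb(3)[of K "Suc i"] by auto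
  from set_integrable_subset[OF q _ this] show ?thesis by (simp add: set_integrable_def)
 qed
 have "B (c i) (prim q (node T K t (Suc i)) - prim q (node T K t i))
   = (\<integral>s. B (c i) (indicator {node T K t i<..node T K t (Suc i)} s *\<^sub>R q s) \<partial>lborel)" for i
 proof -
  have "prim q (node T K t (Suc i)) - prim q (node T K t i) = (\<integral>s. indicator {node T K t i<..node T K t (Suc i)} s *\<^sub>R q s \<partial>lborel)"
   by (rule prim_interval[OF q]) (use nb(2,3)[of K i] nb(3)[of K "Suc i"] in auto)
  then show ?thesis by (simp only: integral_bounded_linear[OF bounded_linear_right iJ])
 qed
 then have "(\<Sum>i<K. B (c i) (prim q (node T K t (Suc i)) - prim q (node T K t i)))
   = (\<Sum>i<K. (\<integral>s. B (c i) (indicator {node T K t i<..node T K t (Suc i)} s *\<^sub>R q s) \<partial>lborel))"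
  by (simp only:)
 also have "\<dots> = (\<integral>s. (\<Sum>i<K. B (c i) (indicator {node T K t i<..node T K t (Suc i)} s *\<^sub>R q s)) \<partial>lborel)"
  by (rule Bochner_Integration.integral_sum[symmetric]) (rule integrable_bounded_linear[OF bounded_linear_right iJ])
 also have "\<dots> = prim (\<lambda>s. B (stepf T K c s) (q s)) t"
  unfolding set_lebesgue_integral_def
 proof (rule lint_cong[OF refl])
  fix s
  have "indicator {node T K t i<..node T K t (Suc i)} s = indicator {0..t} s * (indicator {T * real i / real K<..T * real (Suc i) / real K} s :: real)" for i
  proof -
   have "0 \<le> T * real i / real K" using T by simp
   then show ?thesis by (auto simp: indicator_def node_def simp del: of_nat_Suc)
  qed
  then show "(\<Sum>i<K. B (c i) (indicator {node T K t i<..node T K t (Suc i)} s *\<^sub>R q s)) = indicator {0..t} s *\<^sub>R B (stepf T K c s) (q s)"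
   unfolding stepf_def sum_left scaleR_sum_right
   by (intro sum.cong) (simp_all add: scaleR_left scaleR_right del: of_nat_Suc)
 qed
 finally show ?thesis .
qed

text \<open>The elementary integral of a nonrandom step function. The integrator is arbitrary, so
  the same coefficients can be used with \<open>B\<close>, with the observation and with the
  innovation.\<close>

definition wint :: "real => nat => (nat => real^'n^'d) => (real => 'w => real^'n) => real => 'w => real^'d" where
 "wint T K c N t w = (\<Sum>i<K. c i *v (N (node T K t (Suc i)) w - N (node T K t i) w))"

lemma wint_eq_simple_integral:
 "wint T K c N t w = simple_integral K (\<lambda>i. T * real i / real K) (\<lambda>i _. c i) N t w"
 by (simp add: wint_def simple_integral_def node_def)

context prob_space
begin

lemma cov_sum_left: "(\<And>i. i \<in> I ==> sqint (V i)) ==> sqint Z ==> cov (\<lambda>w. \<Sum>i\<in>I. V i w) Z = (\<Sum>i\<in>I. cov (V i) Z)"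
 unfolding cov_def bb_outer.sum_left by (rule Bochner_Integration.integral_sum) (auto intro: sqint_bilinear[OF bb_outer])

lemma ms_trace: "sqint V ==> ms V = trace (cov V V)"
 by (simp add: ms_components cov_component trace_def ms_real power2_eq_square)

lemma trace_mult_transpose: "trace (A ** transpose A) = (norm (A :: real^'n^'d))\<^sup>2"
 unfolding power2_norm_eq_inner inner_vec_def
 by (simp add: trace_def matrix_matrix_mult_def transpose_def inner_vec_def)

definition past :: "(real => 'a => real^'n) => real => ('a => real) set" where
 "past N t = {\<lambda>w. N s w $ j | s j. s \<in> {0..t}}"

context
 fixes S :: "('a => real) set"
 assumes G: "gaussian_family S"
begin

lemma past_cspan: "gproc T S N ==> t \<in> {0..T} ==> past N t \<subseteq> cspan S"
 by (auto simp: past_def gproc_def vspan_def)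

lemma past_family: "gproc T S N ==> t \<in> {0..T} ==> gaussian_family (past N t)"
 by (rule gaussian_family_subset[OF G past_cspan])

lemma vspan_past: "gproc T S N ==> t \<in> {0..T} ==> s \<in> {0..t} ==> vspan (past N t) (N s)"
 unfolding vspan_def by (intro allI cspan_base[OF gf_sqint[OF past_family]]) (auto simp: past_def)

lemma wint_vspan:
 assumes N: "gproc T S N" and T: "0 \<le> T" and t: "t \<in> {0..T}"
 shows "vspan (past N t) (wint T K c N t)"
 unfolding wint_def[abs_def]
 by (intro vspan_sum[OF gf_sqint[OF past_family[OF N t]]] vspan_mv[OF gf_sqint[OF past_family[OF N t]]]
   vspan_diff[OF gf_sqint[OF past_family[OF N t]]] vspan_past[OF N t] node_bounds(1)[OF T t])

lemma vspan_past_imp: "gproc T S N ==> t \<in> {0..T} ==> vspan (past N t) V ==> vspan S V"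
 unfolding vspan_def using cspan_idem[where S=S and S'="past N t", OF gf_sqint[OF G]] past_cspan by blast

lemma gproc_wint:
 assumes N: "gproc T S N" and T: "0 \<le> T"
 shows "gproc T S (wint T K c N)"
proof -
 have "continuous_on {0..T} (\<lambda>t. wint T K c N t z)" if w: "z \<in> space M" for z
 proof -
  have "continuous_on {0..T} (\<lambda>t. N (node T K t i) z)" for i
   by (rule continuous_on_compose2[OF gproc_path[OF N w], where f="\<lambda>t. node T K t i"])
    (use node_bounds(3)[OF T] in \<open>auto simp: node_def intro!: continuous_intros\<close>)
  then show ?thesis unfolding wint_def by (intro continuous_intros)
 qed
 then show ?thesis
  unfolding gproc_def cproc_def
  using vspan_past_imp[OF N _ wint_vspan[OF N T]] sqintD[OF vspan_sqint[OF gf_sqint[OF G]]] by blast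
qed

lemma cov_wint:
 fixes c :: "nat => real^'n^'d" and V :: "'a => real^'k"
 assumes N: "gproc T S N" and T: "0 \<le> T" and t: "t \<in> {0..T}" and V: "sqint V" and q: "L1on T q"
  and NV: "\<And>u. u \<in> {0..T} ==> cov (N u) V = prim q u"
 shows "cov (wint T K c N t) V = prim (\<lambda>s. stepf T K c s ** q s) t"
proof -
 have sq: "sqint (N (node T K t i))" for i by (rule gproc_sqint[OF G N node_bounds(3)[OF T t]])
 have "cov (wint T K c N t) V = (\<Sum>i<K. c i ** (cov (N (node T K t (Suc i))) V - cov (N (node T K t i)) V))"
  unfolding wint_def[abs_def]
  by (simp add: cov_sum_left cov_mv_left cov_diff_left sqint_mv sqint_diff sq V)
 also have "\<dots> = (\<Sum>i<K. c i ** (prim q (node T K t (Suc i)) - prim q (node T K t i)))"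
  by (simp only: NV[OF node_bounds(3)[OF T t]])
 also have "\<dots> = prim (\<lambda>s. stepf T K c s ** q s) t" by (rule stepf_prim[OF bb_mm T q t])
 finally show ?thesis .
qed

text \<open>Inside a Gaussian family the covariance determines everything else: independence of
  increments and the start at 0 are consequences, so only the covariance is recorded.\<close>

definition bm :: "real => (real => 'a => real^'n) => bool" where
 "bm T N \<longleftrightarrow> gproc T S N \<and> (\<forall>s\<in>{0..T}. \<forall>t\<in>{0..T}. cov (N s) (N t) = min s t *\<^sub>R mat 1)"

lemma bmD: "bm T N ==> gproc T S N" "bm T N ==> s \<in> {0..T} ==> t \<in> {0..T} ==> cov (N s) (N t) = min s t *\<^sub>R mat 1"
 by (auto simp: bm_def)

lemma prim_const: "0 \<le> t ==> prim (\<lambda>s. x) t = t *\<^sub>R (x :: 'b::euclidean_space)"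
 by (simp add: set_integral_const)

text \<open>The covariance \<open>min u v\<close> of Brownian motion with its value at
  \<open>v\<close> is the primitive of the indicator of \<open>[0,v]\<close>. In this form it fits
  the general rule that integrates a density \<open>q\<close> of the covariance of the integrator
  with a fixed vector.\<close>

lemma wiener_cov_past:
 fixes f :: "real => real^'n^'d"
 assumes f: "L2on T f" and v: "v \<in> {0..T}" and t: "t \<in> {0..T}"
 shows "L2on T (\<lambda>s. indicator {0..v} s *\<^sub>R (mat 1 :: real^'n^'n))"
  and "u \<in> {0..T} ==> prim (\<lambda>s. indicator {0..v} s *\<^sub>R (mat 1 :: real^'n^'n)) u = min u v *\<^sub>R mat 1"
  and "prim (\<lambda>s. f s ** (indicator {0..v} s *\<^sub>R (mat 1 :: real^'n^'n))) t = prim f (min t v)"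
proof -
 show "L2on T (\<lambda>s. indicator {0..v} s *\<^sub>R (mat 1 :: real^'n^'n))"
  by (rule L2on_bounded[where C="norm (mat 1 :: real^'n^'n)"]) (auto simp: set_borel_measurable_def indicator_def)
 show "prim (\<lambda>s. indicator {0..v} s *\<^sub>R (mat 1 :: real^'n^'n)) u = min u v *\<^sub>R mat 1" if "u \<in> {0..T}"
  using that v by (subst prim_indicator) (auto simp: prim_const)
 have "prim (\<lambda>s. f s ** (indicator {0..v} s *\<^sub>R (mat 1 :: real^'n^'n))) t = prim (\<lambda>s. indicator {0..v} s *\<^sub>R f s) t"
  by (simp add: bb_mm.scaleR_right)
 then show "prim (\<lambda>s. f s ** (indicator {0..v} s *\<^sub>R (mat 1 :: real^'n^'n))) t = prim f (min t v)"
  using v t by (simp add: prim_indicator)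
qed

lemma cov_wint_past:
 fixes N :: "real => 'a => real^'n"
 assumes N: "bm T N" and T: "0 \<le> T" and t: "t \<in> {0..T}" and v: "v \<in> {0..T}"
 shows "cov (wint T K c N t) (N v) = prim (stepf T K c) (min t v)"
proof -
 have "cov (wint T K c N t) (N v) = prim (\<lambda>s. stepf T K c s ** (indicator {0..v} s *\<^sub>R (mat 1 :: real^'n^'n))) t"
  by (rule cov_wint[OF bmD(1)[OF N] T t gproc_sqint[OF G bmD(1)[OF N] v]
     L2on_L1on[OF wiener_cov_past(1)[OF L2on_stepf v t]]])
    (simp only: bmD(2)[OF N _ v] wiener_cov_past(2)[OF L2on_stepf v t])
 also have "\<dots> = prim (stepf T K c) (min t v)" by (rule wiener_cov_past(3)[OF L2on_stepf v t])
 finally show ?thesis .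
qed

text \<open>\<open>cov_wint\<close> is applied with the difference \<open>D\<close> of the two
  integrals as the fixed vector; the density of its covariance with the integrator is again the
  difference of the step functions, and taking the trace gives the squared norm.\<close>

lemma wint_isometry:
 fixes N :: "real => 'a => real^'n" and c c' :: "nat => real^'n^'d"
 assumes N: "bm T N" and T: "0 \<le> T" and t: "t \<in> {0..T}"
 shows "ms (\<lambda>w. wint T K c N t w - wint T K' c' N t w) = prim (\<lambda>s. (norm (stepf T K c s - stepf T K' c' s))\<^sup>2) t"
proof -
 note gN = bmD(1)[OF N]
 define D where "D w = wint T K c N t w - wint T K' c' N t w" for w
 define d where "d s = stepf T K c s - stepf T K' c' s" for s
 note sw = gproc_sqint[OF G gproc_wint[OF gN T] t]
 have D: "sqint D" unfolding D_def[abs_def] by (rule sqint_diff[OF sw sw])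
 have d: "L2on T d" unfolding d_def by (rule L2on_diff[OF L2on_stepf L2on_stepf])
 define q where "q s = indicator {0..t} s *\<^sub>R transpose (d s)" for s
 have dT: "L2on T (\<lambda>s. transpose (d s))" by (rule L2on_linear[OF bl_transpose d])
 have q2: "L2on T q" unfolding q_def[abs_def] by (rule L2on_indicator[OF dT]) simp
 note q = L2on_L1on[OF q2]
 have ND: "cov (N u) D = prim q u" if u: "u \<in> {0..T}" for u
 proof -
  have m: "min t u \<le> T" using t by (auto simp: min_le_iff_disj)
  have "cov D (N u) = prim (stepf T K c) (min t u) - prim (stepf T K' c') (min t u)"
   unfolding D_def[abs_def] cov_diff_left[OF sw sw gproc_sqint[OF G gN u]] cov_wint_past[OF N T t u] ..
  also have "\<dots> = prim d (min t u)" unfolding d_def by (rule prim_diff[OF L2on_L1on[OF L2on_stepf] L2on_L1on[OF L2on_stepf] m, symmetric])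
  finally have "cov (N u) D = transpose (prim d (min t u))" using cov_transpose[OF D gproc_sqint[OF G gN u]] by simp
  also have "\<dots> = prim (\<lambda>s. transpose (d s)) (min t u)" by (rule prim_transpose[OF L2on_L1on[OF d] m])
  also have "\<dots> = prim q u" unfolding q_def using t u by (simp add: prim_indicator min.commute)
  finally show ?thesis .
 qed
 have I: "L1on T (\<lambda>s. stepf T K c s ** q s)" for K and c :: "nat => real^'n^'d"
  by (rule L2on_bilinear[OF bb_mm L2on_stepf q2])
 have dd: "L1on T (\<lambda>s. d s ** transpose (d s))" by (rule L2on_bilinear[OF bb_mm d dT])
 have tT: "t \<le> T" using t by simp
 have "cov D D = cov (wint T K c N t) D - cov (wint T K' c' N t) D"
  using cov_diff_left[OF sw sw D] by (simp only: D_def[abs_def])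
 also have "\<dots> = prim (\<lambda>s. stepf T K c s ** q s) t - prim (\<lambda>s. stepf T K' c' s ** q s) t"
  by (simp only: cov_wint[OF gN T t D q ND])
 also have "\<dots> = prim (\<lambda>s. stepf T K c s ** q s - stepf T K' c' s ** q s) t" by (rule prim_diff[OF I I tT, symmetric])
 also have "\<dots> = prim (\<lambda>s. d s ** transpose (d s)) t"
  by (rule prim_cong) (simp add: q_def d_def bb_mm.diff_left)
 finally have "trace (cov D D) = trace (prim (\<lambda>s. d s ** transpose (d s)) t)" by simp
 also have "\<dots> = prim (\<lambda>s. trace (d s ** transpose (d s))) t"
 proof (rule prim_bounded_linear(1)[OF _ dd tT])
  show "bounded_linear (trace :: real^'d^'d => real)"
   unfolding linear_conv_bounded_linear[symmetric] by (rule linearI) (auto simp: trace_def sum.distrib sum_distrib_left)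
 qed
 finally have "ms D = prim (\<lambda>s. (norm (d s))\<^sup>2) t" by (simp add: ms_trace[OF D] trace_mult_transpose)
 then show ?thesis by (simp add: D_def[abs_def] d_def)
qed

text \<open>Step functions at squared distance \<open>16\<^sup>-\<^sup>j\<close> from \<open>f\<close>: by the maximal inequality and Borel-Cantelli
 their integrals converge uniformly in time, almost surely.\<close>

lemma wiener_integral:
 fixes N :: "real => 'a => real^'n" and f :: "real => real^'n^'d"
 assumes N: "bm T N" and T: "0 < T" and f: "L2on T f"
 obtains I K c where "gproc T S I" "\<And>j. (K j :: nat) > 0" "(\<lambda>j. sqdist T (stepf T (K j) (c j)) f) \<longlonglongrightarrow> 0"
  "\<And>t. t \<in> {0..T} ==> (\<lambda>j. ms (\<lambda>z. wint T (K j) (c j) N t z - I t z)) \<longlonglongrightarrow> 0"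
  "\<And>t. t \<in> {0..T} ==> vspan (past N t) (I t)"
proof -
 have T0: "0 \<le> T" using T by simp
 note gN = bmD(1)[OF N]
 \<comment> \<open>Consecutive elementary integrals differ at time \<open>T\<close> by at most
   \<open>4 * 16\<^sup>-\<^sup>j\<close> in mean square. At level \<open>2\<^sup>-\<^sup>j\<close>
   the maximal inequality yields probability at most \<open>4 * 4\<^sup>-\<^sup>j\<close> per
   component, and both levels and probabilities are summable.\<close>
 define e where "e j = (1 / 16 :: real) ^ j" for j :: nat
 have ej: "e j > 0" for j by (simp add: e_def)
 have "\<exists>d :: nat \<times> (nat => real^'n^'d). fst d > 0 \<and> sqdist T (stepf T (fst d) (snd d)) f < e j" for j
 proof -
  obtain K and c :: "nat => real^'n^'d" where "K > 0" "sqdist T (stepf T K c) f < e j" by (rule L2_step_dense[OF T f ej[of j]])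
  then show ?thesis by (intro exI[of _ "(K, c)"]) simp
 qed
 then have "\<exists>d :: nat => nat \<times> (nat => real^'n^'d). \<forall>j. fst (d j) > 0 \<and> sqdist T (stepf T (fst (d j)) (snd (d j))) f < e j"
  by (intro choice allI)
 then obtain d :: "nat => nat \<times> (nat => real^'n^'d)" where d: "\<And>j. fst (d j) > 0 \<and> sqdist T (stepf T (fst (d j)) (snd (d j))) f < e j"
  by blast
 define K where "K j = fst (d j)" for j
 define c where "c j = snd (d j)" for j
 have K: "(K j :: nat) > 0" and cf: "sqdist T (stepf T (K j) (c j)) f < e j" for j using d[of j] by (simp_all add: K_def c_def)
 have sq0: "0 \<le> sqdist T (stepf T (K j) (c j)) f" for j by (rule prim_nonneg) simp
 have cl: "(\<lambda>j. sqdist T (stepf T (K j) (c j)) f) \<longlonglongrightarrow> 0"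
 proof (rule tendsto_sandwich[of "\<lambda>_. 0" _ _ e])
  show "e \<longlonglongrightarrow> 0" unfolding e_def[abs_def] by (rule LIMSEQ_realpow_zero) auto
 qed (intro always_eventually allI sq0 less_imp_le[OF cf] tendsto_const)+
 define w where "w j = wint T (K j) (c j) N" for j
 define D where "D j t z = w (Suc j) t z - w j t z" for j t z
 have gw: "gproc T S (w j)" for j unfolding w_def by (rule gproc_wint[OF gN T0])
 have gD: "gproc T S (D j)" for j unfolding D_def[abs_def] by (rule gproc_diff[OF G gw gw])
 have msD: "ms (D j T) \<le> 4 * e j" for j
 proof -
  have "ms (D j T) = sqdist T (stepf T (K (Suc j)) (c (Suc j))) (stepf T (K j) (c j))"
   unfolding D_def[abs_def] w_def by (rule wint_isometry[OF N T0]) (use T in simp)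
  also have "\<dots> \<le> 2 * sqdist T (stepf T (K (Suc j)) (c (Suc j))) f + 2 * sqdist T f (stepf T (K j) (c j))"
   by (rule sqdist_triangle[OF L2on_stepf f L2on_stepf])
  also have "sqdist T f (stepf T (K j) (c j)) = sqdist T (stepf T (K j) (c j)) f" by (simp add: norm_minus_commute)
  finally have "ms (D j T) \<le> 2 * sqdist T (stepf T (K (Suc j)) (c (Suc j))) f + 2 * sqdist T (stepf T (K j) (c j)) f" .
  moreover have "e (Suc j) = e j / 16" by (simp add: e_def)
  ultimately show ?thesis using cf[of j] cf[of "Suc j"] ej[of j] by linarith
 qed
 have "\<exists>B. B \<in> events \<and> prob B \<le> 4 * (1 / 4) ^ j \<and> (\<forall>z\<in>space M - B. \<forall>t\<in>{0..T}. \<bar>D j t z $ i\<bar> \<le> (1 / 2) ^ j)" for j and i :: 'd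
 proof -
  obtain B where B: "B \<in> events" "prob B \<le> ms (\<lambda>z. D j T z $ i) / ((1 / 2) ^ j)\<^sup>2"
   "\<And>z t. z \<in> space M - B ==> t \<in> {0..T} ==> \<bar>D j t z $ i\<bar> \<le> (1 / 2) ^ j"
  proof (rule maximal_inequality_continuous[OF G T, of "\<lambda>t z. D j t z $ i" "(1 / 2) ^ j"])
   show "(\<lambda>z. D j t z $ i) \<in> cspan S" if "t \<in> {0..T}" for t using gprocD(2)[OF gD that, of j] by (simp add: vspan_def)
   show "continuous_on {0..T} (\<lambda>t. D j t z $ i)" if "z \<in> space M" for z
    by (intro continuous_intros gproc_path[OF gD that])
   fix s u :: real assume su: "0 \<le> s" "s \<le> u" "u \<le> T"
   then have s: "s \<in> {0..T}" and u: "u \<in> {0..T}" and TT: "T \<in> {0..T}" by auto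
   have Ds: "vspan (past N s) (D j s)" unfolding D_def[abs_def] w_def
    by (intro vspan_diff[OF gf_sqint[OF past_family[OF gN s]]] wint_vspan[OF gN T0 s])
   define R where "R z = D j T z - D j u z" for z
   have R: "sqint R" unfolding R_def[abs_def] by (rule sqint_diff[OF gproc_sqint[OF G gD TT] gproc_sqint[OF G gD u]])
   \<comment> \<open>The covariance of an elementary integral at time \<open>x\<close> with
     \<open>N v\<close> is a primitive up to \<open>min x v\<close>; for
     \<open>v \<le> s \<le> u\<close> it is the same at \<open>T\<close> and at \<open>u\<close>, so
     the increment is orthogonal to the past of \<open>N\<close> up to \<open>s\<close>.\<close>
   have "cov R (N v) = 0" if v: "v \<in> {0..s}" for v
   proof -
    have vT: "v \<in> {0..T}" using v su by auto
    have m: "min T v = v" "min u v = v" using v su by auto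
    note sN = gproc_sqint[OF G gN vT] and sw = gproc_sqint[OF G gw]
    have cw: "cov (w i x) (N v) = prim (stepf T (K i) (c i)) (min x v)" if "x \<in> {0..T}" for i x
     unfolding w_def by (rule cov_wint_past[OF N T0 that vT])
    have cD: "cov (D j x) (N v) = cov (w (Suc j) x) (N v) - cov (w j x) (N v)" if "x \<in> {0..T}" for x
     unfolding D_def[abs_def] by (rule cov_diff_left[OF sw[OF that] sw[OF that] sN])
    have "cov R (N v) = cov (D j T) (N v) - cov (D j u) (N v)"
     unfolding R_def[abs_def] by (rule cov_diff_left[OF gproc_sqint[OF G gD TT] gproc_sqint[OF G gD u] sN])
    then show ?thesis by (simp only: cD[OF TT] cD[OF u] cw[OF TT] cw[OF u] m) simp
   qed
   then have o: "expectation (\<lambda>z. X z * R z $ i') = 0" if "X \<in> past N s" for X i'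
    using that cov_component[OF R gproc_sqint[OF G gN]] su by (force simp: past_def mult.commute)
   have "cov (D j s) R = 0" by (rule vspan_orthogonal[OF gf_sqint[OF past_family[OF gN s]] Ds R o])
   then have "cov (D j s) R $ i $ i = 0" by simp
   then show "expectation (\<lambda>z. D j s z $ i * (D j T z $ i - D j u z $ i)) = 0"
    using cov_component[OF gproc_sqint[OF G gD s] R, of j i i] by (simp add: R_def)
  qed auto
  have "ms (\<lambda>z. D j T z $ i) \<le> ms (D j T)"
   using T member_le_sum[of i UNIV "\<lambda>i. ms (\<lambda>z. D j T z $ i)"] by (simp add: ms_components[OF gproc_sqint[OF G gD]] ms_nonneg)
  also have "\<dots> \<le> 4 * (1 / 4) ^ j * ((1 / 2) ^ j)\<^sup>2"
  proof -
   have "((1 / 2 :: real) ^ j)\<^sup>2 = (1 / 4) ^ j" by (simp add: power2_eq_square power_mult_distrib[symmetric])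
   then have "4 * (1 / 4) ^ j * ((1 / 2 :: real) ^ j)\<^sup>2 = 4 * e j" by (simp add: e_def power_mult_distrib[symmetric])
   then show ?thesis using msD[of j] by simp
  qed
  finally have "ms (\<lambda>z. D j T z $ i) / ((1 / 2) ^ j)\<^sup>2 \<le> 4 * (1 / 4) ^ j" by (subst pos_divide_le_eq) auto
  with B show ?thesis by (intro exI[of _ B]) auto
 qed
 then obtain B where B: "\<And>j i. B j i \<in> events" "\<And>j i. prob (B j i) \<le> 4 * (1 / 4) ^ j"
  "\<And>j i z t. z \<in> space M - B j i ==> t \<in> {0..T} ==> \<bar>D j t z $ i\<bar> \<le> (1 / 2) ^ j" by metis
 define A where "A j = (\<Union>i. B j i)" for j
 have Aev: "A j \<in> events" for j unfolding A_def using B(1) by (intro sets.finite_UN) auto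
 have Ap: "prob (A j) \<le> real CARD('d) * (4 * (1 / 4) ^ j)" for j
 proof -
  have "prob (A j) \<le> (\<Sum>i\<in>UNIV. prob (B j i))" unfolding A_def by (rule finite_measure_subadditive_finite) (use B(1) in auto)
  also have "\<dots> \<le> (\<Sum>i\<in>(UNIV::'d set). 4 * (1 / 4) ^ j)" by (intro sum_mono B(2))
  finally show ?thesis by simp
 qed
 have "summable (\<lambda>j. prob (A j))"
  by (rule summable_comparison_test'[of "\<lambda>j. real CARD('d) * (4 * (1 / 4) ^ j)" 0]) (use Ap in \<open>auto intro!: summable_mult summable_geometric\<close>)
 then have "AE z in M. eventually (\<lambda>j. z \<in> space M - A j) sequentially"
  by (intro borel_cantelli_AE1) (use Aev in \<open>auto simp: emeasure_eq_measure\<close>)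
 then obtain N0 where N0: "\<And>z. z \<in> space M - N0 ==> eventually (\<lambda>j. z \<in> space M - A j) sequentially" "N0 \<in> null_sets M"
  by (rule AE_E3) blast
 define \<Omega>0 where "\<Omega>0 = space M - N0"
 have \<Omega>0: "\<Omega>0 \<in> events" unfolding \<Omega>0_def using N0(2) by auto
 have uc: "uniform_limit {0..T} (\<lambda>j t. w j t z) (\<lambda>t. lim (\<lambda>j. w j t z)) sequentially" if w: "z \<in> \<Omega>0" for z
 proof -
  have "\<forall>\<^sub>F j in sequentially. \<forall>t\<in>{0..T}. norm (D j t z) \<le> real CARD('d) * (1 / 2) ^ j"
   using N0(1)[OF w[unfolded \<Omega>0_def]]
  proof eventually_elim
   case (elim j)
   show ?case
   proof
    fix t assume t: "t \<in> {0..T}"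
    have "norm (D j t z) \<le> (\<Sum>i\<in>UNIV. \<bar>D j t z $ i\<bar>)" by (rule norm_le_l1_cart)
    also have "\<dots> \<le> (\<Sum>i\<in>(UNIV::'d set). (1 / 2) ^ j)" using elim t by (intro sum_mono B(3)) (auto simp: A_def)
    finally show "norm (D j t z) \<le> real CARD('d) * (1 / 2) ^ j" by simp
   qed
  qed
  moreover have "summable (\<lambda>j. real CARD('d) * (1 / 2 :: real) ^ j)" by (intro summable_mult summable_geometric) simp
  ultimately have "uniform_limit {0..T} (\<lambda>n t. \<Sum>j<n. D j t z) (\<lambda>t. \<Sum>j. D j t z) sequentially"
   by (rule Weierstrass_m_test_ev)
  then have "uniform_limit {0..T} (\<lambda>n t. w 0 t z + (\<Sum>j<n. D j t z)) (\<lambda>t. w 0 t z + (\<Sum>j. D j t z)) sequentially"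
   by (intro uniform_limit_intros)
  moreover have "w 0 t z + (\<Sum>j<n. D j t z) = w n t z" for n t
   unfolding D_def using sum_lessThan_telescope[of "\<lambda>j. w j t z" n] by simp
  ultimately have ul: "uniform_limit {0..T} (\<lambda>j t. w j t z) (\<lambda>t. w 0 t z + (\<Sum>j. D j t z)) sequentially" by simp
  have "lim (\<lambda>j. w j t z) = w 0 t z + (\<Sum>j. D j t z)" if "t \<in> {0..T}" for t
   by (rule limI[OF tendsto_uniform_limitI[OF ul that]])
  then show ?thesis using ul by (subst uniform_limit_cong'[OF refl]) auto
 qed
 \<comment> \<open>On the exceptional null set the integral is put to 0, so that every path is
   continuous.\<close>
 define I where "I t z = indicator \<Omega>0 z *\<^sub>R lim (\<lambda>j. w j t z)" for t z
 have conv: "(\<lambda>j. indicator \<Omega>0 z *\<^sub>R w j t z) \<longlonglongrightarrow> I t z" if t: "t \<in> {0..T}" for t z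
  unfolding I_def using tendsto_uniform_limitI[OF uc t] by (cases "z \<in> \<Omega>0") auto
 have Im: "I t \<in> borel_measurable M" if t: "t \<in> {0..T}" for t
 proof (rule borel_measurable_LIMSEQ_metric[OF _ conv[OF t]])
  show "(\<lambda>z. indicator \<Omega>0 z *\<^sub>R w j t z) \<in> borel_measurable M" for j
   using \<Omega>0 sqintD[OF gproc_sqint[OF G gw t]] by (intro borel_measurable_scaleR) auto
 qed
 have "cproc T I"
  unfolding cproc_def
 proof (intro conjI ballI Im)
  fix z assume w: "z \<in> space M"
  show "continuous_on {0..T} (\<lambda>t. I t z)"
  proof (cases "z \<in> \<Omega>0")
   case True
   have "continuous_on {0..T} (\<lambda>t. lim (\<lambda>j. w j t z))"
    by (rule uniform_limit_theorem[OF _ uc[OF True]]) (use gproc_path[OF gw w] in \<open>auto intro!: always_eventually\<close>)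
   then show ?thesis using True by (simp add: I_def)
  qed (simp add: I_def)
 qed
 have aeI: "AE z in M. (\<lambda>j. w j t z) \<longlonglongrightarrow> I t z" if t: "t \<in> {0..T}" for t
  using AE_not_in[OF N0(2)] AE_space
 proof eventually_elim
  case (elim z)
  then have "z \<in> \<Omega>0" by (simp add: \<Omega>0_def)
  with conv[OF t, of z] show ?case by simp
 qed
 have vp: "vspan (past N t) (I t)" if t: "t \<in> {0..T}" for t
  by (rule gv_AE_limit(1)[OF past_family[OF gN t] _ aeI[OF t] Im[OF t]]) (unfold w_def, rule wint_vspan[OF gN T0 t])
 have lim: "(\<lambda>j. ms (\<lambda>z. wint T (K j) (c j) N t z - I t z)) \<longlonglongrightarrow> 0" if t: "t \<in> {0..T}" for t
  using gv_AE_limit(2)[OF G gprocD(2)[OF gw t] aeI[OF t] Im[OF t]] by (simp add: w_def)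
 have gI: "gproc T S I" unfolding gproc_def using \<open>cproc T I\<close> vspan_past_imp[OF gN _ vp] by blast
 show ?thesis by (rule that[OF gI K cl lim vp])
qed

text \<open>The fixed vector \<open>V\<close> may be any one whose covariance with the integrator
  has a density \<open>q\<close>; passing to the limit needs convergence of the step functions on
  one side and of the elementary integrals on the other.\<close>

lemma wiener_cov:
 fixes N :: "real => 'a => real^'n" and f :: "real => real^'n^'d"
 assumes N: "gproc T S N" and T: "0 \<le> T" and f: "L2on T f" and I: "sqint I" and t: "t \<in> {0..T}"
  and cl: "(\<lambda>j. sqdist T (stepf T (K j) (c j)) f) \<longlonglongrightarrow> 0" and lim: "(\<lambda>j. ms (\<lambda>w. wint T (K j) (c j) N t w - I w)) \<longlonglongrightarrow> 0"
  and V: "sqint V" and q: "L2on T q" and NV: "\<And>u. u \<in> {0..T} ==> cov (N u) V = prim q u"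
 shows "cov I V = prim (\<lambda>s. f s ** q s) t"
proof (rule LIMSEQ_unique)
 show "(\<lambda>j. cov (wint T (K j) (c j) N t) V) \<longlonglongrightarrow> cov I V"
  by (rule cov_tendsto[OF gproc_sqint[OF G gproc_wint[OF N T] t] I V lim])
 show "(\<lambda>j. cov (wint T (K j) (c j) N t) V) \<longlonglongrightarrow> prim (\<lambda>s. f s ** q s) t"
  using L2_tendsto[OF bb_mm L2on_stepf f cl q t] by (simp only: cov_wint[OF N T t V L2on_L1on[OF q] NV])
qed

end

end

section \<open>Conditional moments in a Gaussian space\<close>

context prob_space
begin

lemma cov_cong: "(\<And>w. w \<in> space M ==> V w = V' w) ==> (\<And>w. w \<in> space M ==> Z w = Z' w) ==> cov V Z = cov V' Z'"
 unfolding cov_def by (rule lint_cong) auto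

text \<open>A subsequence of the approximating linear combinations converges almost everywhere, and
  its limit is measurable with respect to the uncompleted \<sigma>-algebra; \<open>Y\<close> equals
  it almost everywhere.\<close>

lemma cspan_cond_exp:
 assumes sq: "\<And>Z. Z \<in> ZZ ==> sqint Z" and Y: "Y \<in> cspan ZZ"
 shows "AE w in M. real_cond_exp M (gen ZZ) Y w = Y w"
proof -
 have sub: "subalgebra M (gen ZZ)" by (rule subalgebra_gen) (rule sqintD[OF sq])
 interpret F: sigma_finite_subalgebra M "gen ZZ" by (rule finite_measure_subalgebraI[OF sub])
 have lm: "L \<in> borel_measurable (gen ZZ)" if "L \<in> lin ZZ" for L
  using that
 proof induction
  case (add X Y a)
  then show ?case using gen_measurable[of X ZZ] by (intro borel_measurable_add borel_measurable_times borel_measurable_const)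
 qed simp
 note sY = cspan_sqint[OF sq Y]
 have "\<exists>L. L \<in> lin ZZ \<and> sqint L \<and> ms (\<lambda>w. Y w - L w) < 1 / real (Suc n)" for n
  using cspanE[OF sq Y, of "1 / real (Suc n)"] by (metis of_nat_0_less_iff zero_less_Suc zero_less_divide_1_iff)
 then obtain L where L: "\<And>n. L n \<in> lin ZZ" "\<And>n. sqint (L n)" "\<And>n. ms (\<lambda>w. Y w - L n w) < 1 / real (Suc n)" by metis
 have m: "integrable M (\<lambda>w. (Y w - L n w)\<^sup>2)" for n using sqint_diff[OF sY L(2)[of n]] by (simp add: sqint_def)
 have "(\<lambda>n. \<integral>w. norm ((Y w - L n w)\<^sup>2) \<partial>M) \<longlonglongrightarrow> 0"
 proof (rule tendsto_sandwich[of "\<lambda>_. 0" _ _ "\<lambda>n. 1 / real (Suc n)"])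
  show "(\<lambda>n. 1 / real (Suc n)) \<longlonglongrightarrow> 0" by (rule LIMSEQ_Suc[OF lim_const_over_n])
  show "\<forall>\<^sub>F n in sequentially. (\<integral>w. norm ((Y w - L n w)\<^sup>2) \<partial>M) \<le> 1 / real (Suc n)"
   using L(3) by (intro always_eventually allI less_imp_le) (simp add: ms_real)
 qed (auto intro!: always_eventually)
 from tendsto_L1_AE_subseq[OF m this] obtain r where r: "strict_mono r" "AE w in M. (\<lambda>n. (Y w - L (r n) w)\<^sup>2) \<longlonglongrightarrow> 0" by blast
 define Y' where "Y' w = lim (\<lambda>n. L (r n) w)" for w
 have Y': "Y' \<in> borel_measurable (gen ZZ)" unfolding Y'_def[abs_def] by (rule borel_measurable_lim_metric) (rule lm[OF L(1)])
 have ae: "AE w in M. Y w = Y' w"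
  using r(2)
 proof eventually_elim
  case (elim w)
  have "(\<lambda>n. Y w - L (r n) w) \<longlonglongrightarrow> 0" using tendsto_real_sqrt[OF elim] by (simp add: tendsto_rabs_zero_iff)
  then have "(\<lambda>n. Y w - (Y w - L (r n) w)) \<longlonglongrightarrow> Y w - 0" by (intro tendsto_diff tendsto_const)
  then have "(\<lambda>n. L (r n) w) \<longlonglongrightarrow> Y w" by simp
  then show ?case unfolding Y'_def by (rule limI[symmetric])
 qed
 have Y'M: "Y' \<in> borel_measurable M" by (rule measurable_from_subalg[OF sub Y'])
 have "integrable M Y'"
  using integrable_cong_AE[OF sqintD[OF sY] Y'M ae] sqint_integrable[OF sY] by simp
 then have "AE w in M. real_cond_exp M (gen ZZ) Y' w = Y' w" by (rule F.real_cond_exp_F_meas[OF _ Y'])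
 moreover have "AE w in M. real_cond_exp M (gen ZZ) Y w = real_cond_exp M (gen ZZ) Y' w"
  by (rule F.real_cond_exp_cong[OF ae sqintD[OF sY] Y'M])
 ultimately show ?thesis using ae by eventually_elim simp
qed

text \<open>Independence is available for one variable at a time, so the product is polarised into
  the squares of \<open>X + Y\<close> and \<open>X - Y\<close>, which are both orthogonal to
  \<open>ZZ\<close>.\<close>

lemma gf_cov_cond_exp:
 assumes G: "gaussian_family S" and X: "X \<in> cspan S" and Y: "Y \<in> cspan S" and ZZ: "ZZ \<subseteq> cspan S"
  and oX: "\<And>Z. Z \<in> ZZ ==> expectation (\<lambda>w. Z w * X w) = 0" and oY: "\<And>Z. Z \<in> ZZ ==> expectation (\<lambda>w. Z w * Y w) = 0"
 shows "AE w in M. real_cond_exp M (gen ZZ) (\<lambda>w. X w * Y w) w = expectation (\<lambda>w. X w * Y w)"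
proof -
 note S = gf_sqint[OF G]
 have zs: "Z \<in> ZZ ==> sqint Z" for Z using ZZ cspan_sqint[OF S] by blast
 have sub: "subalgebra M (gen ZZ)" by (rule subalgebra_gen) (rule sqintD[OF zs])
 interpret F: sigma_finite_subalgebra M "gen ZZ" by (rule finite_measure_subalgebraI[OF sub])
 note sX = cspan_sqint[OF S X] and sY = cspan_sqint[OF S Y]
 note zX = sqint_mult[OF zs sX] and zY = sqint_mult[OF zs sY]
 have sq: "expectation (\<lambda>w. (V w)\<^sup>2 * indicator A w) = expectation (\<lambda>w. (V w)\<^sup>2) * prob A"
  if V: "V \<in> cspan S" and o: "\<And>Z. Z \<in> ZZ ==> expectation (\<lambda>w. Z w * V w) = 0" and A: "A \<in> sets (gen ZZ)" for V A
 proof (rule gf_independent[OF G V ZZ o])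
  show "A \<in> sigma_sets (space M) {Z -` B \<inter> space M | Z B. Z \<in> ZZ \<and> B \<in> sets borel}" using A by (simp add: sets_gen)
  show "A \<in> events" using A sub by (auto simp: subalgebra_def)
  show "integrable M (\<lambda>w. (V w)\<^sup>2)" using cspan_sqint[OF S V] by (simp add: sqint_def)
 qed auto
 have iXY: "integrable M (\<lambda>w. X w * Y w)" by (rule sqint_mult[OF sX sY])
 show ?thesis
 proof (rule F.real_cond_exp_charact[OF _ iXY])
  fix A assume A: "A \<in> sets (gen ZZ)"
  then have AM: "A \<in> events" using sub by (auto simp: subalgebra_def)
  define P where "P w = X w + Y w" for w
  define Q where "Q w = X w - Y w" for w
  have P: "P \<in> cspan S" unfolding P_def[abs_def] by (rule cspan_add[OF S X Y])
  have Q: "Q \<in> cspan S" unfolding Q_def[abs_def] by (rule cspan_diff[OF S X Y])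
  have oP: "expectation (\<lambda>w. Z w * P w) = 0" and oQ: "expectation (\<lambda>w. Z w * Q w) = 0" if "Z \<in> ZZ" for Z
   using oX[OF that] oY[OF that] zX[OF that] zY[OF that] by (simp_all add: P_def Q_def ring_distribs)
  have iP: "integrable M (\<lambda>w. (P w)\<^sup>2)" and iQ: "integrable M (\<lambda>w. (Q w)\<^sup>2)"
   using cspan_sqint[OF S P] cspan_sqint[OF S Q] by (simp_all add: sqint_def)
  have iA: "integrable M (\<lambda>w. (P w)\<^sup>2 * indicator A w)" "integrable M (\<lambda>w. (Q w)\<^sup>2 * indicator A w)"
   using integrable_mult_indicator[OF AM iP] integrable_mult_indicator[OF AM iQ] by (simp_all add: mult.commute)
  have pol: "X w * Y w = ((P w)\<^sup>2 - (Q w)\<^sup>2) / 4" for w by (simp add: P_def Q_def power2_eq_square algebra_simps)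
  have "expectation (\<lambda>w. X w * Y w * indicator A w) = expectation (\<lambda>w. ((P w)\<^sup>2 * indicator A w - (Q w)\<^sup>2 * indicator A w) / 4)"
   by (rule lint_cong[OF refl]) (simp add: pol left_diff_distrib)
  also have "\<dots> = (expectation (\<lambda>w. (P w)\<^sup>2 * indicator A w) - expectation (\<lambda>w. (Q w)\<^sup>2 * indicator A w)) / 4"
   by (simp add: iA)
  also have "\<dots> = (expectation (\<lambda>w. (P w)\<^sup>2) - expectation (\<lambda>w. (Q w)\<^sup>2)) / 4 * prob A"
   by (simp add: sq[OF P oP A] sq[OF Q oQ A] left_diff_distrib)
  also have "(expectation (\<lambda>w. (P w)\<^sup>2) - expectation (\<lambda>w. (Q w)\<^sup>2)) / 4 = expectation (\<lambda>w. X w * Y w)"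
   by (simp add: pol iP iQ)
  finally show "(LINT w:A|M. X w * Y w) = (LINT w:A|M. expectation (\<lambda>w. X w * Y w))"
   using AM by (simp add: set_lebesgue_integral_def mult.commute)
 qed auto
qed

lemma gv_limit:
 fixes X :: "nat => 'a => real^'d"
 assumes G: "gaussian_family S" and X: "\<And>n. vspan S (X n)" and Y: "sqint Y" and lim: "(\<lambda>n. ms (\<lambda>w. X n w - Y w)) \<longlonglongrightarrow> 0"
 shows "vspan S Y"
 unfolding vspan_def
proof (intro allI cspan_limit[OF gf_sqint[OF G]] sqint_component[OF Y])
 fix i and e :: real assume "e > 0"
 then have "\<forall>\<^sub>F n in sequentially. ms (\<lambda>w. X n w - Y w) < e" by (rule order_tendstoD(2)[OF lim])
 then obtain n where n: "ms (\<lambda>w. X n w - Y w) < e" by (auto simp: eventually_sequentially)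
 have "ms (\<lambda>w. Y w $ i - X n w $ i) = ms (\<lambda>w. (X n w - Y w) $ i)" by (subst ms_minus_commute) simp
 also have "\<dots> \<le> ms (\<lambda>w. X n w - Y w)"
  using member_le_sum[of i UNIV "\<lambda>i. ms (\<lambda>w. (X n w - Y w) $ i)"]
  by (simp only: ms_components[OF sqint_diff[OF gv_sqint[OF G X] Y]]) (simp add: ms_nonneg)
 finally show "\<exists>Z\<in>cspan S. ms (\<lambda>w. Y w $ i - Z w) < e" using n X[of n] by (intro bexI[of _ "\<lambda>w. X n w $ i"]) (auto simp: vspan_def)
qed

lemma gproc_cov_prim_right:
 fixes A :: "real => real^'d^'k" and Z :: "'a => real^'e"
 assumes G: "gaussian_family S" and T: "0 \<le> T" and Y: "gproc T S Y" and A: "L1on T A" and Z: "sqint Z" and t: "t \<in> {0..T}"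
 shows "cov Z (\<lambda>w. prim (\<lambda>s. A s *v Y s w) t) = prim (\<lambda>s. cov Z (Y s) ** transpose (A s)) t"
proof -
 have "cov Z (\<lambda>w. prim (\<lambda>s. A s *v Y s w) t) = transpose (prim (\<lambda>s. A s ** cov (Y s) Z) t)"
  using cov_transpose[OF gproc_sqint[OF G gproc_prim[OF G T Y A] t] Z] gproc_cov_prim(1)[OF G T Y A Z t] by simp
 also have "\<dots> = prim (\<lambda>s. transpose (A s ** cov (Y s) Z)) t"
  by (rule prim_transpose[OF gproc_cov_prim(2)[OF G T Y A Z t]]) (use t in simp)
 also have "\<dots> = prim (\<lambda>s. cov Z (Y s) ** transpose (A s)) t"
  by (rule prim_cong) (use t in \<open>simp add: matrix_transpose_mul cov_transpose[OF gproc_sqint[OF G Y] Z]\<close>)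
 finally show ?thesis .
qed

end

section \<open>The Kalman-Bucy filter\<close>

text \<open>The noise \<open>B\<close> of the observation also drives the state through
  \<open>c\<close>, which is why the gain is \<open>c + P k\<^sup>T\<close> rather than
  \<open>P k\<^sup>T\<close>. Independence assumptions are stated as vanishing covariances, which
  suffices in a Gaussian space.\<close>

locale linear_system = prob_space M for M :: "'w measure" +
 fixes S :: "('w => real) set" and T :: real and U :: "real => 'w => real^'d" and Z B :: "real => 'w => real^'n"
  and W :: "real => 'w => real^'l" and b :: "real => real^'d^'d" and k :: "real => real^'d^'n"
  and \<sigma> :: "real^'l^'d" and c :: "real^'n^'d"
 assumes G: "gaussian_family S" and T: "0 < T" and gU: "gproc T S U" and gZ: "gproc T S Z"
  and bmW: "bm S T W" and bmB: "bm S T B"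
  and WB: "\<And>s t. s \<in> {0..T} ==> t \<in> {0..T} ==> cov (W s) (B t) = 0"
  and WU: "\<And>t. t \<in> {0..T} ==> cov (W t) (U 0) = 0" and BU: "\<And>t. t \<in> {0..T} ==> cov (B t) (U 0) = 0"
  and b: "L1on T b" and k: "L2on T k"
  and U_eq: "\<And>w t. w \<in> space M ==> t \<in> {0..T} ==> U t w = U 0 w + prim (\<lambda>s. b s *v U s w) t + \<sigma> *v W t w + c *v B t w"
  and Z_eq: "\<And>w t. w \<in> space M ==> t \<in> {0..T} ==> Z t w = prim (\<lambda>s. k s *v U s w) t + B t w"

text \<open>Fixes the constructed objects: the Riccati solution, the gain, the fundamental pair, the
  integral \<open>I\<close> of \<open>f\<close> against \<open>B\<close>, and the grid sizes
  \<open>n\<close> and coefficients \<open>x\<close> of the step functions that define it. Expanding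
  the square of the gain gives this form of the Riccati equation, whose drift \<open>b - c k\<close>
  isolates a purely quadratic term.\<close>

locale kalman_bucy = linear_system M S T U Z B W b k \<sigma> c
 for M :: "'w measure" and S T and U :: "real => 'w => real^'d" and Z B :: "real => 'w => real^'n"
  and W :: "real => 'w => real^'l" and b :: "real => real^'d^'d" and k :: "real => real^'d^'n"
  and \<sigma> :: "real^'l^'d" and c :: "real^'n^'d" +
 fixes P :: "real => real^'d^'d" and f :: "real => real^'n^'d" and \<beta> \<Phi> \<Psi> :: "real => real^'d^'d"
  and I :: "real => 'w => real^'d" and n :: "nat => nat" and x :: "nat => nat => real^'n^'d"
 assumes P: "continuous_on {0..T} P" and P_eq: "\<And>t. t \<in> {0..T} ==>
    P t = cov (U 0) (U 0) + prim (\<lambda>s. (b s - c ** k s) ** P s + P s ** transpose (b s - c ** k s) + \<sigma> ** transpose \<sigma>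
     - P s ** (transpose (k s) ** k s) ** P s) t"
  and f_def: "f = (\<lambda>s. c + P s ** transpose (k s))" and \<beta>_def: "\<beta> = (\<lambda>s. b s - f s ** k s)"
  and F: "fundamental T \<beta> \<Phi> \<Psi>"
  and gI: "gproc T S I" and dense: "(\<lambda>j. sqdist T (stepf T (n j) (x j)) f) \<longlonglongrightarrow> 0"
  and I_lim: "\<And>t. t \<in> {0..T} ==> (\<lambda>j. ms (\<lambda>w. wint T (n j) (x j) B t w - I t w)) \<longlonglongrightarrow> 0"
begin

lemma T0: "0 \<le> T" using T by simp

lemma f2: "L2on T f"
 unfolding f_def by (rule L2on_add[OF L2on_continuous[OF continuous_on_const]
    L2on_mult_continuous[OF bounded_bilinear.flip[OF bb_mm] L2on_linear[OF bl_transpose k] P]])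

lemma fk1: "L1on T (\<lambda>s. f s ** k s)" by (rule L2on_bilinear[OF bb_mm f2 k])

lemma \<beta>1: "L1on T \<beta>" unfolding \<beta>_def by (rule set_integral_diff(1)[OF b fk1])

lemma gB: "gproc T S B" by (rule bmD(1)[OF G bmB])
lemma gW: "gproc T S W" by (rule bmD(1)[OF G bmW])

lemmas sq = gproc_sqint[OF G]

lemma cov_I_zero:
 fixes V :: "'w => real^'k"
 assumes V: "sqint V" and BV: "\<And>u. u \<in> {0..T} ==> cov (B u) V = 0" and t: "t \<in> {0..T}"
 shows "cov (I t) V = 0"
 using wiener_cov[OF G gB T0 f2 sq[OF gI t] t dense I_lim[OF t] V L2on_continuous[OF continuous_on_const[of _ 0]]] BV
 by (simp add: bb_mm.zero_right)

lemma cov_I_B: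
 assumes t: "t \<in> {0..T}" and v: "v \<in> {0..T}"
 shows "cov (I t) (B v) = prim f (min t v)"
proof -
 note w = wiener_cov_past[OF G f2 v t]
 have "cov (I t) (B v) = prim (\<lambda>s. f s ** (indicator {0..v} s *\<^sub>R (mat 1 :: real^'n^'n))) t"
  by (rule wiener_cov[OF G gB T0 f2 sq[OF gI t] t dense I_lim[OF t] sq[OF gB v] w(1)]) (simp only: w(2) bmD(2)[OF G bmB _ v])
 then show ?thesis by (simp only: w(3))
qed

text \<open>The integral of \<open>f\<close> against \<open>Z\<close>, split along the observation
  equation into a Lebesgue and a Wiener integral.\<close>

definition JZ :: "real => 'w => real^'d" where "JZ t w = prim (\<lambda>s. (f s ** k s) *v U s w) t + I t w"
text \<open>The pathwise solution of \<open>V = JZ + \<integral> \<beta> V ds\<close> in the form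
  given by \<open>fundamental_mv\<close>; it will be the filter.\<close>

definition V :: "real => 'w => real^'d" where "V t w = JZ t w + \<Phi> t *v prim (\<lambda>s. (\<Psi> s ** \<beta> s) *v JZ s w) t"
definition \<epsilon> :: "real => 'w => real^'d" where "\<epsilon> t w = U t w - V t w"
text \<open>The noise left in the filtering error: the noise of the state minus the part
  \<open>I\<close> that the filter feeds back.\<close>

definition \<xi> :: "real => 'w => real^'d" where "\<xi> t w = \<sigma> *v W t w + c *v B t w - I t w"

lemma \<beta>_s: "\<beta> s = b s - f s ** k s" and f_s: "f s = c + P s ** transpose (k s)"
 by (simp_all only: \<beta>_def f_def)

lemmas Fs = fundamentalD[OF F]

lemma \<Psi>\<beta>1: "L1on T (\<lambda>s. \<Psi> s ** \<beta> s)" by (rule L1on_bilinear2[OF bb_mm \<beta>1 Fs(2)])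

lemma gJZ: "gproc T S JZ"
 unfolding JZ_def[abs_def] by (rule gproc_add[OF G gproc_prim[OF G T0 gU fk1] gI])

lemma gV: "gproc T S V"
 unfolding V_def[abs_def] by (rule gproc_add[OF G gJZ gproc_mv[OF G gproc_prim[OF G T0 gJZ \<Psi>\<beta>1] Fs(1)]])

lemma g\<epsilon>: "gproc T S \<epsilon>"
 unfolding \<epsilon>_def[abs_def] by (rule gproc_diff[OF G gU gV])

lemma g\<xi>: "gproc T S \<xi>"
 unfolding \<xi>_def[abs_def]
 by (rule gproc_diff[OF G gproc_add[OF G gproc_mv[OF G gW continuous_on_const] gproc_mv[OF G gB continuous_on_const]] gI])

lemma V_eq: "w \<in> space M ==> t \<in> {0..T} ==> V t w = JZ t w + prim (\<lambda>s. \<beta> s *v V s w) t"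
 by (rule fundamental_mv(2)[OF F \<beta>1 gproc_path[OF gJZ]]) (auto simp: V_def)

text \<open>The drift \<open>f k U\<close> contained in \<open>JZ\<close> turns
  \<open>b U - \<beta> V\<close> into \<open>\<beta> (U - V)\<close>, so the error obeys a closed
  equation driven by \<open>\<xi>\<close>, with no reference to the filter.\<close>

lemma \<epsilon>_eq:
 assumes w: "z \<in> space M" and t: "t \<in> {0..T}"
 shows "\<epsilon> t z = U 0 z + prim (\<lambda>s. \<beta> s *v \<epsilon> s z) t + \<xi> t z"
proof -
 have tT: "t \<le> T" using t by simp
 have i: "L1on T (\<lambda>s. b s *v U s z)" "L1on T (\<lambda>s. (f s ** k s) *v U s z)" "L1on T (\<lambda>s. \<beta> s *v V s z)"
  by (rule L1on_bilinear[OF bb_mv b gproc_path[OF gU w]] L1on_bilinear[OF bb_mv fk1 gproc_path[OF gU w]] L1on_bilinear[OF bb_mv \<beta>1 gproc_path[OF gV w]])+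
 have "prim (\<lambda>s. \<beta> s *v \<epsilon> s z) t = prim (\<lambda>s. b s *v U s z - (f s ** k s) *v U s z - \<beta> s *v V s z) t"
  by (rule prim_cong) (simp add: \<epsilon>_def \<beta>_s bb_mv.diff_right bb_mv.diff_left)
 also have "\<dots> = prim (\<lambda>s. b s *v U s z) t - prim (\<lambda>s. (f s ** k s) *v U s z) t - prim (\<lambda>s. \<beta> s *v V s z) t"
  by (simp only: prim_diff[OF set_integral_diff(1)[OF i(1,2)] i(3) tT] prim_diff[OF i(1,2) tT])
 finally show ?thesis using U_eq[OF w t] V_eq[OF w t] by (simp add: \<epsilon>_def \<xi>_def JZ_def)
qed

section \<open>Covariances of the filtering error with the past\<close>

lemma noise_cov:
 fixes Q :: "'w => real^'k"
 assumes Q: "sqint Q" and \<eta>: "L1on T \<eta>" and \<xi>Q: "\<And>t. t \<in> {0..T} ==> cov (\<xi> t) Q = prim \<eta> t" and t: "t \<in> {0..T}"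
 shows "\<Psi> t ** cov (\<epsilon> t) Q = cov (U 0) Q + prim (\<lambda>s. \<Psi> s ** \<eta> s) t"
proof (rule fundamental_mm[OF F \<beta>1 \<eta> gproc_cov_continuous[OF G g\<epsilon> Q] _ t])
 fix t assume t: "t \<in> {0..T}"
 note i = gproc_cov_prim[OF G T0 g\<epsilon> \<beta>1 Q t]
 have z: "0 \<in> {0..T}" using T0 by simp
 have "cov (\<epsilon> t) Q = cov (\<lambda>w. U 0 w + prim (\<lambda>s. \<beta> s *v \<epsilon> s w) t + \<xi> t w) Q"
  by (rule cov_cong[OF \<epsilon>_eq[OF _ t] refl])
 also have "\<dots> = cov (U 0) Q + prim (\<lambda>s. \<beta> s ** cov (\<epsilon> s) Q) t + prim \<eta> t"
  by (simp only: cov_add_left[OF sqint_add[OF sq[OF gU z] sq[OF gproc_prim[OF G T0 g\<epsilon> \<beta>1] t]] sq[OF g\<xi> t] Q]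
    cov_add_left[OF sq[OF gU z] sq[OF gproc_prim[OF G T0 g\<epsilon> \<beta>1] t] Q] i(1) \<xi>Q[OF t])
 also have "\<dots> = cov (U 0) Q + prim (\<lambda>s. \<beta> s ** cov (\<epsilon> s) Q + \<eta> s) t"
  using prim_add[OF i(2) \<eta>, of t] t by simp
 finally show "cov (\<epsilon> t) Q = cov (U 0) Q + prim (\<lambda>s. \<beta> s ** cov (\<epsilon> s) Q + \<eta> s) t" .
qed

lemma cov_\<xi>:
 fixes Q :: "'w => real^'k"
 assumes "sqint Q" "t \<in> {0..T}"
 shows "cov (\<xi> t) Q = \<sigma> ** cov (W t) Q + c ** cov (B t) Q - cov (I t) Q"
proof -
 note s = sq[OF gW assms(2)] sq[OF gB assms(2)] sq[OF gI assms(2)]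
 show ?thesis
  unfolding \<xi>_def[abs_def]
  by (simp add: cov_diff_left cov_add_left cov_mv_left sqint_add sqint_mv s assms(1))
qed

lemma zero_in: "0 \<in> {0..T}" using T0 by simp

lemma \<epsilon>_U0: "t \<in> {0..T} ==> \<Psi> t ** cov (\<epsilon> t) (U 0) = cov (U 0) (U 0)"
 using noise_cov[OF sq[OF gU zero_in] L1on_continuous[OF continuous_on_const[of _ 0]], of t]
  cov_\<xi>[OF sq[OF gU zero_in]] WU BU cov_I_zero[OF sq[OF gU zero_in] BU] by (simp add: bb_mm.zero_right)

text \<open>Here \<open>Q\<close> is the value at time \<open>v\<close> of one of the driving
  noises: later noise is uncorrelated with it, so the covariance with \<open>\<xi> u\<close> freezes
  at \<open>v\<close> and the integral ends there.\<close>

lemma \<epsilon>_noise: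
 fixes Q :: "'w => real^'k"
 assumes Q: "sqint Q" and QU: "cov Q (U 0) = 0" and q: "L2on T q" and t: "t \<in> {0..T}" and v: "v \<in> {0..t}"
  and \<xi>Q: "\<And>u. u \<in> {0..T} ==> cov (\<xi> u) Q = prim q (min u v)"
 shows "\<Psi> t ** cov (\<epsilon> t) Q = prim (\<lambda>s. \<Psi> s ** q s) v"
proof -
 have i: "L1on T (\<lambda>s. indicator {0..v} s *\<^sub>R q s)" by (rule L2on_L1on, rule L2on_indicator[OF q]) simp
 have e: "cov (\<xi> u) Q = prim (\<lambda>s. indicator {0..v} s *\<^sub>R q s) u" if "u \<in> {0..T}" for u
  using \<xi>Q[OF that] that v by (simp add: prim_indicator)
 have "cov (U 0) Q = 0" using cov_transpose[OF Q sq[OF gU zero_in]] QU by (simp add: transpose_zero)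
 then have "\<Psi> t ** cov (\<epsilon> t) Q = prim (\<lambda>s. indicator {0..v} s *\<^sub>R (\<Psi> s ** q s)) t"
  using noise_cov[OF Q i e t] by (simp add: bb_mm.scaleR_right)
 then show ?thesis using t v by (simp add: prim_indicator min_absorb2)
qed

lemma cf2: "L2on T (\<lambda>s. c - f s)" by (rule L2on_diff[OF L2on_continuous[OF continuous_on_const] f2])

lemma \<epsilon>_B:
 assumes t: "t \<in> {0..T}" and v: "v \<in> {0..t}"
 shows "\<Psi> t ** cov (\<epsilon> t) (B v) = prim (\<lambda>s. \<Psi> s ** (c - f s)) v"
proof -
 have vT: "v \<in> {0..T}" using t v by auto
 show ?thesis
 proof (rule \<epsilon>_noise[OF sq[OF gB vT] BU[OF vT] cf2 t v])
  fix u assume u: "u \<in> {0..T}"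
  have m: "0 \<le> min u v" "min u v \<le> T" using u vT by auto
  have "cov (\<xi> u) (B v) = min u v *\<^sub>R c - prim f (min u v)"
   by (simp add: cov_\<xi>[OF sq[OF gB vT] u] WB[OF u vT] bmD(2)[OF G bmB u vT] cov_I_B[OF u vT] mm_simps)
  then show "cov (\<xi> u) (B v) = prim (\<lambda>s. c - f s) (min u v)"
   using prim_diff[OF L1on_continuous[OF continuous_on_const] L2on_L1on[OF f2] m(2), of c] prim_const[OF G m(1), of c] by simp
 qed
qed

lemma \<epsilon>_W:
 assumes t: "t \<in> {0..T}" and v: "v \<in> {0..t}"
 shows "\<Psi> t ** cov (\<epsilon> t) (W v) = prim (\<lambda>s. \<Psi> s ** \<sigma>) v"
proof -
 have vT: "v \<in> {0..T}" using t v by auto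
 have BW: "cov (B u) (W v) = 0" if "u \<in> {0..T}" for u
  using cov_transpose[OF sq[OF gW vT] sq[OF gB that]] WB[OF vT that] by (simp add: transpose_zero)
 show ?thesis
 proof (rule \<epsilon>_noise[OF sq[OF gW vT] WU[OF vT] L2on_continuous[OF continuous_on_const] t v])
  fix u assume u: "u \<in> {0..T}"
  have m: "0 \<le> min u v" using u vT by auto
  have IW: "cov (I u) (W v) = 0" by (rule cov_I_zero[OF sq[OF gW vT] BW u])
  show "cov (\<xi> u) (W v) = prim (\<lambda>s. \<sigma>) (min u v)"
   by (simp add: cov_\<xi>[OF sq[OF gW vT] u] BW[OF u] bmD(2)[OF G bmW u vT] IW mm_simps prim_const[OF G m])
 qed
qed

text \<open>The source term that remains when the Riccati equation is written as
  \<open>P' = \<beta> P + P b\<^sup>T + \<eta>\<close>; it is also what the noises contribute to the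
  covariance of the error with \<open>U\<close>.\<close>

definition \<eta> :: "real => real^'d^'d" where "\<eta> s = \<sigma> ** transpose \<sigma> + (c - f s) ** transpose c"

lemmas cf1 = L2on_L1on[OF cf2]

lemma \<eta>1: "L1on T \<eta>"
 unfolding \<eta>_def[abs_def]
 by (rule set_integral_add(1)[OF L1on_continuous[OF continuous_on_const] L1on_bilinear[OF bb_mm cf1 continuous_on_const]])

lemma \<Psi>\<eta>1: "L1on T (\<lambda>s. \<Psi> s ** \<eta> s)" by (rule L1on_bilinear2[OF bb_mm \<eta>1 Fs(2)])

text \<open>Since \<open>c - f = - P k\<^sup>T\<close>, the Riccati right side equals
  \<open>\<beta> P + P b\<^sup>T + \<eta>\<close>; multiplication by \<open>\<Psi>\<close> removes
  the first term.\<close>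

lemma \<Psi>P:
 assumes t: "t \<in> {0..T}"
 shows "\<Psi> t ** P t = cov (U 0) (U 0) + prim (\<lambda>s. (\<Psi> s ** P s) ** transpose (b s) + \<Psi> s ** \<eta> s) t"
proof -
 have i: "L1on T (\<lambda>s. P s ** transpose (b s) + \<eta> s)"
  by (rule set_integral_add(1)[OF L1on_bilinear2[OF bb_mm L1on_transpose[OF b] P] \<eta>1])
 have "P u = cov (U 0) (U 0) + prim (\<lambda>s. \<beta> s ** P s + (P s ** transpose (b s) + \<eta> s)) u" if "u \<in> {0..T}" for u
  unfolding P_eq[OF that]
  by (rule arg_cong[where f="(+) _"], rule prim_cong) (simp add: \<beta>_s f_s \<eta>_def mm_simps)
 from fundamental_mm[OF F \<beta>1 i P this t] show ?thesis by (simp add: mm_simps)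
qed

text \<open>For fixed \<open>t\<close> the function
  \<open>u \<mapsto> \<Psi> t ** cov (\<epsilon> t) (U u)\<close> on \<open>[0,t]\<close> solves
  \<open>y' = y b\<^sup>T + \<Psi> \<eta>\<close>, because the covariances of the error with
  \<open>U 0\<close> and both noises, multiplied by \<open>\<Psi> t\<close>, do not depend on
  \<open>t\<close>. By \<open>\<Psi>P\<close> the function \<open>\<Psi> P\<close> solves the same
  equation with the same initial value. Orthogonality to \<open>Z v\<close> is then the choice of
  the gain.\<close>

lemma \<epsilon>_past:
 assumes t: "t \<in> {0..T}" and v: "v \<in> {0..t}"
 shows "cov (\<lambda>w. \<Psi> t *v \<epsilon> t w) (U v) = \<Psi> v ** P v" and "cov (\<epsilon> t) (Z v) = 0"
proof -
 define m where "m w = \<Psi> t *v \<epsilon> t w" for w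
 have sm: "sqint m" unfolding m_def[abs_def] by (rule sqint_mv[OF sq[OF g\<epsilon> t]])
 have cm: "cov m Q = \<Psi> t ** cov (\<epsilon> t) Q" if "sqint Q" for Q :: "'w => real^'k"
  unfolding m_def by (rule cov_mv_left[OF sq[OF g\<epsilon> t] that])
 have tT: "t \<le> T" and uT: "u \<in> {0..t} ==> u \<in> {0..T}" for u using t by auto
 have i: "L1on T (\<lambda>s. \<Psi> s ** (c - f s) ** transpose c)" "L1on T (\<lambda>s. \<Psi> s ** \<sigma> ** transpose \<sigma>)" "L1on T (\<lambda>s. \<Psi> s ** (c - f s))"
  by (rule L1on_bilinear[OF bb_mm L1on_bilinear2[OF bb_mm cf1 Fs(2)] continuous_on_const])
   (rule L1on_continuous, intro continuous_intros Fs(2), rule L1on_bilinear2[OF bb_mm cf1 Fs(2)])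
 have mU: "continuous_on {0..T} (\<lambda>u. cov m (U u))"
  by (rule continuous_on_eq[OF continuous_on_transpose[OF gproc_cov_continuous[OF G gU sm]]]) (rule cov_transpose[OF sq[OF gU] sm])
 have step: "cov m (U u) = cov (U 0) (U 0) + prim (\<lambda>s. cov m (U s) ** transpose (b s) + \<Psi> s ** \<eta> s) u" if u: "u \<in> {0..t}" for u
 proof -
  note uT = uT[OF u]
  have uTT: "u \<le> T" using uT by simp
  have bi: "L1on T (\<lambda>s. cov m (U s) ** transpose (b s))" by (rule L1on_bilinear2[OF bb_mm L1on_transpose[OF b] mU])
  note s = sq[OF gU zero_in] sq[OF gproc_prim[OF G T0 gU b] uT] sq[OF gW uT] sq[OF gB uT]
  have "cov m (U u) = cov m (\<lambda>w. U 0 w + prim (\<lambda>s. b s *v U s w) u + \<sigma> *v W u w + c *v B u w)"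
   by (rule cov_cong[OF refl U_eq[OF _ uT]])
  also have "\<dots> = cov m (U 0) + cov m (\<lambda>w. prim (\<lambda>s. b s *v U s w) u) + cov m (W u) ** transpose \<sigma> + cov m (B u) ** transpose c"
   by (simp only: cov_add_right[OF sm sqint_mv[OF s(4)] sqint_add[OF sqint_add[OF s(1,2)] sqint_mv[OF s(3)]]]
     cov_add_right[OF sm sqint_mv[OF s(3)] sqint_add[OF s(1,2)]] cov_add_right[OF sm s(2,1)] cov_mv_right[OF sm s(3)] cov_mv_right[OF sm s(4)])
  also have "\<dots> = cov (U 0) (U 0) + prim (\<lambda>s. cov m (U s) ** transpose (b s)) u
    + prim (\<lambda>s. \<Psi> s ** \<sigma>) u ** transpose \<sigma> + prim (\<lambda>s. \<Psi> s ** (c - f s)) u ** transpose c"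
   by (simp only: gproc_cov_prim_right[OF G T0 gU b sm uT] cm[OF s(1)] cm[OF s(3)] cm[OF s(4)] \<epsilon>_U0[OF t] \<epsilon>_W[OF t u] \<epsilon>_B[OF t u])
  also have "prim (\<lambda>s. \<Psi> s ** \<sigma>) u ** transpose \<sigma> = prim (\<lambda>s. \<Psi> s ** \<sigma> ** transpose \<sigma>) u"
   by (rule prim_bounded_linear(1)[OF bb_mm.bounded_linear_left _ uTT]) (rule L1on_continuous, intro continuous_intros Fs(2))
  also have "prim (\<lambda>s. \<Psi> s ** (c - f s)) u ** transpose c = prim (\<lambda>s. \<Psi> s ** (c - f s) ** transpose c) u"
   by (rule prim_bounded_linear(1)[OF bb_mm.bounded_linear_left i(3) uTT])
  also have "cov (U 0) (U 0) + prim (\<lambda>s. cov m (U s) ** transpose (b s)) u + prim (\<lambda>s. \<Psi> s ** \<sigma> ** transpose \<sigma>) u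
    + prim (\<lambda>s. \<Psi> s ** (c - f s) ** transpose c) u
   = cov (U 0) (U 0) + prim (\<lambda>s. cov m (U s) ** transpose (b s) + \<Psi> s ** \<sigma> ** transpose \<sigma> + \<Psi> s ** (c - f s) ** transpose c) u"
   unfolding prim_add[OF set_integral_add(1)[OF bi i(2)] i(1) uTT] prim_add[OF bi i(2) uTT] by (simp only: add.assoc)
  also have "prim (\<lambda>s. cov m (U s) ** transpose (b s) + \<Psi> s ** \<sigma> ** transpose \<sigma> + \<Psi> s ** (c - f s) ** transpose c) u
    = prim (\<lambda>s. cov m (U s) ** transpose (b s) + \<Psi> s ** \<eta> s) u"
   by (rule prim_cong) (simp add: \<eta>_def mm_simps)
  finally show ?thesis .
 qed
 have mUP: "cov m (U u) = \<Psi> u ** P u" if u: "u \<in> {0..t}" for u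
 proof (rule linear_right_unique[OF L1on_subset[OF L1on_transpose[OF b] tT] L1on_subset[OF \<Psi>\<eta>1 tT] _ step _ _ u])
  show "continuous_on {0..t} (\<lambda>u. cov m (U u))" by (rule continuous_on_subset[OF mU]) (use t in auto)
  show "continuous_on {0..t} (\<lambda>u. \<Psi> u ** P u)" by (rule continuous_on_subset[OF continuous_on_mm[OF Fs(2) P]]) (use t in auto)
  show "\<Psi> u ** P u = cov (U 0) (U 0) + prim (\<lambda>s. \<Psi> s ** P s ** transpose (b s) + \<Psi> s ** \<eta> s) u" if "u \<in> {0..t}" for u
   by (rule \<Psi>P[OF uT[OF that]])
 qed
 show "cov (\<lambda>w. \<Psi> t *v \<epsilon> t w) (U v) = \<Psi> v ** P v" using mUP[OF v] by (simp add: m_def[abs_def])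
 note vT = uT[OF v]
 have k1: "L1on T k" by (rule L2on_L1on[OF k])
 have "cov m (Z v) = cov m (\<lambda>w. prim (\<lambda>s. k s *v U s w) v + B v w)" by (rule cov_cong[OF refl Z_eq[OF _ vT]])
 also have "\<dots> = prim (\<lambda>s. cov m (U s) ** transpose (k s)) v + prim (\<lambda>s. \<Psi> s ** (c - f s)) v"
  by (simp only: cov_add_right[OF sm sq[OF gB vT] sq[OF gproc_prim[OF G T0 gU k1] vT]] gproc_cov_prim_right[OF G T0 gU k1 sm vT]
    cm[OF sq[OF gB vT]] \<epsilon>_B[OF t v])
 also have "\<dots> = prim (\<lambda>s. cov m (U s) ** transpose (k s) + \<Psi> s ** (c - f s)) v"
  by (rule prim_add[OF L1on_bilinear2[OF bb_mm L1on_transpose[OF k1] mU] i(3), symmetric]) (use vT in simp)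
 \<comment> \<open>The integrand is \<open>\<Psi> (P k\<^sup>T + c - f)\<close>, which vanishes by
   the definition of \<open>f\<close>.\<close>
 also have "\<dots> = prim (\<lambda>s. 0) v"
  by (rule prim_cong) (use v in \<open>simp add: mUP f_s mm_simps\<close>)
 finally have "\<Psi> t ** cov (\<epsilon> t) (Z v) = 0" using cm[OF sq[OF gZ vT]] by simp
 then have "(\<Phi> t ** \<Psi> t) ** cov (\<epsilon> t) (Z v) = 0" by (simp add: matrix_mul_assoc[symmetric] bb_mm.zero_right)
 then show "cov (\<epsilon> t) (Z v) = 0" by (simp add: Fs(6)[OF t])
qed

text \<open>Adding the drift \<open>a \<integral> k Q ds\<close> to an integrator adds, along each
  path, the Lebesgue integral of step function times \<open>k Q\<close> to the elementary integral;
  it converges pathwise and hence, in the Gaussian space, in mean square. With \<open>a = 1\<close>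
  and \<open>Q = U\<close> this leads from \<open>B\<close> to \<open>Z\<close>, with
  \<open>a = -1\<close> and \<open>Q = V\<close> from \<open>Z\<close> to the innovation.\<close>

lemma shift_lim:
 assumes Q: "gproc T S Q" and Y: "gproc T S Y" and L: "sqint L" and t: "t \<in> {0..T}"
  and YL: "(\<lambda>j. ms (\<lambda>z. wint T (n j) (x j) Y t z - L z)) \<longlonglongrightarrow> 0"
 shows "(\<lambda>j. ms (\<lambda>z. wint T (n j) (x j) (\<lambda>t z. Y t z + a *\<^sub>R prim (\<lambda>s. k s *v Q s z) t) t z
  - (L z + a *\<^sub>R prim (\<lambda>s. (f s ** k s) *v Q s z) t))) \<longlonglongrightarrow> 0"
proof -
 define A where "A j z = prim (\<lambda>s. (stepf T (n j) (x j) s ** k s) *v Q s z) t" for j z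
 define A' where "A' z = prim (\<lambda>s. (f s ** k s) *v Q s z) t" for z
 have gA': "gproc T S (\<lambda>t z. prim (\<lambda>s. (f s ** k s) *v Q s z) t)" by (rule gproc_prim[OF G T0 Q fk1])
 have vA: "vspan S (A j)" for j
  unfolding A_def by (rule gprocD(2)[OF gproc_prim[OF G T0 Q L2on_bilinear[OF bb_mm L2on_stepf k]] t])
 have kQ: "L2on T (\<lambda>s. k s *v Q s z)" if "z \<in> space M" for z
  by (rule L2on_mult_continuous[OF bb_mv k gproc_path[OF Q that]])
 have sA': "sqint A'" unfolding A'_def[abs_def] by (rule sq[OF gA' t])
 have "(\<lambda>j. A j z) \<longlonglongrightarrow> A' z" if "z \<in> space M" for z
  using L2_tendsto[OF bb_mv L2on_stepf f2 dense kQ[OF that] t] by (simp add: A_def A'_def matrix_vector_mul_assoc)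
 then have lA: "(\<lambda>j. ms (\<lambda>z. A j z - A' z)) \<longlonglongrightarrow> 0"
  by (intro gv_AE_limit(2)[OF G vA _ sqintD[OF sA']] AE_I2)
 have split: "wint T (n j) (x j) (\<lambda>t z. Y t z + a *\<^sub>R prim (\<lambda>s. k s *v Q s z) t) t z = wint T (n j) (x j) Y t z + a *\<^sub>R A j z"
  if w: "z \<in> space M" for j z
  unfolding wint_def A_def
  by (simp add: matrix_vector_mul_assoc[symmetric] stepf_prim[OF bb_mv T0 L2on_L1on[OF kQ[OF w]] t, symmetric]
    bb_mv.add_right bb_mv.diff_right bb_mv.scaleR_right scaleR_sum_right scaleR_diff_right sum.distrib[symmetric] algebra_simps)
 have le: "ms (\<lambda>z. wint T (n j) (x j) (\<lambda>t z. Y t z + a *\<^sub>R prim (\<lambda>s. k s *v Q s z) t) t z - (L z + a *\<^sub>R A' z))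
   \<le> 2 * ms (\<lambda>z. wint T (n j) (x j) Y t z - L z) + 2 * (a\<^sup>2 * ms (\<lambda>z. A j z - A' z))" for j
 proof -
  have "ms (\<lambda>z. wint T (n j) (x j) (\<lambda>t z. Y t z + a *\<^sub>R prim (\<lambda>s. k s *v Q s z) t) t z - (L z + a *\<^sub>R A' z))
   = ms (\<lambda>z. (wint T (n j) (x j) Y t z - L z) + a *\<^sub>R (A j z - A' z))"
   unfolding ms_def by (rule lint_cong[OF refl]) (simp add: split algebra_simps)
  also have "\<dots> \<le> 2 * ms (\<lambda>z. wint T (n j) (x j) Y t z - L z) + 2 * ms (\<lambda>z. a *\<^sub>R (A j z - A' z))"
   by (intro ms_add_le sqint_scaleR sqint_diff gv_sqint[OF G vA] sA' L sq[OF gproc_wint[OF G Y T0] t])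
  finally show ?thesis by (simp add: ms_def power_mult_distrib)
 qed
 have "(\<lambda>j. 2 * ms (\<lambda>z. wint T (n j) (x j) Y t z - L z) + 2 * (a\<^sup>2 * ms (\<lambda>z. A j z - A' z))) \<longlonglongrightarrow> 2 * 0 + 2 * (a\<^sup>2 * 0)"
  by (intro tendsto_intros YL lA)
 then have l0: "(\<lambda>j. 2 * ms (\<lambda>z. wint T (n j) (x j) Y t z - L z) + 2 * (a\<^sup>2 * ms (\<lambda>z. A j z - A' z))) \<longlonglongrightarrow> 0" by simp
 show ?thesis unfolding A'_def[symmetric]
  by (rule tendsto_sandwich[OF _ _ tendsto_const l0]) (use le ms_nonneg in \<open>auto intro!: always_eventually\<close>)
qed

lemma JZ_lim:
 assumes t: "t \<in> {0..T}"
 shows "(\<lambda>j. ms (\<lambda>w. wint T (n j) (x j) Z t w - JZ t w)) \<longlonglongrightarrow> 0"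
proof (rule Lim_transform_eventually[OF shift_lim[OF gU gB sq[OF gI t] t I_lim[OF t], of 1] always_eventually[OF allI]])
 show "ms (\<lambda>w. wint T (n j) (x j) (\<lambda>t w. B t w + 1 *\<^sub>R prim (\<lambda>s. k s *v U s w) t) t w - (I t w + 1 *\<^sub>R prim (\<lambda>s. (f s ** k s) *v U s w) t))
  = ms (\<lambda>w. wint T (n j) (x j) Z t w - JZ t w)" for j
  unfolding ms_def
  by (rule lint_cong[OF refl]) (simp add: wint_def JZ_def Z_eq[OF _ node_bounds(3)[OF T0 t]] add.commute)
qed

text \<open>Written with \<open>B\<close>, the process \<open>JZ\<close> is no visible function of
  the observation; as the limit of elementary integrals against \<open>Z\<close> it lies in the
  closed span of the past of \<open>Z\<close>.\<close>

lemma JZ_past: "t \<in> {0..T} ==> vspan (past Z t) (JZ t)"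
 by (rule gv_limit[OF past_family[OF G gZ] wint_vspan[OF G gZ T0] sq[OF gJZ] JZ_lim])

lemma V_past:
 assumes t: "t \<in> {0..T}"
 shows "vspan (past Z t) (V t)"
proof -
 note G' = past_family[OF G gZ t]
 have "vspan (past Z t) (JZ s)" if s: "s \<in> {0..t}" for s
 proof (rule vspan_mono[OF _ JZ_past])
  show "past Z s \<subseteq> past Z t" using s by (force simp: past_def)
 qed (use s t in auto)
 then show ?thesis
  unfolding V_def[abs_def]
  by (intro vspan_add[OF gf_sqint[OF G']] vspan_mv[OF gf_sqint[OF G']] JZ_past t gv_prim[OF G' T0 gprocD(1)[OF gJZ] \<Psi>\<beta>1])
qed

lemma \<epsilon>_V: assumes t: "t \<in> {0..T}" shows "cov (V t) (\<epsilon> t) = 0"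
proof (rule vspan_orthogonal[OF gf_sqint[OF past_family[OF G gZ t]] V_past[OF t] sq[OF g\<epsilon> t]])
 fix X j assume "X \<in> past Z t"
 then obtain s i where s: "s \<in> {0..t}" "X = (\<lambda>w. Z s w $ i)" by (auto simp: past_def)
 then have sT: "s \<in> {0..T}" using t by auto
 show "expectation (\<lambda>w. X w * \<epsilon> t w $ j) = 0"
  using cov_component[OF sq[OF g\<epsilon> t] sq[OF gZ sT], of j i] \<epsilon>_past(2)[OF t s(1)] by (simp add: s(2) mult.commute)
qed

text \<open>Of the two parts of \<open>\<epsilon> = U - V\<close>, the covariance of the error with
  \<open>U t\<close> is \<open>P t\<close>, and the one with \<open>V t\<close> vanishes as
  \<open>V t\<close> belongs to the span of the past of \<open>Z\<close>.\<close>

lemma \<epsilon>_\<epsilon>: assumes t: "t \<in> {0..T}" shows "cov (\<epsilon> t) (\<epsilon> t) = P t"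
proof -
 have tt: "t \<in> {0..t}" using t by simp
 have "\<Psi> t ** cov (\<epsilon> t) (U t) = \<Psi> t ** P t"
  using \<epsilon>_past(1)[OF t tt] by (simp only: cov_mv_left[OF sq[OF g\<epsilon> t] sq[OF gU t]])
 then have "(\<Phi> t ** \<Psi> t) ** cov (\<epsilon> t) (U t) = (\<Phi> t ** \<Psi> t) ** P t" by (simp add: matrix_mul_assoc[symmetric])
 then have "cov (\<epsilon> t) (U t) = P t" by (simp add: Fs(6)[OF t])
 moreover have "cov (\<epsilon> t) (V t) = 0"
  using cov_transpose[OF sq[OF gV t] sq[OF g\<epsilon> t]] \<epsilon>_V[OF t] by (simp add: transpose_zero)
 moreover have "cov (\<epsilon> t) (\<epsilon> t) = cov (\<epsilon> t) (U t) - cov (\<epsilon> t) (V t)"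
  using cov_diff_right[OF sq[OF g\<epsilon> t] sq[OF gV t] sq[OF gU t]] by (simp only: \<epsilon>_def[symmetric])
 ultimately show ?thesis by simp
qed

text \<open>Because \<open>\<beta> = b - f k\<close>, the filter minus its drift \<open>b V\<close>
  is \<open>JZ\<close> minus the drift \<open>f k V\<close>, which is exactly the shift of
  integrator from \<open>Z\<close> to the innovation.\<close>

lemma ito_lim:
 assumes t: "t \<in> {0..T}"
 shows "(\<lambda>j. ms (\<lambda>z. wint T (n j) (x j) (\<lambda>t z. Z t z - prim (\<lambda>s. k s *v V s z) t) t z - (V t z - prim (\<lambda>s. b s *v V s z) t))) \<longlonglongrightarrow> 0"
proof (rule Lim_transform_eventually[OF shift_lim[OF gV gZ sq[OF gJZ t] t JZ_lim[OF t], of "-1"] always_eventually[OF allI]])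
 have "V t z - prim (\<lambda>s. b s *v V s z) t = JZ t z - prim (\<lambda>s. (f s ** k s) *v V s z) t" if w: "z \<in> space M" for z
 proof -
  have i: "L1on T (\<lambda>s. b s *v V s z)" "L1on T (\<lambda>s. (f s ** k s) *v V s z)"
   by (rule L1on_bilinear[OF bb_mv b gproc_path[OF gV w]] L1on_bilinear[OF bb_mv fk1 gproc_path[OF gV w]])+
  have "prim (\<lambda>s. \<beta> s *v V s z) t = prim (\<lambda>s. b s *v V s z) t - prim (\<lambda>s. (f s ** k s) *v V s z) t"
   using t by (simp only: \<beta>_s bb_mv.diff_left prim_diff[OF i] atLeastAtMost_iff)
  then show ?thesis using V_eq[OF w t] by simp
 qed
 then show "ms (\<lambda>z. wint T (n j) (x j) (\<lambda>t z. Z t z + -1 *\<^sub>R prim (\<lambda>s. k s *v V s z) t) t z - (JZ t z + -1 *\<^sub>R prim (\<lambda>s. (f s ** k s) *v V s z) t))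
  = ms (\<lambda>z. wint T (n j) (x j) (\<lambda>t z. Z t z - prim (\<lambda>s. k s *v V s z) t) t z - (V t z - prim (\<lambda>s. b s *v V s z) t))" for j
  unfolding ms_def by (intro lint_cong[OF refl]) simp
qed

text \<open>At time 0 all elementary integrals are 0, hence so is their mean square limit, which at
  time 0 is \<open>V\<close> itself.\<close>

lemma V_0: "AE w in M. V 0 w = 0"
proof -
 have "wint T (n j) (x j) N 0 w = 0" for j and N :: "real => 'w => real^'n" and w
  using T0 by (simp add: wint_def node_def)
 then have "ms (\<lambda>w. - V 0 w) = 0"
  using ito_lim[OF zero_in] by (simp add: LIMSEQ_const_iff)
 then have "ms (V 0) = 0" by (simp add: ms_def)
 then show ?thesis by (rule ms_zero_AE[OF sq[OF gV zero_in]])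
qed

text \<open>If \<open>H U\<close> vanishes, \<open>H V\<close> equals \<open>- H \<epsilon>\<close>
  and is orthogonal to itself, since \<open>V\<close> and the error are orthogonal. Thus filter and
  error both vanish in this direction, and so does the error covariance. This lets coefficients be
  changed along such a direction.\<close>

lemma null_direction:
 fixes H :: "real^'d^'q"
 assumes t: "t \<in> {0..T}" and HU: "AE w in M. H *v U t w = 0"
 shows "AE w in M. H *v V t w = 0" and "H ** P t = 0"
proof -
 note e = sq[OF g\<epsilon> t] and HV = sqint_mv[OF sq[OF gV t], of H]
 have "cov (\<lambda>w. H *v V t w) (\<lambda>w. H *v V t w) = cov (\<lambda>w. H *v V t w) (\<lambda>w. (- H) *v \<epsilon> t w)"
 proof (rule cov_AE[OF _ _ HV HV HV sqint_mv[OF e]])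
  show "AE w in M. H *v V t w = (- H) *v \<epsilon> t w"
   using HU by eventually_elim (simp add: \<epsilon>_def bb_mv.diff_right bb_mv.minus_left)
 qed simp
 also have "\<dots> = H ** cov (V t) (\<epsilon> t) ** transpose (- H)"
  by (simp only: cov_mv_right[OF HV e] cov_mv_left[OF sq[OF gV t] e])
 finally have "ms (\<lambda>w. H *v V t w) = 0"
  by (simp add: \<epsilon>_V[OF t] ms_trace[OF HV] bb_mm.zero_right bb_mm.zero_left trace_def)
 then show HV0: "AE w in M. H *v V t w = 0" by (rule ms_zero_AE[OF HV])
 have "H ** P t = cov (\<lambda>w. H *v \<epsilon> t w) (\<epsilon> t)" by (simp only: cov_mv_left[OF e e] \<epsilon>_\<epsilon>[OF t])
 also have "\<dots> = cov (\<lambda>w. (0 :: real^'d^'q) *v \<epsilon> t w) (\<epsilon> t)"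
 proof (rule cov_AE[OF _ _ sqint_mv[OF e] sqint_mv[OF e] e e])
  show "AE w in M. H *v \<epsilon> t w = 0 *v \<epsilon> t w"
   using HU HV0 by eventually_elim (simp add: \<epsilon>_def bb_mv.diff_right bb_mv.zero_left)
 qed simp
 finally show "H ** P t = 0" by (simp only: cov_mv_left[OF e e] bb_mm.zero_left)
qed

end

lemma (in linear_system) kalman_bucy_exists:
 obtains P f \<beta> \<Phi> \<Psi> I n x where "kalman_bucy M S T U Z B W b k \<sigma> c P f \<beta> \<Phi> \<Psi> I n x" "\<And>t. t \<in> {0..T} ==> transpose (P t) = P t"
proof -
 have T0: "0 \<le> T" and z: "0 \<in> {0..T}" using T by auto
 note sU = gproc_sqint[OF G gU z]
 have bk: "L1on T (\<lambda>s. b s - c ** k s)"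
  by (rule set_integral_diff(1)[OF b L1on_bilinear2[OF bb_mm L2on_L1on[OF k] continuous_on_const]])
 have Q: "transpose (\<sigma> ** transpose \<sigma>) = \<sigma> ** transpose \<sigma>" "0 \<le> v \<bullet> ((\<sigma> ** transpose \<sigma>) *v v)" for v
  using quadratic_congruence[of v \<sigma> "mat 1"] by (simp_all add: mm_simps)
 obtain P where P: "continuous_on {0..T} P" and Ps: "\<And>t. t \<in> {0..T} ==> transpose (P t) = P t"
  and Pe: "\<And>t. t \<in> {0..T} ==> P t = cov (U 0) (U 0) + prim (\<lambda>s. (b s - c ** k s) ** P s + P s ** transpose (b s - c ** k s) + \<sigma> ** transpose \<sigma>
     - P s ** (transpose (k s) ** k s) ** P s) t"
 proof (rule riccati_exists[OF T0 bk k Q cov_transpose[OF sU sU] cov_psd[OF sU]], goal_cases)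
  case (1 P)
  show ?case by (rule 1(1)[OF 1(2-4)])
 qed
 define f where "f = (\<lambda>s. c + P s ** transpose (k s))"
 have f: "L2on T f"
  unfolding f_def by (rule L2on_add[OF L2on_continuous[OF continuous_on_const]
    L2on_mult_continuous[OF bounded_bilinear.flip[OF bb_mm] L2on_linear[OF bl_transpose k] P]])
 define \<beta> where "\<beta> = (\<lambda>s. b s - f s ** k s)"
 have "L1on T \<beta>" unfolding \<beta>_def by (rule set_integral_diff(1)[OF b L2on_bilinear[OF bb_mm f k]])
 then obtain \<Phi> \<Psi> where F: "fundamental T \<beta> \<Phi> \<Psi>" by (rule fundamental_exists)
 obtain I n x where I: "gproc T S I" "\<And>j. (n j :: nat) > 0" "(\<lambda>j. sqdist T (stepf T (n j) (x j)) f) \<longlonglongrightarrow> 0"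
  "\<And>t. t \<in> {0..T} ==> (\<lambda>j. ms (\<lambda>w. wint T (n j) (x j) B t w - I t w)) \<longlonglongrightarrow> 0"
  "\<And>t. t \<in> {0..T} ==> vspan (past B t) (I t)"
 proof (rule wiener_integral[OF G bmB T f], goal_cases)
  case (1 I n x)
  show ?case by (rule 1(1)[OF 1(2-6)])
 qed
 have "kalman_bucy M S T U Z B W b k \<sigma> c P f \<beta> \<Phi> \<Psi> I n x"
  by unfold_locales (fact P Pe f_def \<beta>_def F I(1,3,4))+
 then show ?thesis by (rule that[OF _ Ps])
qed

section \<open>Decorrelation of the observation noise\<close>

lemma (in prob_space) bm_0: "gaussian_family S ==> bm S T N ==> 0 \<le> T ==> AE w in M. N 0 w = 0"
proof -
 assume G: "gaussian_family S" and N: "bm S T N" and T: "0 \<le> T"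
 have z: "0 \<in> {0..T}" using T by simp
 note s = gproc_sqint[OF G bmD(1)[OF G N] z]
 show ?thesis by (rule ms_zero_AE[OF s]) (simp add: ms_trace[OF s] bmD(2)[OF G N z z] trace_def)
qed

locale correlated_initial = prob_space M for M :: "'w measure" +
 fixes S :: "('w => real) set" and T :: real and X0 :: "'w => real^'m" and N :: "real => 'w => real^'n"
  and \<rho> \<rho>' \<rho>'' :: "real => real^'m^'n"
 assumes G: "gaussian_family S" and T: "0 < T" and vX0: "vspan S X0" and bmN: "bm S T N"
  and \<rho>: "\<And>t. t \<in> {0..T} ==> \<rho> t = cov (N t) X0"
  and \<rho>1: "\<And>t. t \<in> {0..T} ==> (\<rho> has_vector_derivative \<rho>' t) (at t within {0..T})"
  and \<rho>2: "\<And>t. t \<in> {0..T} ==> (\<rho>' has_vector_derivative \<rho>'' t) (at t within {0..T})"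
  and \<rho>''c: "continuous_on {0..T} \<rho>''"
begin

lemma T0: "0 \<le> T" using T by simp
lemma zero_in: "0 \<in> {0..T}" using T by simp
lemma gN: "gproc T S N" by (rule bmD(1)[OF G bmN])
lemmas sN = gproc_sqint[OF G gN]
lemma sX: "sqint X0" by (rule gv_sqint[OF G vX0])

lemma \<rho>'c: "continuous_on {0..T} \<rho>'" and \<rho>c: "continuous_on {0..T} \<rho>"
 unfolding continuous_on_eq_continuous_within
 using has_vector_derivative_continuous[OF \<rho>1] has_vector_derivative_continuous[OF \<rho>2] by blast+

lemma \<rho>_0: "\<rho> 0 = 0"
proof -
 have "cov (N 0) X0 = cov (\<lambda>_. 0 :: real^'n) X0"
  by (rule cov_AE[OF bm_0[OF G bmN T0]]) (use sN[OF zero_in] sX in auto)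
 also have "\<dots> = 0" by (simp add: cov_def vec_eq_iff outer_def zero_vec_def)
 finally show ?thesis using \<rho>[OF zero_in] by simp
qed

lemma \<rho>_prim: "t \<in> {0..T} ==> \<rho> t = prim \<rho>' t"
 using prim_FTC[OF \<rho>1 \<rho>'c] \<rho>_0 by simp

lemma \<rho>'_prim: "t \<in> {0..T} ==> \<rho>' t = \<rho>' 0 + prim \<rho>'' t"
 by (rule prim_FTC[OF \<rho>2 \<rho>''c])

definition p :: "real => real^'n^'m" where "p s = transpose (\<rho>'' s)"

lemma pc: "continuous_on {0..T} p" unfolding p_def[abs_def] by (intro continuous_intros \<rho>''c)
lemmas p1 = L1on_continuous[OF pc]

lemma \<rho>'T_prim: "t \<in> {0..T} ==> transpose (\<rho>' t) = transpose (\<rho>' 0) + prim p t"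
 using prim_transpose[OF L1on_continuous[OF \<rho>''c], of t] \<rho>'_prim[of t] by (simp add: p_def transpose_add)

definition Xbar :: "real => 'w => real^'m" where "Xbar t w = X0 w + prim (\<lambda>s. p s *v N s w) t"
text \<open>Integration by parts shows this to be \<open>X0\<close> minus the Wiener integral of
  \<open>\<rho>'\<^sup>T\<close> against \<open>N\<close> up to \<open>t\<close>, that is,
  \<open>X0\<close> with its regression on the past of \<open>N\<close> removed;
  \<open>\<Gamma> t\<close> is its covariance.\<close>

definition R :: "real => 'w => real^'m" where "R t w = Xbar t w - transpose (\<rho>' t) *v N t w"
definition \<Gamma> :: "real => real^'m^'m" where "\<Gamma> t = cov X0 X0 - prim (\<lambda>u. transpose (\<rho>' u) ** \<rho>' u) t"

lemma gXbar: "gproc T S Xbar"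
 unfolding Xbar_def[abs_def] by (rule gproc_add[OF G gproc_const[OF G vX0] gproc_prim[OF G T0 gN p1]])

lemma g\<rho>N: "gproc T S (\<lambda>t w. transpose (\<rho>' t) *v N t w)"
 by (rule gproc_mv[OF G gN continuous_on_transpose[OF \<rho>'c]])

lemma gR: "gproc T S R"
 unfolding R_def[abs_def] by (rule gproc_diff[OF G gXbar g\<rho>N])

lemmas sR = gproc_sqint[OF G gR]

lemma cov_R:
 fixes Q :: "'w => real^'k"
 assumes Q: "sqint Q" and t: "t \<in> {0..T}"
 shows "cov (R t) Q = cov X0 Q + prim (\<lambda>s. p s ** cov (N s) Q) t - transpose (\<rho>' t) ** cov (N t) Q"
proof -
 note sp = gproc_sqint[OF G gproc_prim[OF G T0 gN p1] t]
 have "cov (R t) Q = cov (Xbar t) Q - cov (\<lambda>w. transpose (\<rho>' t) *v N t w) Q"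
  unfolding R_def[abs_def] by (rule cov_diff_left[OF gproc_sqint[OF G gXbar t] gproc_sqint[OF G g\<rho>N t] Q])
 also have "cov (Xbar t) Q = cov X0 Q + cov (\<lambda>w. prim (\<lambda>s. p s *v N s w) t) Q"
  unfolding Xbar_def[abs_def] by (rule cov_add_left[OF sX sp Q])
 finally show ?thesis by (simp only: gproc_cov_prim(1)[OF G T0 gN p1 Q t] cov_mv_left[OF sN[OF t] Q])
qed

text \<open>The right side vanishes for \<open>v \<le> w\<close>: this is the orthogonality of the
  residual to the past of \<open>N\<close>. For later \<open>v\<close> it is the growth of
  \<open>\<rho>\<close> since time \<open>w\<close>.\<close>

lemma cov_R_N:
 assumes w: "w \<in> {0..T}" and v: "v \<in> {0..T}"
 shows "cov (R w) (N v) = transpose (\<rho> v) - transpose (\<rho> (min w v))"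
proof -
 have m: "min w v \<in> {0..T}" "w \<le> T" using w v by auto
 \<comment> \<open>The density of \<open>s \<mapsto> min s v\<close>; the product rule for
   \<open>min s v\<close> and \<open>\<rho>'\<^sup>T\<close> evaluates the integral of
   \<open>min s v\<close> times \<open>p\<close>.\<close>
 define i where "i s = (indicator {0..v} s *\<^sub>R 1 :: real)" for s
 have i1: "L1on T i" unfolding i_def[abs_def]
  by (rule L2on_L1on[OF L2on_indicator[OF L2on_continuous[OF continuous_on_const]]]) simp
 have ip: "min s v = 0 + prim i s" if "s \<in> {0..T}" for s
  using that v prim_const[OF G, of "min s v" "1::real"] prim_indicator[of s v "\<lambda>_. 1::real"] by (simp add: i_def)
 have tc: "continuous_on {0..T} (\<lambda>s. transpose (\<rho>' s))" by (intro continuous_intros \<rho>'c)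
 have a: "L1on T (\<lambda>s. i s *\<^sub>R transpose (\<rho>' s))" by (rule L1on_bilinear[OF bounded_bilinear_scaleR i1 tc])
 have b: "L1on T (\<lambda>s. min s v *\<^sub>R p s)" by (rule L1on_continuous) (intro continuous_intros pc)
 have "min w v *\<^sub>R transpose (\<rho>' w) = prim (\<lambda>s. i s *\<^sub>R transpose (\<rho>' s) + min s v *\<^sub>R p s) w"
  using ac_product(2)[OF bounded_bilinear_scaleR i1 p1 ip \<rho>'T_prim w] by simp
 also have "\<dots> = prim (\<lambda>s. i s *\<^sub>R transpose (\<rho>' s)) w + prim (\<lambda>s. min s v *\<^sub>R p s) w" by (rule prim_add[OF a b m(2)])
 also have "prim (\<lambda>s. i s *\<^sub>R transpose (\<rho>' s)) w = transpose (\<rho> (min w v))"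
  using prim_transpose[OF L1on_continuous[OF \<rho>'c], of "min w v"] m w v
  by (simp add: i_def prim_indicator \<rho>_prim[OF m(1)])
 finally have e: "prim (\<lambda>s. min s v *\<^sub>R p s) w = min w v *\<^sub>R transpose (\<rho>' w) - transpose (\<rho> (min w v))" by simp
 have "prim (\<lambda>s. p s ** cov (N s) (N v)) w = prim (\<lambda>s. min s v *\<^sub>R p s) w"
 proof (rule prim_cong)
  fix s assume "s \<in> {0..w}"
  then have "s \<in> {0..T}" using w by auto
  then show "p s ** cov (N s) (N v) = min s v *\<^sub>R p s" using v by (simp only: bmD(2)[OF G bmN]) (simp add: bb_mm.scaleR_right)
 qed
 moreover have "cov X0 (N v) = transpose (\<rho> v)" using cov_transpose[OF sN[OF v] sX] \<rho>[OF v] by simp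
 ultimately show ?thesis
  by (simp only: cov_R[OF sN[OF v] w] bmD(2)[OF G bmN w v] e) (simp add: bb_mm.scaleR_right)
qed

lemma \<rho>\<rho>1: "L1on T (\<lambda>s. transpose (\<rho>' s) ** \<rho>' s)"
 by (rule L1on_continuous) (intro continuous_intros \<rho>'c)

lemma cov_R_X0:
 assumes t: "t \<in> {0..T}"
 shows "cov (R t) X0 = \<Gamma> t"
proof -
 have tT: "t \<le> T" using t by simp
 have b: "L1on T (\<lambda>s. p s ** \<rho> s)" by (rule L1on_continuous) (intro continuous_intros pc \<rho>c)
 have r: "\<rho> t = 0 + prim \<rho>' t" if "t \<in> {0..T}" for t using \<rho>_prim[OF that] by simp
 have "transpose (\<rho>' t) ** \<rho> t = prim (\<lambda>s. p s ** \<rho> s + transpose (\<rho>' s) ** \<rho>' s) t"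
  using ac_product(2)[OF bb_mm p1 L1on_continuous[OF \<rho>'c] \<rho>'T_prim r t] by (simp add: bb_mm.zero_right)
 also have "\<dots> = prim (\<lambda>s. p s ** \<rho> s) t + prim (\<lambda>s. transpose (\<rho>' s) ** \<rho>' s) t" by (rule prim_add[OF b \<rho>\<rho>1 tT])
 finally have e: "prim (\<lambda>s. p s ** \<rho> s) t = transpose (\<rho>' t) ** \<rho> t - prim (\<lambda>s. transpose (\<rho>' s) ** \<rho>' s) t" by simp
 have "prim (\<lambda>s. p s ** cov (N s) X0) t = prim (\<lambda>s. p s ** \<rho> s) t"
  by (rule prim_cong) (use t \<rho> in auto)
 then show ?thesis by (simp only: cov_R[OF sX t] e \<rho>[OF t, symmetric] \<Gamma>_def) simp
qed

text \<open>\<open>R w\<close> differs from \<open>X0\<close> by a functional of \<open>N\<close> up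
  to time \<open>w\<close>, to which the later residual \<open>R u\<close> is orthogonal; so the
  covariance is the one with \<open>X0\<close>.\<close>

lemma cov_R_R:
 assumes w: "w \<in> {0..T}" and u: "u \<in> {0..T}" and wu: "w \<le> u"
 shows "cov (R u) (R w) = \<Gamma> u"
proof -
 have z: "cov (R u) (N s) = 0" if "s \<in> {0..w}" for s
  using cov_R_N[OF u, of s] that w wu by (simp add: min_absorb2)
 have Nz: "cov (N s) (R u) = 0" if "s \<in> {0..w}" for s
 proof -
  have "s \<in> {0..T}" using that w by auto
  from cov_transpose[OF sR[OF u] sN[OF this]] z[OF that] show ?thesis by (simp add: transpose_zero)
 qed
 have "cov (R w) (R u) = cov X0 (R u) + prim (\<lambda>s. p s ** cov (N s) (R u)) w - transpose (\<rho>' w) ** cov (N w) (R u)"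
  by (rule cov_R[OF sR[OF u] w])
 also have "prim (\<lambda>s. p s ** cov (N s) (R u)) w = prim (\<lambda>s. 0) w" by (rule prim_cong) (simp add: Nz bb_mm.zero_right)
 finally have "cov (R w) (R u) = cov X0 (R u)" using Nz[of w] w by (simp add: bb_mm.zero_right)
 then have "transpose (cov (R w) (R u)) = transpose (cov X0 (R u))" by simp
 then show ?thesis by (simp only: cov_transpose[OF sR[OF w] sR[OF u]] cov_transpose[OF sX sR[OF u]] cov_R_X0[OF u])
qed

text \<open>The defining difference shows no sign; positivity comes from reading it as the
  covariance of \<open>R t\<close>. The regularity of the gain rests on it.\<close>

lemma \<Gamma>_psd: "t \<in> {0..T} ==> 0 \<le> v \<bullet> (\<Gamma> t *v v)"
 using cov_psd[OF sR, of t] cov_R_R[of t t] by simp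

lemma \<Gamma>_sym: "t \<in> {0..T} ==> transpose (\<Gamma> t) = \<Gamma> t"
 using cov_transpose[OF sR sR, of t t] cov_R_R[of t t] by simp

text \<open>\<open>K R\<close> is the drift that \<open>N\<close> acquires once \<open>X0\<close> is
  known: subtracting it cancels \<open>\<rho>\<close>, because
  \<open>cov (R s) X0 = \<Gamma> s\<close> and \<open>K \<Gamma> = \<rho>'\<close>. The covariance
  of \<open>B\<close> is found by direct integration, using that a residual is orthogonal to earlier
  values of \<open>N\<close>. The last claim serves for vectors such as \<open>W t\<close>.\<close>

lemma decorrelated_noise:
 assumes Kc: "continuous_on {0..T} K" and K: "\<And>t. t \<in> {0..T} ==> K t ** \<Gamma> t = \<rho>' t"
 defines "B \<equiv> \<lambda>t z. N t z - prim (\<lambda>s. K s *v R s z) t"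
 shows "bm S T B" and "t \<in> {0..T} ==> cov (B t) X0 = 0"
  and "\<And>Q :: 'w => real^'q. sqint Q ==> (\<And>t. t \<in> {0..T} ==> cov (N t) Q = 0) ==> cov X0 Q = 0 ==> t \<in> {0..T} ==> cov (B t) Q = 0"
proof -
 note K1 = L1on_continuous[OF Kc]
 have gKR: "gproc T S (\<lambda>t z. prim (\<lambda>s. K s *v R s z) t)" by (rule gproc_prim[OF G T0 gR K1])
 have gB: "gproc T S B" unfolding B_def by (rule gproc_diff[OF G gN gKR])
 have cB: "cov (B t) Q = cov (N t) Q - prim (\<lambda>s. K s ** cov (R s) Q) t" if "sqint Q" "t \<in> {0..T}" for t and Q :: "'w => real^'k"
 proof -
  have "cov (B t) Q = cov (N t) Q - cov (\<lambda>z. prim (\<lambda>s. K s *v R s z) t) Q"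
   unfolding B_def by (rule cov_diff_left[OF sN[OF that(2)] gproc_sqint[OF G gKR that(2)] that(1)])
  then show ?thesis by (simp only: gproc_cov_prim(1)[OF G T0 gR K1 that])
 qed
 show "cov (B t) X0 = 0" if t: "t \<in> {0..T}" for t
 proof -
  have "prim (\<lambda>s. K s ** cov (R s) X0) t = prim \<rho>' t" by (rule prim_cong) (use t cov_R_X0 K in auto)
  then show ?thesis using cB[OF sX t] \<rho>[OF t] \<rho>_prim[OF t] by simp
 qed
 show "cov (B t) Q = 0" if Q: "sqint Q" and NQ: "\<And>t. t \<in> {0..T} ==> cov (N t) Q = 0" and XQ: "cov X0 Q = 0" and t: "t \<in> {0..T}"
  for Q :: "'w => real^'q"
 proof -
  have RQ: "cov (R s) Q = 0" if s: "s \<in> {0..T}" for s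
  proof -
   have "prim (\<lambda>u. p u ** cov (N u) Q) s = prim (\<lambda>u. 0) s" by (rule prim_cong) (use s NQ in \<open>auto simp: bb_mm.zero_right\<close>)
   then show ?thesis using cov_R[OF Q s] XQ NQ[OF s] by (simp add: bb_mm.zero_right)
  qed
  have "prim (\<lambda>u. K u ** cov (R u) Q) t = prim (\<lambda>u. 0) t" by (rule prim_cong) (use t RQ in \<open>auto simp: bb_mm.zero_right\<close>)
  then show ?thesis using cB[OF Q t] NQ[OF t] by simp
 qed
 define L where "L t = prim K t" for t
 have Lc: "continuous_on {0..T} L" unfolding L_def[abs_def] by (rule prim_continuous[OF K1])
 have Kr: "L1on T (\<lambda>s. K s ** transpose (\<rho> s))" "L1on T (\<lambda>s. L s ** transpose (\<rho>' s))"
  by (rule L1on_continuous, intro continuous_intros Kc \<rho>c Lc \<rho>'c)+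
 \<comment> \<open>Only times \<open>w < s\<close> contribute, since \<open>R w\<close> is
   orthogonal to \<open>N s\<close> for \<open>s \<le> w\<close>; the value therefore does not
   depend on \<open>t\<close>.\<close>
 have BN: "cov (B t) (N s) = s *\<^sub>R mat 1 - (L s ** transpose (\<rho> s) - prim (\<lambda>w. K w ** transpose (\<rho> w)) s)"
  if t: "t \<in> {0..T}" and s: "s \<in> {0..t}" for s t
 proof -
  have sT: "s \<in> {0..T}" "s \<le> T" using t s by auto
  have Kl: "L1on T (\<lambda>w. K w ** transpose (\<rho> s))" by (rule L1on_continuous) (intro continuous_intros Kc)
  have "prim (\<lambda>w. K w ** cov (R w) (N s)) t = prim (\<lambda>w. indicator {0..s} w *\<^sub>R (K w ** transpose (\<rho> s) - K w ** transpose (\<rho> w))) t"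
   by (rule prim_cong) (use t sT in \<open>auto simp: cov_R_N indicator_def bb_mm.diff_right bb_mm.zero_right min_def\<close>)
  also have "\<dots> = prim (\<lambda>w. K w ** transpose (\<rho> s) - K w ** transpose (\<rho> w)) s"
   using t s by (simp add: prim_indicator min_absorb2)
  also have "\<dots> = prim (\<lambda>w. K w ** transpose (\<rho> s)) s - prim (\<lambda>w. K w ** transpose (\<rho> w)) s" by (rule prim_diff[OF Kl Kr(1) sT(2)])
  also have "prim (\<lambda>w. K w ** transpose (\<rho> s)) s = L s ** transpose (\<rho> s)"
   unfolding L_def by (rule prim_bounded_linear(1)[OF bb_mm.bounded_linear_left K1 sT(2), symmetric])
  finally show ?thesis using cB[OF sN[OF sT(1)] t] bmD(2)[OF G bmN t sT(1)] s by (simp add: min_absorb2)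
 qed
 have BR: "cov (B t) (R u) = - (L u ** \<Gamma> u)" if t: "t \<in> {0..T}" and u: "u \<in> {0..t}" for u t
 proof -
  have uT: "u \<in> {0..T}" "u \<le> T" and tT: "t \<le> T" using t u by auto
  have a: "L1on T (\<lambda>w. K w ** \<Gamma> u)" by (rule L1on_continuous) (intro continuous_intros Kc)
  note r = L1on_continuous[OF \<rho>'c]
  have ai: "L1on T (\<lambda>w. indicator {0..u} w *\<^sub>R (K w ** \<Gamma> u - \<rho>' w))"
   by (rule L2on_L1on, rule L2on_indicator, rule L2on_continuous) (intro continuous_intros Kc \<rho>'c, simp)
  \<comment> \<open>For \<open>w \<ge> u\<close> the covariance is \<open>\<Gamma> w\<close>, so the
    product is \<open>\<rho>' w\<close>; for \<open>w \<le> u\<close> it is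
    \<open>\<Gamma> u\<close>, and the deviation is put under an indicator of
    \<open>[0,u]\<close>.\<close>
  have "K w ** cov (R w) (R u) = indicator {0..u} w *\<^sub>R (K w ** \<Gamma> u - \<rho>' w) + \<rho>' w" if w: "w \<in> {0..t}" for w
  proof (cases "w \<le> u")
   case True
   have wT: "w \<in> {0..T}" using w t by auto
   have "cov (R w) (R u) = transpose (cov (R u) (R w))" by (rule cov_transpose[OF sR[OF uT(1)] sR[OF wT], symmetric])
   then show ?thesis using True w by (simp add: cov_R_R[OF wT uT(1) True] \<Gamma>_sym[OF uT(1)])
  next
   case False
   have wT: "w \<in> {0..T}" using w t by auto
   then show ?thesis using False cov_R_R[OF uT(1) wT] K[OF wT] by simp
  qed
  then have "prim (\<lambda>w. K w ** cov (R w) (R u)) t = prim (\<lambda>w. indicator {0..u} w *\<^sub>R (K w ** \<Gamma> u - \<rho>' w) + \<rho>' w) t"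
   by (rule prim_cong)
  also have "\<dots> = prim (\<lambda>w. K w ** \<Gamma> u - \<rho>' w) u + prim \<rho>' t"
   using prim_add[OF ai r tT] t u by (simp add: prim_indicator min_absorb2)
  also have "prim (\<lambda>w. K w ** \<Gamma> u - \<rho>' w) u = L u ** \<Gamma> u - \<rho> u"
   unfolding L_def by (simp only: prim_diff[OF a r uT(2)] prim_bounded_linear(1)[OF bb_mm.bounded_linear_left K1 uT(2), symmetric] \<rho>_prim[OF uT(1)])
  finally have e: "prim (\<lambda>w. K w ** cov (R w) (R u)) t = L u ** \<Gamma> u - \<rho> u + \<rho> t" using \<rho>_prim[OF t] by simp
  have "cov (N t) (R u) = transpose (cov (R u) (N t))" by (rule cov_transpose[OF sR[OF uT(1)] sN[OF t], symmetric])
  also have "\<dots> = \<rho> t - \<rho> u" using cov_R_N[OF uT(1) t] u by (simp add: transpose_diff min_absorb1)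
  finally show ?thesis using cB[OF sR[OF uT(1)] t] e by simp
 qed
 have BB: "cov (B t) (B s) = s *\<^sub>R mat 1" if t: "t \<in> {0..T}" and s: "s \<in> {0..t}" for s t
 proof -
  have sT: "s \<in> {0..T}" "s \<le> T" using t s by auto
  note sB = gproc_sqint[OF G gB t]
  have Bs: "B s = (\<lambda>z. N s z - prim (\<lambda>s. K s *v R s z) s)" by (simp add: B_def)
  have "cov (B t) (B s) = cov (B t) (N s) - cov (B t) (\<lambda>z. prim (\<lambda>s. K s *v R s z) s)"
   unfolding Bs by (rule cov_diff_right[OF sB gproc_sqint[OF G gKR sT(1)] sN[OF sT(1)]])
  also have "cov (B t) (\<lambda>z. prim (\<lambda>s. K s *v R s z) s) = prim (\<lambda>u. cov (B t) (R u) ** transpose (K u)) s"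
   by (rule gproc_cov_prim_right[OF G T0 gR K1 sB sT(1)])
  also have "\<dots> = prim (\<lambda>u. - (L u ** transpose (\<rho>' u))) s"
  proof (rule prim_cong)
   fix u assume "u \<in> {0..s}"
   then have u: "u \<in> {0..t}" "u \<in> {0..T}" using s t by auto
   have "\<Gamma> u ** transpose (K u) = transpose (\<rho>' u)"
    using arg_cong[OF K[OF u(2)], of transpose] by (simp add: matrix_transpose_mul \<Gamma>_sym[OF u(2)])
   then show "cov (B t) (R u) ** transpose (K u) = - (L u ** transpose (\<rho>' u))"
    by (simp add: BR[OF t u(1)] bb_mm.minus_left matrix_mul_assoc[symmetric])
  qed
  also have "\<dots> = - prim (\<lambda>u. L u ** transpose (\<rho>' u)) s" by (simp add: set_lebesgue_integral_def)
  also have "cov (B t) (N s) = s *\<^sub>R mat 1 - (L s ** transpose (\<rho> s) - prim (\<lambda>w. K w ** transpose (\<rho> w)) s)" by (rule BN[OF t s])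
  \<comment> \<open>Integration by parts of \<open>L\<close> against \<open>\<rho>\<^sup>T\<close>:
    the two integrals are precisely the remaining corrections, so they cancel and only
    \<open>s\<close> times the identity is left.\<close>
  also have "L s ** transpose (\<rho> s) = prim (\<lambda>w. K w ** transpose (\<rho> w)) s + prim (\<lambda>w. L w ** transpose (\<rho>' w)) s"
  proof -
   have l: "L t = 0 + prim K t" for t by (simp add: L_def)
   have r: "transpose (\<rho> t) = 0 + prim (\<lambda>s. transpose (\<rho>' s)) t" if "t \<in> {0..T}" for t
    using prim_transpose[OF L1on_continuous[OF \<rho>'c], of t] that \<rho>_prim[OF that] by simp
   have "L s ** transpose (\<rho> s) = prim (\<lambda>w. K w ** transpose (\<rho> w) + L w ** transpose (\<rho>' w)) s"
    using ac_product(2)[OF bb_mm K1 L1on_transpose[OF L1on_continuous[OF \<rho>'c]] l r sT(1)] by (simp add: bb_mm.zero_right)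
   then show ?thesis by (simp only: prim_add[OF Kr sT(2)])
  qed
  finally show ?thesis by simp
 qed
 show "bm S T B"
  unfolding bm_def[OF G]
 proof (intro conjI ballI gB)
  fix s t assume s: "s \<in> {0..T}" and t: "t \<in> {0..T}"
  show "cov (B s) (B t) = min s t *\<^sub>R mat 1"
  proof (cases "t \<le> s")
   case True
   then show ?thesis using BB[OF s, of t] t by (simp add: min_absorb2)
  next
   case False
   then have "transpose (cov (B t) (B s)) = transpose (s *\<^sub>R mat 1)" using BB[OF t, of s] s by simp
   then show ?thesis using False by (simp add: cov_transpose[OF gproc_sqint[OF G gB t] gproc_sqint[OF G gB s]] transpose_scaleR)
  qed
 qed
qed

end

section \<open>The partially observed system\<close>

context prob_space
begin

text \<open>Independence of two families of events passes to the \<sigma>-algebras of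
  \<open>X\<close> and \<open>Y\<close> because preimages of Borel sets are stable under
  intersection; products then factorise.\<close>

lemma indep_set_product:
 assumes AB: "indep_set A B" and X: "\<And>C. C \<in> sets borel ==> X -` C \<inter> space M \<in> A" and Y: "\<And>C. C \<in> sets borel ==> Y -` C \<inter> space M \<in> B"
  and iX: "integrable M X" and iY: "integrable M (Y :: 'a => real)"
 shows "expectation (\<lambda>w. X w * Y w) = expectation X * expectation Y"
proof (rule indep_var_lebesgue_integral[OF _ iX iY])
 have rv: "random_variable borel X" "random_variable borel Y" using iX iY by auto
 have st: "Int_stable {V -` C \<inter> space M | C. C \<in> sets borel}" for V :: "'a => real"
 proof (rule Int_stableI)
  fix a b assume "a \<in> {V -` C \<inter> space M | C. C \<in> sets borel}" "b \<in> {V -` C \<inter> space M | C. C \<in> sets borel}"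
  then obtain C D where "C \<in> sets borel" "D \<in> sets borel" "a = V -` C \<inter> space M" "b = V -` D \<inter> space M" by auto
  then have "a \<inter> b = V -` (C \<inter> D) \<inter> space M" "C \<inter> D \<in> sets borel" by auto
  then show "a \<inter> b \<in> {V -` C \<inter> space M | C. C \<in> sets borel}" by blast
 qed
 have "indep_set {X -` C \<inter> space M | C. C \<in> sets borel} {Y -` C \<inter> space M | C. C \<in> sets borel}"
 proof (rule indep_setI)
  fix a b assume "a \<in> {X -` C \<inter> space M | C. C \<in> sets borel}" "b \<in> {Y -` C \<inter> space M | C. C \<in> sets borel}"
  then show "prob (a \<inter> b) = prob a * prob b" using X Y by (intro indep_setD[OF AB]) auto
 qed (use rv in \<open>auto intro: measurable_sets\<close>)
 then show "indep_var borel X borel Y" unfolding indep_var_eq using rv indep_set_sigma_sets[OF _ st st] by blast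
qed

lemma gaussian_rvD:
 assumes Y: "gaussian_rv M Y"
 shows "sqint Y" and "expectation Y = 0 ==> expectation (\<lambda>w. cos (Y w)) = exp (- ms Y / 2) \<and> expectation (\<lambda>w. sin (Y w)) = 0"
proof -
 let ?\<nu> = std_normal_distribution
 interpret \<nu>: real_distribution ?\<nu> by (rule real_dist_normal_dist)
 obtain a b where m [measurable]: "Y \<in> borel_measurable M" and d: "distr M borel Y = distr ?\<nu> borel (\<lambda>z. a + b * z)"
  using Y by (auto simp: gaussian_rv_def)
 have tr: "expectation (\<lambda>w. g (Y w)) = (LINT z|?\<nu>. g (a + b * z))" "integrable M (\<lambda>w. g (Y w)) = integrable ?\<nu> (\<lambda>z. g (a + b * z))"
  if [measurable]: "g \<in> borel_measurable borel" for g :: "real => real"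
 proof -
  have "expectation (\<lambda>w. g (Y w)) = integral\<^sup>L (distr M borel Y) g" by (rule integral_distr[symmetric]) measurable
  also have "\<dots> = (LINT z|?\<nu>. g (a + b * z))" unfolding d by (rule integral_distr) measurable
  finally show "expectation (\<lambda>w. g (Y w)) = (LINT z|?\<nu>. g (a + b * z))" .
  have "integrable M (\<lambda>w. g (Y w)) = integrable (distr M borel Y) g" by (rule integrable_distr_eq[symmetric]) measurable
  also have "\<dots> = integrable ?\<nu> (\<lambda>z. g (a + b * z))" unfolding d by (rule integrable_distr_eq) measurable
  finally show "integrable M (\<lambda>w. g (Y w)) = integrable ?\<nu> (\<lambda>z. g (a + b * z))" .
 qed
 have p1: "measure ?\<nu> UNIV = 1" using \<nu>.prob_space by simp
 note mom = integrable_std_normal_distribution_moment[of 1] integrable_std_normal_distribution_moment[of 2]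
 have z1: "(LINT z|?\<nu>. z) = 0" using integral_std_normal_distribution_moment_odd[of 1] by simp
 have z2: "(LINT z|?\<nu>. z\<^sup>2) = 1" using std_normal_distribution_even_moments(1)[of 1] by simp
 have p: "(a + b * z)\<^sup>2 = a\<^sup>2 + 2 * a * b * z + b\<^sup>2 * z\<^sup>2" for z by (simp add: power2_eq_square algebra_simps)
 have "integrable ?\<nu> (\<lambda>z. (a + b * z)\<^sup>2)" unfolding p using mom by simp
 then have "integrable M (\<lambda>w. (Y w)\<^sup>2)" using tr(2)[of "\<lambda>x. x\<^sup>2"] by simp
 then show "sqint Y" by (simp add: sqint_def)
 have EY: "expectation Y = a" using tr(1)[of "\<lambda>x. x"] mom z1 by (simp add: p1)
 have EY2: "ms Y = a\<^sup>2 + b\<^sup>2" unfolding ms_real using tr(1)[of "\<lambda>x. x\<^sup>2"] mom z1 z2 by (simp add: p p1)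
 assume "expectation Y = 0"
 then have a: "a = 0" using EY by simp
 have ch: "(CLINT z|?\<nu>. iexp (b * z)) = complex_of_real (exp (- (b\<^sup>2) / 2))"
  using fun_cong[OF char_std_normal_distribution, of b] by (simp add: char_def)
 have I: "complex_integrable ?\<nu> (\<lambda>z. iexp (b * z))" by (rule \<nu>.integrable_iexp) auto
 have "(LINT z|?\<nu>. cos (b * z)) = Re (CLINT z|?\<nu>. iexp (b * z))" "(LINT z|?\<nu>. sin (b * z)) = Im (CLINT z|?\<nu>. iexp (b * z))"
  using integral_Re[OF I] integral_Im[OF I] by (simp_all add: Re_exp Im_exp)
 then show "expectation (\<lambda>w. cos (Y w)) = exp (- ms Y / 2) \<and> expectation (\<lambda>w. sin (Y w)) = 0"
  unfolding ch using tr(1)[of cos] tr(1)[of sin] by (simp add: a EY2)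
qed

lemma gaussian_rv_AE: "gaussian_rv M Y ==> AE w in M. Y w = Y' w ==> Y' \<in> borel_measurable M ==> gaussian_rv M Y'"
 unfolding gaussian_rv_def using distr_cong_AE[of M M borel borel Y Y'] by auto

lemma standard_bmD:
 assumes N: "standard_brownian_motion M T (N :: real => 'a => real^'n)" and sN: "\<And>t. t \<in> {0..T} ==> sqint (N t)" and T: "0 \<le> T"
 shows "t \<in> {0..T} ==> expectation (\<lambda>w. N t w $ i) = 0"
  and "s \<in> {0..T} ==> t \<in> {0..T} ==> cov (N s) (N t) = min s t *\<^sub>R mat 1"
proof -
 have z: "0 \<in> {0..T}" using T by simp
 have N0: "AE w in M. N 0 w = 0" using N by (simp add: standard_brownian_motion_def)
 have inc: "expectation (\<lambda>w. (N t w - N s w) $ i) = 0" "expectation (\<lambda>w. (N t w - N s w) $ i * (N t w - N s w) $ j) = (if i = j then t - s else 0)"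
  "expectation (\<lambda>w. N s w $ i * (N t w - N s w) $ j) = 0"
  if st: "0 \<le> s" "s < t" "t \<le> T" for s t i j
 proof -
  define D where "D i w = (N t w - N s w) $ i" for i w
  have sT: "s \<in> {0..T}" "t \<in> {0..T}" using st by auto
  have d: "distributed M lborel (D i) (normal_density 0 (sqrt (t - s)))" and iv: "indep_vars (\<lambda>_. borel) D UNIV"
   and ind: "indep_set (sets (generated_sigma M N {0..s})) {(\<lambda>w. N t w - N s w) -` A \<inter> space M | A. A \<in> sets borel}" for i
   using N st unfolding standard_brownian_motion_def D_def by auto
  have sq: "sqint (D i)" for i unfolding D_def by (rule sqint_component[OF sqint_diff[OF sN[OF sT(2)] sN[OF sT(1)]]])
  have p: "0 < sqrt (t - s)" using st by simp
  have E0: "expectation (D i) = 0" for i by (rule normal_distributed_expectation[OF p d])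
  from this[of i] show "expectation (\<lambda>w. (N t w - N s w) $ i) = 0" unfolding D_def[abs_def] .
  have "expectation (\<lambda>w. D i w * D j w) = (if i = j then t - s else 0)"
  proof (cases "i = j")
   case True
   then show ?thesis using normal_distributed_variance[OF p d, of i] E0[of i] st by (simp add: power2_eq_square)
  next
   case False
   have "expectation (\<lambda>w. \<Prod>i\<in>{i, j}. D i w) = (\<Prod>i\<in>{i, j}. expectation (D i))"
    by (rule indep_vars_lebesgue_integral[OF _ indep_vars_subset[OF iv]]) (use sqint_integrable[OF sq] in auto)
   then show ?thesis using False E0 by simp
  qed
  then show "expectation (\<lambda>w. (N t w - N s w) $ i * (N t w - N s w) $ j) = (if i = j then t - s else 0)" by (simp add: D_def)
  have "expectation (\<lambda>w. N s w $ i * D j w) = expectation (\<lambda>w. N s w $ i) * expectation (D j)"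
  proof (rule indep_set_product[OF ind])
   fix C :: "real set" assume C: "C \<in> sets borel"
   have c: "(\<lambda>x :: real^'n. x $ i) -` C \<inter> space borel \<in> sets borel" for i by (rule measurable_sets[OF _ C]) measurable
   show "(\<lambda>w. N s w $ i) -` C \<inter> space M \<in> sets (generated_sigma M N {0..s})"
    unfolding generated_sigma_def using c[of i] st
    by (auto simp: sets_measure_of_conv vimage_def intro!: sigma_sets.Basic exI[of _ s] exI[of _ "{x. x $ i \<in> C}"])
   show "D j -` C \<inter> space M \<in> {(\<lambda>w. N t w - N s w) -` A \<inter> space M | A. A \<in> sets borel}"
    using c[of j] by (auto simp: D_def vimage_def intro!: exI[of _ "{x. x $ j \<in> C}"])
  qed (use sqint_integrable[OF sqint_component[OF sN[OF sT(1)]]] sqint_integrable[OF sq] in auto)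
  then show "expectation (\<lambda>w. N s w $ i * (N t w - N s w) $ j) = 0" using E0 by (simp add: D_def)
 qed
 have aeN: "AE w in M. N t w - N 0 w = N t w" for t using N0 by eventually_elim simp
 have mm: "N t \<in> borel_measurable M" if "t \<in> {0..T}" for t by (rule sqintD[OF sN[OF that]])
 show "expectation (\<lambda>w. N t w $ i) = 0" if t: "t \<in> {0..T}" for t i
 proof (cases "t = 0")
  case True
  have "expectation (\<lambda>w. N 0 w $ i) = expectation (\<lambda>_. 0)"
   by (rule integral_cong_AE) (use N0 mm[OF z] in auto)
  then show ?thesis using True by simp
 next
  case False
  have "expectation (\<lambda>w. N t w $ i) = expectation (\<lambda>w. (N t w - N 0 w) $ i)"
   by (rule integral_cong_AE) (use aeN[of t] mm[OF z] mm[OF t] in \<open>auto elim: eventually_mono\<close>)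
  then show ?thesis using inc(1)[of 0 t i] False t by simp
 qed
 have var: "cov (N t) (N t) = t *\<^sub>R mat 1" if t: "t \<in> {0..T}" for t
 proof (cases "t = 0")
  case True
  have "cov (N 0) (N 0) = cov (\<lambda>_. 0 :: real^'n) (\<lambda>_. 0 :: real^'n)" by (rule cov_AE[OF N0 N0]) (use sN[OF z] in auto)
  also have "\<dots> = 0" by (simp add: cov_def vec_eq_iff outer_def zero_vec_def)
  finally show ?thesis using True by simp
 next
  case False
  define D where "D w = N t w - N 0 w" for w
  have D: "sqint D" unfolding D_def[abs_def] by (rule sqint_diff[OF sN[OF t] sN[OF z]])
  have "cov (N t) (N t) = cov D D"
   by (rule cov_AE) (use aeN[of t] D sN[OF t] in \<open>auto simp: D_def elim: eventually_mono\<close>)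
  also have "\<dots> = t *\<^sub>R mat 1"
   unfolding vec_eq_iff using inc(2)[of 0 t] False t by (simp add: cov_component[OF D D] D_def mat_def)
  finally show ?thesis .
 qed
 have le: "cov (N s) (N t) = s *\<^sub>R mat 1" if st: "s \<in> {0..T}" "t \<in> {0..T}" "s \<le> t" for s t
 proof (cases "s = t")
  case False
  have D: "sqint (\<lambda>w. N t w - N s w)" by (rule sqint_diff[OF sN[OF st(2)] sN[OF st(1)]])
  have "cov (N s) (\<lambda>w. N t w - N s w) = 0"
   unfolding vec_eq_iff using inc(3)[of s t] False st by (simp add: cov_component[OF sN[OF st(1)] D])
  then have "cov (N s) (N t) = cov (N s) (N s)"
   by (simp add: cov_diff_right[OF sN[OF st(1)] sN[OF st(1)] sN[OF st(2)]])
  then show ?thesis using var[OF st(1)] by simp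
 qed (use var[OF st(1)] in simp)
 show "cov (N s) (N t) = min s t *\<^sub>R mat 1" if s: "s \<in> {0..T}" and t: "t \<in> {0..T}" for s t
 proof (cases "s \<le> t")
  case True
  then show ?thesis using le[OF s t] by (simp add: min_absorb1)
 next
  case False
  then have "transpose (cov (N t) (N s)) = transpose (t *\<^sub>R mat 1)" using le[OF t s] by simp
  then show ?thesis using False by (simp add: cov_transpose[OF sN[OF t] sN[OF s]] transpose_scaleR)
 qed
qed

lemma jointly_gaussian_sqint:
 assumes JG: "jointly_gaussian M T X0 W N"
 shows "sqint X0" "t \<in> {0..T} ==> sqint (W t)" "t \<in> {0..T} ==> sqint (N t)"
proof -
 have g: "finite F ==> F \<subseteq> {0..T} ==> gaussian_rv M (\<lambda>z. u \<bullet> X0 z + (\<Sum>t\<in>F. v t \<bullet> W t z + w t \<bullet> N t z))" for F u v w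
  using JG by (auto simp: jointly_gaussian_def)
 show "sqint X0" by (rule sqint_vecI) (use gaussian_rvD(1)[OF g[of "{}" "axis _ 1"]] in \<open>simp add: inner_axis'\<close>)
 assume t: "t \<in> {0..T}"
 show "sqint (W t)"
  by (rule sqint_vecI) (use t gaussian_rvD(1)[OF g[of "{t}" 0 "\<lambda>_. axis _ 1" "\<lambda>_. 0"]] in \<open>simp add: inner_axis'\<close>)
 show "sqint (N t)"
  by (rule sqint_vecI) (use t gaussian_rvD(1)[OF g[of "{t}" 0 "\<lambda>_. 0" "\<lambda>_. axis _ 1"]] in \<open>simp add: inner_axis'\<close>)
qed

text \<open>The family is built from modified variables, while the Gaussian hypothesis concerns the
  original ones; both agree off one null set, and almost surely equal variables have the same
  law.\<close>

lemma gaussian_familyI: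
 fixes X0 X0' :: "'a => real^'m" and W W' :: "real => 'a => real^'l" and N N' :: "real => 'a => real^'n"
 assumes JG: "jointly_gaussian M T X0 W N"
  and mean: "\<And>i. expectation (\<lambda>z. X0 z $ i) = 0" "\<And>t i. t \<in> {0..T} ==> expectation (\<lambda>z. W t z $ i) = 0"
   "\<And>t i. t \<in> {0..T} ==> expectation (\<lambda>z. N t z $ i) = 0"
  and ae: "AE z in M. X0' z = X0 z \<and> (\<forall>t\<in>{0..T}. W' t z = W t z \<and> N' t z = N t z)"
  and m: "X0' \<in> borel_measurable M" "\<And>t. t \<in> {0..T} ==> W' t \<in> borel_measurable M" "\<And>t. t \<in> {0..T} ==> N' t \<in> borel_measurable M"
 defines "S \<equiv> {Y. (\<exists>i. Y = (\<lambda>z. X0' z $ i)) \<or> (\<exists>t\<in>{0..T}. (\<exists>i. Y = (\<lambda>z. W' t z $ i)) \<or> (\<exists>i. Y = (\<lambda>z. N' t z $ i)))}"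
 shows "gaussian_family S"
proof -
 note js = jointly_gaussian_sqint[OF JG]
 have s': "sqint X0'" "\<And>t. t \<in> {0..T} ==> sqint (W' t)" "\<And>t. t \<in> {0..T} ==> sqint (N' t)"
  by (rule sqint_AE[OF js(1) _ m(1)] sqint_AE[OF js(2) _ m(2)] sqint_AE[OF js(3) _ m(3)]; use ae in \<open>auto elim: eventually_mono\<close>)+
 have mean': "expectation (\<lambda>z. X0' z $ i) = 0" "t \<in> {0..T} ==> expectation (\<lambda>z. W' t z $ j) = 0" "t \<in> {0..T} ==> expectation (\<lambda>z. N' t z $ k) = 0" for i j k t
 proof -
  have "expectation (\<lambda>z. X0' z $ i) = expectation (\<lambda>z. X0 z $ i)"
   by (rule integral_cong_AE) (use ae m(1) sqintD[OF js(1)] in \<open>auto elim: eventually_mono\<close>)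
  then show "expectation (\<lambda>z. X0' z $ i) = 0" by (simp add: mean)
  assume t: "t \<in> {0..T}"
  have "expectation (\<lambda>z. W' t z $ j) = expectation (\<lambda>z. W t z $ j)"
   by (rule integral_cong_AE) (use t ae m(2)[OF t] sqintD[OF js(2)[OF t]] in \<open>auto elim: eventually_mono\<close>)
  then show "expectation (\<lambda>z. W' t z $ j) = 0" by (simp add: mean(2)[OF t])
  have "expectation (\<lambda>z. N' t z $ k) = expectation (\<lambda>z. N t z $ k)"
   by (rule integral_cong_AE) (use t ae m(3)[OF t] sqintD[OF js(3)[OF t]] in \<open>auto elim: eventually_mono\<close>)
  then show "expectation (\<lambda>z. N' t z $ k) = 0" by (simp add: mean(3)[OF t])
 qed
 have S: "sqint Y \<and> expectation Y = 0" if "Y \<in> S" for Y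
  using that s' mean' unfolding S_def by (auto intro: sqint_component)
 \<comment> \<open>Normal form of a linear combination. The coefficients vanish outside
   \<open>F\<close>, so \<open>F\<close> can be enlarged by a new time without changing the sum and
   without distinguishing whether that time already occurs.\<close>
 have L: "\<exists>F u v w. finite F \<and> F \<subseteq> {0..T} \<and> (\<forall>t. t \<notin> F \<longrightarrow> v t = 0 \<and> w t = 0) \<and>
   Y = (\<lambda>z. u \<bullet> X0' z + (\<Sum>t\<in>F. v t \<bullet> W' t z + w t \<bullet> N' t z))" if "Y \<in> lin S" for Y
  using that
 proof induction
  case zero
  show ?case by (intro exI[of _ "{}"] exI[of _ 0] exI[of _ "\<lambda>_. 0"]) simp
 next
  case (add X Y a)
  then obtain F u v w where F: "finite F" "F \<subseteq> {0..T}" "\<And>t. t \<notin> F ==> v t = 0 \<and> w t = 0"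
   and Y: "Y = (\<lambda>z. u \<bullet> X0' z + (\<Sum>t\<in>F. v t \<bullet> W' t z + w t \<bullet> N' t z))" by blast
  have ins: "(\<Sum>s\<in>F. v s \<bullet> W' s z + w s \<bullet> N' s z) = (\<Sum>s\<in>insert t F. v s \<bullet> W' s z + w s \<bullet> N' s z)" for t z
   by (rule sum.mono_neutral_left) (use F in auto)
  have del: "(\<Sum>s\<in>insert t F. if s = t then c else 0) = (c :: real)" for t c using F(1) by simp
  from add(1) consider i where "X = (\<lambda>z. X0' z $ i)" | t i where "t \<in> {0..T}" "X = (\<lambda>z. W' t z $ i)"
   | t i where "t \<in> {0..T}" "X = (\<lambda>z. N' t z $ i)" unfolding S_def by blast
  then show ?case
  proof cases
   case 1
   show ?thesis
    by (rule exI[of _ F], rule exI[of _ "u + a *\<^sub>R axis i 1"], rule exI[of _ v], rule exI[of _ w])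
     (use F in \<open>simp add: 1 Y inner_add_left inner_axis' algebra_simps\<close>)
  next
   case (2 t i)
   have x: "(v s + (if s = t then a *\<^sub>R axis i 1 else 0)) \<bullet> W' s z + w s \<bullet> N' s z
     = (v s \<bullet> W' s z + w s \<bullet> N' s z) + (if s = t then a * W' t z $ i else 0)" for s z
    by (simp add: inner_add_left inner_axis')
   have y: "(\<Sum>s\<in>insert t F. (v s + (if s = t then a *\<^sub>R axis i 1 else 0)) \<bullet> W' s z + w s \<bullet> N' s z) = (\<Sum>s\<in>F. v s \<bullet> W' s z + w s \<bullet> N' s z) + a * W' t z $ i" for z
    unfolding x sum.distrib[of "\<lambda>s. v s \<bullet> W' s z + w s \<bullet> N' s z"] del ins[of z t] ..
   show ?thesis
    by (intro exI[of _ "insert t F"] exI[of _ u] exI[of _ "\<lambda>s. v s + (if s = t then a *\<^sub>R axis i 1 else 0)"] exI[of _ w])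
     (use F 2(1) in \<open>simp add: 2(2) Y y del: sum.insert, simp add: add_ac\<close>)
  next
   case (3 t i)
   have x: "v s \<bullet> W' s z + (w s + (if s = t then a *\<^sub>R axis i 1 else 0)) \<bullet> N' s z
     = (v s \<bullet> W' s z + w s \<bullet> N' s z) + (if s = t then a * N' t z $ i else 0)" for s z
    by (simp add: inner_add_left inner_axis')
   have y: "(\<Sum>s\<in>insert t F. v s \<bullet> W' s z + (w s + (if s = t then a *\<^sub>R axis i 1 else 0)) \<bullet> N' s z) = (\<Sum>s\<in>F. v s \<bullet> W' s z + w s \<bullet> N' s z) + a * N' t z $ i" for z
    unfolding x sum.distrib[of "\<lambda>s. v s \<bullet> W' s z + w s \<bullet> N' s z"] del ins[of z t] ..
   show ?thesis
    by (intro exI[of _ "insert t F"] exI[of _ u] exI[of _ v] exI[of _ "\<lambda>s. w s + (if s = t then a *\<^sub>R axis i 1 else 0)"])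
     (use F 3(1) in \<open>simp add: 3(2) Y y del: sum.insert, simp add: add_ac\<close>)
  qed
 qed
 show ?thesis
  unfolding gaussian_family_def
 proof (intro conjI ballI)
  fix Y assume Y: "Y \<in> lin S"
  show E: "expectation Y = 0"
   using Y
  proof induction
   case (add X Y a)
   have "integrable M X" "integrable M Y"
    using S add(1) lin_sqint[OF add(2)] by (auto intro!: sqint_integrable)
   then show ?case using S[OF add(1)] add.IH by simp
  qed simp
  obtain F u v w where F: "finite F" "F \<subseteq> {0..T}"
   and Ye: "Y = (\<lambda>z. u \<bullet> X0' z + (\<Sum>t\<in>F. v t \<bullet> W' t z + w t \<bullet> N' t z))" using L[OF Y] by blast
  have "gaussian_rv M (\<lambda>z. u \<bullet> X0 z + (\<Sum>t\<in>F. v t \<bullet> W t z + w t \<bullet> N t z))" using JG F by (simp add: jointly_gaussian_def)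
  then have "gaussian_rv M Y"
  proof (rule gaussian_rv_AE)
   show "AE z in M. u \<bullet> X0 z + (\<Sum>t\<in>F. v t \<bullet> W t z + w t \<bullet> N t z) = Y z"
    using ae
   proof eventually_elim
    case (elim z)
    then show ?case unfolding Ye using F(2) by (auto intro!: sum.cong)
   qed
   show "Y \<in> borel_measurable M" by (rule sqintD[OF lin_sqint[OF Y]]) (use S in blast)
  qed
  from gaussian_rvD(2)[OF this E]
  show "expectation (\<lambda>z. cos (Y z)) = exp (- ms Y / 2)" "expectation (\<lambda>z. sin (Y z)) = 0" by auto
 qed (use S in blast)
qed

end

section \<open>Block vectors and block matrices\<close>

lemma sum_blocks: "(\<Sum>i\<in>UNIV. f i) = (\<Sum>i\<in>UNIV. f (Inl i)) + ((\<Sum>i\<in>UNIV. f (Inr (Inl i))) + (\<Sum>i\<in>UNIV. f (Inr (Inr i))))"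
 for f :: "'a::finite + 'b::finite + 'c::finite => 'd::comm_monoid_add"
proof -
 have p: "sum g UNIV = (\<Sum>i\<in>UNIV. g (Inl i)) + (\<Sum>i\<in>UNIV. g (Inr i))" for g :: "'x::finite + 'y::finite => 'd"
  using sum.Plus[of "UNIV :: 'x set" "UNIV :: 'y set" g] by simp
 show ?thesis by (simp only: p)
qed

lemma vstack3_nth [simp]: "vstack3 x y z $ Inl i = x $ i" "vstack3 x y z $ Inr (Inl j) = y $ j" "vstack3 x y z $ Inr (Inr k) = z $ k"
 by (simp_all add: vstack3_def)

lemma hstack3_nth [simp]: "hstack3 A B C $ i = vstack3 (A $ i) (B $ i) (C $ i)"
 by (simp add: hstack3_def)

lemma forall_blocks: "(\<forall>i. P i) \<longleftrightarrow> (\<forall>i. P (Inl i)) \<and> (\<forall>i. P (Inr (Inl i))) \<and> (\<forall>i. P (Inr (Inr i)))"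
 by (metis sum.exhaust)

text \<open>The three coordinate embeddings. Writing every block object as a sum of products with
  them reduces block calculations to matrix algebra with the relations
  \<open>blk_ortho\<close>.\<close>

definition blk1 :: "real^'m::finite^('m + 'k::finite + 'n::finite)" where "blk1 = vstack3 (mat 1) 0 0"
definition blk2 :: "real^'k::finite^('m::finite + 'k + 'n::finite)" where "blk2 = vstack3 0 (mat 1) 0"
definition blk3 :: "real^'n::finite^('m::finite + 'k::finite + 'n)" where "blk3 = vstack3 0 0 (mat 1)"

lemmas blk_defs = blk1_def blk2_def blk3_def

lemma vstack3_blocks:
 fixes A :: "real^'q^'m" and B :: "real^'q^'k" and C :: "real^'q^'n"
 shows "vstack3 A B C = blk1 ** A + blk2 ** B + blk3 ** C"
 unfolding vec_eq_iff forall_blocks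
 by (simp add: blk_defs matrix_matrix_mult_def mat_def if_distrib[of "\<lambda>x. x * _"] cong: if_cong)

lemma vstack3_blocks_vec:
 fixes x :: "real^'m" and y :: "real^'k" and z :: "real^'n"
 shows "vstack3 x y z = blk1 *v x + blk2 *v y + blk3 *v z"
 unfolding vec_eq_iff forall_blocks
 by (simp add: blk_defs matrix_vector_mult_def mat_def if_distrib[of "\<lambda>x. x * _"] cong: if_cong)

lemma hstack3_blocks:
 fixes A :: "real^'m^'r" and B :: "real^'k^'r" and C :: "real^'n^'r"
 shows "hstack3 A B C = A ** transpose blk1 + B ** transpose blk2 + C ** transpose blk3"
 unfolding vec_eq_iff forall_blocks
 by (simp add: blk_defs matrix_matrix_mult_def mat_def transpose_def if_distrib[of "\<lambda>x. _ * x"] cong: if_cong)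

lemma blk_ortho [simp]:
 "transpose blk1 ** blk1 = (mat 1 :: real^'m^'m)" "transpose blk2 ** blk2 = (mat 1 :: real^'k^'k)" "transpose blk3 ** blk3 = (mat 1 :: real^'n^'n)"
 "transpose blk1 ** blk2 = (0 :: real^'k^'m)" "transpose blk1 ** blk3 = (0 :: real^'n^'m)" "transpose blk2 ** blk1 = (0 :: real^'m^'k)"
 "transpose blk2 ** blk3 = (0 :: real^'n^'k)" "transpose blk3 ** blk1 = (0 :: real^'m^'n)" "transpose blk3 ** blk2 = (0 :: real^'k^'n)"
 by (simp_all add: vec_eq_iff matrix_matrix_mult_def sum_blocks blk_defs mat_def transpose_def
   if_distrib[of "\<lambda>x. x * _"] if_distrib[of "\<lambda>x. _ * x"] cong: if_cong)

lemma blk_mv [simp]: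
 "transpose blk1 *v (blk1 *v x) = (x :: real^'m)" "transpose blk2 *v (blk2 *v y) = (y :: real^'k)" "transpose blk3 *v (blk3 *v z) = (z :: real^'n)"
 "transpose blk1 *v (blk2 *v y) = (0 :: real^'m)" "transpose blk1 *v (blk3 *v z) = (0 :: real^'m)" "transpose blk2 *v (blk1 *v x) = (0 :: real^'k)"
 "transpose blk2 *v (blk3 *v z) = (0 :: real^'k)" "transpose blk3 *v (blk1 *v x) = (0 :: real^'n)" "transpose blk3 *v (blk2 *v y) = (0 :: real^'n)"
 by (simp_all add: matrix_vector_mul_assoc)

lemmas mv_simps = matrix_vector_mul_assoc[symmetric] bb_mv.add_left bb_mv.add_right bb_mv.diff_left bb_mv.diff_right
 bb_mv.minus_left bb_mv.minus_right bb_mv.zero_left bb_mv.zero_right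

section \<open>Versions of processes and their conditional moments\<close>

lemma set_borel_measurable_restrict:
 "set_borel_measurable lborel {0..T} (f :: real => 'b::euclidean_space) \<longleftrightarrow> f \<in> borel_measurable (restrict_space borel {0..T})"
 unfolding set_borel_measurable_def by (subst borel_measurable_restrict_space_iff) auto

lemma AE_prim_cong:
 assumes ae: "AE s in lborel. s \<in> {0..T} \<longrightarrow> f s = (g s :: 'b::euclidean_space)" and t: "t \<le> T"
  and f: "set_borel_measurable lborel {0..T} f" and g: "L1on T g"
 shows "L1on T f" and "prim f t = prim g t"
proof -
 have e: "AE s in lborel. indicator {0..T} s *\<^sub>R f s = indicator {0..T} s *\<^sub>R g s" using ae by eventually_elim (auto simp: indicator_def)
 have m: "(\<lambda>s. indicator {0..T} s *\<^sub>R f s) \<in> borel_measurable lborel" using f by (simp add: set_borel_measurable_def)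
 show f1: "L1on T f" unfolding set_integrable_def
  using g integrable_cong_AE[OF m _ e] by (auto simp: set_integrable_def)
 show "prim f t = prim g t"
  unfolding set_lebesgue_integral_def
 proof (rule integral_cong_AE)
  show "AE s in lborel. indicator {0..t} s *\<^sub>R f s = indicator {0..t} s *\<^sub>R g s"
   using ae by eventually_elim (use t in \<open>auto simp: indicator_def\<close>)
 qed (use L1on_subset[OF f1 t] L1on_subset[OF g t] in \<open>auto simp: set_integrable_def\<close>)
qed

context prob_space
begin

lemma cproc_jointly_measurable:
 assumes T: "0 \<le> T" and Y: "cproc T Y"
 shows "jointly_measurable M T Y"
proof -
 have "(\<lambda>x. Y (clampT T (fst x)) (snd x)) \<in> borel_measurable (restrict_space borel {0..T} \<Otimes>\<^sub>M M)"
 proof (rule measurable_compose[where g="\<lambda>(t, w). Y (clampT T t) w" and N="borel \<Otimes>\<^sub>M M" and f="\<lambda>x. (fst x, snd x)", simplified split_beta' fst_conv snd_conv])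
  show "(\<lambda>x. (fst x, snd x)) \<in> restrict_space borel {0..T} \<Otimes>\<^sub>M M \<rightarrow>\<^sub>M borel \<Otimes>\<^sub>M M"
   by (intro measurable_Pair measurable_snd measurable_compose[OF measurable_fst] measurable_restrict_space1 measurable_ident_sets refl)
  show "(\<lambda>x. Y (clampT T (fst x)) (snd x)) \<in> borel_measurable (borel \<Otimes>\<^sub>M M)" using cproc_joint[OF T Y] by (simp add: split_beta')
 qed
 then show ?thesis
  unfolding jointly_measurable_def
  by (subst measurable_cong[where g="\<lambda>x. Y (clampT T (fst x)) (snd x)"])
    (auto simp: space_pair_measure space_restrict_space clampT_def)
qed

text \<open>Fubini exchanges the quantifiers: equality almost surely at each time becomes, for
  almost every outcome, equality at almost every time, which is all that time integrals see.\<close>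

lemma jointly_measurable_AE:
 fixes Y V :: "real => 'a => 'b::euclidean_space"
 assumes T: "0 \<le> T" and Y: "jointly_measurable M T Y" and V: "jointly_measurable M T V"
  and ae: "\<And>t. t \<in> {0..T} ==> AE w in M. Y t w = V t w"
 shows "AE w in M. AE s in lborel. s \<in> {0..T} \<longrightarrow> Y s w = V s w"
  and "w \<in> space M ==> set_borel_measurable lborel {0..T} (\<lambda>s. Y s w)"
proof -
 let ?R = "restrict_space borel {0..T}"
 interpret P: pair_sigma_finite lborel M ..
 have c: "(\<lambda>x. (clampT T (fst x), snd x)) \<in> lborel \<Otimes>\<^sub>M M \<rightarrow>\<^sub>M ?R \<Otimes>\<^sub>M M"
 proof (intro measurable_Pair measurable_snd measurable_compose[OF measurable_fst] measurable_restrict_space2)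
  show "clampT T \<in> borel_measurable lborel" using borel_measurable_continuous_onI[OF clampT_continuous] by simp
 qed (use clampT_in[OF T] in auto)
 have [measurable]: "(\<lambda>x. Y (clampT T (fst x)) (snd x)) \<in> borel_measurable (lborel \<Otimes>\<^sub>M M)"
  "(\<lambda>x. V (clampT T (fst x)) (snd x)) \<in> borel_measurable (lborel \<Otimes>\<^sub>M M)"
  using measurable_compose[OF c Y[unfolded jointly_measurable_def]] measurable_compose[OF c V[unfolded jointly_measurable_def]] by simp_all
 have "{x \<in> space (lborel \<Otimes>\<^sub>M M). Y (clampT T (fst x)) (snd x) = V (clampT T (fst x)) (snd x)}
   = {x \<in> space (lborel \<Otimes>\<^sub>M M). norm (Y (clampT T (fst x)) (snd x) - V (clampT T (fst x)) (snd x)) = 0}" by auto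
 also have "\<dots> \<in> sets (lborel \<Otimes>\<^sub>M M)" by measurable
 finally have "(AE s in lborel. AE w in M. Y (clampT T s) w = V (clampT T s) w) = (AE w in M. AE s in lborel. Y (clampT T s) w = V (clampT T s) w)"
  by (rule P.AE_commute)
 then have "AE w in M. AE s in lborel. Y (clampT T s) w = V (clampT T s) w"
  using ae[OF clampT_in[OF T]] by auto
 then show "AE w in M. AE s in lborel. s \<in> {0..T} \<longrightarrow> Y s w = V s w"
  by eventually_elim (auto simp: clampT_def elim!: eventually_mono)
 assume "w \<in> space M"
 then have "(\<lambda>s. (s, w)) \<in> ?R \<rightarrow>\<^sub>M ?R \<Otimes>\<^sub>M M" by (intro measurable_Pair measurable_ident_sets refl measurable_const)
 from measurable_compose[OF this Y[unfolded jointly_measurable_def]]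
 show "set_borel_measurable lborel {0..T} (\<lambda>s. Y s w)" by (simp add: set_borel_measurable_restrict)
qed

text \<open>Vectors and their coordinates generate the same \<sigma>-algebra; an equality of
  measures holds as both sides carry the zero measure.\<close>

lemma generated_sigma_eq_gen: "generated_sigma M (Z :: real => 'a => real^'n) {0..t} = gen (past Z t)"
proof -
 let ?A = "{Z s -` A \<inter> space M | s A. s \<in> {0..t} \<and> A \<in> sets borel}"
 let ?B = "{X -` B \<inter> space M | X B. X \<in> past Z t \<and> B \<in> sets borel}"
 have "sigma_sets (space M) ?A = sigma_sets (space M) ?B"
 proof (rule sigma_sets_eqI)
  fix a assume "a \<in> ?A"
  then obtain s A where s: "s \<in> {0..t}" "A \<in> sets borel" "a = Z s -` A \<inter> space M" by blast
  have "Z s \<in> borel_measurable (gen (past Z t))"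
   by (rule borel_measurable_vecI, rule gen_measurable) (use s in \<open>auto simp: past_def\<close>)
  from measurable_sets[OF this s(2)] show "a \<in> sigma_sets (space M) ?B" by (simp add: s(3) sets_gen)
 next
  fix b assume "b \<in> ?B"
  then obtain s j B where s: "s \<in> {0..t}" "B \<in> sets borel" "b = (\<lambda>w. Z s w $ j) -` B \<inter> space M" unfolding past_def by blast
  have "(\<lambda>x :: real^'n. x $ j) -` B \<inter> space borel \<in> sets borel" by (rule measurable_sets[OF _ s(2)]) measurable
  then have "{x. x $ j \<in> B} \<in> sets (borel :: (real^'n) measure)" by (simp add: vimage_def)
  then show "b \<in> sigma_sets (space M) ?A"
   using s by (intro sigma_sets.Basic) (auto simp: vimage_def intro!: exI[of _ s] exI[of _ "{x. x $ j \<in> B}"])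
 qed
 moreover have "?A \<subseteq> Pow (space M)" "?B \<subseteq> Pow (space M)" by auto
 ultimately show ?thesis unfolding generated_sigma_def gen_def by (intro measure_eqI) (simp_all add: emeasure_sigma)
qed

text \<open>Split \<open>U\<close> into \<open>V\<close>, which is almost surely measurable for the
  conditioning \<sigma>-algebra, and \<open>U - V\<close>, which is orthogonal to and hence
  independent of it. The conditioned vector \<open>U'\<close> may differ from \<open>U\<close> on a
  null set.\<close>

lemma conditional_moments:
 fixes U V :: "'a => real^'d"
 assumes G: "gaussian_family S" and U: "vspan S U" and V: "vspan S V" and Um: "U' \<in> borel_measurable M" and UU: "AE w in M. U' w = U w"
  and ZS: "ZZ \<subseteq> cspan S" and VZ: "vspan ZZ V" and o: "\<And>Z i. Z \<in> ZZ ==> expectation (\<lambda>w. Z w * (U w - V w) $ i) = 0"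
 shows "AE w in M. V w = cond_mean M (gen ZZ) U' w"
  and "AE w in M. cond_cov M (gen ZZ) U' w = cov (\<lambda>w. U w - V w) (\<lambda>w. U w - V w)"
proof -
 note S = gf_sqint[OF G]
 have zs: "Z \<in> ZZ ==> sqint Z" for Z using ZS cspan_sqint[OF S] by blast
 have sub: "subalgebra M (gen ZZ)" by (rule subalgebra_gen) (rule sqintD[OF zs])
 interpret F: sigma_finite_subalgebra M "gen ZZ" by (rule finite_measure_subalgebraI[OF sub])
 define e where "e w = U w - V w" for w
 have e: "vspan S e" unfolding e_def[abs_def] by (rule vspan_diff[OF S U V])
 note se = gv_sqint[OF G e] and sV = gv_sqint[OF G V] and sU = gv_sqint[OF G U]
 have ec: "(\<lambda>w. e w $ i) \<in> cspan S" for i using e by (simp add: vspan_def)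
 have oe: "expectation (\<lambda>w. Z w * e w $ i) = 0" if "Z \<in> ZZ" for Z i using o[OF that] by (simp add: e_def)
 have c1: "AE w in M. V w $ i = cond_mean M (gen ZZ) U' w $ i" for i
 proof -
  have 1: "AE w in M. real_cond_exp M (gen ZZ) (\<lambda>w. V w $ i) w = V w $ i"
   by (rule cspan_cond_exp[OF zs]) (use VZ in \<open>auto simp: vspan_def\<close>)
  have 2: "AE w in M. real_cond_exp M (gen ZZ) (\<lambda>w. e w $ i) w = 0" by (rule gf_orth_past(1)[OF G ec ZS oe])
  have 3: "AE w in M. real_cond_exp M (gen ZZ) (\<lambda>w. V w $ i + e w $ i) w
    = real_cond_exp M (gen ZZ) (\<lambda>w. V w $ i) w + real_cond_exp M (gen ZZ) (\<lambda>w. e w $ i) w"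
   by (rule F.real_cond_exp_add) (use sqint_integrable[OF sqint_component[OF sV]] sqint_integrable[OF sqint_component[OF se]] in auto)
  have 4: "AE w in M. real_cond_exp M (gen ZZ) (\<lambda>w. U' w $ i) w = real_cond_exp M (gen ZZ) (\<lambda>w. V w $ i + e w $ i) w"
  proof (rule F.real_cond_exp_cong)
   show "AE w in M. U' w $ i = V w $ i + e w $ i" using UU by eventually_elim (simp add: e_def)
  qed (use Um sqintD[OF sV] sqintD[OF se] in measurable)
  show ?thesis using 1 2 3 4 by eventually_elim (simp add: cond_mean_def)
 qed
 then have "AE w in M. \<forall>i. V w $ i = cond_mean M (gen ZZ) U' w $ i" by (subst AE_all_countable) simp
 then show cm: "AE w in M. V w = cond_mean M (gen ZZ) U' w" by eventually_elim (simp add: vec_eq_iff)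
 have cmm: "(\<lambda>w. cond_mean M (gen ZZ) U' w $ i) \<in> borel_measurable M" for i
  unfolding cond_mean_def by (simp add: borel_measurable_cond_exp2)
 have "AE w in M. cond_cov M (gen ZZ) U' w $ i $ j = cov e e $ i $ j" for i j
 proof -
  have 1: "AE w in M. real_cond_exp M (gen ZZ) (\<lambda>w. e w $ i * e w $ j) w = expectation (\<lambda>w. e w $ i * e w $ j)"
   by (rule gf_cov_cond_exp[OF G ec ec ZS oe oe])
  have 2: "AE w in M. real_cond_exp M (gen ZZ) (\<lambda>w. (U' w $ i - cond_mean M (gen ZZ) U' w $ i) * (U' w $ j - cond_mean M (gen ZZ) U' w $ j)) w
    = real_cond_exp M (gen ZZ) (\<lambda>w. e w $ i * e w $ j) w"
  proof (rule F.real_cond_exp_cong)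
   show "AE w in M. (U' w $ i - cond_mean M (gen ZZ) U' w $ i) * (U' w $ j - cond_mean M (gen ZZ) U' w $ j) = e w $ i * e w $ j"
    using cm UU by eventually_elim (simp add: e_def)
   show "(\<lambda>w. (U' w $ i - cond_mean M (gen ZZ) U' w $ i) * (U' w $ j - cond_mean M (gen ZZ) U' w $ j)) \<in> borel_measurable M"
    using Um cmm by measurable
  qed (use sqintD[OF se] in measurable)
  show ?thesis using 1 2 by eventually_elim (simp add: cond_cov_def cov_component[OF se se])
 qed
 then have "AE w in M. \<forall>i j. cond_cov M (gen ZZ) U' w $ i $ j = cov e e $ i $ j" by (subst AE_all_countable, intro allI, subst AE_all_countable) simp
 then show "AE w in M. cond_cov M (gen ZZ) U' w = cov (\<lambda>w. U w - V w) (\<lambda>w. U w - V w)"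
  by eventually_elim (simp add: vec_eq_iff e_def[abs_def])
qed

end

section \<open>The augmented system and its regular version\<close>

locale filtering = correlated_initial M S T X0 N \<rho> \<rho>' \<rho>''
 for M :: "'w measure" and S T and X0 :: "'w => real^'m" and N :: "real => 'w => real^'n" and \<rho> \<rho>' \<rho>'' +
 fixes W :: "real => 'w => real^'l" and X :: "real => 'w => real^'m" and Z :: "real => 'w => real^'n"
  and a :: "real => real^'m^'m" and \<sigma>0 :: "real^'l^'m" and h g' :: "real => real^'m^'n" and r :: "real => real^'n^'n"
 assumes bmW: "bm S T W" and NW: "\<And>s t. s \<in> {0..T} ==> t \<in> {0..T} ==> cov (N s) (W t) = 0"
  and XW: "\<And>t. t \<in> {0..T} ==> cov X0 (W t) = 0"
  and a1: "L1on T a" and h2: "L2on T h" and Xc: "\<And>w. w \<in> space M ==> continuous_on {0..T} (\<lambda>t. X t w)"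
  and X_eq: "\<And>w t. w \<in> space M ==> t \<in> {0..T} ==> X t w = X0 w + prim (\<lambda>s. a s *v X s w) t + \<sigma>0 *v W t w"
  and Z_eq: "\<And>w t. w \<in> space M ==> t \<in> {0..T} ==> Z t w = prim (\<lambda>s. h s *v X s w) t + N t w"
  and W_0: "\<And>w. w \<in> space M ==> W 0 w = 0" and N_0: "\<And>w. w \<in> space M ==> N 0 w = 0"
  and g_eq: "\<And>t. t \<in> {0..T} ==> g' t ** \<Gamma> t = \<rho>' t" and rc: "continuous_on {0..T} r"
  and r_eq: "\<And>t. t \<in> {0..T} ==> r t = - (g' t ** transpose (\<rho>' t))"
begin

lemma regular_gain:
 obtains E where "transpose E = E" "cov X0 X0 ** E = 0" "\<And>t. t \<in> {0..T} ==> \<rho>' t ** E = 0"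
  "continuous_on {0..T} (\<lambda>t. g' t ** (mat 1 - E))" "\<And>t. t \<in> {0..T} ==> (g' t ** (mat 1 - E)) ** \<Gamma> t = \<rho>' t"
proof (rule gain_regular[OF T0 cov_transpose[OF sX sX] \<rho>'c rc \<Gamma>_def \<Gamma>_psd g_eq r_eq], goal_cases)
 case (4 E)
 show ?case by (rule 4(1)[OF 4(2-6)])
qed

text \<open>\<open>X\<close> is given only as a solution of its equation. Path by path,
  \<open>fundamental_mv\<close> identifies it with an explicit functional of \<open>X0\<close> and
  \<open>W\<close>, which is a Gaussian process.\<close>

lemma gX: "gproc T S X"
proof -
 obtain \<Phi> \<Psi> where F: "fundamental T a \<Phi> \<Psi>" by (rule fundamental_exists[OF a1])
 note Fs = fundamentalD[OF F]
 define L where "L t z = X0 z + \<sigma>0 *v W t z" for t z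
 have gL: "gproc T S L"
  unfolding L_def[abs_def] by (rule gproc_add[OF G gproc_const[OF G vX0] gproc_mv[OF G bmD(1)[OF G bmW] continuous_on_const]])
 have \<Psi>a: "L1on T (\<lambda>s. \<Psi> s ** a s)" by (rule L1on_bilinear2[OF bb_mm a1 Fs(2)])
 define Y where "Y t z = L t z + \<Phi> t *v prim (\<lambda>s. (\<Psi> s ** a s) *v L s z) t" for t z
 have gY: "gproc T S Y"
  unfolding Y_def[abs_def] by (rule gproc_add[OF G gL gproc_mv[OF G gproc_prim[OF G T0 gL \<Psi>a] Fs(1)]])
 have XY: "X t z = Y t z" if w: "z \<in> space M" and t: "t \<in> {0..T}" for t z
  unfolding Y_def
  by (rule fundamental_mv(1)[OF F a1 gproc_path[OF gL w] Xc[OF w] _ t]) (simp add: X_eq[OF w] L_def)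
 have "X t \<in> borel_measurable M" if t: "t \<in> {0..T}" for t
  using cprocD(1)[OF gprocD(1)[OF gY] t] by (subst measurable_cong[OF XY[OF _ t]])
 moreover from this have "vspan S (X t)" if t: "t \<in> {0..T}" for t
  using vspan_AE[OF gf_sqint[OF G] gprocD(2)[OF gY t]] XY[OF _ t] t by (auto intro: AE_I2)
 ultimately show ?thesis unfolding gproc_def cproc_def using Xc by blast
qed

lemma gZ: "gproc T S Z"
proof -
 have gY: "gproc T S (\<lambda>t z. prim (\<lambda>s. h s *v X s z) t + N t z)" (is "gproc T S ?Y")
  by (rule gproc_add[OF G gproc_prim[OF G T0 gX L2on_L1on[OF h2]] gN])
 have "Z t \<in> borel_measurable M" if t: "t \<in> {0..T}" for t
  using cprocD(1)[OF gprocD(1)[OF gY] t] by (subst measurable_cong[OF Z_eq[OF _ t]])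
 moreover from this have "vspan S (Z t)" if t: "t \<in> {0..T}" for t
  using vspan_AE[OF gf_sqint[OF G] gprocD(2)[OF gY t]] Z_eq[OF _ t] t by (auto intro: AE_I2)
 moreover have "continuous_on {0..T} (\<lambda>t. Z t z)" if w: "z \<in> space M" for z
  by (rule continuous_on_eq[OF gproc_path[OF gY w]]) (simp add: Z_eq[OF w])
 ultimately show ?thesis unfolding gproc_def cproc_def by blast
qed

definition U :: "real => 'w => real^('m + 'm + 'n)" where "U t w = vstack3 (X t w) (Xbar t w) (N t w)"
definition b :: "real => real^('m + 'm + 'n)^('m + 'm + 'n)" where
 "b t = vstack3 (hstack3 (a t) 0 0) (hstack3 0 0 (p t)) (hstack3 0 (g' t) (r t))"
definition k :: "real => real^('m + 'm + 'n)^'n" where "k t = hstack3 (h t) (g' t) (r t)"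

lemma U_blk: "U t w = blk1 *v X t w + blk2 *v Xbar t w + blk3 *v N t w"
 by (simp add: U_def vstack3_blocks_vec)

lemma gU: "gproc T S U"
 unfolding U_blk[abs_def]
 by (intro gproc_add[OF G] gproc_mv[OF G] gX gXbar gN continuous_on_const)

end

text \<open>The continuous \<open>K\<close> solves the same equation
  \<open>K \<Gamma> = \<rho>'\<close> as \<open>g'\<close> and yields the same \<open>r\<close>,
  since \<open>E \<rho>'\<^sup>T = 0\<close>; it can therefore replace \<open>g'\<close> in all
  integrals.\<close>

locale regular_filtering = filtering M S T X0 N \<rho> \<rho>' \<rho>'' W X Z a \<sigma>0 h g' r
 for M :: "'w measure" and S T and X0 :: "'w => real^'m" and N :: "real => 'w => real^'n" and \<rho> \<rho>' \<rho>''
  and W :: "real => 'w => real^'l" and X :: "real => 'w => real^'m" and Z :: "real => 'w => real^'n"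
  and a :: "real => real^'m^'m" and \<sigma>0 :: "real^'l^'m" and h g' :: "real => real^'m^'n" and r :: "real => real^'n^'n" +
 fixes E :: "real^'m^'m" and K :: "real => real^'m^'n"
 assumes E_sym: "transpose E = E" and cov_E: "cov X0 X0 ** E = 0" and \<rho>'E: "\<And>t. t \<in> {0..T} ==> \<rho>' t ** E = 0"
  and K_def: "K = (\<lambda>t. g' t ** (mat 1 - E))"
  and Kc: "continuous_on {0..T} K" and K_eq: "\<And>t. t \<in> {0..T} ==> K t ** \<Gamma> t = \<rho>' t"
begin

lemma E\<rho>': "t \<in> {0..T} ==> E ** transpose (\<rho>' t) = 0"
 using arg_cong[OF \<rho>'E, of t transpose] by (simp add: matrix_transpose_mul E_sym transpose_zero)

lemma K_split: "g' t = K t + g' t ** E"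
 by (simp add: K_def mm_simps)

lemma r_K: "t \<in> {0..T} ==> r t = - (K t ** transpose (\<rho>' t))"
 by (simp add: r_eq K_def mm_simps matrix_mul_assoc[symmetric] E\<rho>')

lemma K_R: "t \<in> {0..T} ==> K t *v R t w = K t *v Xbar t w + r t *v N t w"
 by (simp add: R_def r_K mv_simps)

definition B :: "real => 'w => real^'n" where "B = (\<lambda>t w. N t w - prim (\<lambda>s. K s *v R s w) t)"
definition b' :: "real => real^('m + 'm + 'n)^('m + 'm + 'n)" where
 "b' t = blk1 ** a t ** transpose blk1 + blk2 ** p t ** transpose blk3 + blk3 ** K t ** transpose blk2 + blk3 ** r t ** transpose blk3"
definition k' :: "real => real^('m + 'm + 'n)^'n" where
 "k' t = h t ** transpose blk1 + K t ** transpose blk2 + r t ** transpose blk3"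
text \<open>Applied to the augmented state this reads off \<open>E Xbar\<close>; the coefficients
  \<open>b\<close> and \<open>k\<close> differ from \<open>b'\<close> and \<open>k'\<close> only by
  multiples of it.\<close>

definition EE :: "real^('m + 'm + 'n)^'m" where "EE = E ** transpose blk2"

lemma noise: "bm S T B" "t \<in> {0..T} ==> cov (B t) X0 = 0"
 "sqint Q ==> (\<And>t. t \<in> {0..T} ==> cov (N t) Q = 0) ==> cov X0 Q = 0 ==> t \<in> {0..T} ==> cov (B t) Q = 0"
 for Q :: "'w => real^'q"
 unfolding B_def by (rule decorrelated_noise[OF Kc K_eq]; assumption)+

lemma b_split: "b t = b' t + blk3 ** g' t ** EE"
proof -
 have "b t = blk1 ** a t ** transpose blk1 + blk2 ** p t ** transpose blk3 + blk3 ** g' t ** transpose blk2 + blk3 ** r t ** transpose blk3"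
  by (simp add: b_def vstack3_blocks hstack3_blocks mm_simps add.assoc)
 also have "blk3 ** g' t ** transpose blk2 = blk3 ** K t ** transpose blk2 + blk3 ** g' t ** EE"
  by (subst K_split) (simp only: mm_simps EE_def)
 finally show ?thesis by (simp add: b'_def)
qed

lemma k_split: "k t = k' t + g' t ** EE"
proof -
 have "k t = h t ** transpose blk1 + g' t ** transpose blk2 + r t ** transpose blk3" by (simp add: k_def hstack3_blocks)
 also have "g' t ** transpose blk2 = K t ** transpose blk2 + g' t ** EE"
  by (subst K_split) (simp only: mm_simps EE_def)
 finally show ?thesis by (simp add: k'_def)
qed

lemma L1c: "L1on T f ==> L1on T (\<lambda>s. (A :: real^'i^'j) ** f s ** (C :: real^'o^'q))"
 by (rule L1on_bilinear[OF bb_mm L1on_bilinear2[OF bb_mm _ continuous_on_const] continuous_on_const])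

lemma b'1: "L1on T b'"
 unfolding b'_def[abs_def]
 by (intro set_integral_add(1) L1c a1 p1 L1on_continuous[OF Kc] L1on_continuous[OF rc])

lemma k'2: "L2on T k'"
 unfolding k'_def[abs_def]
 by (intro L2on_add L2on_mult_continuous[OF bb_mm h2 continuous_on_const] L2on_continuous continuous_intros Kc rc)

lemma zero_in: "0 \<in> {0..T}" using T0 by simp

text \<open>\<open>K Xbar + r N = K R\<close> is the drift that separates \<open>N\<close> from
  \<open>B\<close>; inserting it closes the system, with \<open>B\<close> as the noise of both the
  third block and the observation.\<close>

lemma aug_eq:
 assumes w: "z \<in> space M" and t: "t \<in> {0..T}"
 shows "U t z = U 0 z + prim (\<lambda>s. b' s *v U s z) t + (blk1 ** \<sigma>0) *v W t z + blk3 *v B t z"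
  and "Z t z = prim (\<lambda>s. k' s *v U s z) t + B t z"
proof -
 have tT: "t \<le> T" using t by simp
 have i: "L1on T (\<lambda>s. a s *v X s z)" "L1on T (\<lambda>s. p s *v N s z)" "L1on T (\<lambda>s. K s *v R s z)" "L1on T (\<lambda>s. h s *v X s z)"
  by (rule L1on_bilinear[OF bb_mv a1 Xc[OF w]] L1on_bilinear[OF bb_mv p1 gproc_path[OF gN w]]
    L1on_bilinear[OF bb_mv L1on_continuous[OF Kc] gproc_path[OF gR w]] L1on_bilinear[OF bb_mv L2on_L1on[OF h2] Xc[OF w]])+
 have i1: "L1on T (\<lambda>s. blk1 *v (a s *v X s z) :: real^('m + 'm + 'n))" "L1on T (\<lambda>s. blk2 *v (p s *v N s z) :: real^('m + 'm + 'n))"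
   "L1on T (\<lambda>s. blk3 *v (K s *v R s z) :: real^('m + 'm + 'n))"
  by (rule prim_bounded_linear(2)[OF bb_mv.bounded_linear_right i(1) order_refl] prim_bounded_linear(2)[OF bb_mv.bounded_linear_right i(2) order_refl]
    prim_bounded_linear(2)[OF bb_mv.bounded_linear_right i(3) order_refl])+
 have "prim (\<lambda>s. b' s *v U s z) t = prim (\<lambda>s. blk1 *v (a s *v X s z) + blk2 *v (p s *v N s z) + blk3 *v (K s *v R s z)) t"
  by (rule prim_cong) (use t in \<open>simp add: b'_def U_blk mv_simps K_R del: transpose_matrix_vector\<close>)
 also have "\<dots> = prim (\<lambda>s. blk1 *v (a s *v X s z)) t + prim (\<lambda>s. blk2 *v (p s *v N s z)) t + prim (\<lambda>s. blk3 *v (K s *v R s z)) t"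
  unfolding prim_add[OF set_integral_add(1)[OF i1(1,2)] i1(3) tT] prim_add[OF i1(1,2) tT] ..
 also have "\<dots> = blk1 *v prim (\<lambda>s. a s *v X s z) t + blk2 *v prim (\<lambda>s. p s *v N s z) t + blk3 *v prim (\<lambda>s. K s *v R s z) t"
  by (simp only: prim_bounded_linear(1)[OF bb_mv.bounded_linear_right i(1) tT] prim_bounded_linear(1)[OF bb_mv.bounded_linear_right i(2) tT]
    prim_bounded_linear(1)[OF bb_mv.bounded_linear_right i(3) tT])
 finally have e: "prim (\<lambda>s. b' s *v U s z) t = blk1 *v prim (\<lambda>s. a s *v X s z) t + blk2 *v prim (\<lambda>s. p s *v N s z) t + blk3 *v prim (\<lambda>s. K s *v R s z) t" .
 have U0: "U 0 z = blk1 *v X0 z + blk2 *v X0 z"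
  using X_eq[OF w zero_in] by (simp add: U_blk Xbar_def W_0[OF w] N_0[OF w] bb_mv.zero_right)
 show "U t z = U 0 z + prim (\<lambda>s. b' s *v U s z) t + (blk1 ** \<sigma>0) *v W t z + blk3 *v B t z"
  unfolding e U0 unfolding U_blk X_eq[OF w t] Xbar_def B_def by (simp add: mv_simps algebra_simps)
 have "prim (\<lambda>s. k' s *v U s z) t = prim (\<lambda>s. h s *v X s z + K s *v R s z) t"
  by (rule prim_cong) (use t in \<open>simp add: k'_def U_blk mv_simps K_R del: transpose_matrix_vector\<close>)
 also have "\<dots> = prim (\<lambda>s. h s *v X s z) t + prim (\<lambda>s. K s *v R s z) t" by (rule prim_add[OF i(4,3) tT])
 finally show "Z t z = prim (\<lambda>s. k' s *v U s z) t + B t z" using Z_eq[OF w t] by (simp add: B_def)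
qed

lemma cov_U0:
 fixes Q :: "'w => real^'q"
 assumes Q: "sqint Q" and X0Q: "cov X0 Q = 0"
 shows "cov (U 0) Q = 0"
proof -
 have "cov (U 0) Q = cov (\<lambda>z. (blk1 + blk2) *v X0 z) Q"
 proof (rule cov_cong[OF _ refl])
  fix z assume w: "z \<in> space M"
  show "U 0 z = (blk1 + blk2) *v X0 z"
   using X_eq[OF w zero_in] by (simp add: U_blk Xbar_def W_0[OF w] N_0[OF w] mv_simps)
 qed
 also have "\<dots> = 0" by (simp only: cov_mv_left[OF sX Q] X0Q bb_mm.zero_right)
 finally show ?thesis .
qed

sublocale aug: linear_system M S T U Z B W b' k' "blk1 ** \<sigma>0" blk3
proof unfold_locales
 note sW = gproc_sqint[OF G bmD(1)[OF G bmW]] and sB = gproc_sqint[OF G bmD(1)[OF G noise(1)]] and sU = gproc_sqint[OF G gU zero_in]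
 have flip: "cov V Q = 0" if "cov Q V = 0" "sqint V" "sqint Q" for V :: "'w => real^'i" and Q :: "'w => real^'j"
  using cov_transpose[OF that(3,2)] that(1) by (simp add: transpose_zero)
 fix s t assume s: "s \<in> {0..T}" and t: "t \<in> {0..T}"
 have "cov (B t) (W s) = 0" by (rule noise(3)[OF sW[OF s] NW[OF _ s] XW[OF s] t])
 then show "cov (W s) (B t) = 0" by (rule flip[OF _ sW[OF s] sB[OF t]])
next
 note sW = gproc_sqint[OF G bmD(1)[OF G bmW]] and sB = gproc_sqint[OF G bmD(1)[OF G noise(1)]] and sU = gproc_sqint[OF G gU zero_in]
 fix t assume t: "t \<in> {0..T}"
 have "transpose (cov (U 0) (W t)) = 0" by (simp add: cov_U0[OF sW[OF t] XW[OF t]] transpose_zero)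
 then show "cov (W t) (U 0) = 0" by (simp add: cov_transpose[OF sU sW[OF t]])
 have "cov X0 (B t) = 0" using cov_transpose[OF sB[OF t] sX] noise(2)[OF t] by (simp add: transpose_zero)
 then have "transpose (cov (U 0) (B t)) = 0" by (simp add: cov_U0[OF sB[OF t]] transpose_zero)
 then show "cov (B t) (U 0) = 0" by (simp add: cov_transpose[OF sU sB[OF t]])
qed (fact G T gU gZ bmW noise(1) b'1 k'2 aug_eq)+

text \<open>Differentiate the constant function \<open>\<rho>' E = 0\<close>; one-sided derivatives
  at the ends of the interval are still unique because \<open>T > 0\<close>.\<close>

lemma E_\<rho>'': assumes s: "s \<in> {0..T}" shows "E ** transpose (\<rho>'' s) = 0"
proof -
 have "((\<lambda>t. \<rho>' t ** E) has_vector_derivative \<rho>'' s ** E) (at s within {0..T})"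
  by (rule bounded_linear.has_vector_derivative[OF bb_mm.bounded_linear_left \<rho>2[OF s]])
 moreover have "((\<lambda>t. \<rho>' t ** E) has_vector_derivative 0) (at s within {0..T})"
  by (rule has_vector_derivative_transform[OF s _ has_vector_derivative_const]) (use \<rho>'E in auto)
 ultimately have "\<rho>'' s ** E = 0"
  using T s by (intro vector_derivative_unique_within_closed_interval[of 0 T s]) (auto simp: cbox_interval)
 from arg_cong[OF this, of transpose] show ?thesis by (simp add: matrix_transpose_mul E_sym transpose_zero)
qed

text \<open>\<open>E X0\<close> has zero second moment since \<open>cov X0 X0 ** E = 0\<close>, and
  the integral part of \<open>Xbar\<close> is killed by \<open>E p = 0\<close>.\<close>

lemma EE_U: assumes t: "t \<in> {0..T}" shows "AE w in M. EE *v U t w = 0"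
proof -
 have EX: "sqint (\<lambda>w. E *v X0 w)" by (rule sqint_mv[OF sX])
 have "cov (\<lambda>w. E *v X0 w) (\<lambda>w. E *v X0 w) = E ** (cov X0 X0 ** transpose E)"
  by (simp only: cov_mv_left[OF sX EX] cov_mv_right[OF sX sX])
 then have "ms (\<lambda>w. E *v X0 w) = 0" by (simp add: ms_trace[OF EX] E_sym cov_E bb_mm.zero_right trace_def)
 from ms_zero_AE[OF EX this] AE_space show ?thesis
 proof eventually_elim
  case (elim w)
  have "EE *v U t w = E *v Xbar t w" by (simp add: EE_def U_blk mv_simps del: transpose_matrix_vector)
  also have "\<dots> = E *v prim (\<lambda>s. p s *v N s w) t" using elim(1) by (simp add: Xbar_def mv_simps)
  also have "\<dots> = prim (\<lambda>s. E *v (p s *v N s w)) t"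
   by (rule prim_bounded_linear(1)[OF bb_mv.bounded_linear_right L1on_bilinear[OF bb_mv p1 gproc_path[OF gN elim(2)]]]) (use t in simp)
  also have "\<dots> = prim (\<lambda>s. 0) t"
   by (rule prim_cong) (use t in \<open>simp add: p_def matrix_vector_mul_assoc E_\<rho>'' bb_mv.zero_left del: transpose_matrix_vector\<close>)
  finally show ?case by simp
 qed
qed

end

text \<open>This is where completeness enters: the exceptional part of a preimage lies in a null
  set, hence is measurable.\<close>

lemma (in complete_measure) borel_measurable_AE:
 fixes f g :: "'a => 'b::topological_space"
 assumes f: "f \<in> borel_measurable M" and ae: "AE w in M. f w = g w"
 shows "g \<in> borel_measurable M"
proof (rule measurableI)
 obtain A where A: "\<And>w. w \<in> space M - A ==> f w = g w" "A \<in> null_sets M" using AE_E3[OF ae] by blast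
 fix C :: "'b set" assume "C \<in> sets borel"
 then have m: "f -` C \<inter> space M \<in> sets M" by (rule measurable_sets[OF f])
 have "g -` C \<inter> space M = (f -` C \<inter> space M - A) \<union> (g -` C \<inter> space M \<inter> A)" using A(1) by auto
 moreover have "g -` C \<inter> space M \<inter> A \<in> sets M" by (rule complete[OF _ A(2)]) auto
 moreover have "f -` C \<inter> space M - A \<in> sets M" by (rule sets.Diff[OF m null_setsD2[OF A(2)]])
 ultimately show "g -` C \<inter> space M \<in> sets M" by (metis sets.Un)
qed simp

theorem theorem4p1:
  fixes M :: "'w measure" and T :: real
    and X :: "real \<Rightarrow> 'w \<Rightarrow> real ^ 'm::finite"
    and Z N :: "real \<Rightarrow> 'w \<Rightarrow> real ^ 'n::finite"
    and W :: "real \<Rightarrow> 'w \<Rightarrow> real ^ 'l::finite"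
    and a :: "real \<Rightarrow> real ^ 'm ^ 'm"
    and \<sigma>0 :: "real ^ 'l ^ 'm"
    and h :: "real \<Rightarrow> real ^ 'm ^ 'n"
    and \<Sigma>0 :: "real ^ 'm ^ 'm"
    and \<rho> \<rho>' \<rho>'' g g' :: "real \<Rightarrow> real ^ 'm ^ 'n"
    and p :: "real \<Rightarrow> real ^ 'n ^ 'm"
    and q r :: "real \<Rightarrow> real ^ 'n ^ 'n"
    and Xbar :: "real \<Rightarrow> 'w \<Rightarrow> real ^ 'm"
    and U :: "real \<Rightarrow> 'w \<Rightarrow> real ^ ('m + 'm + 'n)"
    and b :: "real \<Rightarrow> real ^ ('m + 'm + 'n) ^ ('m + 'm + 'n)"
    and \<sigma> :: "real ^ 'l ^ ('m + 'm + 'n)"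
    and c :: "real ^ 'n ^ ('m + 'm + 'n)"
    and k :: "real \<Rightarrow> real ^ ('m + 'm + 'n) ^ 'n"
    and FZ :: "real \<Rightarrow> 'w measure"
  assumes prob: "prob_space M" and complete: "complete_measure M" and T_pos: "0 < T"
    \<comment> \<open>the driving noises and the initial condition\<close>
    and W_bm: "standard_brownian_motion M T W"
    and N_bm: "standard_brownian_motion M T N"
    and gaussian: "jointly_gaussian M T (X 0) W N"
    and X0_mean: "\<And>i. prob_space.expectation M (\<lambda>\<omega>. X 0 \<omega> $ i) = 0"
    and X0_cov: "\<And>i j. prob_space.expectation M (\<lambda>\<omega>. X 0 \<omega> $ i * X 0 \<omega> $ j) = \<Sigma>0 $ i $ j"
    and W_indep: "prob_space.indep_set M (sets (generated_sigma M W {0..T}))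
                    (sets (generated_sigma M (\<lambda>t \<omega>. (X 0 \<omega>, N t \<omega>)) {0..T}))"
    and \<rho>_eq: "\<And>t i j. t \<in> {0..T} \<Longrightarrow>
                 \<rho> t $ i $ j = prob_space.expectation M (\<lambda>\<omega>. N t \<omega> $ i * X 0 \<omega> $ j)"
    and \<rho>_C1: "\<And>t. t \<in> {0..T} \<Longrightarrow> (\<rho> has_vector_derivative \<rho>' t) (at t within {0..T})"
    and \<rho>_C2: "\<And>t. t \<in> {0..T} \<Longrightarrow> (\<rho>' has_vector_derivative \<rho>'' t) (at t within {0..T})"
    and \<rho>''_cont: "continuous_on {0..T} \<rho>''"
    \<comment> \<open>the function g and the coefficients built from it\<close>
    and g_cont: "continuous_on {0..T} g" and g_0: "g 0 = 0"
    and g_deriv: "\<And>t. t \<in> {0..T} \<Longrightarrow> (g has_vector_derivative g' t) (at t within {0..T})"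
    and g_eq: "\<And>t. t \<in> {0..T} \<Longrightarrow>
                 g' t ** (\<Sigma>0 - (LINT u:{0..t}|lborel. transpose (\<rho>' u) ** \<rho>' u)) = \<rho>' t"
    and p_def: "p = (\<lambda>s. transpose (\<rho>'' s))"
    and q_def: "q = (\<lambda>s. - (g s ** transpose (\<rho>'' s)) - g' s ** transpose (\<rho>' s))"
    and p_cont: "continuous_on {0..T} p" and q_cont: "continuous_on {0..T} q"
    and r_def: "r = (\<lambda>t. g t ** p t + q t)"
    \<comment> \<open>the linear system\<close>
    and a_L1: "set_integrable lborel {0..T} a"
    and h_meas: "set_borel_measurable lborel {0..T} h"
    and h_L2: "set_integrable lborel {0..T} (\<lambda>s. (norm (h s))\<^sup>2)"
    and X_meas: "\<And>t. t \<in> {0..T} \<Longrightarrow> X t \<in> borel_measurable M"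
    and Z_meas: "\<And>t. t \<in> {0..T} \<Longrightarrow> Z t \<in> borel_measurable M"
    and aX_int: "AE \<omega> in M. set_integrable lborel {0..T} (\<lambda>s. a s *v X s \<omega>)"
    and X_eq: "AE \<omega> in M. \<forall>t\<in>{0..T}.
                 X t \<omega> = X 0 \<omega> + (LINT s:{0..t}|lborel. a s *v X s \<omega>) + \<sigma>0 *v W t \<omega>"
    and Z_eq: "AE \<omega> in M. \<forall>t\<in>{0..T}.
                 Z t \<omega> = (LINT s:{0..t}|lborel. h s *v X s \<omega>) + N t \<omega>"
    \<comment> \<open>the augmented system\<close>
    and Xbar_def: "Xbar = (\<lambda>t \<omega>. X 0 \<omega> + (LINT s:{0..t}|lborel. p s *v N s \<omega>))"
    and U_def: "U = (\<lambda>t \<omega>. vstack3 (X t \<omega>) (Xbar t \<omega>) (N t \<omega>))"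
    and b_def: "b = (\<lambda>t. vstack3 (hstack3 (a t) 0 0)
                                 (hstack3 0 0 (p t))
                                 (hstack3 0 (g' t) (r t)))"
    and \<sigma>_def: "\<sigma> = vstack3 \<sigma>0 0 0"
    and c_def: "c = vstack3 0 0 (mat 1)"
    and k_def: "k = (\<lambda>t. hstack3 (h t) (g' t) (r t))"
    and FZ_def: "FZ = (\<lambda>t. generated_sigma M Z {0..t})"
  shows "\<exists>P :: real \<Rightarrow> real ^ ('m + 'm + 'n) ^ ('m + 'm + 'n).
    \<comment> \<open>the conditional covariance is deterministic, given by P\<close>
    (\<forall>t\<in>{0..T}. AE \<omega> in M. cond_cov M (FZ t) (U t) \<omega> = P t) \<and>
    \<comment> \<open>(i) the filter equation, for every version of the conditional mean\<close>
    (\<exists>Uh. cond_mean_version M T FZ U Uh \<and>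
          (AE \<omega> in M. continuous_on {0..T} (\<lambda>t. Uh t \<omega>))) \<and>
    (\<forall>Uh \<nu>. cond_mean_version M T FZ U Uh \<and>
            \<nu> = (\<lambda>t \<omega>. Z t \<omega> - (LINT s:{0..t}|lborel. k s *v Uh s \<omega>)) \<longrightarrow>
       (AE \<omega> in M. set_integrable lborel {0..T} (\<lambda>s. b s *v Uh s \<omega>)) \<and>
       (AE \<omega> in M. set_integrable lborel {0..T} (\<lambda>s. k s *v Uh s \<omega>)) \<and>
       (\<exists>J. has_ito_integral M T FZ \<nu> (\<lambda>s \<omega>. c + P s ** transpose (k s)) J \<and>
            (\<forall>t\<in>{0..T}. AE \<omega> in M.
               Uh t \<omega> = Uh 0 \<omega> + (LINT s:{0..t}|lborel. b s *v Uh s \<omega>) + J t \<omega>))) \<and>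
    \<comment> \<open>(ii) the Riccati equation: P is absolutely continuous and solves it almost everywhere,
        and classically wherever a and h are continuous\<close>
    (let A = c ** transpose c + \<sigma> ** transpose \<sigma>;
         R = (\<lambda>t. P t ** transpose (b t) + b t ** P t + A
                    - (c + P t ** transpose (k t)) ** transpose (c + P t ** transpose (k t)))
     in set_integrable lborel {0..T} R \<and>
        (\<forall>t\<in>{0..T}. P t = P 0 + (LINT s:{0..t}|lborel. R s)) \<and>
        (AE t in lborel. t \<in> {0..T} \<longrightarrow> (P has_vector_derivative R t) (at t within {0..T})) \<and>
        (\<forall>t\<in>{0..T}. continuous (at t within {0..T}) a \<and> continuous (at t within {0..T}) h \<longrightarrow>
             (P has_vector_derivative R t) (at t within {0..T})))"
proof -
 interpret prob_space M by (rule prob)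
 have T0: "0 \<le> T" and z: "0 \<in> {0..T}" using T_pos by auto

 \<comment> \<open>Moments of the driving noises\<close>
 note js = jointly_gaussian_sqint[OF gaussian]
 have Nm: "expectation (\<lambda>w. N t w $ i) = 0" if "t \<in> {0..T}" for t i by (rule standard_bmD(1)[OF N_bm js(3) T0 that])
 have Wm: "expectation (\<lambda>w. W t w $ i) = 0" if "t \<in> {0..T}" for t i by (rule standard_bmD(1)[OF W_bm js(2) T0 that])
 have Nc: "cov (N s) (N t) = min s t *\<^sub>R mat 1" if "s \<in> {0..T}" "t \<in> {0..T}" for s t by (rule standard_bmD(2)[OF N_bm js(3) T0 that])
 have Wc: "cov (W s) (W t) = min s t *\<^sub>R mat 1" if "s \<in> {0..T}" "t \<in> {0..T}" for s t by (rule standard_bmD(2)[OF W_bm js(2) T0 that])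

 \<comment> \<open>Modification of the processes off a null set\<close>
 have ae0: "AE w in M. W 0 w = 0" "AE w in M. N 0 w = 0" "AE w in M. continuous_on {0..T} (\<lambda>t. W t w)"
  "AE w in M. continuous_on {0..T} (\<lambda>t. N t w)"
  using W_bm N_bm unfolding standard_brownian_motion_def by blast+
 let ?good = "\<lambda>w. W 0 w = 0 \<and> N 0 w = 0 \<and> continuous_on {0..T} (\<lambda>t. W t w) \<and> continuous_on {0..T} (\<lambda>t. N t w)
   \<and> L1on T (\<lambda>s. a s *v X s w) \<and> (\<forall>t\<in>{0..T}. X t w = X 0 w + prim (\<lambda>s. a s *v X s w) t + \<sigma>0 *v W t w)
   \<and> (\<forall>t\<in>{0..T}. Z t w = prim (\<lambda>s. h s *v X s w) t + N t w)"
 from ae0 aX_int X_eq Z_eq have "AE w in M. ?good w" by eventually_elim blast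
 then obtain A where A: "\<And>w. w \<in> space M - A ==> ?good w" and A0: "A \<in> null_sets M"
  by (rule AE_E3) blast
 define \<Omega> where "\<Omega> = space M - A"
 have \<Omega>: "\<Omega> \<in> events" unfolding \<Omega>_def using A0 by auto
 have ae: "AE w in M. w \<in> \<Omega>" using AE_not_in[OF A0] AE_space by eventually_elim (simp add: \<Omega>_def)
 \<comment> \<open>Modifications for which path continuity and the equations hold for every \<open>w\<close>.\<close>
 define X' where "X' t w = (indicator \<Omega> w :: real) *\<^sub>R X t w" for t w
 define Z' where "Z' t w = (indicator \<Omega> w :: real) *\<^sub>R Z t w" for t w
 define N' where "N' t w = (indicator \<Omega> w :: real) *\<^sub>R N t w" for t w
 define W' where "W' t w = (indicator \<Omega> w :: real) *\<^sub>R W t w" for t w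
 have on: "X' t w = X t w" "Z' t w = Z t w" "N' t w = N t w" "W' t w = W t w" if "w \<in> \<Omega>" for t w
  using that by (simp_all add: X'_def Z'_def N'_def W'_def)
 have off: "X' t w = 0" "Z' t w = 0" "N' t w = 0" "W' t w = 0" if "w \<notin> \<Omega>" for t w
  using that by (simp_all add: X'_def Z'_def N'_def W'_def)
 have aeq: "AE w in M. X t w = X' t w" "AE w in M. Z t w = Z' t w" "AE w in M. N t w = N' t w" "AE w in M. W t w = W' t w" for t
  by (rule eventually_mono[OF ae]; simp add: on)+
 have good: "W 0 w = 0" "N 0 w = 0" "continuous_on {0..T} (\<lambda>t. W t w)" "continuous_on {0..T} (\<lambda>t. N t w)"
   "L1on T (\<lambda>s. a s *v X s w)" "t \<in> {0..T} ==> X t w = X 0 w + prim (\<lambda>s. a s *v X s w) t + \<sigma>0 *v W t w"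
   "t \<in> {0..T} ==> Z t w = prim (\<lambda>s. h s *v X s w) t + N t w" if "w \<in> \<Omega>" for t w
  using A[OF that[unfolded \<Omega>_def]] by blast+
 have m: "(\<lambda>w. (indicator \<Omega> w :: real) *\<^sub>R f w) \<in> borel_measurable M" if "f \<in> borel_measurable M" for f :: "'w => real^'q"
  by (rule borel_measurable_scaleR[OF borel_measurable_indicator[OF \<Omega>] that])
 have X'm: "X' t \<in> borel_measurable M" if "t \<in> {0..T}" for t unfolding X'_def[abs_def] by (rule m[OF X_meas[OF that]])
 have Z'm: "Z' t \<in> borel_measurable M" if "t \<in> {0..T}" for t unfolding Z'_def[abs_def] by (rule m[OF Z_meas[OF that]])
 have N'm: "N' t \<in> borel_measurable M" if "t \<in> {0..T}" for t unfolding N'_def[abs_def] by (rule m[OF sqintD[OF js(3)[OF that]]])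
 have W'm: "W' t \<in> borel_measurable M" if "t \<in> {0..T}" for t unfolding W'_def[abs_def] by (rule m[OF sqintD[OF js(2)[OF that]]])
 \<comment> \<open>Only the initial value and the noises generate the space; \<open>X\<close>,
   \<open>Z\<close> and the augmented state are shown to lie in its closed span afterwards.\<close>
 define S where "S = {Y. (\<exists>i. Y = (\<lambda>w. X' 0 w $ i)) \<or> (\<exists>t\<in>{0..T}. (\<exists>i. Y = (\<lambda>w. W' t w $ i)) \<or> (\<exists>i. Y = (\<lambda>w. N' t w $ i)))}"
 have G: "gaussian_family S"
 proof -
  have ae': "AE w in M. X' 0 w = X 0 w \<and> (\<forall>t\<in>{0..T}. W' t w = W t w \<and> N' t w = N t w)"
   using ae by eventually_elim (simp add: on)
  show ?thesis unfolding S_def by (rule gaussian_familyI[OF gaussian X0_mean Wm Nm ae' X'm[OF z] W'm N'm])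
 qed
 have base: "vspan S (X' 0)" "\<And>t. t \<in> {0..T} ==> vspan S (W' t)" "\<And>t. t \<in> {0..T} ==> vspan S (N' t)"
 proof -
  have S: "(\<lambda>w. X' 0 w $ i) \<in> S" "t \<in> {0..T} ==> (\<lambda>w. W' t w $ j) \<in> S" "t \<in> {0..T} ==> (\<lambda>w. N' t w $ q) \<in> S" for i j q t
   unfolding S_def by blast+
  then show "vspan S (X' 0)" "\<And>t. t \<in> {0..T} ==> vspan S (W' t)" "\<And>t. t \<in> {0..T} ==> vspan S (N' t)"
   unfolding vspan_def by (blast intro: cspan_base[OF gf_sqint[OF G]])+
 qed
 note sX = gv_sqint[OF G base(1)] and sW = gv_sqint[OF G base(2)] and sN = gv_sqint[OF G base(3)]
 have cont0: "continuous_on {0..T} (\<lambda>t. N' t w)" "continuous_on {0..T} (\<lambda>t. W' t w)" "N' 0 w = 0" "W' 0 w = 0" for w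
  by (cases "w \<in> \<Omega>"; simp add: on off good)+
 have bmN: "bm S T N'" and bmW: "bm S T W'"
 proof -
  have "gproc T S N'" "gproc T S W'" unfolding gproc_def cproc_def using base cont0 N'm W'm by blast+
  moreover have "cov (N' s) (N' t) = min s t *\<^sub>R mat 1" "cov (W' s) (W' t) = min s t *\<^sub>R mat 1" if s: "s \<in> {0..T}" and t: "t \<in> {0..T}" for s t
   using cov_AE[OF aeq(3) aeq(3) js(3)[OF s] sN[OF s] js(3)[OF t] sN[OF t]] cov_AE[OF aeq(4) aeq(4) js(2)[OF s] sW[OF s] js(2)[OF t] sW[OF t]]
    Nc[OF s t] Wc[OF s t] by simp_all
  ultimately show "bm S T N'" "bm S T W'" unfolding bm_def[OF G] by blast+
 qed
 have covX: "cov (X' 0) (X' 0) = \<Sigma>0"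
  using cov_AE[OF aeq(1) aeq(1) js(1) sX js(1) sX] by (simp add: vec_eq_iff cov_component[OF js(1) js(1)] X0_cov)
 have \<rho>cov: "\<rho> t = cov (N' t) (X' 0)" if t: "t \<in> {0..T}" for t
  using cov_AE[OF aeq(3) aeq(1) js(3)[OF t] sN[OF t] js(1) sX] by (simp add: vec_eq_iff cov_component[OF js(3)[OF t] js(1)] \<rho>_eq[OF t])
 interpret ci: correlated_initial M S T "X' 0" N' \<rho> \<rho>' \<rho>''
  by unfold_locales (fact G T_pos base(1) bmN \<rho>cov \<rho>_C1 \<rho>_C2 \<rho>''_cont)+

 \<comment> \<open>Orthogonality of \<open>W\<close> to the initial value and to
   \<open>N\<close>\<close>
 have ind: "expectation (\<lambda>w. Y w * W t w $ j) = 0"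
  if Y: "\<And>C. C \<in> sets borel ==> Y -` C \<inter> space M \<in> sets (generated_sigma M (\<lambda>t w. (X 0 w, N t w)) {0..T})"
   and iY: "integrable M Y" and t: "t \<in> {0..T}" for Y t j
 proof -
  have "expectation (\<lambda>w. W t w $ j * Y w) = expectation (\<lambda>w. W t w $ j) * expectation Y"
  proof (rule indep_set_product[OF W_indep _ Y sqint_integrable[OF sqint_component[OF js(2)[OF t]]] iY])
   fix C :: "real set" assume C: "C \<in> sets borel"
   have "(\<lambda>x :: real^'l. x $ j) -` C \<inter> space borel \<in> sets borel" by (rule measurable_sets[OF _ C]) measurable
   then have "{x. x $ j \<in> C} \<in> sets (borel :: (real^'l) measure)" by (simp add: vimage_def)
   then show "(\<lambda>w. W t w $ j) -` C \<inter> space M \<in> sets (generated_sigma M W {0..T})"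
    unfolding generated_sigma_def using t
    by (auto simp: sets_measure_of_conv vimage_def intro!: sigma_sets.Basic exI[of _ t] exI[of _ "{x. x $ j \<in> C}"])
  qed
  then show ?thesis by (simp add: Wm[OF t] mult.commute)
 qed
 \<comment> \<open>The independence hypothesis concerns the pairs formed by the initial value and
   \<open>N t\<close>. Coordinates of either component are continuous functions of a pair; for the
   initial value alone the pair at time 0 is used.\<close>
 have gen: "(\<lambda>w. f (X 0 w, N s w)) -` C \<inter> space M \<in> sets (generated_sigma M (\<lambda>t w. (X 0 w, N t w)) {0..T})"
  if s: "s \<in> {0..T}" and C: "C \<in> sets borel" and f: "continuous_on UNIV f" for f :: "(real^'m) \<times> (real^'n) => real" and s C
 proof -
  have "f -` C \<inter> space borel \<in> sets borel" by (rule measurable_sets[OF borel_measurable_continuous_onI[OF f] C])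
  then show ?thesis
   unfolding generated_sigma_def using s
   by (auto simp: sets_measure_of_conv vimage_def intro!: sigma_sets.Basic exI[of _ s] exI[of _ "{x. f x \<in> C}"])
 qed
 have XW: "cov (X' 0) (W' t) = 0" if t: "t \<in> {0..T}" for t
 proof -
  have "expectation (\<lambda>w. X 0 w $ i * W t w $ j) = 0" for i j
   by (rule ind[OF _ sqint_integrable[OF sqint_component[OF js(1)]] t], rule gen[OF z, of _ "\<lambda>x. fst x $ i", simplified])
    (auto intro!: continuous_intros)
  then show ?thesis
   using cov_AE[OF aeq(1) aeq(4) js(1) sX js(2)[OF t] sW[OF t]] by (simp add: vec_eq_iff cov_component[OF js(1) js(2)[OF t]])
 qed
 have NW: "cov (N' s) (W' t) = 0" if s: "s \<in> {0..T}" and t: "t \<in> {0..T}" for s t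
 proof -
  have "expectation (\<lambda>w. N s w $ i * W t w $ j) = 0" for i j
   by (rule ind[OF _ sqint_integrable[OF sqint_component[OF js(3)[OF s]]] t], rule gen[OF s, of _ "\<lambda>x. snd x $ i", simplified])
    (auto intro!: continuous_intros)
  then show ?thesis
   using cov_AE[OF aeq(3) aeq(4) js(3)[OF s] sN[OF s] js(2)[OF t] sW[OF t]] by (simp add: vec_eq_iff cov_component[OF js(3)[OF s] js(2)[OF t]])
 qed
 have h2: "L2on T h" using h_meas h_L2 by (simp add: L2on_def)
 have X'c: "continuous_on {0..T} (\<lambda>t. X' t w)" for w
 proof (cases "w \<in> \<Omega>")
  case True
  have "continuous_on {0..T} (\<lambda>t. X 0 w + prim (\<lambda>s. a s *v X s w) t + \<sigma>0 *v W t w)"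
   by (intro continuous_intros prim_continuous good[OF True])
  then show ?thesis by (rule continuous_on_eq) (simp add: on[OF True] good(6)[OF True, symmetric])
 qed (simp add: off)
 have X'eq: "X' t w = X' 0 w + prim (\<lambda>s. a s *v X' s w) t + \<sigma>0 *v W' t w" and Z'eq: "Z' t w = prim (\<lambda>s. h s *v X' s w) t + N' t w"
  if "t \<in> {0..T}" for t w
  using good(6,7)[OF _ that, of w] by (cases "w \<in> \<Omega>"; simp add: on off bb_mv.zero_right)+
 \<comment> \<open>The term \<open>g p\<close> cancels the first summand of \<open>q\<close>, so
   \<open>g\<close> itself disappears.\<close>
 have r_eq: "r t = - (g' t ** transpose (\<rho>' t))" for t by (simp add: r_def p_def q_def)
 have rc: "continuous_on {0..T} r" unfolding r_def by (intro continuous_intros g_cont p_cont q_cont)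
 have g\<Gamma>: "g' t ** ci.\<Gamma> t = \<rho>' t" if "t \<in> {0..T}" for t using g_eq[OF that] by (simp add: ci.\<Gamma>_def covX)
 interpret fl: filtering M S T "X' 0" N' \<rho> \<rho>' \<rho>'' W' X' Z' a \<sigma>0 h g' r
  by unfold_locales (assumption | rule bmW NW XW a_L1 h2 X'c X'eq Z'eq cont0 g\<Gamma> rc r_eq)+

 \<comment> \<open>The filter of the regular augmented system\<close>
 obtain E where E: "transpose E = E" "cov (X' 0) (X' 0) ** E = 0" "\<And>t. t \<in> {0..T} ==> \<rho>' t ** E = 0"
  "continuous_on {0..T} (\<lambda>t. g' t ** (mat 1 - E))" "\<And>t. t \<in> {0..T} ==> (g' t ** (mat 1 - E)) ** ci.\<Gamma> t = \<rho>' t"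
  using fl.regular_gain by metis
 interpret rf: regular_filtering M S T "X' 0" N' \<rho> \<rho>' \<rho>'' W' X' Z' a \<sigma>0 h g' r E "\<lambda>t. g' t ** (mat 1 - E)"
  by unfold_locales (fact E refl)+
 have bb: "b = fl.b" by (rule ext) (simp add: b_def fl.b_def ci.p_def p_def)
 have kk: "k = fl.k" by (rule ext) (simp add: k_def fl.k_def)
 have cc: "c = blk3" by (simp add: c_def blk3_def)
 have ss: "\<sigma> = blk1 ** \<sigma>0" by (simp add: \<sigma>_def vstack3_blocks mm_simps)
 obtain P f \<beta> \<Phi> \<Psi> I n x where "kalman_bucy M S T fl.U Z' rf.B W' rf.b' rf.k' (blk1 ** \<sigma>0) blk3 P f \<beta> \<Phi> \<Psi> I n x"
  and Psym: "\<And>t. t \<in> {0..T} ==> transpose (P t) = P t"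
  using rf.aug.kalman_bucy_exists by metis
 then interpret kb: kalman_bucy M S T fl.U Z' rf.B W' rf.b' rf.k' "blk1 ** \<sigma>0" blk3 P f \<beta> \<Phi> \<Psi> I n x by simp
 define V where "V = kb.V"
 \<comment> \<open>The direction \<open>E Xbar\<close> vanishes almost surely, so filter and error
   covariance have no component in it.\<close>
 have EV: "AE w in M. rf.EE *v V t w = 0" and EP: "rf.EE ** P t = 0" if "t \<in> {0..T}" for t
  using kb.null_direction[OF that rf.EE_U[OF that]] by (simp_all add: V_def)
 note P = kb.P and gV = kb.gV[folded V_def] and V_past = kb.V_past[folded V_def] and V_0 = kb.V_0[folded V_def]
  and \<epsilon>_def = kb.\<epsilon>_def[abs_def, folded V_def] and dense = kb.dense[unfolded kb.f_def] and ito = kb.ito_lim[folded V_def]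
 note orth = kb.\<epsilon>_past(2)[unfolded \<epsilon>_def] and Pcov = kb.\<epsilon>_\<epsilon>[unfolded \<epsilon>_def]

 \<comment> \<open>Transfer of the conditional moments to the given processes\<close>
 have Ueq: "AE w in M. U t w = fl.U t w" for t
  using ae by eventually_elim (simp add: U_def fl.U_def Xbar_def ci.Xbar_def p_def ci.p_def on)
 \<comment> \<open>\<open>Xbar\<close> integrates the given \<open>N\<close>, whose paths are
   continuous only almost surely, so measurability of \<open>U t\<close> is inherited from its
   modification by completeness.\<close>
 have Um: "U t \<in> borel_measurable M" if t: "t \<in> {0..T}" for t
  by (rule complete_measure.borel_measurable_AE[OF complete cprocD(1)[OF gprocD(1)[OF fl.gU] t]])
   (use Ueq[of t] in \<open>auto elim: eventually_mono\<close>)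
 have vZ: "vspan S (Z s)" if "s \<in> {0..T}" for s
  by (rule vspan_AE[OF gf_sqint[OF G] gprocD(2)[OF fl.gZ that] _ Z_meas[OF that]]) (use aeq(2)[of s] in \<open>auto elim: eventually_mono\<close>)
 have pastS: "past Z t \<subseteq> cspan S" if "t \<in> {0..T}" for t
  using vZ that by (auto simp: past_def vspan_def)
 \<comment> \<open>The \<sigma>-algebra \<open>FZ t\<close> is generated by the given
   \<open>Z\<close> and is not completed, so it may differ from that of \<open>Z'\<close>. Closed
   spans do not notice null sets, which allows the move from the past of \<open>Z'\<close> to that
   of \<open>Z\<close>.\<close>
 have VZ: "vspan (past Z t) (V t)" if t: "t \<in> {0..T}" for t
  unfolding vspan_def
 proof
  have zs: "Y \<in> past Z t ==> sqint Y" for Y using pastS[OF t] cspan_sqint[OF gf_sqint[OF G]] by blast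
  have ZZ: "Y \<in> cspan (past Z t)" if Y: "Y \<in> past Z' t" for Y
  proof -
   obtain s j where s: "s \<in> {0..t}" "Y = (\<lambda>w. Z' s w $ j)" using Y by (auto simp: past_def)
   then have sT: "s \<in> {0..T}" using t by auto
   have c: "(\<lambda>w. Z s w $ j) \<in> cspan (past Z t)" by (rule cspan_base[OF zs]) (use s in \<open>auto simp: past_def\<close>)
   show ?thesis
    unfolding s(2) by (rule cspan_AE[OF zs c]) (use aeq(2)[of s] Z'm[OF sT] in \<open>auto elim: eventually_mono\<close>)
  qed
  show "(\<lambda>w. V t w $ i) \<in> cspan (past Z t)" for i
   by (rule cspan_idem[where S="past Z t" and S'="past Z' t", OF zs ZZ]) (use V_past[OF t] in \<open>simp_all add: vspan_def\<close>)
 qed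
 have sV: "sqint (V t)" and sU: "sqint (fl.U t)" if "t \<in> {0..T}" for t
  by (rule gproc_sqint[OF G gV that] gproc_sqint[OF G fl.gU that])+
 have orth': "expectation (\<lambda>w. Y w * (fl.U t w - V t w) $ i) = 0" if t: "t \<in> {0..T}" and Y: "Y \<in> past Z t" for t Y i
 proof -
  obtain s j where s: "s \<in> {0..t}" "Y = (\<lambda>w. Z s w $ j)" using Y by (auto simp: past_def)
  then have sT: "s \<in> {0..T}" using t by auto
  note e = sqint_diff[OF sU[OF t] sV[OF t]] and sZ = gv_sqint[OF G vZ[OF sT]]
  have "cov (\<lambda>w. fl.U t w - V t w) (Z s) = cov (\<lambda>w. fl.U t w - V t w) (Z' s)"
   by (rule cov_AE[OF _ aeq(2) e e sZ gproc_sqint[OF G fl.gZ sT]]) simp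
  then show ?thesis using cov_component[OF e sZ, of i j] orth[OF t s(1)] by (simp add: s(2) mult.commute)
 qed
 have FZ: "FZ t = gen (past Z t)" for t by (simp add: FZ_def generated_sigma_eq_gen)
 have Vmean: "AE w in M. V t w = cond_mean M (FZ t) (U t) w" if t: "t \<in> {0..T}" for t
  unfolding FZ by (rule conditional_moments(1)[OF G gprocD(2)[OF fl.gU t] gprocD(2)[OF gV t] Um[OF t] Ueq pastS[OF t] VZ[OF t] orth'[OF t]])
 have Vcov: "AE w in M. cond_cov M (FZ t) (U t) w = P t" if t: "t \<in> {0..T}" for t
  unfolding FZ Pcov[OF t, symmetric] by (rule conditional_moments(2)[OF G gprocD(2)[OF fl.gU t] gprocD(2)[OF gV t] Um[OF t] Ueq pastS[OF t] VZ[OF t] orth'[OF t]])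

 \<comment> \<open>The Riccati equation with the original coefficients\<close>
 have gb: "b t ** P t = rf.b' t ** P t" and gk: "k t ** P t = rf.k' t ** P t" if t: "t \<in> {0..T}" for t
 proof -
  have "b t ** P t = rf.b' t ** P t + blk3 ** g' t ** (rf.EE ** P t)" "k t ** P t = rf.k' t ** P t + g' t ** (rf.EE ** P t)"
   by (simp_all only: bb kk rf.b_split rf.k_split bb_mm.add_left matrix_mul_assoc)
  then show "b t ** P t = rf.b' t ** P t" "k t ** P t = rf.k' t ** P t" by (simp_all add: EP[OF t] bb_mm.zero_right)
 qed
 have gbT: "P t ** transpose (b t) = P t ** transpose (rf.b' t)" and gkT: "P t ** transpose (k t) = P t ** transpose (rf.k' t)" if t: "t \<in> {0..T}" for t
  using arg_cong[OF gb[OF t], of transpose] arg_cong[OF gk[OF t], of transpose] by (simp_all add: matrix_transpose_mul Psym[OF t])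
 define R where "R t = P t ** transpose (b t) + b t ** P t + (c ** transpose c + \<sigma> ** transpose \<sigma>)
   - (c + P t ** transpose (k t)) ** transpose (c + P t ** transpose (k t))" for t
 define R' where "R' t = P t ** transpose (rf.b' t) + rf.b' t ** P t + (c ** transpose c + \<sigma> ** transpose \<sigma>)
   - (c + P t ** transpose (rf.k' t)) ** transpose (c + P t ** transpose (rf.k' t))" for t
 \<comment> \<open>Every occurrence of \<open>b\<close> and \<open>k\<close> is multiplied by
   \<open>P\<close>, which \<open>rf.EE\<close> annihilates, so the possibly irregular
   \<open>g'\<close> has no influence.\<close>
 have RR: "R t = R' t" if "t \<in> {0..T}" for t unfolding R_def R'_def gb[OF that] gbT[OF that] gkT[OF that] ..
 have P_R: "P t = P 0 + prim R t" if t: "t \<in> {0..T}" for t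
 proof -
  have "prim (\<lambda>s. (rf.b' s - blk3 ** rf.k' s) ** P s + P s ** transpose (rf.b' s - blk3 ** rf.k' s) + (blk1 ** \<sigma>0) ** transpose (blk1 ** \<sigma>0)
    - P s ** (transpose (rf.k' s) ** rf.k' s) ** P s) t = prim R t"
  proof (rule prim_cong)
   fix s assume "s \<in> {0..t}"
   then have s: "s \<in> {0..T}" using t by auto
   show "(rf.b' s - blk3 ** rf.k' s) ** P s + P s ** transpose (rf.b' s - blk3 ** rf.k' s) + (blk1 ** \<sigma>0) ** transpose (blk1 ** \<sigma>0)
    - P s ** (transpose (rf.k' s) ** rf.k' s) ** P s = R s"
    unfolding RR[OF s] R'_def ss cc by (simp add: mm_simps Psym[OF s])
  qed
  then show ?thesis using kb.P_eq[OF t] kb.P_eq[OF z] by (simp add: prim_0)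
 qed
 have f2: "L2on T (\<lambda>s. c + P s ** transpose (rf.k' s))"
  by (rule L2on_add[OF L2on_continuous[OF continuous_on_const]
   L2on_mult_continuous[OF bounded_bilinear.flip[OF bb_mm] L2on_linear[OF bl_transpose rf.k'2] P]])
 have R'1: "L1on T R'"
  unfolding R'_def[abs_def]
  by (intro set_integral_add(1) set_integral_diff(1) L1on_bilinear[OF bb_mm rf.b'1 P] L1on_bilinear2[OF bb_mm L1on_transpose[OF rf.b'1] P]
    L1on_continuous[OF continuous_on_const] L2on_bilinear[OF bb_mm f2 L2on_linear[OF bl_transpose f2]])
 have R1: "L1on T R" using R'1 L1on_cong[of T R R'] RR by blast
 have deriv: "(P has_vector_derivative R t) (at t within {0..T})" if "t \<in> {0..T}" "(prim R has_vector_derivative R t) (at t within {0..T})" for t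
 proof -
  have "((\<lambda>t. P 0 + prim R t) has_vector_derivative 0 + R t) (at t within {0..T})"
   by (rule has_vector_derivative_add[OF has_vector_derivative_const that(2)])
  then show ?thesis using has_vector_derivative_transform[OF that(1) P_R] by simp
 qed
 \<comment> \<open>Continuity is proved for \<open>R'\<close>, whose coefficients contain the
   continuous gain instead of \<open>g'\<close>, and transferred by equality on the
   interval.\<close>
 have R_cont: "continuous (at t within {0..T}) R"
  if t: "t \<in> {0..T}" and a: "continuous (at t within {0..T}) a" and h: "continuous (at t within {0..T}) h" for t
 proof -
  have cw: "continuous (at t within {0..T}) f" if "continuous_on {0..T} f" for f :: "real => 'q::topological_space"
   using that t by (simp add: continuous_on_eq_continuous_within)
  note c = a h cw[OF P] cw[OF ci.pc] cw[OF rf.Kc] cw[OF rc]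
  have "continuous (at t within {0..T}) rf.b'" "continuous (at t within {0..T}) rf.k'"
   unfolding rf.b'_def[abs_def] rf.k'_def[abs_def] by (intro continuous_add bb_mm.continuous continuous_const c)+
  then have "continuous (at t within {0..T}) R'"
   unfolding R'_def[abs_def]
   by (intro continuous_add continuous_diff bb_mm.continuous bounded_linear.continuous[OF bl_transpose] continuous_const c)
  then show ?thesis
   by (rule continuous_transform_within[OF _ zero_less_one t]) (simp add: RR)
 qed
 show ?thesis
 proof (intro exI[of _ P] conjI)
  show "\<forall>t\<in>{0..T}. AE w in M. cond_cov M (FZ t) (U t) w = P t" using Vcov by blast
  have Vj: "jointly_measurable M T V" by (rule cproc_jointly_measurable[OF T0 gprocD(1)[OF gV]])
  show "\<exists>Uh. cond_mean_version M T FZ U Uh \<and> (AE w in M. continuous_on {0..T} (\<lambda>t. Uh t w))"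
   by (intro exI[of _ V] conjI) (use Vj Vmean gproc_path[OF gV] in \<open>auto simp: cond_mean_version_def\<close>)
  show "let A = c ** transpose c + \<sigma> ** transpose \<sigma>;
    R = (\<lambda>t. P t ** transpose (b t) + b t ** P t + A - (c + P t ** transpose (k t)) ** transpose (c + P t ** transpose (k t)))
   in set_integrable lborel {0..T} R \<and>
   (\<forall>t\<in>{0..T}. P t = P 0 + (LINT s:{0..t}|lborel. R s)) \<and>
   (AE t in lborel. t \<in> {0..T} \<longrightarrow> (P has_vector_derivative R t) (at t within {0..T})) \<and>
   (\<forall>t\<in>{0..T}. continuous (at t within {0..T}) a \<and> continuous (at t within {0..T}) h \<longrightarrow>
      (P has_vector_derivative R t) (at t within {0..T}))"
   unfolding Let_def R_def[symmetric]
  proof (intro conjI ballI impI)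
   show "AE t in lborel. t \<in> {0..T} \<longrightarrow> (P has_vector_derivative R t) (at t within {0..T})"
    using prim_has_vector_derivative_AE[OF R1] by eventually_elim (use deriv in blast)
  qed (use R1 P_R deriv prim_has_vector_derivative[OF R1] R_cont in blast)+
  show "\<forall>Uh \<nu>. cond_mean_version M T FZ U Uh \<and> \<nu> = (\<lambda>t w. Z t w - (LINT s:{0..t}|lborel. k s *v Uh s w)) \<longrightarrow>
   (AE w in M. set_integrable lborel {0..T} (\<lambda>s. b s *v Uh s w)) \<and>
   (AE w in M. set_integrable lborel {0..T} (\<lambda>s. k s *v Uh s w)) \<and>
   (\<exists>J. has_ito_integral M T FZ \<nu> (\<lambda>s w. c + P s ** transpose (k s)) J \<and>
     (\<forall>t\<in>{0..T}. AE w in M.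
       Uh t w = Uh 0 w + (LINT s:{0..t}|lborel. b s *v Uh s w) + J t w))"
  proof (intro allI impI)
   fix Uh \<nu>
   assume as: "cond_mean_version M T FZ U Uh \<and> \<nu> = (\<lambda>t w. Z t w - (LINT s:{0..t}|lborel. k s *v Uh s w))"
   then have Uj: "jointly_measurable M T Uh" and \<nu>: "\<nu> = (\<lambda>t w. Z t w - prim (\<lambda>s. k s *v Uh s w) t)" by (auto simp: cond_mean_version_def)
   have UV: "AE w in M. Uh t w = V t w" if t: "t \<in> {0..T}" for t
   proof -
    have "AE w in M. Uh t w = cond_mean M (FZ t) (U t) w" using as t by (auto simp: cond_mean_version_def)
    then show ?thesis using Vmean[OF t] by eventually_elim simp
   qed
   have j0: "jointly_measurable M T (\<lambda>s w. rf.EE *v V s w)" "jointly_measurable M T (\<lambda>s w. 0 :: real^'m)"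
    by (rule cproc_jointly_measurable[OF T0]; auto intro!: cproc_mv gprocD(1)[OF gV] cproc_const)+
   have cm: "set_borel_measurable lborel {0..T} (\<lambda>s. A :: real^'i^'j)" for A by (rule L1on_meas[OF L1on_continuous[OF continuous_on_const]])
   \<comment> \<open>The products \<open>b Uh\<close> and \<open>k Uh\<close> agree almost
     everywhere with integrable functions, but integrability also demands measurability, for which
     \<open>g'\<close> has to be measurable.\<close>
   note g'm = derivative_set_borel_measurable[OF T_pos g_deriv]
   have add: "set_borel_measurable lborel {0..T} (\<lambda>s. f1 s + f2 s)"
    if "set_borel_measurable lborel {0..T} f1" "set_borel_measurable lborel {0..T} f2" for f1 f2 :: "real => real^'i^'j"
    using that unfolding set_borel_measurable_restrict by (rule borel_measurable_add)
   note mm = set_borel_measurable_bilinear[OF bb_mm]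
   have bm: "set_borel_measurable lborel {0..T} b"
    unfolding bb rf.b_split[abs_def] by (rule add[OF L1on_meas[OF rf.b'1] mm[OF mm[OF cm g'm] cm]])
   have km: "set_borel_measurable lborel {0..T} k"
    unfolding kk rf.k_split[abs_def] by (rule add[OF L1on_meas[OF L2on_L1on[OF rf.k'2]] mm[OF g'm cm]])
   have UVs: "AE w in M. AE s in lborel. s \<in> {0..T} \<longrightarrow> Uh s w = V s w" by (rule jointly_measurable_AE(1)[OF T0 Uj Vj UV])
   \<comment> \<open>The component of the filter in the null direction vanishes almost surely at
     each time; by Fubini it vanishes along almost every path at almost every time, and the term
     with \<open>g'\<close> drops out of the integrals.\<close>
   have EVs: "AE w in M. AE s in lborel. s \<in> {0..T} \<longrightarrow> rf.EE *v V s w = 0" by (rule jointly_measurable_AE(1)[OF T0 j0 EV])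
   have Uhm: "set_borel_measurable lborel {0..T} (\<lambda>s. Uh s w)" if "w \<in> space M" for w
    by (rule jointly_measurable_AE(2)[OF T0 Uj Vj UV that])
   have key: "AE w in M. w \<in> \<Omega> \<and> L1on T (\<lambda>s. b s *v Uh s w) \<and> L1on T (\<lambda>s. k s *v Uh s w) \<and>
     (\<forall>t\<in>{0..T}. prim (\<lambda>s. b s *v Uh s w) t = prim (\<lambda>s. rf.b' s *v V s w) t \<and> prim (\<lambda>s. k s *v Uh s w) t = prim (\<lambda>s. rf.k' s *v V s w) t)"
    using UVs EVs ae AE_space
   proof eventually_elim
    case (elim w)
    have eqs: "AE s in lborel. s \<in> {0..T} \<longrightarrow> b s *v Uh s w = rf.b' s *v V s w" "AE s in lborel. s \<in> {0..T} \<longrightarrow> k s *v Uh s w = rf.k' s *v V s w"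
     using elim(1,2) by (eventually_elim, simp add: bb kk rf.b_split rf.k_split mv_simps)+
    note Um = Uhm[OF elim(4)]
    note i = L1on_bilinear[OF bb_mv rf.b'1 gproc_path[OF gV elim(4)]]
     L1on_bilinear[OF bb_mv L2on_L1on[OF rf.k'2] gproc_path[OF gV elim(4)]]
    note pb = AE_prim_cong[OF eqs(1) _ set_borel_measurable_bilinear[OF bb_mv bm Um] i(1)]
     and pk = AE_prim_cong[OF eqs(2) _ set_borel_measurable_bilinear[OF bb_mv km Um] i(2)]
    show ?case using elim(3) pb(1)[OF order_refl] pk(1)[OF order_refl] pb(2) pk(2) by simp
   qed
   \<comment> \<open>The Ito integral is defined as what remains of the filter after removing its
     drift, hence has continuous paths; \<open>kb.ito_lim\<close> shows that it is the required
     limit.\<close>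
   define J where "J t w = V t w - prim (\<lambda>s. rf.b' s *v V s w) t" for t w
   define \<nu>' where "\<nu>' = (\<lambda>t w. Z' t w - prim (\<lambda>s. rf.k' s *v V s w) t)"
   have gJ: "gproc T S J" unfolding J_def[abs_def] by (rule gproc_diff[OF G gV gproc_prim[OF G T0 gV rf.b'1]])
   have g\<nu>: "gproc T S \<nu>'" unfolding \<nu>'_def by (rule gproc_diff[OF G fl.gZ gproc_prim[OF G T0 gV L2on_L1on[OF rf.k'2]]])
   have c_eq: "c + P s ** transpose (k s) = blk3 + P s ** transpose (rf.k' s)" if "s \<in> {0..T}" for s
    by (simp add: gkT[OF that] cc)
   have Hm: "(\<lambda>s. c + P s ** transpose (k s)) \<in> borel_measurable (restrict_space borel {0..T})"
   proof (subst measurable_cong)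
    show "c + P s ** transpose (k s) = c + P s ** transpose (rf.k' s)" if "s \<in> space (restrict_space borel {0..T})" for s
     using gkT[of s] that by (simp add: space_restrict_space)
    show "(\<lambda>s. c + P s ** transpose (rf.k' s)) \<in> borel_measurable (restrict_space borel {0..T})"
     using f2 by (simp add: L2on_def set_borel_measurable_restrict)
   qed
   have "has_ito_integral M T FZ \<nu> (\<lambda>s w. c + P s ** transpose (k s)) J"
    unfolding has_ito_integral_def
   proof (intro conjI)
    show "jointly_measurable M T (\<lambda>s w. c + P s ** transpose (k s))"
     unfolding jointly_measurable_def using measurable_compose[OF measurable_fst Hm] by (simp add: split_beta')
    show "\<forall>t\<in>{0..T}. J t \<in> borel_measurable M" using cprocD(1)[OF gprocD(1)[OF gJ]] by blast
    show "AE w in M. continuous_on {0..T} (\<lambda>t. J t w)" using gproc_path[OF gJ] by (intro AE_I2)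
    \<comment> \<open>The simple integrands are nonrandom step functions, so adaptedness is
      immediate; the same ones were used to construct the integral against \<open>B\<close>.\<close>
    define \<tau> where "\<tau> j i = T * real i / real (n j)" for j i
    define \<zeta> where "\<zeta> j i = (\<lambda>w :: 'w. x j i)" for j i
    have si: "simple_integrand M T FZ (n j) (\<tau> j) (\<zeta> j)" for j
     unfolding simple_integrand_def
    proof (intro conjI allI impI)
     show "\<tau> j i \<le> \<tau> j (Suc i)" for i unfolding \<tau>_def using T0 by (intro divide_right_mono mult_left_mono) auto
     show "\<tau> j (n j) \<le> T" using T0 by (cases "n j = 0") (auto simp: \<tau>_def)
     have "norm (\<zeta> j i w) \<le> (\<Sum>i<n j. norm (x j i))" if "i < n j" for i w
      unfolding \<zeta>_def using that by (intro member_le_sum) auto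
     then show "\<exists>C. \<forall>i<n j. \<forall>w\<in>space M. norm (\<zeta> j i w) \<le> C" by blast
    qed (auto simp: \<tau>_def \<zeta>_def)
    have d1: "(\<integral>\<^sup>+w. (\<integral>\<^sup>+s\<in>{0..T}. ennreal ((norm (simple_process (n j) (\<tau> j) (\<zeta> j) s w - (c + P s ** transpose (k s))))\<^sup>2) \<partial>lborel) \<partial>M)
      = ennreal (sqdist T (stepf T (n j) (x j)) (\<lambda>s. blk3 + P s ** transpose (rf.k' s)))" for j
    proof -
     let ?d = "\<lambda>s. (norm (stepf T (n j) (x j) s - (blk3 + P s ** transpose (rf.k' s))))\<^sup>2"
     have "L1on T ?d" using L2on_diff[OF L2on_stepf f2, of "n j" "x j"] by (simp add: L2on_def cc)
     then have i: "integrable lborel (\<lambda>s. indicator {0..T} s *\<^sub>R ?d s)" by (simp add: set_integrable_def)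
     have "simple_process (n j) (\<tau> j) (\<zeta> j) s w = stepf T (n j) (x j) s" for s w
      by (simp add: simple_process_def stepf_def \<tau>_def \<zeta>_def)
     then have "(\<integral>\<^sup>+s\<in>{0..T}. ennreal ((norm (simple_process (n j) (\<tau> j) (\<zeta> j) s w - (c + P s ** transpose (k s))))\<^sup>2) \<partial>lborel)
       = (\<integral>\<^sup>+s. ennreal (indicator {0..T} s *\<^sub>R ?d s) \<partial>lborel)" for w
      by (intro nn_integral_cong) (auto simp: indicator_def c_eq)
     also have "(\<integral>\<^sup>+s. ennreal (indicator {0..T} s *\<^sub>R ?d s) \<partial>lborel) = ennreal (prim ?d T)"
      unfolding set_lebesgue_integral_def by (rule nn_integral_eq_integral[OF i]) simp
     finally show ?thesis by (simp add: emeasure_space_1)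
    qed
    have d2: "(\<integral>\<^sup>+w. ennreal ((norm (simple_integral (n j) (\<tau> j) (\<zeta> j) \<nu> t w - J t w))\<^sup>2) \<partial>M) = ennreal (ms (\<lambda>w. wint T (n j) (x j) \<nu>' t w - J t w))"
     if t: "t \<in> {0..T}" for t j
    proof -
     have "AE w in M. simple_integral (n j) (\<tau> j) (\<zeta> j) \<nu> t w = wint T (n j) (x j) \<nu>' t w"
      using key
     proof eventually_elim
      case (elim w)
      have "\<nu> u w = \<nu>' u w" if "u \<in> {0..T}" for u using elim that by (simp add: \<nu> \<nu>'_def on)
      from this[OF node_bounds(3)[OF T0 t]] have "wint T (n j) (x j) \<nu> t w = wint T (n j) (x j) \<nu>' t w" by (simp add: wint_def)
      then show ?case by (simp add: wint_eq_simple_integral \<tau>_def[abs_def] \<zeta>_def[abs_def])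
     qed
     then have "(\<integral>\<^sup>+w. ennreal ((norm (simple_integral (n j) (\<tau> j) (\<zeta> j) \<nu> t w - J t w))\<^sup>2) \<partial>M)
      = (\<integral>\<^sup>+w. ennreal ((norm (wint T (n j) (x j) \<nu>' t w - J t w))\<^sup>2) \<partial>M)"
      by (intro nn_integral_cong_AE) (auto elim: eventually_mono)
     also have "\<dots> = ennreal (ms (\<lambda>w. wint T (n j) (x j) \<nu>' t w - J t w))"
      unfolding ms_def
      using sqint_diff[OF gproc_sqint[OF G gproc_wint[OF G g\<nu> T0] t] gproc_sqint[OF G gJ t]]
      by (intro nn_integral_eq_integral) (auto simp: sqint_def)
     finally show ?thesis .
    qed
    have l1: "(\<lambda>j. ennreal (sqdist T (stepf T (n j) (x j)) (\<lambda>s. blk3 + P s ** transpose (rf.k' s)))) \<longlonglongrightarrow> 0"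
     using tendsto_ennrealI[OF dense] by simp
    have l2: "(\<lambda>j. ennreal (ms (\<lambda>w. wint T (n j) (x j) \<nu>' t w - J t w))) \<longlonglongrightarrow> 0" if "t \<in> {0..T}" for t
     using tendsto_ennrealI[OF ito[OF that]] by (simp add: \<nu>'_def J_def)
    show "\<exists>K \<tau> \<xi>. (\<forall>j. simple_integrand M T FZ (K j) (\<tau> j) (\<xi> j)) \<and>
      (\<lambda>j. \<integral>\<^sup>+w. (\<integral>\<^sup>+s\<in>{0..T}. ennreal ((norm (simple_process (K j) (\<tau> j) (\<xi> j) s w - (c + P s ** transpose (k s))))\<^sup>2) \<partial>lborel) \<partial>M) \<longlonglongrightarrow> 0 \<and>
      (\<forall>t\<in>{0..T}. (\<lambda>j. \<integral>\<^sup>+w. ennreal ((norm (simple_integral (K j) (\<tau> j) (\<xi> j) \<nu> t w - J t w))\<^sup>2) \<partial>M) \<longlonglongrightarrow> 0)"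
     by (rule exI[of _ n], rule exI[of _ \<tau>], rule exI[of _ \<zeta>]) (intro conjI allI ballI, simp_all only: si d1 d2 l1 l2)
   qed
   \<comment> \<open>\<open>Uh 0\<close> agrees almost surely with \<open>V 0\<close>, which is 0,
     so the initial value may be inserted.\<close>
   moreover have "AE w in M. Uh t w = Uh 0 w + prim (\<lambda>s. b s *v Uh s w) t + J t w" if t: "t \<in> {0..T}" for t
    using UV[OF t] UV[OF z] V_0 key by eventually_elim (use t in \<open>simp add: J_def\<close>)
   ultimately show "(AE w in M. L1on T (\<lambda>s. b s *v Uh s w)) \<and> (AE w in M. L1on T (\<lambda>s. k s *v Uh s w)) \<and>
    (\<exists>J. has_ito_integral M T FZ \<nu> (\<lambda>s w. c + P s ** transpose (k s)) J \<and>
     (\<forall>t\<in>{0..T}. AE w in M. Uh t w = Uh 0 w + prim (\<lambda>s. b s *v Uh s w) t + J t w))"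
    using key by (intro conjI exI[of _ J] ballI) (auto elim: eventually_mono)
  qed
 qed
qed

end
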